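(* For every integer $n\geq 2$ there is an isomorphism of associative $\mathbb{C}$-algebras $$U(\mathfrak{s}_{n})_{X_{n}}\cong \mathcal{D}_{n}\otimes U(\mathfrak{s}_{n-1}).$$
   Context: All vector spaces, algebras and tensor products are over $\mathbb{C}$; $\mathbb{Z}_+$ is the set of nonnegative integers; $U(\mathfrak{g})$ is the universal enveloping algebra of a Lie algebra $\mathfrak{g}$. For $n\ge 1$, $\mathfrak{s}_n=\mathfrak{gl}_n\ltimes\mathbb{C}^n$ is the semidirect product of $\mathfrak{gl}_n$ (with basis the matrix units $e_{ij}$, $1\le i,j\le n$) and its natural representation $\mathbb{C}^n$ (with standard basis $e_1,\dots,e_n$), so that $[e_{ij},e_{kl}]=\delta_{jk}e_{il}-\delta_{li}e_{kj}$, $[e_{ij},e_k]=\delta_{jk}e_i$, $[e_i,e_j]=0$. The set $X_n=\{e_1^{i_1}\cdots e_n^{i_n}\mid i_1,\dots,i_n\in\mathbb{Z}_+\}$ is an Ore subset of $U(\mathfrak{s}_n)$, and $U(\mathfrak{s}_n)_{X_n}$ denotes the localization of $U(\mathfrak{s}_n)$ with respect to $X_n$. The Weyl algebra $\mathcal{D}_n$ is the subalgebra of $\mathrm{End}_{\mathbb{C}}(A_n)$ generated by $x_i,x_i^{-1},\frac{\partial}{\partial x_i}$, $1\le i\le n$, where $A_n=\mathbb{C}[x_1^{\pm1},\dots,x_n^{\pm1}]$ is the Laurent polynomial algebra. *)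

theory Defs
  imports
    "HOL-Algebra.QuotRing"
    "HOL-Algebra.Subrings"
    "HOL-Library.Poly_Mapping"
    "Jordan_Normal_Form.Matrix"
    "Jordan_Normal_Form.VS_Connect"
begin

section \<open>Associative algebras over the complex numbers\<close>

text \<open>
  An associative algebra is represented by a record of type \<^typ>\<open>(complex, 'a) module\<close>, with all
  fields in use; scalars come from \<^term>\<open>class_ring :: complex ring\<close>.
\<close>

definition alg_iso ::
  "(complex, 'a, 'm) module_scheme \<Rightarrow> (complex, 'b, 'n) module_scheme \<Rightarrow> ('a \<Rightarrow> 'b) set" where
  "alg_iso A B = ring_iso A B \<inter> module_hom class_ring A B"

definition alg_isomorphic ::
  "(complex, 'a, 'm) module_scheme \<Rightarrow> (complex, 'b, 'n) module_scheme \<Rightarrow> bool"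
  (infix \<open>\<cong>\<^sub>a\<^sub>l\<^sub>g\<close> 50) where
  "A \<cong>\<^sub>a\<^sub>l\<^sub>g B \<longleftrightarrow> alg_iso A B \<noteq> {}"

definition quotient_alg ::
  "(complex, 'a, 'm) module_scheme \<Rightarrow> 'a set \<Rightarrow> (complex, 'a set) module" where
  "quotient_alg A I =
     \<lparr>carrier = carrier (A Quot I), mult = mult (A Quot I), one = one (A Quot I),
      zero = zero (A Quot I), add = add (A Quot I),
      smult = (\<lambda>c X. \<Union>x\<in>X. I +>\<^bsub>A\<^esub> (c \<odot>\<^bsub>A\<^esub> x))\<rparr>"

definition generated_subalg_carrier ::
  "(complex, 'a, 'm) module_scheme \<Rightarrow> 'a set \<Rightarrow> 'a set" where
  "generated_subalg_carrier A G =
     \<Inter>{S. subring S A \<and> (\<forall>c. \<forall>x\<in>S. c \<odot>\<^bsub>A\<^esub> x \<in> S) \<and> G \<subseteq> S}"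

text \<open>Linear endomorphisms are made extensional so that equality is equality on the carrier.\<close>

definition End_alg :: "(complex, 'a, 'm) module_scheme \<Rightarrow> (complex, 'a \<Rightarrow> 'a) module" where
  "End_alg V =
     \<lparr>carrier = module_hom class_ring V V \<inter> extensional (carrier V),
      mult = (\<lambda>f g. compose (carrier V) f g),
      one = (\<lambda>x\<in>carrier V. x),
      zero = (\<lambda>x\<in>carrier V. \<zero>\<^bsub>V\<^esub>),
      add = (\<lambda>f g. \<lambda>x\<in>carrier V. f x \<oplus>\<^bsub>V\<^esub> g x),
      smult = (\<lambda>c f. \<lambda>x\<in>carrier V. c \<odot>\<^bsub>V\<^esub> f x)\<rparr>"

text \<open>
  The monoid algebra of \<open>M\<close>: finitely supported functions on \<^term>\<open>carrier M\<close>
  with the convolution product.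
\<close>

definition monoid_alg :: "('a, 'x) monoid_scheme \<Rightarrow> (complex, 'a \<Rightarrow>\<^sub>0 complex) module" where
  "monoid_alg M =
     \<lparr>carrier = {p. Poly_Mapping.keys p \<subseteq> carrier M},
      mult = (\<lambda>p q. \<Sum>a\<in>Poly_Mapping.keys p. \<Sum>b\<in>Poly_Mapping.keys q.
        Poly_Mapping.single (a \<otimes>\<^bsub>M\<^esub> b) (Poly_Mapping.lookup p a * Poly_Mapping.lookup q b)),
      one = Poly_Mapping.single \<one>\<^bsub>M\<^esub> 1,
      zero = 0,
      add = (+),
      smult = (\<lambda>c. Poly_Mapping.map (\<lambda>z. c * z))\<rparr>"


section \<open>Tensor products\<close>

definition bilinear_relators ::
  "(complex, 'a, 'm) module_scheme \<Rightarrow> (complex, 'b, 'n) module_scheme \<Rightarrow> ('a \<times> 'b \<Rightarrow>\<^sub>0 complex) set"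
  where
  "bilinear_relators A B =
     {Poly_Mapping.single (a \<oplus>\<^bsub>A\<^esub> a', b) 1 - Poly_Mapping.single (a, b) 1
        - Poly_Mapping.single (a', b) 1
        | a a' b. a \<in> carrier A \<and> a' \<in> carrier A \<and> b \<in> carrier B}
   \<union> {Poly_Mapping.single (a, b \<oplus>\<^bsub>B\<^esub> b') 1 - Poly_Mapping.single (a, b) 1
        - Poly_Mapping.single (a, b') 1
        | a b b'. a \<in> carrier A \<and> b \<in> carrier B \<and> b' \<in> carrier B}
   \<union> {Poly_Mapping.single (c \<odot>\<^bsub>A\<^esub> a, b) 1 - Poly_Mapping.single (a, b) c
        | c a b. a \<in> carrier A \<and> b \<in> carrier B}
   \<union> {Poly_Mapping.single (a, c \<odot>\<^bsub>B\<^esub> b) 1 - Poly_Mapping.single (a, b) c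
        | c a b. a \<in> carrier A \<and> b \<in> carrier B}"

text \<open>
  The free vector space on \<^term>\<open>carrier A \<times> carrier B\<close> modulo the span of the bilinearity
  relators. Taking the free vector space as the monoid algebra of the multiplicative monoid
  \<^term>\<open>A \<times>\<times> B\<close> equips the quotient with the product
  \<open>(a \<otimes> b) (a' \<otimes> b') = a a' \<otimes> b b'\<close>; the span is an ideal for it.
\<close>

definition tensor_alg ::
  "(complex, 'a, 'm) module_scheme \<Rightarrow> (complex, 'b, 'n) module_scheme
    \<Rightarrow> (complex, ('a \<times> 'b \<Rightarrow>\<^sub>0 complex) set) module" (infixr \<open>\<otimes>\<^sub>a\<^sub>l\<^sub>g\<close> 75) where
  "A \<otimes>\<^sub>a\<^sub>l\<^sub>g B =
     quotient_alg (monoid_alg (A \<times>\<times> B))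
       (LinearCombinations.module.span class_ring (monoid_alg (A \<times>\<times> B)) (bilinear_relators A B))"


section \<open>Universal enveloping algebras\<close>

text \<open>The fields \<^const>\<open>mult\<close> and \<^const>\<open>one\<close> carry no meaning for a Lie algebra.\<close>

record 'a lie_algebra = "(complex, 'a) module" +
  lie_bracket :: "'a \<Rightarrow> 'a \<Rightarrow> 'a"

definition word_monoid :: "'a set \<Rightarrow> 'a list monoid" where
  "word_monoid X = \<lparr>carrier = lists X, mult = (@), one = []\<rparr>"

text \<open>
  The first two families of relators cut the free algebra on the set \<^term>\<open>carrier L\<close> down to the
  tensor algebra of the vector space \<open>L\<close>; the third one is \<open>x y - y x = [x, y]\<close>.
\<close>

definition enveloping_relators ::
  "('a, 'm) lie_algebra_scheme \<Rightarrow> ('a list \<Rightarrow>\<^sub>0 complex) set" where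
  "enveloping_relators L =
     {Poly_Mapping.single [x \<oplus>\<^bsub>L\<^esub> y] 1 - Poly_Mapping.single [x] 1 - Poly_Mapping.single [y] 1
        | x y. x \<in> carrier L \<and> y \<in> carrier L}
   \<union> {Poly_Mapping.single [c \<odot>\<^bsub>L\<^esub> x] 1 - Poly_Mapping.single [x] c | c x. x \<in> carrier L}
   \<union> {Poly_Mapping.single [x, y] 1 - Poly_Mapping.single [y, x] 1
        - Poly_Mapping.single [lie_bracket L x y] 1
        | x y. x \<in> carrier L \<and> y \<in> carrier L}"

definition enveloping_ideal ::
  "('a, 'm) lie_algebra_scheme \<Rightarrow> ('a list \<Rightarrow>\<^sub>0 complex) set" where
  "enveloping_ideal L = Idl\<^bsub>monoid_alg (word_monoid (carrier L))\<^esub> (enveloping_relators L)"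

definition enveloping_alg ::
  "('a, 'm) lie_algebra_scheme \<Rightarrow> (complex, ('a list \<Rightarrow>\<^sub>0 complex) set) module" where
  "enveloping_alg L =
     quotient_alg (monoid_alg (word_monoid (carrier L))) (enveloping_ideal L)"

definition enveloping_incl ::
  "('a, 'm) lie_algebra_scheme \<Rightarrow> 'a \<Rightarrow> ('a list \<Rightarrow>\<^sub>0 complex) set" where
  "enveloping_incl L x =
     enveloping_ideal L +>\<^bsub>monoid_alg (word_monoid (carrier L))\<^esub> Poly_Mapping.single [x] 1"


section \<open>Ore localization\<close>

text \<open>
  Left fractions: the pair \<open>(s, r)\<close> stands for \<open>s\<^sup>-\<^sup>1 r\<close>. When \<open>S\<close> is a left Ore set, two fractions
  have a common denominator \<open>u s = u' s'\<close>, and \<open>u r = v s'\<close> with \<open>u \<in> S\<close> allows to rewrite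
  \<open>r s'\<^sup>-\<^sup>1 = u\<^sup>-\<^sup>1 v\<close>. The operations collect the results of all such choices, which
  all lie in one class.
\<close>

definition frac_rel ::
  "(complex, 'a, 'm) module_scheme \<Rightarrow> 'a set \<Rightarrow> (('a \<times> 'a) \<times> ('a \<times> 'a)) set" where
  "frac_rel A S =
     {((s, r), (s', r')). s \<in> S \<and> r \<in> carrier A \<and> s' \<in> S \<and> r' \<in> carrier A \<and>
        (\<exists>u\<in>carrier A. \<exists>u'\<in>carrier A.
           u \<otimes>\<^bsub>A\<^esub> s = u' \<otimes>\<^bsub>A\<^esub> s' \<and> u \<otimes>\<^bsub>A\<^esub> s \<in> S \<and> u \<otimes>\<^bsub>A\<^esub> r = u' \<otimes>\<^bsub>A\<^esub> r')}"

definition left_frac ::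
  "(complex, 'a, 'm) module_scheme \<Rightarrow> 'a set \<Rightarrow> 'a \<Rightarrow> 'a \<Rightarrow> ('a \<times> 'a) set" where
  "left_frac A S s r = frac_rel A S `` {(s, r)}"

definition ore_localization ::
  "(complex, 'a, 'm) module_scheme \<Rightarrow> 'a set \<Rightarrow> (complex, ('a \<times> 'a) set) module" where
  "ore_localization A S =
     \<lparr>carrier = (S \<times> carrier A) // frac_rel A S,
      mult = (\<lambda>X Y. \<Union>{left_frac A S (u \<otimes>\<^bsub>A\<^esub> s) (v \<otimes>\<^bsub>A\<^esub> r') | s r s' r' u v.
        (s, r) \<in> X \<and> (s', r') \<in> Y \<and> u \<in> S \<and> v \<in> carrier A \<and> u \<otimes>\<^bsub>A\<^esub> r = v \<otimes>\<^bsub>A\<^esub> s'}),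
      one = left_frac A S \<one>\<^bsub>A\<^esub> \<one>\<^bsub>A\<^esub>,
      zero = left_frac A S \<one>\<^bsub>A\<^esub> \<zero>\<^bsub>A\<^esub>,
      add = (\<lambda>X Y. \<Union>{left_frac A S (u \<otimes>\<^bsub>A\<^esub> s) (u \<otimes>\<^bsub>A\<^esub> r \<oplus>\<^bsub>A\<^esub> u' \<otimes>\<^bsub>A\<^esub> r') | s r s' r' u u'.
        (s, r) \<in> X \<and> (s', r') \<in> Y \<and> u \<in> carrier A \<and> u' \<in> carrier A \<and>
        u \<otimes>\<^bsub>A\<^esub> s = u' \<otimes>\<^bsub>A\<^esub> s' \<and> u \<otimes>\<^bsub>A\<^esub> s \<in> S}),
      smult = (\<lambda>c X. \<Union>{left_frac A S s (c \<odot>\<^bsub>A\<^esub> r) | s r. (s, r) \<in> X})\<rparr>"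


section \<open>The Lie algebra \<open>\<s>\<^sub>n\<close> and the Ore set \<open>X\<^sub>n\<close>\<close>

text \<open>Matrix and vector indices range over \<open>0, \<dots>, n - 1\<close>.\<close>

definition s_lie :: "nat \<Rightarrow> (complex mat \<times> complex vec) lie_algebra" where
  "s_lie n =
     \<lparr>carrier = carrier_mat n n \<times> carrier_vec n,
      mult = undefined, one = undefined,
      zero = (0\<^sub>m n n, 0\<^sub>v n),
      add = (\<lambda>(A, v) (B, w). (A + B, v + w)),
      smult = (\<lambda>c (A, v). (c \<cdot>\<^sub>m A, c \<cdot>\<^sub>v v)),
      lie_bracket = (\<lambda>(A, v) (B, w). (A * B - B * A, A *\<^sub>v w - B *\<^sub>v v))\<rparr>"

definition s_mat :: "nat \<Rightarrow> nat \<Rightarrow> nat \<Rightarrow> complex mat \<times> complex vec" where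
  "s_mat n i j = (mat n n (\<lambda>(k, l). if k = i \<and> l = j then 1 else 0), 0\<^sub>v n)"

definition s_vec :: "nat \<Rightarrow> nat \<Rightarrow> complex mat \<times> complex vec" where
  "s_vec n i = (0\<^sub>m n n, unit_vec n i)"

lemma s_lie_brackets:
  assumes "i < n" "j < n" "k < n" "l < n"
  shows "lie_bracket (s_lie n) (s_mat n i j) (s_mat n k l) =
      ((if j = k then 1 else 0) \<odot>\<^bsub>s_lie n\<^esub> s_mat n i l) \<oplus>\<^bsub>s_lie n\<^esub>
      ((if l = i then - 1 else 0) \<odot>\<^bsub>s_lie n\<^esub> s_mat n k j)"
    and "lie_bracket (s_lie n) (s_mat n i j) (s_vec n k) =
      (if j = k then 1 else 0) \<odot>\<^bsub>s_lie n\<^esub> s_vec n i"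
    and "lie_bracket (s_lie n) (s_vec n i) (s_vec n j) = \<zero>\<^bsub>s_lie n\<^esub>"
  using assms
  by (auto simp: s_lie_def s_mat_def s_vec_def unit_vec_def scalar_prod_def if_distrib sum.delta
      intro!: eq_matI eq_vecI cong: if_cong)

definition X_set :: "nat \<Rightarrow> ((complex mat \<times> complex vec) list \<Rightarrow>\<^sub>0 complex) set set" where
  "X_set n =
     {foldr (\<lambda>i y. (enveloping_incl (s_lie n) (s_vec n i) [^]\<^bsub>enveloping_alg (s_lie n)\<^esub> k i)
          \<otimes>\<^bsub>enveloping_alg (s_lie n)\<^esub> y) [0..<n] \<one>\<^bsub>enveloping_alg (s_lie n)\<^esub>
        | k :: nat \<Rightarrow> nat. True}"


section \<open>The Weyl algebra\<close>

text \<open>A Laurent monomial is given by its exponent vector.\<close>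

definition laurent_alg :: "nat \<Rightarrow> (complex, int vec \<Rightarrow>\<^sub>0 complex) module" where
  "laurent_alg n = monoid_alg (monoid_vec TYPE(int) n)"

definition laurent_mult :: "nat \<Rightarrow> int vec \<Rightarrow> (int vec \<Rightarrow>\<^sub>0 complex) \<Rightarrow> (int vec \<Rightarrow>\<^sub>0 complex)" where
  "laurent_mult n a =
     (\<lambda>p\<in>carrier (laurent_alg n). Poly_Mapping.single a 1 \<otimes>\<^bsub>laurent_alg n\<^esub> p)"

definition laurent_deriv :: "nat \<Rightarrow> nat \<Rightarrow> (int vec \<Rightarrow>\<^sub>0 complex) \<Rightarrow> (int vec \<Rightarrow>\<^sub>0 complex)" where
  "laurent_deriv n i =
     (\<lambda>p\<in>carrier (laurent_alg n). \<Sum>a\<in>Poly_Mapping.keys p.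
        Poly_Mapping.single (a - unit_vec n i) (of_int (a $ i) * Poly_Mapping.lookup p a))"

definition weyl_alg :: "nat \<Rightarrow> (complex, (int vec \<Rightarrow>\<^sub>0 complex) \<Rightarrow> (int vec \<Rightarrow>\<^sub>0 complex)) module" where
  "weyl_alg n =
     (End_alg (laurent_alg n))
       \<lparr>carrier := generated_subalg_carrier (End_alg (laurent_alg n))
          (\<Union>i<n. {laurent_mult n (unit_vec n i), laurent_mult n (- unit_vec n i), laurent_deriv n i})\<rparr>"

end

theory Submission
  imports Defs
begin

text \<open>
  Let \<open>z = n - 1\<close>. Inside the localization put \<open>N\<^sub>i\<^sub>j = e\<^sub>i\<^sup>-\<^sup>1 e\<^sub>j e\<^sub>i\<^sub>j\<close>. These elements satisfy
  \<open>N\<^sub>i\<^sub>j e\<^sub>k = e\<^sub>k (N\<^sub>i\<^sub>j + \<delta>\<^sub>j\<^sub>k)\<close>, so the \<open>e\<^sub>i\<close> and \<open>e\<^sub>i\<^sup>-\<^sup>1 N\<^sub>i\<^sub>i\<close> satisfy the relations of \<open>x\<^sub>i\<close> and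
  \<open>\<partial>/\<partial>x\<^sub>i\<close>, while the differences \<open>N\<^sub>i\<^sub>j - N\<^sub>z\<^sub>j\<close> commute with them and span a copy of the matrices
  with vanishing column sums, a Lie algebra isomorphic to \<open>\<s>\<^sub>z\<close>. Conversely
  \<open>e\<^sub>i \<mapsto> x\<^sub>i\<close>, \<open>e\<^sub>i\<^sub>j \<mapsto> x\<^sub>i x\<^sub>j\<^sup>-\<^sup>1 (x\<^sub>j \<partial>/\<partial>x\<^sub>j + \<zeta>\<^sub>i\<^sub>j)\<close> with \<open>\<zeta>\<^sub>i\<^sub>j\<close> in the Lie algebra of
  column-sum-zero matrices, spanned by the \<open>\<zeta>\<^sub>i\<^sub>j - \<zeta>\<^sub>z\<^sub>j\<close>, defines a homomorphism \<open>\<Phi>\<close>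
  from \<open>U(\<s>\<^sub>n)\<close> to \<open>\<D>\<^sub>n \<otimes> U(\<s>\<^sub>z)\<close> that inverts \<open>X\<^sub>n\<close>. Its kernel consists of \<open>X\<^sub>n\<close>-torsion
  because left multiplication of \<open>U(\<s>\<^sub>n)\<close> on its module of right fractions factors through \<open>\<Phi>\<close>,
  and every element of the target is a left fraction \<open>\<Phi>(s)\<^sup>-\<^sup>1 \<Phi>(r)\<close> because such fractions are
  closed under right multiplication by generators.
\<close>

section \<open>Vector spaces and algebras\<close>


text \<open>The commuting \<open>e_i\<close> are coordinate functions on the dual of C^n, and
  inverting them passes to a torus. There the algebra splits into differential operators and the
  enveloping algebra of the stabilizer in gl_n of one point. For the covector (1, ..., 1) the
  stabilizer consists of the matrices with zero column sums, that is, the linear maps from C^n into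
  the hyperplane H of vectors with coordinate sum 0. Such a map amounts to an endomorphism of H and
  the image of one vector outside H, hence the copy of s_(n-1). The prefactor of N_ij undoes the
  shift from e_j to e_i that e_ij performs, so that N_ij acts on monomials in the e_k by scaling.

  The obstacle is injectivity: a map back from the tensor product should land in the localization,
  whose ring structure is not yet available. Right fractions only have to form a vector space with
  left multiplication; their endomorphisms are an algebra in which X_n is invertible, and this
  serves as target. Moreover D_n is given by operators, not by a presentation, so maps out of it
  rest on the linear independence of normally ordered monomials.\<close>

locale cvs = abelian_group V for V :: "(complex, 'a, 'm) module_scheme" (structure) +
  assumes smult_closed [simp, intro]: "x \<in> carrier V \<Longrightarrow> c \<odot> x \<in> carrier V"
    and smult_l_distr: "x \<in> carrier V \<Longrightarrow> (c + d) \<odot> x = c \<odot> x \<oplus> d \<odot> x"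
    and smult_r_distr: "\<lbrakk>x \<in> carrier V; y \<in> carrier V\<rbrakk> \<Longrightarrow> c \<odot> (x \<oplus> y) = c \<odot> x \<oplus> c \<odot> y"
    and smult_smult [simp]: "x \<in> carrier V \<Longrightarrow> c \<odot> (d \<odot> x) = (c * d) \<odot> x"
    and smult_one [simp]: "x \<in> carrier V \<Longrightarrow> 1 \<odot> x = x"
begin

lemma smult_zero_left [simp]: "x \<in> carrier V \<Longrightarrow> 0 \<odot> x = \<zero>"
  using smult_l_distr[of x 0 0] by (metis add.l_cancel_one add_0 smult_closed)

lemma smult_zero_right [simp]: "c \<odot> \<zero> = \<zero>"
  using smult_r_distr[of \<zero> \<zero> c] by (metis add.l_cancel_one l_zero smult_closed zero_closed)

lemma smult_minus_left: "x \<in> carrier V \<Longrightarrow> (- c) \<odot> x = \<ominus> (c \<odot> x)"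
  using smult_l_distr[of x "- c" c] by (metis add.inv_equality ab_left_minus smult_closed smult_zero_left)

lemma smult_minus_right: "x \<in> carrier V \<Longrightarrow> c \<odot> (\<ominus> x) = \<ominus> (c \<odot> x)"
  using smult_r_distr[of "\<ominus> x" x c] by (metis add.inv_closed add.inv_equality l_neg smult_closed smult_zero_right)

lemma minus_eq_smult: "x \<in> carrier V \<Longrightarrow> \<ominus> x = (- 1) \<odot> x"
  by (simp add: smult_minus_left)

lemma finsum_smult:
  assumes "finite K" "f \<in> K \<rightarrow> carrier V"
  shows "(\<Oplus>a\<in>K. c \<odot> f a) = c \<odot> (\<Oplus>a\<in>K. f a)"
  using assms by (induction K rule: finite_induct) (auto simp: smult_r_distr Pi_def)

text \<open>Connects these axioms with the module locale in which the span of
  \<open>tensor_alg\<close> is defined, together with its closure and minimality properties.\<close>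

lemma module_class_ring: "Module.module class_ring V"
proof -
  interpret C: field "class_ring :: complex ring" by (rule class_field)
  show ?thesis
    by unfold_locales
      (auto simp: class_ring_simps smult_l_distr smult_r_distr)
qed

end

section \<open>Finitely supported functions and their linear extension to a vector space\<close>

lemma lookup_map_times [simp]:
  "Poly_Mapping.lookup (Poly_Mapping.map ((*) c) p) k = c * (Poly_Mapping.lookup p k :: complex)"
  by (simp add: Poly_Mapping.map.rep_eq when_def)

lemma keys_map_times: "Poly_Mapping.keys (Poly_Mapping.map ((*) c) p) \<subseteq> Poly_Mapping.keys (p :: 'a \<Rightarrow>\<^sub>0 complex)"
  by (auto simp: in_keys_iff)

lemma keys_minus: "Poly_Mapping.keys (p - q) \<subseteq> Poly_Mapping.keys p \<union> Poly_Mapping.keys (q :: 'a \<Rightarrow>\<^sub>0 complex)"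
  by (auto simp: in_keys_iff lookup_minus)

lemma map_times_add:
  "Poly_Mapping.map ((*) c) (p + q) = Poly_Mapping.map ((*) c) p + Poly_Mapping.map ((*) (c :: complex)) q"
  by (rule poly_mapping_eqI) (simp add: lookup_add distrib_left)

lemma map_times_single: "Poly_Mapping.map ((*) (c :: complex)) (Poly_Mapping.single a d) = Poly_Mapping.single a (c * d)"
  by simp

text \<open>A finitely supported function is the finite sum of its point masses, so an additive
  property need only be checked on those. The bound \<open>S\<close> on the supports is kept through
  the induction because it supplies the carrier side conditions.\<close>

lemma finsupp_induct [consumes 1, case_names zero single add]:
  assumes "Poly_Mapping.keys p \<subseteq> S" "P 0" "\<And>a c. a \<in> S \<Longrightarrow> P (Poly_Mapping.single a c)"
    and "\<And>p q. \<lbrakk>Poly_Mapping.keys p \<subseteq> S; Poly_Mapping.keys q \<subseteq> S; P p; P q\<rbrakk> \<Longrightarrow> P (p + q)"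
  shows "P (p :: 'a \<Rightarrow>\<^sub>0 complex)"
proof -
  have *: "P (\<Sum>a\<in>K. Poly_Mapping.single a (Poly_Mapping.lookup p a)) \<and>
      Poly_Mapping.keys (\<Sum>a\<in>K. Poly_Mapping.single a (Poly_Mapping.lookup p a)) \<subseteq> S"
    if "finite K" "K \<subseteq> S" for K
    using that
  proof (induction K rule: finite_induct)
    case (insert a K)
    have "Poly_Mapping.keys (Poly_Mapping.single a (Poly_Mapping.lookup p a)) \<subseteq> S"
      using insert by auto
    with insert show ?case
      using assms(3,4) keys_add[of "Poly_Mapping.single a (Poly_Mapping.lookup p a)"]
      by (simp; blast)
  qed (simp add: assms)
  have "p = (\<Sum>a\<in>Poly_Mapping.keys p. Poly_Mapping.single a (Poly_Mapping.lookup p a))"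
    by (rule poly_mapping_eqI)
      (simp add: lookup_sum lookup_single when_def in_keys_iff sum.delta'[OF finite_keys] if_distrib cong: if_cong)
  then show ?thesis using *[OF finite_keys assms(1)] by simp
qed

text \<open>The linear extension of \<open>f\<close> from the basis of point masses. All linear maps
  out of free vector spaces, monoid algebras and, through coordinates, Lie algebras are built with
  it.\<close>

definition lin :: "(complex, 'b, 'm) module_scheme \<Rightarrow> ('a \<Rightarrow> 'b) \<Rightarrow> ('a \<Rightarrow>\<^sub>0 complex) \<Rightarrow> 'b" where
  "lin V f p = (\<Oplus>\<^bsub>V\<^esub>a\<in>Poly_Mapping.keys p. Poly_Mapping.lookup p a \<odot>\<^bsub>V\<^esub> f a)"

context cvs
begin

text \<open>Indices outside the support contribute zero; over a common index set two sums can be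
  added termwise.\<close>

lemma lin_superset:
  assumes "finite K" "Poly_Mapping.keys p \<subseteq> K" "f \<in> K \<rightarrow> carrier V"
  shows "lin V f p = (\<Oplus>a\<in>K. Poly_Mapping.lookup p a \<odot> f a)"
  unfolding lin_def using assms
  by (intro add.finprod_mono_neutral_cong_left) (auto simp: in_keys_iff Pi_def)

lemma lin_zero [simp]: "lin V f 0 = \<zero>"
  by (simp add: lin_def)

context
  fixes f :: "'b \<Rightarrow> 'a" and S
  assumes f: "f \<in> S \<rightarrow> carrier V"
begin

lemma lin_closed: "Poly_Mapping.keys p \<subseteq> S \<Longrightarrow> lin V f p \<in> carrier V"
  using f unfolding lin_def by (intro finsum_closed) auto

lemma lin_single: "a \<in> S \<Longrightarrow> lin V f (Poly_Mapping.single a c) = c \<odot> f a"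
  using f finsum_insert[of "{}" a "\<lambda>b. Poly_Mapping.lookup (Poly_Mapping.single a c) b \<odot> f b"]
  by (subst lin_superset[of "{a}"]) (auto simp: Pi_def)

lemma lin_add:
  assumes "Poly_Mapping.keys p \<subseteq> S" "Poly_Mapping.keys q \<subseteq> S"
  shows "lin V f (p + q) = lin V f p \<oplus> lin V f q"
proof -
  let ?K = "Poly_Mapping.keys p \<union> Poly_Mapping.keys q"
  have K: "finite ?K" "f \<in> ?K \<rightarrow> carrier V" using f assms by auto
  have "lin V f (p + q) = (\<Oplus>a\<in>?K. Poly_Mapping.lookup p a \<odot> f a \<oplus> Poly_Mapping.lookup q a \<odot> f a)"
    using K keys_add[of p q] lin_superset[of ?K "p + q" f]
    by (simp add: lookup_add) (intro finsum_cong', auto simp: smult_l_distr Pi_def)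
  also have "\<dots> = (\<Oplus>a\<in>?K. Poly_Mapping.lookup p a \<odot> f a) \<oplus> (\<Oplus>a\<in>?K. Poly_Mapping.lookup q a \<odot> f a)"
    using K by (intro finsum_addf) auto
  also have "\<dots> = lin V f p \<oplus> lin V f q"
    using K lin_superset[of ?K p f] lin_superset[of ?K q f] by simp
  finally show ?thesis .
qed

lemma lin_smult:
  assumes "Poly_Mapping.keys p \<subseteq> S"
  shows "lin V f (Poly_Mapping.map ((*) c) p) = c \<odot> lin V f p"
proof -
  have K: "f \<in> Poly_Mapping.keys p \<rightarrow> carrier V" using f assms by auto
  have "lin V f (Poly_Mapping.map ((*) c) p) = (\<Oplus>a\<in>Poly_Mapping.keys p. c \<odot> (Poly_Mapping.lookup p a \<odot> f a))"
    using K keys_map_times[of c p]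
    by (subst lin_superset[of "Poly_Mapping.keys p"]) (auto simp: Pi_def intro!: finsum_cong')
  also have "\<dots> = c \<odot> lin V f p"
    using K unfolding lin_def by (intro finsum_smult) auto
  finally show ?thesis .
qed

lemma lin_diff:
  assumes "Poly_Mapping.keys p \<subseteq> S" "Poly_Mapping.keys q \<subseteq> S"
  shows "lin V f (p - q) = lin V f p \<ominus> lin V f q"
proof -
  have eq: "p - q = p + Poly_Mapping.map ((*) (-1)) q"
    by (rule poly_mapping_eqI) (simp add: lookup_add lookup_minus)
  have k: "Poly_Mapping.keys (Poly_Mapping.map ((*) (-1)) q) \<subseteq> S" using keys_map_times[of "-1" q] assms(2) by (rule order_trans)
  have "lin V f (p - q) = lin V f p \<oplus> (- 1) \<odot> lin V f q"
    unfolding eq by (simp only: lin_add[OF assms(1) k] lin_smult[OF assms(2)])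
  then show ?thesis using lin_closed[OF assms(2)] by (simp add: smult_minus_left minus_eq)
qed

end

end

section \<open>Associative algebras and their homomorphisms\<close>

locale calg = ring A + cvs A for A :: "(complex, 'a, 'm) module_scheme" (structure) +
  assumes smult_mult_left [simp]: "\<lbrakk>x \<in> carrier A; y \<in> carrier A\<rbrakk> \<Longrightarrow> (c \<odot> x) \<otimes> y = c \<odot> (x \<otimes> y)"
    and smult_mult_right [simp]: "\<lbrakk>x \<in> carrier A; y \<in> carrier A\<rbrakk> \<Longrightarrow> x \<otimes> (c \<odot> y) = c \<odot> (x \<otimes> y)"

definition alg_hom ::
  "(complex, 'a, 'm) module_scheme \<Rightarrow> (complex, 'b, 'n) module_scheme \<Rightarrow> ('a \<Rightarrow> 'b) set" where
  "alg_hom A B = {h \<in> Ring.ring_hom A B. \<forall>c. \<forall>x\<in>carrier A. h (c \<odot>\<^bsub>A\<^esub> x) = c \<odot>\<^bsub>B\<^esub> h x}"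

lemma alg_homI:
  assumes "\<And>x. x \<in> carrier A \<Longrightarrow> h x \<in> carrier B"
    and "\<And>x y. \<lbrakk>x \<in> carrier A; y \<in> carrier A\<rbrakk> \<Longrightarrow> h (x \<otimes>\<^bsub>A\<^esub> y) = h x \<otimes>\<^bsub>B\<^esub> h y"
    and "\<And>x y. \<lbrakk>x \<in> carrier A; y \<in> carrier A\<rbrakk> \<Longrightarrow> h (x \<oplus>\<^bsub>A\<^esub> y) = h x \<oplus>\<^bsub>B\<^esub> h y"
    and "h \<one>\<^bsub>A\<^esub> = \<one>\<^bsub>B\<^esub>"
    and "\<And>c x. x \<in> carrier A \<Longrightarrow> h (c \<odot>\<^bsub>A\<^esub> x) = c \<odot>\<^bsub>B\<^esub> h x"
  shows "h \<in> alg_hom A B"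
  using assms by (auto simp: alg_hom_def Ring.ring_hom_def)

lemma alg_homD:
  assumes "h \<in> alg_hom A B"
  shows "x \<in> carrier A \<Longrightarrow> h x \<in> carrier B"
    and "\<lbrakk>x \<in> carrier A; y \<in> carrier A\<rbrakk> \<Longrightarrow> h (x \<otimes>\<^bsub>A\<^esub> y) = h x \<otimes>\<^bsub>B\<^esub> h y"
    and "\<lbrakk>x \<in> carrier A; y \<in> carrier A\<rbrakk> \<Longrightarrow> h (x \<oplus>\<^bsub>A\<^esub> y) = h x \<oplus>\<^bsub>B\<^esub> h y"
    and "h \<one>\<^bsub>A\<^esub> = \<one>\<^bsub>B\<^esub>"
    and "x \<in> carrier A \<Longrightarrow> h (c \<odot>\<^bsub>A\<^esub> x) = c \<odot>\<^bsub>B\<^esub> h x"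
  using assms by (auto simp: alg_hom_def Ring.ring_hom_def)

lemma alg_hom_comp:
  assumes "g \<in> alg_hom B C" "h \<in> alg_hom A B"
  shows "(\<lambda>x. g (h x)) \<in> alg_hom A C"
  using assms by (intro alg_homI) (simp_all add: alg_homD[OF assms(1)] alg_homD[OF assms(2)])

lemma alg_hom_minus:
  assumes "h \<in> alg_hom A B" "calg A" "calg B"
  shows "h \<zero>\<^bsub>A\<^esub> = \<zero>\<^bsub>B\<^esub>"
    and "x \<in> carrier A \<Longrightarrow> h (\<ominus>\<^bsub>A\<^esub> x) = \<ominus>\<^bsub>B\<^esub> h x"
    and "\<lbrakk>x \<in> carrier A; y \<in> carrier A\<rbrakk> \<Longrightarrow> h (x \<ominus>\<^bsub>A\<^esub> y) = h x \<ominus>\<^bsub>B\<^esub> h y"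
proof -
  interpret A: calg A by fact
  interpret B: calg B by fact
  show "h \<zero>\<^bsub>A\<^esub> = \<zero>\<^bsub>B\<^esub>"
    using alg_homD(5)[OF assms(1), of "\<zero>\<^bsub>A\<^esub>" 0] alg_homD(1)[OF assms(1), of "\<zero>\<^bsub>A\<^esub>"] by simp
  show neg: "h (\<ominus>\<^bsub>A\<^esub> x) = \<ominus>\<^bsub>B\<^esub> h x" if "x \<in> carrier A" for x
    using alg_homD(5)[OF assms(1) that] alg_homD(1)[OF assms(1) that] that
    by (simp add: A.minus_eq_smult B.minus_eq_smult)
  show "h (x \<ominus>\<^bsub>A\<^esub> y) = h x \<ominus>\<^bsub>B\<^esub> h y" if "x \<in> carrier A" "y \<in> carrier A"
    using that by (simp add: a_minus_def alg_homD(3)[OF assms(1)] neg)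
qed

section \<open>Quotients\<close>

text \<open>\<open>A Quot I\<close> and \<open>quotient_alg A I\<close> are records of different
  types with the same ring operations. The ring axioms depend on the five ring fields only, so they
  pass from one to the other.\<close>

lemma calg_ring_cong:
  assumes "ring R" "carrier R' = carrier R" "mult R' = mult R" "one R' = one R" "zero R' = zero R" "add R' = add R"
  shows "ring R'"
proof -
  interpret ring R by fact
  have "abelian_group R'"
  proof (rule abelian_groupI)
    show "\<exists>y\<in>carrier R'. y \<oplus>\<^bsub>R'\<^esub> x = \<zero>\<^bsub>R'\<^esub>" if "x \<in> carrier R'" for x
      using that l_neg[of x] assms by (intro bexI[of _ "\<ominus>\<^bsub>R\<^esub> x"]) auto
  qed (simp_all add: assms a_ac)
  moreover have "Group.monoid R'"
    by (rule monoidI) (simp_all add: assms m_assoc)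
  ultimately show ?thesis
    by (rule ringI) (simp_all add: assms l_distr r_distr)
qed

locale calg_ideal = calg A + ideal I A for I and A :: "(complex, 'a, 'm) module_scheme" (structure)
begin

text \<open>Scaling by \<open>c\<close> is multiplication by \<open>c\<close> times the unit, so a
  ring ideal is automatically a subspace.\<close>

lemma smult_ideal: "x \<in> I \<Longrightarrow> c \<odot> x \<in> I"
  using I_l_closed[of x "c \<odot> \<one>"] a_Hcarr[of x] by simp

lemma quotient_simps:
  "carrier (quotient_alg A I) = a_rcosets I"
  "\<zero>\<^bsub>quotient_alg A I\<^esub> = I" "\<one>\<^bsub>quotient_alg A I\<^esub> = I +> \<one>"
  by (auto simp: quotient_alg_def FactRing_def)

lemma quotient_ops:
  assumes "x \<in> carrier A" "y \<in> carrier A"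
  shows "(I +> x) \<otimes>\<^bsub>quotient_alg A I\<^esub> (I +> y) = I +> (x \<otimes> y)"
    and "(I +> x) \<oplus>\<^bsub>quotient_alg A I\<^esub> (I +> y) = I +> (x \<oplus> y)"
  using assms by (auto simp: quotient_alg_def FactRing_def rcoset_mult_add a_rcos_sum)

lemma coset_eq_iff:
  assumes "x \<in> carrier A" "y \<in> carrier A"
  shows "I +> x = I +> y \<longleftrightarrow> x \<ominus> y \<in> I"
  using quotient_eq_iff_same_a_r_cos[OF ideal_axioms assms] by simp

text \<open>The scalar action is a union over all representatives. They all yield one coset, because
  \<open>c\<close> times a difference lying in \<open>I\<close> lies in \<open>I\<close>
  again.\<close>

lemma quotient_smult:
  assumes "x \<in> carrier A"
  shows "c \<odot>\<^bsub>quotient_alg A I\<^esub> (I +> x) = I +> (c \<odot> x)"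
proof -
  have "I +> (c \<odot> y) = I +> (c \<odot> x)" if "y \<in> I +> x" for y
  proof -
    have y: "y \<in> carrier A" using a_elemrcos_carrier[OF assms that] .
    have "y \<ominus> x \<in> I" using that a_rcos_module_minus[OF ring_axioms assms y] by simp
    then have "c \<odot> (y \<ominus> x) \<in> I" by (rule smult_ideal)
    then show ?thesis using y assms
      by (subst coset_eq_iff) (auto simp: a_minus_def smult_r_distr smult_minus_right)
  qed
  then have "(\<Union>y\<in>I +> x. I +> (c \<odot> y)) = (\<Union>y\<in>I +> x. I +> (c \<odot> x))" by simp
  also have "\<dots> = I +> (c \<odot> x)" using a_rcos_self[OF assms] by auto
  finally show ?thesis by (simp add: quotient_alg_def)
qed

lemma quotient_elem: "X \<in> carrier (quotient_alg A I) \<Longrightarrow> \<exists>x\<in>carrier A. X = I +> x"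
  by (auto simp: quotient_simps A_RCOSETS_def RCOSETS_def a_r_coset_def)

lemma coset_closed [simp]: "x \<in> carrier A \<Longrightarrow> I +> x \<in> carrier (quotient_alg A I)"
  by (simp add: quotient_simps a_rcosetsI a_subset)

lemma calg_quotient: "calg (quotient_alg A I)"
proof -
  have "ring (quotient_alg A I)"
    using calg_ring_cong[OF quotient_is_ring, of "quotient_alg A I"] by (simp add: quotient_alg_def)
  then interpret Q: ring "quotient_alg A I" .
  show ?thesis
    by unfold_locales
      (auto dest!: quotient_elem simp: quotient_smult quotient_ops smult_l_distr smult_r_distr)
qed

text \<open>\<open>g\<close> evaluates \<open>h\<close> at an arbitrary representative; two
  representatives differ by an element of \<open>I\<close>, which \<open>h\<close> kills.\<close>

lemma quotient_lift:
  assumes h: "h \<in> alg_hom A W" and W: "calg W" and I: "\<And>x. x \<in> I \<Longrightarrow> h x = \<zero>\<^bsub>W\<^esub>"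
  shows "\<exists>g\<in>alg_hom (quotient_alg A I) W. \<forall>x\<in>carrier A. g (I +> x) = h x"
proof -
  interpret W: calg W by fact
  define g where "g X = h (SOME x. x \<in> X)" for X
  have g: "g (I +> x) = h x" if x: "x \<in> carrier A" for x
  proof -
    define y where "y = (SOME x'. x' \<in> I +> x)"
    have y: "y \<in> I +> x" unfolding y_def using a_rcos_self[OF x] by (rule someI)
    then have yc: "y \<in> carrier A" using a_elemrcos_carrier[OF x] by simp
    have "y \<ominus> x \<in> I" using y a_rcos_module_minus[OF ring_axioms x yc] by simp
    then have "h y \<ominus>\<^bsub>W\<^esub> h x = \<zero>\<^bsub>W\<^esub>" using I[of "y \<ominus> x"] alg_hom_minus(3)[OF h calg_axioms W yc x] by simp
    then have "h y = h x" using alg_homD(1)[OF h] x yc by simp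
    then show ?thesis by (simp add: g_def y_def)
  qed
  have "g \<in> alg_hom (quotient_alg A I) W"
    by (rule alg_homI)
      (auto dest!: quotient_elem simp: g quotient_ops quotient_simps(3) quotient_smult alg_homD[OF h])
  with g show ?thesis by blast
qed

end

text \<open>By minimality of a generated ideal, a homomorphism that kills the relators then kills
  the whole ideal.\<close>

lemma (in calg) kernel_ideal:
  assumes h: "h \<in> alg_hom A W" and W: "calg W"
  shows "ideal {x \<in> carrier A. h x = \<zero>\<^bsub>W\<^esub>} A"
proof -
  interpret W: calg W by fact
  have "ring_hom_ring A W h"
    using h by (intro ring_hom_ringI2) (auto simp: alg_hom_def ring_axioms W.ring_axioms)
  from ring_hom_ring.kernel_is_ideal[OF this] show ?thesis by (simp add: a_kernel_def kernel_def)
qed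

section \<open>Monoid algebras\<close>

lemma monoid_alg_simps [simp]:
  "carrier (monoid_alg M) = {p. Poly_Mapping.keys p \<subseteq> carrier M}"
  "\<one>\<^bsub>monoid_alg M\<^esub> = Poly_Mapping.single \<one>\<^bsub>M\<^esub> 1"
  "\<zero>\<^bsub>monoid_alg M\<^esub> = 0"
  "p \<oplus>\<^bsub>monoid_alg M\<^esub> q = p + q"
  "c \<odot>\<^bsub>monoid_alg M\<^esub> p = Poly_Mapping.map ((*) c) p"
  by (simp_all add: monoid_alg_def)

lemma map_times_zero [simp]: "Poly_Mapping.map ((*) (c :: complex)) 0 = 0"
  by (rule poly_mapping_eqI) simp

lemma keys_add_subset: "\<lbrakk>Poly_Mapping.keys p \<subseteq> S; Poly_Mapping.keys q \<subseteq> S\<rbrakk> \<Longrightarrow> Poly_Mapping.keys (p + q) \<subseteq> S"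
  using keys_add[of p q] by blast

lemma keys_diff_subset: "\<lbrakk>Poly_Mapping.keys p \<subseteq> S; Poly_Mapping.keys q \<subseteq> S\<rbrakk> \<Longrightarrow> Poly_Mapping.keys (p - q) \<subseteq> S"
  for p q :: "'a \<Rightarrow>\<^sub>0 complex"
  using keys_minus[of p q] by blast

text \<open>With index sets fixed in advance, bilinearity of the convolution becomes distributivity
  of finite double sums.\<close>

lemma conv_superset:
  assumes "finite K" "Poly_Mapping.keys p \<subseteq> K" "finite L" "Poly_Mapping.keys q \<subseteq> L"
  shows "p \<otimes>\<^bsub>monoid_alg M\<^esub> q = (\<Sum>a\<in>K. \<Sum>b\<in>L.
    Poly_Mapping.single (a \<otimes>\<^bsub>M\<^esub> b) (Poly_Mapping.lookup p a * Poly_Mapping.lookup q b))"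
proof -
  have "p \<otimes>\<^bsub>monoid_alg M\<^esub> q = (\<Sum>a\<in>Poly_Mapping.keys p. \<Sum>b\<in>L.
    Poly_Mapping.single (a \<otimes>\<^bsub>M\<^esub> b) (Poly_Mapping.lookup p a * Poly_Mapping.lookup q b))"
    using assms unfolding monoid_alg_def
    by (simp, intro sum.cong refl sum.mono_neutral_left) (auto simp: in_keys_iff)
  also have "\<dots> = (\<Sum>a\<in>K. \<Sum>b\<in>L.
    Poly_Mapping.single (a \<otimes>\<^bsub>M\<^esub> b) (Poly_Mapping.lookup p a * Poly_Mapping.lookup q b))"
    using assms by (intro sum.mono_neutral_left) (auto simp: in_keys_iff)
  finally show ?thesis .
qed

lemma conv_add_left: "(p + p') \<otimes>\<^bsub>monoid_alg M\<^esub> q = p \<otimes>\<^bsub>monoid_alg M\<^esub> q + p' \<otimes>\<^bsub>monoid_alg M\<^esub> q"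
proof -
  let ?K = "Poly_Mapping.keys p \<union> Poly_Mapping.keys p'" and ?L = "Poly_Mapping.keys q"
  have "Poly_Mapping.keys (p + p') \<subseteq> ?K" by (rule keys_add)
  then show ?thesis
    by (subst (1 2 3) conv_superset[of ?K _ ?L])
      (auto simp: lookup_add distrib_right single_add sum.distrib)
qed

lemma conv_add_right: "p \<otimes>\<^bsub>monoid_alg M\<^esub> (q + q') = p \<otimes>\<^bsub>monoid_alg M\<^esub> q + p \<otimes>\<^bsub>monoid_alg M\<^esub> q'"
proof -
  let ?K = "Poly_Mapping.keys p" and ?L = "Poly_Mapping.keys q \<union> Poly_Mapping.keys q'"
  have "Poly_Mapping.keys (q + q') \<subseteq> ?L" by (rule keys_add)
  then show ?thesis
    by (subst (1 2 3) conv_superset[of ?K _ ?L])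
      (auto simp: lookup_add distrib_left single_add sum.distrib)
qed

lemma conv_zero [simp]: "0 \<otimes>\<^bsub>monoid_alg M\<^esub> q = 0" "p \<otimes>\<^bsub>monoid_alg M\<^esub> 0 = 0"
  by (simp_all add: monoid_alg_def)

lemma conv_diff_left: "(p - p') \<otimes>\<^bsub>monoid_alg M\<^esub> q = p \<otimes>\<^bsub>monoid_alg M\<^esub> q - p' \<otimes>\<^bsub>monoid_alg M\<^esub> q"
proof -
  have "p \<otimes>\<^bsub>monoid_alg M\<^esub> q = (p - p') \<otimes>\<^bsub>monoid_alg M\<^esub> q + p' \<otimes>\<^bsub>monoid_alg M\<^esub> q"
    by (subst conv_add_left[symmetric]) simp
  then show ?thesis by simp
qed

lemma conv_diff_right: "p \<otimes>\<^bsub>monoid_alg M\<^esub> (q - q') = p \<otimes>\<^bsub>monoid_alg M\<^esub> q - p \<otimes>\<^bsub>monoid_alg M\<^esub> q'"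
proof -
  have "p \<otimes>\<^bsub>monoid_alg M\<^esub> q = p \<otimes>\<^bsub>monoid_alg M\<^esub> (q - q') + p \<otimes>\<^bsub>monoid_alg M\<^esub> q'"
    by (subst conv_add_right[symmetric]) simp
  then show ?thesis by simp
qed

lemma conv_single [simp]:
  "Poly_Mapping.single a c \<otimes>\<^bsub>monoid_alg M\<^esub> Poly_Mapping.single b d = Poly_Mapping.single (a \<otimes>\<^bsub>M\<^esub> b) (c * d)"
  by (subst conv_superset[of "{a}" _ "{b}"]) auto

lemma map_times_sum:
  "Poly_Mapping.map ((*) (c :: complex)) (sum f K) = (\<Sum>a\<in>K. Poly_Mapping.map ((*) c) (f a))"
  by (induction K rule: infinite_finite_induct) (simp_all add: map_times_add)

lemma conv_smult:
  "Poly_Mapping.map ((*) c) p \<otimes>\<^bsub>monoid_alg M\<^esub> q = Poly_Mapping.map ((*) c) (p \<otimes>\<^bsub>monoid_alg M\<^esub> q)"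
  "p \<otimes>\<^bsub>monoid_alg M\<^esub> Poly_Mapping.map ((*) c) q = Poly_Mapping.map ((*) c) (p \<otimes>\<^bsub>monoid_alg M\<^esub> q)"
proof -
  let ?K = "Poly_Mapping.keys p" and ?L = "Poly_Mapping.keys q"
  note k = keys_map_times[of c p] keys_map_times[of c q]
  show "Poly_Mapping.map ((*) c) p \<otimes>\<^bsub>monoid_alg M\<^esub> q = Poly_Mapping.map ((*) c) (p \<otimes>\<^bsub>monoid_alg M\<^esub> q)"
    using k by (subst (1 2) conv_superset[of ?K _ ?L]) (auto simp: map_times_sum mult.assoc)
  show "p \<otimes>\<^bsub>monoid_alg M\<^esub> Poly_Mapping.map ((*) c) q = Poly_Mapping.map ((*) c) (p \<otimes>\<^bsub>monoid_alg M\<^esub> q)"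
    using k by (subst (1 2) conv_superset[of ?K _ ?L]) (auto simp: map_times_sum mult.left_commute)
qed

lemma conv_closed:
  assumes "Group.monoid M" "Poly_Mapping.keys p \<subseteq> carrier M" "Poly_Mapping.keys q \<subseteq> carrier M"
  shows "Poly_Mapping.keys (p \<otimes>\<^bsub>monoid_alg M\<^esub> q) \<subseteq> carrier M"
proof -
  interpret Group.monoid M by fact
  show ?thesis using assms(2)
  proof (induction p rule: finsupp_induct)
    case (single a c)
    show ?case using assms(3)
      by (induction q rule: finsupp_induct) (simp_all add: conv_add_right single keys_add_subset)
  qed (simp_all add: conv_add_left keys_add_subset)
qed

lemma calg_monoid_alg:
  assumes "Group.monoid M"
  shows "calg (monoid_alg M)"
proof -
  interpret M: Group.monoid M by fact
  have one: "Poly_Mapping.single \<one>\<^bsub>M\<^esub> 1 \<otimes>\<^bsub>monoid_alg M\<^esub> p = p" "p \<otimes>\<^bsub>monoid_alg M\<^esub> Poly_Mapping.single \<one>\<^bsub>M\<^esub> 1 = p"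
    if "Poly_Mapping.keys p \<subseteq> carrier M" for p
    using that by (induction p rule: finsupp_induct) (simp_all add: conv_add_left conv_add_right)
  have assoc: "p \<otimes>\<^bsub>monoid_alg M\<^esub> q \<otimes>\<^bsub>monoid_alg M\<^esub> r = p \<otimes>\<^bsub>monoid_alg M\<^esub> (q \<otimes>\<^bsub>monoid_alg M\<^esub> r)"
    if p: "Poly_Mapping.keys p \<subseteq> carrier M" and q: "Poly_Mapping.keys q \<subseteq> carrier M"
      and r: "Poly_Mapping.keys r \<subseteq> carrier M" for p q r
    using p
  proof (induction p rule: finsupp_induct)
    case (single a c)
    show ?case using q
    proof (induction q rule: finsupp_induct)
      case (single b d)
      show ?case using r
        by (induction r rule: finsupp_induct)
          (simp_all add: conv_add_right single \<open>a \<in> carrier M\<close> M.m_assoc mult.assoc)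
    qed (simp_all add: conv_add_left conv_add_right)
  qed (simp_all add: conv_add_left)
  have ab: "abelian_group (monoid_alg M)"
  proof (rule abelian_groupI)
    fix x assume "x \<in> carrier (monoid_alg M)"
    then show "\<exists>y\<in>carrier (monoid_alg M). y \<oplus>\<^bsub>monoid_alg M\<^esub> x = \<zero>\<^bsub>monoid_alg M\<^esub>"
      using keys_minus[of 0 x] by (intro bexI[of _ "- x"]) (auto simp: in_keys_iff)
  qed (simp_all add: add_ac keys_add_subset)
  have "Group.monoid (monoid_alg M)"
    by (rule monoidI) (use conv_closed[OF assms] one assoc in auto)
  with ab have "ring (monoid_alg M)"
    by (rule ringI) (simp_all add: conv_add_left conv_add_right)
  then interpret F: ring "monoid_alg M" .
  show ?thesis
    by unfold_locales
      (auto intro!: poly_mapping_eqI intro: keys_map_times[THEN subset_trans, THEN subsetD]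
        simp: lookup_add distrib_right map_times_add conv_smult)
qed

lemma monoid_alg_minus:
  assumes "Group.monoid M" "p \<in> carrier (monoid_alg M)" "q \<in> carrier (monoid_alg M)"
  shows "\<ominus>\<^bsub>monoid_alg M\<^esub> q = - q" "p \<ominus>\<^bsub>monoid_alg M\<^esub> q = p - q"
proof -
  interpret calg "monoid_alg M" by (rule calg_monoid_alg) fact
  show "\<ominus>\<^bsub>monoid_alg M\<^esub> q = - q"
    using assms by (intro minus_equality) (auto simp: in_keys_iff subset_eq)
  then show "p \<ominus>\<^bsub>monoid_alg M\<^esub> q = p - q"
    by (simp add: a_minus_def)
qed

text \<open>Both sides of the product formula are bilinear, so multiplicativity on single monoid
  elements is enough.\<close>

lemma lin_alg_hom:
  assumes "Group.monoid M" "calg W" and f: "f \<in> carrier M \<rightarrow> carrier W"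
    and one: "f \<one>\<^bsub>M\<^esub> = \<one>\<^bsub>W\<^esub>"
    and mult: "\<And>a b. \<lbrakk>a \<in> carrier M; b \<in> carrier M\<rbrakk> \<Longrightarrow> f (a \<otimes>\<^bsub>M\<^esub> b) = f a \<otimes>\<^bsub>W\<^esub> f b"
  shows "lin W f \<in> alg_hom (monoid_alg M) W"
proof -
  interpret M: Group.monoid M by fact
  interpret W: calg W by fact
  note closed = W.lin_closed[OF f] and single = W.lin_single[OF f] and add = W.lin_add[OF f]
  have fc: "f a \<in> carrier W" if "a \<in> carrier M" for a using f that by auto
  note cc = conv_closed[OF assms(1)]
  have "lin W f (p \<otimes>\<^bsub>monoid_alg M\<^esub> q) = lin W f p \<otimes>\<^bsub>W\<^esub> lin W f q"
    if p: "Poly_Mapping.keys p \<subseteq> carrier M" and q: "Poly_Mapping.keys q \<subseteq> carrier M" for p q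
    using p
  proof (induction p rule: finsupp_induct)
    case (single a c)
    then have k: "Poly_Mapping.keys (Poly_Mapping.single a c) \<subseteq> carrier M" by auto
    then have lc: "lin W f (Poly_Mapping.single a c) \<in> carrier W" by (rule closed)
    show ?case using q
    proof (induction q rule: finsupp_induct)
      case (add r s)
      then show ?case
        by (simp add: conv_add_right W.lin_add[OF f] cc[OF k] lc closed W.r_distr)
    next
      case (single b d)
      with \<open>a \<in> carrier M\<close> show ?case
        by (simp add: W.lin_single[OF f] fc mult mult.commute)
    qed (simp add: lc)
  qed (simp_all add: conv_add_left add cc q closed W.l_distr)
  then show ?thesis
    by (intro alg_homI) (simp_all add: closed add single one W.lin_smult[OF f])
qed

section \<open>Universal property of the enveloping algebra\<close>

text \<open>Closure of the operations places the relators in the free algebra on the carrier; the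
  relations of the Lie algebra enter through the relators themselves.\<close>

locale lie_ops =
  fixes L :: "('a, 'm) lie_algebra_scheme"
  assumes add_closed [simp]: "\<lbrakk>x \<in> carrier L; y \<in> carrier L\<rbrakk> \<Longrightarrow> x \<oplus>\<^bsub>L\<^esub> y \<in> carrier L"
    and smult_closed [simp]: "x \<in> carrier L \<Longrightarrow> c \<odot>\<^bsub>L\<^esub> x \<in> carrier L"
    and bracket_closed [simp]: "\<lbrakk>x \<in> carrier L; y \<in> carrier L\<rbrakk> \<Longrightarrow> lie_bracket L x y \<in> carrier L"
begin

abbreviation "F \<equiv> monoid_alg (word_monoid (carrier L))"
abbreviation "U \<equiv> enveloping_alg L"
abbreviation "\<iota> \<equiv> enveloping_incl L"

lemma monoid_word: "Group.monoid (word_monoid X)"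
  by (rule monoidI) (auto simp: word_monoid_def)

lemma word_simps [simp]:
  "carrier (word_monoid X) = lists X" "v \<otimes>\<^bsub>word_monoid X\<^esub> w = v @ w" "\<one>\<^bsub>word_monoid X\<^esub> = []"
  by (auto simp: word_monoid_def)

sublocale F: calg F by (rule calg_monoid_alg[OF monoid_word])

lemma single_in_F: "w \<in> lists (carrier L) \<Longrightarrow> Poly_Mapping.single w c \<in> carrier F"
  by auto

lemma diff_in_F: "\<lbrakk>p \<in> carrier F; q \<in> carrier F\<rbrakk> \<Longrightarrow> p - q \<in> carrier F"
  by (simp add: keys_diff_subset)

lemma add_in_F: "\<lbrakk>p \<in> carrier F; q \<in> carrier F\<rbrakk> \<Longrightarrow> p + q \<in> carrier F"
  by (simp add: keys_add_subset)

lemma relators_carrier: "enveloping_relators L \<subseteq> carrier F"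
  unfolding enveloping_relators_def
  by (auto simp del: monoid_alg_simps intro!: diff_in_F single_in_F)

sublocale E: calg_ideal "enveloping_ideal L" F
  unfolding enveloping_ideal_def calg_ideal_def
  using F.genideal_ideal[OF relators_carrier] F.calg_axioms by simp

lemma U_eq: "U = quotient_alg F (enveloping_ideal L)"
  by (simp add: enveloping_alg_def)

sublocale U: calg U
  unfolding U_eq by (rule E.calg_quotient)

lemma incl_closed [simp]: "x \<in> carrier L \<Longrightarrow> \<iota> x \<in> carrier U"
  unfolding enveloping_incl_def U_eq by (intro E.coset_closed) auto

lemma relator_eq:
  assumes "p - q \<in> enveloping_relators L" "p \<in> carrier F" "q \<in> carrier F"
  shows "enveloping_ideal L +>\<^bsub>F\<^esub> p = enveloping_ideal L +>\<^bsub>F\<^esub> q"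
proof -
  have "p - q \<in> enveloping_ideal L"
    unfolding enveloping_ideal_def using F.genideal_self[OF relators_carrier] assms(1) by (rule subsetD)
  then show ?thesis
    using E.coset_eq_iff[OF assms(2,3)] monoid_alg_minus(2)[OF monoid_word assms(2,3)] by simp
qed

lemma incl_add: "\<lbrakk>x \<in> carrier L; y \<in> carrier L\<rbrakk> \<Longrightarrow> \<iota> (x \<oplus>\<^bsub>L\<^esub> y) = \<iota> x \<oplus>\<^bsub>U\<^esub> \<iota> y"
proof -
  let ?s = "\<lambda>w. Poly_Mapping.single w (1 :: complex)"
  assume "x \<in> carrier L" "y \<in> carrier L"
  \<comment> \<open>The relator \<open>a - b - c\<close> is regrouped as \<open>a - (b + c)\<close>
    to match \<open>relator_eq\<close>.\<close>
  have "?s [x \<oplus>\<^bsub>L\<^esub> y] - (?s [x] + ?s [y]) \<in> enveloping_relators L"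
    using \<open>x \<in> carrier L\<close> \<open>y \<in> carrier L\<close> unfolding enveloping_relators_def diff_diff_eq[symmetric] by blast
  then have "enveloping_ideal L +>\<^bsub>F\<^esub> ?s [x \<oplus>\<^bsub>L\<^esub> y] = enveloping_ideal L +>\<^bsub>F\<^esub> (?s [x] + ?s [y])"
    using \<open>x \<in> carrier L\<close> \<open>y \<in> carrier L\<close> by (intro relator_eq add_in_F single_in_F) auto
  with \<open>x \<in> carrier L\<close> \<open>y \<in> carrier L\<close> show ?thesis
    using E.quotient_ops(2)[of "?s [x]" "?s [y]"]
    by (simp add: enveloping_incl_def U_eq)
qed

lemma incl_smult:
  assumes "x \<in> carrier L"
  shows "\<iota> (c \<odot>\<^bsub>L\<^esub> x) = c \<odot>\<^bsub>U\<^esub> \<iota> x"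
proof -
  have "Poly_Mapping.single [c \<odot>\<^bsub>L\<^esub> x] 1 - Poly_Mapping.single [x] c \<in> enveloping_relators L"
    using assms unfolding enveloping_relators_def by blast
  then have "enveloping_ideal L +>\<^bsub>F\<^esub> Poly_Mapping.single [c \<odot>\<^bsub>L\<^esub> x] 1
      = enveloping_ideal L +>\<^bsub>F\<^esub> Poly_Mapping.single [x] c"
    using assms by (intro relator_eq single_in_F) auto
  with assms show ?thesis
    using E.quotient_smult[of "Poly_Mapping.single [x] 1" c]
    by (simp add: enveloping_incl_def U_eq)
qed

lemma incl_bracket:
  assumes "x \<in> carrier L" "y \<in> carrier L"
  shows "\<iota> x \<otimes>\<^bsub>U\<^esub> \<iota> y = \<iota> y \<otimes>\<^bsub>U\<^esub> \<iota> x \<oplus>\<^bsub>U\<^esub> \<iota> (lie_bracket L x y)"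
proof -
  let ?s = "\<lambda>w. Poly_Mapping.single w (1 :: complex)"
  have "?s [x, y] - (?s [y, x] + ?s [lie_bracket L x y]) \<in> enveloping_relators L"
    using assms unfolding enveloping_relators_def diff_diff_eq[symmetric] by blast
  then have "enveloping_ideal L +>\<^bsub>F\<^esub> ?s [x, y] = enveloping_ideal L +>\<^bsub>F\<^esub> (?s [y, x] + ?s [lie_bracket L x y])"
    using assms by (intro relator_eq add_in_F single_in_F) auto
  with assms show ?thesis
    using E.quotient_ops(2)[of "?s [y, x]" "?s [lie_bracket L x y]"]
    by (simp add: enveloping_incl_def U_eq E.quotient_ops)
qed

text \<open>Classes of words span the algebra, and words grow by prepending letters, so the only
  products to consider are left multiplications by Lie elements.\<close>

lemma envelope_induct:
  assumes "X \<in> carrier U" "P \<one>\<^bsub>U\<^esub>"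
    and "\<And>X Y. \<lbrakk>X \<in> carrier U; Y \<in> carrier U; P X; P Y\<rbrakk> \<Longrightarrow> P (X \<oplus>\<^bsub>U\<^esub> Y)"
    and "\<And>c X. \<lbrakk>X \<in> carrier U; P X\<rbrakk> \<Longrightarrow> P (c \<odot>\<^bsub>U\<^esub> X)"
    and "\<And>x X. \<lbrakk>x \<in> carrier L; X \<in> carrier U; P X\<rbrakk> \<Longrightarrow> P (\<iota> x \<otimes>\<^bsub>U\<^esub> X)"
  shows "P X"
proof -
  let ?q = "\<lambda>p. enveloping_ideal L +>\<^bsub>F\<^esub> p"
  obtain p where p: "p \<in> carrier F" "X = ?q p"
    using E.quotient_elem assms(1) unfolding U_eq by blast
  have word: "P (?q (Poly_Mapping.single w 1))" if "w \<in> lists (carrier L)" for w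
    using that
  proof (induction w)
    case Nil
    show ?case using assms(2) by (simp add: U_eq E.quotient_simps)
  next
    case (Cons x w)
    have "?q (Poly_Mapping.single (x # w) 1) = \<iota> x \<otimes>\<^bsub>U\<^esub> ?q (Poly_Mapping.single w 1)"
      using Cons by (simp add: enveloping_incl_def U_eq E.quotient_ops)
    then show ?case using Cons assms(5)[of x "?q (Poly_Mapping.single w 1)"] by (auto simp: U_eq)
  qed
  have single: "P (?q (Poly_Mapping.single w c))" if "w \<in> lists (carrier L)" for w c
    using assms(4)[OF _ word[OF that], of c] that by (simp add: U_eq E.quotient_smult)
  have "Poly_Mapping.keys p \<subseteq> lists (carrier L)" using p by simp
  then have "P (?q p)"
  proof (induction p rule: finsupp_induct)
    case zero
    \<comment> \<open>Zero is treated as the empty word with coefficient 0.\<close>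
    show ?case using single[of "[]" 0] by simp
  next
    case (add p q)
    then show ?case using assms(3)[of "?q p" "?q q"] by (simp add: U_eq E.quotient_ops)
  qed (rule single)
  with p show ?thesis by simp
qed

text \<open>The universal property. \<open>\<phi>\<close> extends to words as an ordered product and
  then linearly; the three hypotheses say that the three families of relators are sent to zero. The
  commutator is written as \<open>xy = yx + [x, y]\<close>, which can be used for rewriting.\<close>

lemma envelope_lift:
  assumes W: "calg W" and \<phi>: "\<And>x. x \<in> carrier L \<Longrightarrow> \<phi> x \<in> carrier W"
    and add: "\<And>x y. \<lbrakk>x \<in> carrier L; y \<in> carrier L\<rbrakk> \<Longrightarrow> \<phi> (x \<oplus>\<^bsub>L\<^esub> y) = \<phi> x \<oplus>\<^bsub>W\<^esub> \<phi> y"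
    and smult: "\<And>c x. x \<in> carrier L \<Longrightarrow> \<phi> (c \<odot>\<^bsub>L\<^esub> x) = c \<odot>\<^bsub>W\<^esub> \<phi> x"
    and bracket: "\<And>x y. \<lbrakk>x \<in> carrier L; y \<in> carrier L\<rbrakk> \<Longrightarrow>
        \<phi> x \<otimes>\<^bsub>W\<^esub> \<phi> y = \<phi> y \<otimes>\<^bsub>W\<^esub> \<phi> x \<oplus>\<^bsub>W\<^esub> \<phi> (lie_bracket L x y)"
  shows "\<exists>\<Phi>\<in>alg_hom U W. \<forall>x\<in>carrier L. \<Phi> (\<iota> x) = \<phi> x"
proof -
  interpret W: calg W by fact
  define f where "f w = foldr (\<lambda>x y. \<phi> x \<otimes>\<^bsub>W\<^esub> y) w \<one>\<^bsub>W\<^esub>" for w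
  have f: "f w \<in> carrier W" if "w \<in> lists (carrier L)" for w
    using that by (induction w) (auto simp: f_def \<phi>)
  have f_append: "f (v @ w) = f v \<otimes>\<^bsub>W\<^esub> f w" if "v \<in> lists (carrier L)" "w \<in> lists (carrier L)" for v w
    using that(1)
  proof (induction v)
    case Nil
    then show ?case using f[OF that(2)] by (simp add: f_def)
  next
    case (Cons x v)
    then show ?case using f[of v] f[OF that(2)] \<phi>[of x] by (simp add: f_def W.m_assoc)
  qed
  have hom: "lin W f \<in> alg_hom F W"
    by (rule lin_alg_hom[OF monoid_word W]) (auto simp: f f_append, simp add: f_def)
  have fS: "f \<in> lists (carrier L) \<rightarrow> carrier W" using f by auto
  note lin_single = W.lin_single[OF fS]
  note lin_diff = W.lin_diff[OF fS]
  have f1: "f [x] = \<phi> x" if "x \<in> carrier L" for x using that \<phi> by (simp add: f_def)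
  have f2: "f [x, y] = \<phi> x \<otimes>\<^bsub>W\<^esub> \<phi> y" if "x \<in> carrier L" "y \<in> carrier L" for x y using that \<phi> by (simp add: f_def)
  have cancel: "a \<oplus>\<^bsub>W\<^esub> b \<ominus>\<^bsub>W\<^esub> a \<ominus>\<^bsub>W\<^esub> b = \<zero>\<^bsub>W\<^esub>" if "a \<in> carrier W" "b \<in> carrier W" for a b
    using that by algebra
  have "enveloping_relators L \<subseteq> {p \<in> carrier F. lin W f p = \<zero>\<^bsub>W\<^esub>}"
  proof
    fix p assume p: "p \<in> enveloping_relators L"
    then have "p \<in> carrier F" using relators_carrier by blast
    moreover have "lin W f p = \<zero>\<^bsub>W\<^esub>"
      using p unfolding enveloping_relators_def
    proof (elim UnE CollectE exE conjE)
      fix x y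
      assume p: "p = Poly_Mapping.single [x \<oplus>\<^bsub>L\<^esub> y] 1 - Poly_Mapping.single [x] 1 - Poly_Mapping.single [y] 1"
        and "x \<in> carrier L" "y \<in> carrier L"
      then show ?thesis
        by (simp add: lin_diff lin_single f1 add \<phi> cancel keys_diff_subset)
    next
      fix c x
      assume p: "p = Poly_Mapping.single [c \<odot>\<^bsub>L\<^esub> x] 1 - Poly_Mapping.single [x] c" and "x \<in> carrier L"
      then show ?thesis
        by (simp add: lin_diff lin_single f1 smult \<phi>)
    next
      fix x y
      assume p: "p = Poly_Mapping.single [x, y] 1 - Poly_Mapping.single [y, x] 1
          - Poly_Mapping.single [lie_bracket L x y] 1"
        and xy: "x \<in> carrier L" "y \<in> carrier L"
      then have "lin W f p = \<phi> x \<otimes>\<^bsub>W\<^esub> \<phi> y \<ominus>\<^bsub>W\<^esub> \<phi> y \<otimes>\<^bsub>W\<^esub> \<phi> x \<ominus>\<^bsub>W\<^esub> \<phi> (lie_bracket L x y)"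
        by (simp add: lin_diff lin_single f1 f2 \<phi> keys_diff_subset)
      then show ?thesis
        using xy by (simp only: bracket[OF xy]) (simp add: \<phi> cancel)
    qed
    ultimately show "p \<in> {p \<in> carrier F. lin W f p = \<zero>\<^bsub>W\<^esub>}" by simp
  qed
  from F.genideal_minimal[OF F.kernel_ideal[OF hom W] this]
  have "lin W f p = \<zero>\<^bsub>W\<^esub>" if "p \<in> enveloping_ideal L" for p
    using that unfolding enveloping_ideal_def by blast
  then have "\<exists>g\<in>alg_hom U W. \<forall>x\<in>carrier F. g (enveloping_ideal L +>\<^bsub>F\<^esub> x) = lin W f x"
    unfolding U_eq by (rule E.quotient_lift[OF hom W])
  then obtain g where
    g: "g \<in> alg_hom U W" "\<forall>x\<in>carrier F. g (enveloping_ideal L +>\<^bsub>F\<^esub> x) = lin W f x"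
    by (elim bexE) (rule that)
  have "g (\<iota> x) = \<phi> x" if "x \<in> carrier L" for x
    using that bspec[OF g(2), of "Poly_Mapping.single [x] 1"] by (simp add: enveloping_incl_def lin_single f1 \<phi>)
  with g(1) show ?thesis by blast
qed

end


section \<open>Tensor products\<close>

locale tensor = A: calg A + B: calg B
  for A :: "(complex, 'a, 'm) module_scheme" and B :: "(complex, 'b, 'n) module_scheme"
begin

abbreviation "F \<equiv> monoid_alg (A \<times>\<times> B)"
abbreviation "I \<equiv> LinearCombinations.module.span class_ring F (bilinear_relators A B)"
abbreviation "T \<equiv> A \<otimes>\<^sub>a\<^sub>l\<^sub>g B"

lemma monoid_prod: "Group.monoid (A \<times>\<times> B)"
  by (intro DirProd_monoid A.monoid_axioms B.monoid_axioms)

sublocale F: calg F by (rule calg_monoid_alg[OF monoid_prod])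

lemma single_in_F: "\<lbrakk>a \<in> carrier A; b \<in> carrier B\<rbrakk> \<Longrightarrow> Poly_Mapping.single (a, b) c \<in> carrier F"
  by auto

lemma diff_in_F: "\<lbrakk>p \<in> carrier F; q \<in> carrier F\<rbrakk> \<Longrightarrow> p - q \<in> carrier F"
  by (simp add: keys_diff_subset)

lemma add_in_F: "\<lbrakk>p \<in> carrier F; q \<in> carrier F\<rbrakk> \<Longrightarrow> p + q \<in> carrier F"
  by (simp add: keys_add_subset)

lemma relators_carrier: "bilinear_relators A B \<subseteq> carrier F"
  unfolding bilinear_relators_def
  by (auto simp del: monoid_alg_simps intro!: diff_in_F single_in_F)

sublocale M: Module.module class_ring F by (rule F.module_class_ring)

lemma span_submodule: "submodule class_ring I F"
  by (rule M.span_is_submodule[OF relators_carrier])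

lemma span_closed:
  "\<lbrakk>x \<in> I; y \<in> I\<rbrakk> \<Longrightarrow> x + y \<in> I" "0 \<in> I" "x \<in> I \<Longrightarrow> Poly_Mapping.map ((*) c) x \<in> I"
  using submodule.m_closed[OF span_submodule] submodule.zero_closed[OF span_submodule]
    submodule.smult_closed[OF span_submodule, of c] by (simp_all add: class_ring_simps)

lemma relator_in_span: "p \<in> bilinear_relators A B \<Longrightarrow> p \<in> I"
  using M.in_own_span[OF relators_carrier] by (rule subsetD)

lemma span_subset:
  assumes "bilinear_relators A B \<subseteq> N" "N \<subseteq> carrier F" "0 \<in> N"
    and "\<And>x y. \<lbrakk>x \<in> N; y \<in> N\<rbrakk> \<Longrightarrow> x + y \<in> N" "\<And>c x. x \<in> N \<Longrightarrow> Poly_Mapping.map ((*) c) x \<in> N"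
  shows "I \<subseteq> N"
  by (rule M.span_is_subset[OF assms(1)])
    (unfold_locales, use assms(2-5) in \<open>simp_all add: class_ring_simps\<close>)

text \<open>Multiplication by a pure tensor only changes the entries of a relator, since products in
  both factors distribute over sums and let scalars out. This is why the linear span of the relators
  is a two-sided ideal.\<close>

lemma relator_mult:
  assumes r: "r \<in> bilinear_relators A B" and "a \<in> carrier A" "b \<in> carrier B"
  shows "Poly_Mapping.single (a, b) 1 \<otimes>\<^bsub>F\<^esub> r \<in> bilinear_relators A B"
    and "r \<otimes>\<^bsub>F\<^esub> Poly_Mapping.single (a, b) 1 \<in> bilinear_relators A B"
proof -
  consider (add_left) x x' y where "r = Poly_Mapping.single (x \<oplus>\<^bsub>A\<^esub> x', y) 1 - Poly_Mapping.single (x, y) 1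
        - Poly_Mapping.single (x', y) 1" "x \<in> carrier A" "x' \<in> carrier A" "y \<in> carrier B"
    | (add_right) x y y' where "r = Poly_Mapping.single (x, y \<oplus>\<^bsub>B\<^esub> y') 1 - Poly_Mapping.single (x, y) 1
        - Poly_Mapping.single (x, y') 1" "x \<in> carrier A" "y \<in> carrier B" "y' \<in> carrier B"
    | (smult_left) c x y where "r = Poly_Mapping.single (c \<odot>\<^bsub>A\<^esub> x, y) 1 - Poly_Mapping.single (x, y) c"
        "x \<in> carrier A" "y \<in> carrier B"
    | (smult_right) c x y where "r = Poly_Mapping.single (x, c \<odot>\<^bsub>B\<^esub> y) 1 - Poly_Mapping.single (x, y) c"
        "x \<in> carrier A" "y \<in> carrier B"
    using r unfolding bilinear_relators_def by (elim UnE CollectE exE conjE)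
  note cases = this
  let ?s = "Poly_Mapping.single (a, b) 1"
  show "?s \<otimes>\<^bsub>F\<^esub> r \<in> bilinear_relators A B"
  proof (cases rule: cases)
    case add_left
    then have "?s \<otimes>\<^bsub>F\<^esub> r = Poly_Mapping.single (a \<otimes>\<^bsub>A\<^esub> x \<oplus>\<^bsub>A\<^esub> a \<otimes>\<^bsub>A\<^esub> x', b \<otimes>\<^bsub>B\<^esub> y) 1
      - Poly_Mapping.single (a \<otimes>\<^bsub>A\<^esub> x, b \<otimes>\<^bsub>B\<^esub> y) 1 - Poly_Mapping.single (a \<otimes>\<^bsub>A\<^esub> x', b \<otimes>\<^bsub>B\<^esub> y) 1"
      using assms by (simp add: conv_diff_right A.r_distr)
    then show ?thesis
      unfolding bilinear_relators_def using assms add_left A.m_closed B.m_closed by blast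
  next
    case add_right
    then have "?s \<otimes>\<^bsub>F\<^esub> r = Poly_Mapping.single (a \<otimes>\<^bsub>A\<^esub> x, b \<otimes>\<^bsub>B\<^esub> y \<oplus>\<^bsub>B\<^esub> b \<otimes>\<^bsub>B\<^esub> y') 1
      - Poly_Mapping.single (a \<otimes>\<^bsub>A\<^esub> x, b \<otimes>\<^bsub>B\<^esub> y) 1 - Poly_Mapping.single (a \<otimes>\<^bsub>A\<^esub> x, b \<otimes>\<^bsub>B\<^esub> y') 1"
      using assms by (simp add: conv_diff_right B.r_distr)
    then show ?thesis
      unfolding bilinear_relators_def using assms add_right A.m_closed B.m_closed by blast
  next
    case smult_left
    then have "?s \<otimes>\<^bsub>F\<^esub> r = Poly_Mapping.single (c \<odot>\<^bsub>A\<^esub> (a \<otimes>\<^bsub>A\<^esub> x), b \<otimes>\<^bsub>B\<^esub> y) 1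
      - Poly_Mapping.single (a \<otimes>\<^bsub>A\<^esub> x, b \<otimes>\<^bsub>B\<^esub> y) c"
      using assms by (simp add: conv_diff_right)
    then show ?thesis
      unfolding bilinear_relators_def using assms smult_left A.m_closed B.m_closed by blast
  next
    case smult_right
    then have "?s \<otimes>\<^bsub>F\<^esub> r = Poly_Mapping.single (a \<otimes>\<^bsub>A\<^esub> x, c \<odot>\<^bsub>B\<^esub> (b \<otimes>\<^bsub>B\<^esub> y)) 1
      - Poly_Mapping.single (a \<otimes>\<^bsub>A\<^esub> x, b \<otimes>\<^bsub>B\<^esub> y) c"
      using assms by (simp add: conv_diff_right)
    then show ?thesis
      unfolding bilinear_relators_def using assms smult_right A.m_closed B.m_closed by blast
  qed
  show "r \<otimes>\<^bsub>F\<^esub> ?s \<in> bilinear_relators A B"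
  proof (cases rule: cases)
    case add_left
    then have "r \<otimes>\<^bsub>F\<^esub> ?s = Poly_Mapping.single (x \<otimes>\<^bsub>A\<^esub> a \<oplus>\<^bsub>A\<^esub> x' \<otimes>\<^bsub>A\<^esub> a, y \<otimes>\<^bsub>B\<^esub> b) 1
      - Poly_Mapping.single (x \<otimes>\<^bsub>A\<^esub> a, y \<otimes>\<^bsub>B\<^esub> b) 1 - Poly_Mapping.single (x' \<otimes>\<^bsub>A\<^esub> a, y \<otimes>\<^bsub>B\<^esub> b) 1"
      using assms by (simp add: conv_diff_left A.l_distr)
    then show ?thesis
      unfolding bilinear_relators_def using assms add_left A.m_closed B.m_closed by blast
  next
    case add_right
    then have "r \<otimes>\<^bsub>F\<^esub> ?s = Poly_Mapping.single (x \<otimes>\<^bsub>A\<^esub> a, y \<otimes>\<^bsub>B\<^esub> b \<oplus>\<^bsub>B\<^esub> y' \<otimes>\<^bsub>B\<^esub> b) 1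
      - Poly_Mapping.single (x \<otimes>\<^bsub>A\<^esub> a, y \<otimes>\<^bsub>B\<^esub> b) 1 - Poly_Mapping.single (x \<otimes>\<^bsub>A\<^esub> a, y' \<otimes>\<^bsub>B\<^esub> b) 1"
      using assms by (simp add: conv_diff_left B.l_distr)
    then show ?thesis
      unfolding bilinear_relators_def using assms add_right A.m_closed B.m_closed by blast
  next
    case smult_left
    then have "r \<otimes>\<^bsub>F\<^esub> ?s = Poly_Mapping.single (c \<odot>\<^bsub>A\<^esub> (x \<otimes>\<^bsub>A\<^esub> a), y \<otimes>\<^bsub>B\<^esub> b) 1
      - Poly_Mapping.single (x \<otimes>\<^bsub>A\<^esub> a, y \<otimes>\<^bsub>B\<^esub> b) c"
      using assms by (simp add: conv_diff_left)
    then show ?thesis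
      unfolding bilinear_relators_def using assms smult_left A.m_closed B.m_closed by blast
  next
    case smult_right
    then have "r \<otimes>\<^bsub>F\<^esub> ?s = Poly_Mapping.single (x \<otimes>\<^bsub>A\<^esub> a, c \<odot>\<^bsub>B\<^esub> (y \<otimes>\<^bsub>B\<^esub> b)) 1
      - Poly_Mapping.single (x \<otimes>\<^bsub>A\<^esub> a, y \<otimes>\<^bsub>B\<^esub> b) c"
      using assms by (simp add: conv_diff_left)
    then show ?thesis
      unfolding bilinear_relators_def using assms smult_right A.m_closed B.m_closed by blast
  qed
qed

lemma span_ideal: "ideal I F"
proof -
  have sub: "I \<subseteq> carrier F" by (rule M.span_is_subset2[OF relators_carrier])
  have rel: "y \<otimes>\<^bsub>F\<^esub> r \<in> I \<and> r \<otimes>\<^bsub>F\<^esub> y \<in> I"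
    if r: "r \<in> bilinear_relators A B" and y: "Poly_Mapping.keys y \<subseteq> carrier (A \<times>\<times> B)" for r y
    using y
  proof (induction y rule: finsupp_induct)
    case zero
    show ?case by (simp add: span_closed)
  next
    case (single w c)
    then obtain a b where w: "w = (a, b)" "a \<in> carrier A" "b \<in> carrier B" by (cases w) auto
    have scaled: "Poly_Mapping.single (a, b) c \<otimes>\<^bsub>F\<^esub> r = Poly_Mapping.map ((*) c) (Poly_Mapping.single (a, b) 1 \<otimes>\<^bsub>F\<^esub> r)"
      "r \<otimes>\<^bsub>F\<^esub> Poly_Mapping.single (a, b) c = Poly_Mapping.map ((*) c) (r \<otimes>\<^bsub>F\<^esub> Poly_Mapping.single (a, b) 1)"
      by (simp flip: conv_smult(1), simp flip: conv_smult(2))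
    show ?case
      unfolding w(1) scaled
      using relator_in_span[OF relator_mult(1)[OF r w(2,3)]] relator_in_span[OF relator_mult(2)[OF r w(2,3)]]
      by (intro conjI span_closed(3))
  qed (simp add: conv_add_left conv_add_right span_closed)
  \<comment> \<open>The elements whose products with everything fall into \<open>I\<close> form a
    subspace. It contains the relators, hence their span.\<close>
  let ?N = "{x \<in> carrier F. \<forall>y\<in>carrier F. y \<otimes>\<^bsub>F\<^esub> x \<in> I \<and> x \<otimes>\<^bsub>F\<^esub> y \<in> I}"
  have "I \<subseteq> ?N"
  proof (rule span_subset)
    show "bilinear_relators A B \<subseteq> ?N" using rel subsetD[OF relators_carrier] by (simp add: subset_eq)
  next
    fix c x assume "x \<in> ?N"
    then show "Poly_Mapping.map ((*) c) x \<in> ?N"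
      using F.smult_closed[of x c] by (simp add: conv_smult span_closed(3))
  qed (auto simp: conv_add_left conv_add_right span_closed(1,2) keys_add_subset)
  then have mult: "y \<otimes>\<^bsub>F\<^esub> x \<in> I" "x \<otimes>\<^bsub>F\<^esub> y \<in> I" if "x \<in> I" "y \<in> carrier F" for x y
    using subsetD[OF \<open>I \<subseteq> ?N\<close> that(1)] that(2) by simp_all
  have "\<ominus>\<^bsub>F\<^esub> x \<in> I" if "x \<in> I" for x
    using F.minus_eq_smult[OF subsetD[OF sub that]] span_closed(3)[OF that, of "-1"] by simp
  then have "subgroup I (add_monoid F)"
    using sub span_closed by (intro F.add.subgroupI) (auto simp: a_inv_def)
  then show ?thesis
    by (intro idealI F.ring_axioms) (use mult in auto)
qed

sublocale T: calg_ideal I F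
  unfolding calg_ideal_def using span_ideal F.calg_axioms by simp

lemma T_eq: "T = quotient_alg F I"
  by (simp add: tensor_alg_def)

sublocale T: calg T
  unfolding T_eq by (rule T.calg_quotient)

definition tens :: "'a \<Rightarrow> 'b \<Rightarrow> ('a \<times> 'b \<Rightarrow>\<^sub>0 complex) set" (infixr \<open>\<otimes>\<^sub>t\<close> 72) where
  "a \<otimes>\<^sub>t b = I +>\<^bsub>F\<^esub> Poly_Mapping.single (a, b) 1"

lemma tens_closed [simp]: "\<lbrakk>a \<in> carrier A; b \<in> carrier B\<rbrakk> \<Longrightarrow> a \<otimes>\<^sub>t b \<in> carrier T"
  unfolding tens_def T_eq by (intro T.coset_closed) auto

lemma relator_eq:
  assumes "p - q \<in> bilinear_relators A B" "p \<in> carrier F" "q \<in> carrier F"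
  shows "I +>\<^bsub>F\<^esub> p = I +>\<^bsub>F\<^esub> q"
  using T.coset_eq_iff[OF assms(2,3)] monoid_alg_minus(2)[OF monoid_prod assms(2,3)] relator_in_span[OF assms(1)]
  by simp

lemma tens_add_left:
  assumes "a \<in> carrier A" "a' \<in> carrier A" "b \<in> carrier B"
  shows "(a \<oplus>\<^bsub>A\<^esub> a') \<otimes>\<^sub>t b = a \<otimes>\<^sub>t b \<oplus>\<^bsub>T\<^esub> a' \<otimes>\<^sub>t b"
proof -
  let ?s = "\<lambda>w. Poly_Mapping.single w (1 :: complex)"
  have "?s (a \<oplus>\<^bsub>A\<^esub> a', b) - (?s (a, b) + ?s (a', b)) \<in> bilinear_relators A B"
    using assms unfolding bilinear_relators_def diff_diff_eq[symmetric] by blast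
  then have "I +>\<^bsub>F\<^esub> ?s (a \<oplus>\<^bsub>A\<^esub> a', b) = I +>\<^bsub>F\<^esub> (?s (a, b) + ?s (a', b))"
    using assms by (intro relator_eq add_in_F single_in_F) auto
  with assms show ?thesis
    using T.quotient_ops(2)[of "?s (a, b)" "?s (a', b)"] by (simp add: tens_def T_eq)
qed

lemma tens_add_right:
  assumes "a \<in> carrier A" "b \<in> carrier B" "b' \<in> carrier B"
  shows "a \<otimes>\<^sub>t (b \<oplus>\<^bsub>B\<^esub> b') = a \<otimes>\<^sub>t b \<oplus>\<^bsub>T\<^esub> a \<otimes>\<^sub>t b'"
proof -
  let ?s = "\<lambda>w. Poly_Mapping.single w (1 :: complex)"
  have "?s (a, b \<oplus>\<^bsub>B\<^esub> b') - (?s (a, b) + ?s (a, b')) \<in> bilinear_relators A B"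
    using assms unfolding bilinear_relators_def diff_diff_eq[symmetric] by blast
  then have "I +>\<^bsub>F\<^esub> ?s (a, b \<oplus>\<^bsub>B\<^esub> b') = I +>\<^bsub>F\<^esub> (?s (a, b) + ?s (a, b'))"
    using assms by (intro relator_eq add_in_F single_in_F) auto
  with assms show ?thesis
    using T.quotient_ops(2)[of "?s (a, b)" "?s (a, b')"] by (simp add: tens_def T_eq)
qed

lemma tens_smult:
  assumes "a \<in> carrier A" "b \<in> carrier B"
  shows "(c \<odot>\<^bsub>A\<^esub> a) \<otimes>\<^sub>t b = c \<odot>\<^bsub>T\<^esub> (a \<otimes>\<^sub>t b)" "a \<otimes>\<^sub>t (c \<odot>\<^bsub>B\<^esub> b) = c \<odot>\<^bsub>T\<^esub> (a \<otimes>\<^sub>t b)"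
proof -
  have eq: "c \<odot>\<^bsub>T\<^esub> (a \<otimes>\<^sub>t b) = I +>\<^bsub>F\<^esub> Poly_Mapping.single (a, b) c"
    using assms T.quotient_smult[of "Poly_Mapping.single (a, b) 1" c] by (simp add: tens_def T_eq)
  have "Poly_Mapping.single (c \<odot>\<^bsub>A\<^esub> a, b) 1 - Poly_Mapping.single (a, b) c \<in> bilinear_relators A B"
    "Poly_Mapping.single (a, c \<odot>\<^bsub>B\<^esub> b) 1 - Poly_Mapping.single (a, b) c \<in> bilinear_relators A B"
    using assms unfolding bilinear_relators_def by blast+
  then show "(c \<odot>\<^bsub>A\<^esub> a) \<otimes>\<^sub>t b = c \<odot>\<^bsub>T\<^esub> (a \<otimes>\<^sub>t b)" "a \<otimes>\<^sub>t (c \<odot>\<^bsub>B\<^esub> b) = c \<odot>\<^bsub>T\<^esub> (a \<otimes>\<^sub>t b)"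
    unfolding eq unfolding tens_def using assms by (intro relator_eq single_in_F; simp)+
qed

lemma tens_mult:
  assumes "a \<in> carrier A" "b \<in> carrier B" "a' \<in> carrier A" "b' \<in> carrier B"
  shows "(a \<otimes>\<^sub>t b) \<otimes>\<^bsub>T\<^esub> (a' \<otimes>\<^sub>t b') = (a \<otimes>\<^bsub>A\<^esub> a') \<otimes>\<^sub>t (b \<otimes>\<^bsub>B\<^esub> b')"
  using assms T.quotient_ops(1)[of "Poly_Mapping.single (a, b) 1" "Poly_Mapping.single (a', b') 1"]
  by (simp add: tens_def T_eq)

lemma tens_one: "\<one>\<^bsub>A\<^esub> \<otimes>\<^sub>t \<one>\<^bsub>B\<^esub> = \<one>\<^bsub>T\<^esub>"
  by (simp add: tens_def T_eq T.quotient_simps)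

lemma tens_left_hom: "(\<lambda>a. a \<otimes>\<^sub>t \<one>\<^bsub>B\<^esub>) \<in> alg_hom A T"
  by (rule alg_homI) (simp_all add: tens_mult tens_add_left tens_smult tens_one)

lemma tens_right_hom: "(\<lambda>b. \<one>\<^bsub>A\<^esub> \<otimes>\<^sub>t b) \<in> alg_hom B T"
  by (rule alg_homI) (simp_all add: tens_mult tens_add_right tens_smult tens_one)

text \<open>Scalars are absorbed into the first factor, so plain sums of pure tensors exhaust the
  tensor product.\<close>

lemma tensor_induct:
  assumes "X \<in> carrier T" and "\<And>a b. \<lbrakk>a \<in> carrier A; b \<in> carrier B\<rbrakk> \<Longrightarrow> P (a \<otimes>\<^sub>t b)"
    and "\<And>X Y. \<lbrakk>X \<in> carrier T; Y \<in> carrier T; P X; P Y\<rbrakk> \<Longrightarrow> P (X \<oplus>\<^bsub>T\<^esub> Y)"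
  shows "P X"
proof -
  obtain p where p: "p \<in> carrier F" "X = I +>\<^bsub>F\<^esub> p"
    using T.quotient_elem assms(1) unfolding T_eq by blast
  have single: "P (I +>\<^bsub>F\<^esub> Poly_Mapping.single w c)" if wc: "w \<in> carrier (A \<times>\<times> B)" for w c
  proof -
    obtain a b where w: "w = (a, b)" "a \<in> carrier A" "b \<in> carrier B" using wc by (cases w) auto
    have "I +>\<^bsub>F\<^esub> Poly_Mapping.single w c = (c \<odot>\<^bsub>A\<^esub> a) \<otimes>\<^sub>t b"
      using w T.quotient_smult[of "Poly_Mapping.single (a, b) 1" c] by (simp add: tens_smult, simp add: tens_def T_eq)
    then show ?thesis using assms(2)[of "c \<odot>\<^bsub>A\<^esub> a" b] w by simp
  qed
  have "Poly_Mapping.keys p \<subseteq> carrier (A \<times>\<times> B)" using p by simp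
  then have "P (I +>\<^bsub>F\<^esub> p)"
  proof (induction p rule: finsupp_induct)
    case zero
    show ?case using single[of "(\<one>\<^bsub>A\<^esub>, \<one>\<^bsub>B\<^esub>)" 0] by simp
  next
    case (add p q)
    then show ?case using assms(3)[of "I +>\<^bsub>F\<^esub> p" "I +>\<^bsub>F\<^esub> q"] by (simp add: T_eq T.quotient_ops)
  qed (rule single)
  with p show ?thesis by simp
qed

text \<open>The universal property: two homomorphisms with commuting images multiply to one.
  Commutation enters through \<open>shuffle\<close>, where the image of the first right factor
  passes the image of the second left factor.\<close>

lemma tensor_lift:
  assumes W: "calg W" and \<rho>: "\<rho> \<in> alg_hom A W" and \<sigma>: "\<sigma> \<in> alg_hom B W"
    and comm: "\<And>a b. \<lbrakk>a \<in> carrier A; b \<in> carrier B\<rbrakk> \<Longrightarrow> \<sigma> b \<otimes>\<^bsub>W\<^esub> \<rho> a = \<rho> a \<otimes>\<^bsub>W\<^esub> \<sigma> b"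
  shows "\<exists>\<psi>\<in>alg_hom T W. \<forall>a\<in>carrier A. \<forall>b\<in>carrier B. \<psi> (a \<otimes>\<^sub>t b) = \<rho> a \<otimes>\<^bsub>W\<^esub> \<sigma> b"
proof -
  interpret W: calg W by fact
  note hom = alg_homD[OF \<rho>] alg_homD[OF \<sigma>]
  define f where "f = (\<lambda>(a, b). \<rho> a \<otimes>\<^bsub>W\<^esub> \<sigma> b)"
  have f: "f \<in> carrier (A \<times>\<times> B) \<rightarrow> carrier W" by (auto simp: f_def hom)
  have shuffle: "r \<otimes>\<^bsub>W\<^esub> r' \<otimes>\<^bsub>W\<^esub> (s \<otimes>\<^bsub>W\<^esub> s') = r \<otimes>\<^bsub>W\<^esub> s \<otimes>\<^bsub>W\<^esub> (r' \<otimes>\<^bsub>W\<^esub> s')"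
    if "s \<otimes>\<^bsub>W\<^esub> r' = r' \<otimes>\<^bsub>W\<^esub> s" "r \<in> carrier W" "r' \<in> carrier W" "s \<in> carrier W" "s' \<in> carrier W" for r r' s s'
  proof -
    have "r \<otimes>\<^bsub>W\<^esub> r' \<otimes>\<^bsub>W\<^esub> (s \<otimes>\<^bsub>W\<^esub> s') = r \<otimes>\<^bsub>W\<^esub> (r' \<otimes>\<^bsub>W\<^esub> s) \<otimes>\<^bsub>W\<^esub> s'"
      using that(2-5) by (simp add: W.m_assoc)
    also have "\<dots> = r \<otimes>\<^bsub>W\<^esub> (s \<otimes>\<^bsub>W\<^esub> r') \<otimes>\<^bsub>W\<^esub> s'" by (simp only: that(1))
    finally show ?thesis using that(2-5) by (simp add: W.m_assoc)
  qed
  have hm: "lin W f \<in> alg_hom F W"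
    by (rule lin_alg_hom[OF monoid_prod W f]) (auto simp: f_def hom shuffle comm)
  note lin_single = W.lin_single[OF f]
  note lin_diff = W.lin_diff[OF f]
  have f1: "f (a, b) = \<rho> a \<otimes>\<^bsub>W\<^esub> \<sigma> b" for a b by (simp add: f_def)
  have cancel: "a \<oplus>\<^bsub>W\<^esub> b \<ominus>\<^bsub>W\<^esub> a \<ominus>\<^bsub>W\<^esub> b = \<zero>\<^bsub>W\<^esub>" if "a \<in> carrier W" "b \<in> carrier W" for a b
    using that by algebra
  have "bilinear_relators A B \<subseteq> {p \<in> carrier F. lin W f p = \<zero>\<^bsub>W\<^esub>}"
  proof
    fix p assume p: "p \<in> bilinear_relators A B"
    then have "p \<in> carrier F" using relators_carrier by blast
    moreover have "lin W f p = \<zero>\<^bsub>W\<^esub>"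
      using p unfolding bilinear_relators_def
      by (auto simp: lin_diff lin_single f1 hom W.l_distr W.r_distr cancel keys_diff_subset)
    ultimately show "p \<in> {p \<in> carrier F. lin W f p = \<zero>\<^bsub>W\<^esub>}" by simp
  qed
  then have "I \<subseteq> {p \<in> carrier F. lin W f p = \<zero>\<^bsub>W\<^esub>}"
  proof (rule span_subset)
    fix c x assume "x \<in> {p \<in> carrier F. lin W f p = \<zero>\<^bsub>W\<^esub>}"
    then show "Poly_Mapping.map ((*) c) x \<in> {p \<in> carrier F. lin W f p = \<zero>\<^bsub>W\<^esub>}"
      using alg_homD(5)[OF hm, of x c] F.smult_closed[of x c] by simp
  next
    fix x y assume "x \<in> {p \<in> carrier F. lin W f p = \<zero>\<^bsub>W\<^esub>}" "y \<in> {p \<in> carrier F. lin W f p = \<zero>\<^bsub>W\<^esub>}"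
    then show "x + y \<in> {p \<in> carrier F. lin W f p = \<zero>\<^bsub>W\<^esub>}"
      using alg_homD(3)[OF hm, of x y] by (simp add: keys_add_subset)
  qed auto
  then have "lin W f p = \<zero>\<^bsub>W\<^esub>" if "p \<in> I" for p using that by blast
  then have "\<exists>g\<in>alg_hom T W. \<forall>x\<in>carrier F. g (I +>\<^bsub>F\<^esub> x) = lin W f x"
    unfolding T_eq by (rule T.quotient_lift[OF hm W])
  then obtain g where g: "g \<in> alg_hom T W" "\<forall>x\<in>carrier F. g (I +>\<^bsub>F\<^esub> x) = lin W f x"
    by (elim bexE) (rule that)
  have "g (a \<otimes>\<^sub>t b) = \<rho> a \<otimes>\<^bsub>W\<^esub> \<sigma> b" if "a \<in> carrier A" "b \<in> carrier B" for a b
    using that bspec[OF g(2), of "Poly_Mapping.single (a, b) 1"] by (simp add: tens_def lin_single f1 hom)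
  with g(1) show ?thesis by blast
qed

end

section \<open>Endomorphism algebras\<close>

lemma End_alg_simps [simp]:
  "f \<otimes>\<^bsub>End_alg V\<^esub> g = compose (carrier V) f g"
  "\<one>\<^bsub>End_alg V\<^esub> = (\<lambda>x\<in>carrier V. x)"
  "\<zero>\<^bsub>End_alg V\<^esub> = (\<lambda>x\<in>carrier V. \<zero>\<^bsub>V\<^esub>)"
  "f \<oplus>\<^bsub>End_alg V\<^esub> g = (\<lambda>x\<in>carrier V. f x \<oplus>\<^bsub>V\<^esub> g x)"
  "c \<odot>\<^bsub>End_alg V\<^esub> f = (\<lambda>x\<in>carrier V. c \<odot>\<^bsub>V\<^esub> f x)"
  by (simp_all add: End_alg_def)

context cvs
begin

lemma End_mem:
  "f \<in> carrier (End_alg V) \<longleftrightarrow> f \<in> extensional (carrier V) \<and> (\<forall>x\<in>carrier V. f x \<in> carrier V) \<and>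
     (\<forall>x\<in>carrier V. \<forall>y\<in>carrier V. f (x \<oplus> y) = f x \<oplus> f y) \<and> (\<forall>c. \<forall>x\<in>carrier V. f (c \<odot> x) = c \<odot> f x)"
  by (auto simp: End_alg_def LinearCombinations.module_hom_def class_ring_simps)

lemma EndD:
  assumes "f \<in> carrier (End_alg V)"
  shows "f \<in> extensional (carrier V)"
    and "x \<in> carrier V \<Longrightarrow> f x \<in> carrier V"
    and "\<lbrakk>x \<in> carrier V; y \<in> carrier V\<rbrakk> \<Longrightarrow> f (x \<oplus> y) = f x \<oplus> f y"
    and "x \<in> carrier V \<Longrightarrow> f (c \<odot> x) = c \<odot> f x"
  using assms by (auto simp: End_mem)

lemma EndI:
  assumes "f \<in> extensional (carrier V)" "\<And>x. x \<in> carrier V \<Longrightarrow> f x \<in> carrier V"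
    and "\<And>x y. \<lbrakk>x \<in> carrier V; y \<in> carrier V\<rbrakk> \<Longrightarrow> f (x \<oplus> y) = f x \<oplus> f y"
    and "\<And>c x. x \<in> carrier V \<Longrightarrow> f (c \<odot> x) = c \<odot> f x"
  shows "f \<in> carrier (End_alg V)"
  using assms by (auto simp: End_mem)

lemma End_eqI:
  assumes "f \<in> carrier (End_alg V)" "g \<in> carrier (End_alg V)" "\<And>x. x \<in> carrier V \<Longrightarrow> f x = g x"
  shows "f = g"
  using extensionalityI[OF EndD(1)[OF assms(1)] EndD(1)[OF assms(2)] assms(3)] .

lemma End_closed:
  "\<lbrakk>f \<in> carrier (End_alg V); g \<in> carrier (End_alg V)\<rbrakk> \<Longrightarrow> compose (carrier V) f g \<in> carrier (End_alg V)"
  "\<lbrakk>f \<in> carrier (End_alg V); g \<in> carrier (End_alg V)\<rbrakk> \<Longrightarrow> (\<lambda>x\<in>carrier V. f x \<oplus> g x) \<in> carrier (End_alg V)"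
  "f \<in> carrier (End_alg V) \<Longrightarrow> (\<lambda>x\<in>carrier V. c \<odot> f x) \<in> carrier (End_alg V)"
  "(\<lambda>x\<in>carrier V. x) \<in> carrier (End_alg V)" "(\<lambda>x\<in>carrier V. \<zero>) \<in> carrier (End_alg V)"
  by (auto intro!: EndI simp: compose_def EndD smult_r_distr a_ac mult.commute)

lemma calg_End: "calg (End_alg V)"
proof -
  note [simp] = End_closed EndD compose_eq
  have ab: "abelian_group (End_alg V)"
  proof (rule abelian_groupI)
    fix f assume f: "f \<in> carrier (End_alg V)"
    show "\<exists>g\<in>carrier (End_alg V). g \<oplus>\<^bsub>End_alg V\<^esub> f = \<zero>\<^bsub>End_alg V\<^esub>"
      by (rule bexI[of _ "(-1) \<odot>\<^bsub>End_alg V\<^esub> f"])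
        (use f End_closed(3)[OF f, of "-1"] in \<open>auto intro!: restrict_ext simp: smult_minus_left l_neg cong: restrict_cong\<close>)
    show "\<zero>\<^bsub>End_alg V\<^esub> \<oplus>\<^bsub>End_alg V\<^esub> f = f"
      using f End_closed(2)[OF End_closed(5) f] by (intro End_eqI) (simp_all cong: restrict_cong)
  qed (auto intro!: restrict_ext simp: a_ac)
  have mon: "Group.monoid (End_alg V)"
  proof (rule monoidI)
    fix f g h assume fgh: "f \<in> carrier (End_alg V)" "g \<in> carrier (End_alg V)" "h \<in> carrier (End_alg V)"
    show "f \<otimes>\<^bsub>End_alg V\<^esub> g \<otimes>\<^bsub>End_alg V\<^esub> h = f \<otimes>\<^bsub>End_alg V\<^esub> (g \<otimes>\<^bsub>End_alg V\<^esub> h)"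
      using fgh by (intro End_eqI) auto
  next
    fix f assume f: "f \<in> carrier (End_alg V)"
    show "\<one>\<^bsub>End_alg V\<^esub> \<otimes>\<^bsub>End_alg V\<^esub> f = f" "f \<otimes>\<^bsub>End_alg V\<^esub> \<one>\<^bsub>End_alg V\<^esub> = f"
      using f by (auto intro!: End_eqI)
  qed auto
  have "ring (End_alg V)"
  proof (rule ringI[OF ab mon])
    fix f g h assume fgh: "f \<in> carrier (End_alg V)" "g \<in> carrier (End_alg V)" "h \<in> carrier (End_alg V)"
    show "(f \<oplus>\<^bsub>End_alg V\<^esub> g) \<otimes>\<^bsub>End_alg V\<^esub> h = f \<otimes>\<^bsub>End_alg V\<^esub> h \<oplus>\<^bsub>End_alg V\<^esub> g \<otimes>\<^bsub>End_alg V\<^esub> h"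
      "h \<otimes>\<^bsub>End_alg V\<^esub> (f \<oplus>\<^bsub>End_alg V\<^esub> g) = h \<otimes>\<^bsub>End_alg V\<^esub> f \<oplus>\<^bsub>End_alg V\<^esub> h \<otimes>\<^bsub>End_alg V\<^esub> g"
      using fgh by (auto intro!: End_eqI)
  qed
  then interpret E: ring "End_alg V" .
  show ?thesis
  proof (intro calg.intro cvs.intro cvs_axioms.intro calg_axioms.intro E.ring_axioms ab)
    fix f assume "f \<in> carrier (End_alg V)"
    then show "1 \<odot>\<^bsub>End_alg V\<^esub> f = f" by (intro End_eqI) auto
  next
    fix c f g assume "f \<in> carrier (End_alg V)" "g \<in> carrier (End_alg V)"
    then show "(c \<odot>\<^bsub>End_alg V\<^esub> f) \<otimes>\<^bsub>End_alg V\<^esub> g = c \<odot>\<^bsub>End_alg V\<^esub> (f \<otimes>\<^bsub>End_alg V\<^esub> g)"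
      "f \<otimes>\<^bsub>End_alg V\<^esub> (c \<odot>\<^bsub>End_alg V\<^esub> g) = c \<odot>\<^bsub>End_alg V\<^esub> (f \<otimes>\<^bsub>End_alg V\<^esub> g)"
      by (auto intro!: End_eqI)
  qed (auto intro!: restrict_ext simp: smult_l_distr smult_r_distr)
qed

text \<open>A vanishing combination of operators can thereby be tested at one well-chosen vector, as
  \<open>wmon_indep\<close> does.\<close>

lemma lin_apply:
  assumes f: "f \<in> S \<rightarrow> carrier (End_alg V)" and "Poly_Mapping.keys p \<subseteq> S" and x: "x \<in> carrier V"
  shows "lin (End_alg V) f p x = lin V (\<lambda>a. f a x) p"
proof -
  interpret E: calg "End_alg V" by (rule calg_End)
  have fx: "(\<lambda>a. f a x) \<in> S \<rightarrow> carrier V" using f x EndD(2) by blast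
  show ?thesis
    using assms(2)
    by (induction p rule: finsupp_induct)
      (use x in \<open>simp_all add: E.lin_single[OF f] E.lin_add[OF f] lin_single[OF fx] lin_add[OF fx]\<close>)
qed

end

section \<open>Generated subalgebras\<close>

context calg
begin

definition subalgebra :: "'a set \<Rightarrow> bool" where
  "subalgebra S \<longleftrightarrow> subring S A \<and> (\<forall>c. \<forall>x\<in>S. c \<odot> x \<in> S)"

lemma subalgebraI:
  assumes "S \<subseteq> carrier A" "\<one> \<in> S" "\<And>x y. \<lbrakk>x \<in> S; y \<in> S\<rbrakk> \<Longrightarrow> x \<otimes> y \<in> S"
    and "\<And>x y. \<lbrakk>x \<in> S; y \<in> S\<rbrakk> \<Longrightarrow> x \<oplus> y \<in> S" "\<And>c x. x \<in> S \<Longrightarrow> c \<odot> x \<in> S"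
  shows "subalgebra S"
proof -
  have "\<ominus> x \<in> S" if "x \<in> S" for x
    using assms(1) assms(5)[OF that, of "-1"] that by (auto simp: minus_eq_smult)
  then show ?thesis unfolding subalgebra_def using assms by (auto intro!: subringI)
qed

lemma generated_least:
  assumes "subalgebra S" "G \<subseteq> S"
  shows "generated_subalg_carrier A G \<subseteq> S"
  using assms unfolding generated_subalg_carrier_def subalgebra_def by blast

lemma generated_subalgebra:
  assumes "G \<subseteq> carrier A"
  shows "subalgebra (generated_subalg_carrier A G)" "G \<subseteq> generated_subalg_carrier A G"
proof -
  have "subalgebra (carrier A)" by (auto intro!: subalgebraI)
  then show "subalgebra (generated_subalg_carrier A G)"
    unfolding generated_subalg_carrier_def subalgebra_def using assms
    by (auto intro!: subring_Inter)
  show "G \<subseteq> generated_subalg_carrier A G" unfolding generated_subalg_carrier_def by blast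
qed

lemma calg_subalgebra:
  assumes "subalgebra S"
  shows "calg (A\<lparr>carrier := S\<rparr>)"
proof -
  have S: "subring S A" "\<And>c x. x \<in> S \<Longrightarrow> c \<odot> x \<in> S" using assms by (auto simp: subalgebra_def)
  interpret R: ring "A\<lparr>carrier := S\<rparr>" by (rule subring_is_ring[OF S(1)])
  note sub = subsetD[OF subringE(1)[OF S(1)]]
  show ?thesis
    by unfold_locales (auto simp: S(2) sub smult_l_distr smult_r_distr)
qed

end

section \<open>Ordered products\<close>

context Group.monoid
begin

definition lprod :: "('i \<Rightarrow> 'a) \<Rightarrow> 'i list \<Rightarrow> 'a" where
  "lprod g l = foldr (\<lambda>i r. g i \<otimes> r) l \<one>"

lemma lprod_simps [simp]: "lprod g [] = \<one>" "lprod g (i # l) = g i \<otimes> lprod g l"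
  by (simp_all add: lprod_def)

lemma lprod_closed [simp]: "(\<And>i. i \<in> set l \<Longrightarrow> g i \<in> carrier G) \<Longrightarrow> lprod g l \<in> carrier G"
  by (induction l) auto

lemma lprod_cong: "(\<And>i. i \<in> set l \<Longrightarrow> g i = h i) \<Longrightarrow> lprod g l = lprod h l"
  by (induction l) auto

lemma lprod_commute:
  assumes "h \<in> carrier G" "\<And>i. i \<in> set l \<Longrightarrow> g i \<in> carrier G" "\<And>i. i \<in> set l \<Longrightarrow> h \<otimes> g i = g i \<otimes> h"
  shows "h \<otimes> lprod g l = lprod g l \<otimes> h"
  using assms(2,3)
proof (induction l)
  case (Cons i l)
  have c: "g i \<in> carrier G" "lprod g l \<in> carrier G" using Cons.prems by auto
  have "h \<otimes> lprod g (i # l) = (h \<otimes> g i) \<otimes> lprod g l" using assms(1) c by (simp add: m_assoc)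
  also have "\<dots> = g i \<otimes> (h \<otimes> lprod g l)" using assms(1) c Cons.prems(2)[of i] by (simp add: m_assoc)
  also have "\<dots> = g i \<otimes> (lprod g l \<otimes> h)" using Cons by simp
  finally show ?case using assms(1) c by (simp add: m_assoc)
qed (use assms(1) in simp)

text \<open>\<open>h\<close> travels through the factors in front of position \<open>i\<close>, with
  which it commutes, and is absorbed there.\<close>

lemma lprod_update:
  assumes "h \<in> carrier G" "\<And>j. j \<in> set l \<Longrightarrow> g j \<in> carrier G" "i \<in> set l" "distinct l"
    and "\<And>j. \<lbrakk>j \<in> set l; j \<noteq> i\<rbrakk> \<Longrightarrow> h \<otimes> g j = g j \<otimes> h"
  shows "h \<otimes> lprod g l = lprod (g(i := h \<otimes> g i)) l"
  using assms(2-)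
proof (induction l)
  case (Cons k l)
  have c: "g k \<in> carrier G" "lprod g l \<in> carrier G" using Cons.prems by auto
  show ?case
  proof (cases "k = i")
    case True
    then have "lprod (g(i := h \<otimes> g i)) l = lprod g l" using Cons.prems by (intro lprod_cong) auto
    with True assms(1) c show ?thesis by (simp add: m_assoc fun_upd_same del: fun_upd_apply)
  next
    case False
    have "h \<otimes> lprod g (k # l) = (h \<otimes> g k) \<otimes> lprod g l" using assms(1) c by (simp add: m_assoc)
    also have "\<dots> = g k \<otimes> (h \<otimes> lprod g l)" using assms(1) c False Cons.prems(4)[of k] by (simp add: m_assoc)
    also have "h \<otimes> lprod g l = lprod (g(i := h \<otimes> g i)) l" using False Cons.prems by (intro Cons.IH) auto
    finally show ?thesis using False by (simp del: fun_upd_apply add: fun_upd_other)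
  qed
qed simp

end

context calg
begin

text \<open>The Leibniz rule when a single factor fails to commute with \<open>h\<close>: the
  commutator \<open>d\<close> appears once, in the place of that factor.\<close>

lemma lprod_derivation:
  assumes "h \<in> carrier A" "\<And>j. j \<in> set l \<Longrightarrow> g j \<in> carrier A" "i \<in> set l" "distinct l" "d \<in> carrier A"
    and "\<And>j. \<lbrakk>j \<in> set l; j \<noteq> i\<rbrakk> \<Longrightarrow> h \<otimes> g j = g j \<otimes> h" "h \<otimes> g i = g i \<otimes> h \<oplus> d"
  shows "h \<otimes> lprod g l = lprod g l \<otimes> h \<oplus> lprod (g(i := d)) l"
  using assms(2-)
proof (induction l)
  case (Cons k l)
  have c: "g k \<in> carrier A" "lprod g l \<in> carrier A" "lprod (g(i := d)) l \<in> carrier A" using Cons.prems by auto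
  have "h \<otimes> lprod g (k # l) = (h \<otimes> g k) \<otimes> lprod g l" using assms(1) c by (simp add: m_assoc)
  also have "\<dots> = lprod g (k # l) \<otimes> h \<oplus> lprod (g(i := d)) (k # l)"
  proof (cases "k = i")
    case True
    have "lprod (g(i := d)) l = lprod g l" using Cons.prems True by (intro lprod_cong) auto
    moreover have "h \<otimes> lprod g l = lprod g l \<otimes> h"
      using Cons.prems True assms(1) by (intro lprod_commute) auto
    ultimately show ?thesis
      using True assms(1) c Cons.prems(4,6) by (simp add: l_distr m_assoc fun_upd_same del: fun_upd_apply)
  next
    case False
    have "(h \<otimes> g k) \<otimes> lprod g l = g k \<otimes> (h \<otimes> lprod g l)"
      using assms(1) c False Cons.prems(5)[of k] by (simp add: m_assoc)
    also have "h \<otimes> lprod g l = lprod g l \<otimes> h \<oplus> lprod (g(i := d)) l"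
      using False Cons.prems by (intro Cons.IH) auto
    finally show ?thesis using False assms(1) c by (simp add: r_distr m_assoc fun_upd_other del: fun_upd_apply)
  qed
  finally show ?case .
qed simp

lemma lprod_smult:
  assumes "\<And>j. j \<in> set l \<Longrightarrow> g j \<in> carrier A" "i \<in> set l" "distinct l" "d \<in> carrier A"
  shows "lprod (g(i := c \<odot> d)) l = c \<odot> lprod (g(i := d)) l"
  using assms
proof (induction l)
  case (Cons k l)
  have cl: "g k \<in> carrier A" "lprod g l \<in> carrier A" "lprod (g(i := d)) l \<in> carrier A" using Cons.prems by auto
  show ?case
  proof (cases "k = i")
    case True
    have "lprod (g(i := d)) l = lprod g l" "lprod (g(i := c \<odot> d)) l = lprod g l"
      using Cons.prems True by (auto intro!: lprod_cong)
    with True cl Cons.prems(4) show ?thesis by (simp add: fun_upd_same del: fun_upd_apply)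
  next
    case False
    have "lprod (g(i := c \<odot> d)) l = c \<odot> lprod (g(i := d)) l"
      using False Cons.prems by (intro Cons.IH) auto
    with False cl show ?thesis by (simp add: fun_upd_other del: fun_upd_apply)
  qed
qed simp

end


section \<open>Representations of the Weyl algebra\<close>

text \<open>The relations of the Weyl algebra, with \<open>y i\<close> for the inverse of
  \<open>x i\<close> and \<open>p i\<close> for the derivative. Both the concrete operators and the
  arbitrary targets of homomorphisms are instances.\<close>

locale weyl_rep = calg W for W :: "(complex, 'a, 'm) module_scheme" (structure) +
  fixes n :: nat and x y p :: "nat \<Rightarrow> 'a"
  assumes x_closed [simp]: "i < n \<Longrightarrow> x i \<in> carrier W"
    and y_closed [simp]: "i < n \<Longrightarrow> y i \<in> carrier W"
    and p_closed [simp]: "i < n \<Longrightarrow> p i \<in> carrier W"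
    and x_comm: "\<lbrakk>i < n; j < n\<rbrakk> \<Longrightarrow> x i \<otimes> x j = x j \<otimes> x i"
    and x_y: "i < n \<Longrightarrow> x i \<otimes> y i = \<one>" and y_x: "i < n \<Longrightarrow> y i \<otimes> x i = \<one>"
    and p_comm: "\<lbrakk>i < n; j < n\<rbrakk> \<Longrightarrow> p i \<otimes> p j = p j \<otimes> p i"
    and p_x: "\<lbrakk>i < n; j < n\<rbrakk> \<Longrightarrow> p i \<otimes> x j = x j \<otimes> p i \<oplus> (if i = j then \<one> else \<zero>)"
begin

text \<open>Whatever commutes with \<open>x\<close> commutes with its inverse:
  \<open>h y = y x h y = y h x y = y h\<close>.\<close>

lemma commute_y:
  assumes "i < n" "h \<in> carrier W" "h \<otimes> x i = x i \<otimes> h"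
  shows "h \<otimes> y i = y i \<otimes> h"
proof -
  have "h \<otimes> y i = y i \<otimes> (x i \<otimes> h) \<otimes> y i"
    using assms(1,2) by (simp add: y_x flip: m_assoc)
  also have "\<dots> = y i \<otimes> h"
    using assms(1,2) by (simp add: x_y m_assoc flip: assms(3))
  finally show ?thesis .
qed

lemma y_comm_x: "\<lbrakk>i < n; j < n\<rbrakk> \<Longrightarrow> y i \<otimes> x j = x j \<otimes> y i"
  using commute_y[of i "x j"] x_comm by simp

lemma y_comm: "\<lbrakk>i < n; j < n\<rbrakk> \<Longrightarrow> y i \<otimes> y j = y j \<otimes> y i"
  using commute_y[of j "y i"] y_comm_x by simp

text \<open>The derivative of the inverse is \<open>- y^2\<close>: the relation
  \<open>p x = x p + 1\<close> is sandwiched between two copies of \<open>y\<close>.\<close>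

lemma p_y_same:
  assumes "i < n"
  shows "p i \<otimes> y i = y i \<otimes> p i \<ominus> y i \<otimes> y i"
proof -
  have "y i \<otimes> (p i \<otimes> x i) \<otimes> y i = y i \<otimes> (x i \<otimes> p i \<oplus> \<one>) \<otimes> y i"
    using assms by (simp add: p_x)
  moreover have "y i \<otimes> (p i \<otimes> x i) \<otimes> y i = y i \<otimes> p i"
    using assms by (simp add: x_y m_assoc)
  moreover have "y i \<otimes> (x i \<otimes> p i \<oplus> \<one>) \<otimes> y i = p i \<otimes> y i \<oplus> y i \<otimes> y i"
    using assms by (simp add: y_x r_distr l_distr flip: m_assoc)
  ultimately have "y i \<otimes> p i = p i \<otimes> y i \<oplus> y i \<otimes> y i" by simp
  then show ?thesis using assms by (simp add: minus_eq a_assoc r_neg)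
qed

text \<open>Integer powers of an invertible element: at least one of the two truncated exponents is
  0.\<close>

definition xpow :: "nat \<Rightarrow> int \<Rightarrow> 'a" where
  "xpow i a = x i [^] nat a \<otimes> y i [^] nat (- a)"

lemma xpow_closed [simp]: "i < n \<Longrightarrow> xpow i a \<in> carrier W"
  by (simp add: xpow_def)

lemma xpow_0 [simp]: "xpow i 0 = \<one>"
  by (simp add: xpow_def)

lemma commute_pow:
  "\<lbrakk>h \<in> carrier W; z \<in> carrier W; h \<otimes> z = z \<otimes> h\<rbrakk> \<Longrightarrow> h \<otimes> z [^] (k :: nat) = z [^] k \<otimes> h"
  by (induction k) (simp_all add: m_assoc[symmetric], simp add: m_assoc)

lemma commute_xpow:
  assumes "i < n" "h \<in> carrier W" "h \<otimes> x i = x i \<otimes> h"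
  shows "h \<otimes> xpow i a = xpow i a \<otimes> h"
proof -
  note c = commute_pow[OF assms(2) x_closed[OF assms(1)] assms(3)]
    commute_pow[OF assms(2) y_closed[OF assms(1)] commute_y[OF assms]]
  have "h \<otimes> xpow i a = (h \<otimes> x i [^] nat a) \<otimes> y i [^] nat (- a)"
    using assms by (simp add: xpow_def m_assoc)
  also have "\<dots> = x i [^] nat a \<otimes> (h \<otimes> y i [^] nat (- a))"
    unfolding c(1) using assms by (simp add: m_assoc)
  finally show ?thesis unfolding c(2) using assms by (simp add: xpow_def m_assoc)
qed

lemma x_xpow:
  assumes "i < n"
  shows "x i \<otimes> xpow i a = xpow i (a + 1)"
proof (cases "a \<ge> 0")
  case True
  then obtain k where k: "a = int k" by (metis nonneg_int_cases)
  have "x i [^] Suc k = x i \<otimes> x i [^] k" using assms by (intro nat_pow_Suc2) simp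
  moreover have "nat (int k + 1) = Suc k" "nat (- (int k + 1)) = 0" by simp_all
  ultimately show ?thesis
    unfolding xpow_def k using assms by (simp del: nat_pow_Suc)
next
  case False
  then obtain k where k: "nat (- a) = Suc k" "nat (- (a + 1)) = k" "nat a = 0" "nat (a + 1) = 0"
    by (cases "nat (- a)") auto
  have "y i [^] Suc k = y i \<otimes> y i [^] k" using assms by (intro nat_pow_Suc2) simp
  moreover have "x i \<otimes> (y i \<otimes> y i [^] k) = y i [^] k"
    using assms by (simp add: x_y flip: m_assoc)
  ultimately show ?thesis
    unfolding xpow_def k using assms by (simp del: nat_pow_Suc)
qed

lemma y_xpow: "i < n \<Longrightarrow> y i \<otimes> xpow i a = xpow i (a - 1)"
  using x_xpow[of i "a - 1"] by (metis (no_types) add_diff_cancel diff_add_cancel l_one m_assoc x_closed xpow_closed y_closed y_x)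

text \<open>The power rule, by induction from 0 in both directions: upwards with \<open>p_x\<close>,
  downwards with \<open>p_y_same\<close>.\<close>

lemma p_xpow:
  assumes i: "i < n"
  shows "p i \<otimes> xpow i a = xpow i a \<otimes> p i \<oplus> of_int a \<odot> xpow i (a - 1)"
proof (induction a rule: int_induct[where k = 0])
  case base
  then show ?case using i by simp
next
  case (step1 a)
  have "p i \<otimes> xpow i (a + 1) = (p i \<otimes> x i) \<otimes> xpow i a"
    using i by (simp add: m_assoc flip: x_xpow)
  also have "\<dots> = x i \<otimes> (p i \<otimes> xpow i a) \<oplus> xpow i a"
    using i by (simp add: p_x l_distr m_assoc)
  also have "\<dots> = xpow i (a + 1) \<otimes> p i \<oplus> (of_int a \<odot> xpow i a \<oplus> 1 \<odot> xpow i a)"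
    unfolding step1.IH using i by (simp add: r_distr x_xpow a_assoc flip: m_assoc)
  also have "of_int a \<odot> xpow i a \<oplus> 1 \<odot> xpow i a = of_int (a + 1) \<odot> xpow i (a + 1 - 1)"
    using i smult_l_distr[of "xpow i a" "of_int a" 1] by simp
  finally show ?case .
next
  case (step2 a)
  have "p i \<otimes> xpow i (a - 1) = (p i \<otimes> y i) \<otimes> xpow i a"
    using i by (simp add: m_assoc flip: y_xpow)
  also have "\<dots> = y i \<otimes> (p i \<otimes> xpow i a) \<ominus> xpow i (a - 1 - 1)"
    using i by (simp add: p_y_same minus_eq l_distr l_minus m_assoc y_xpow)
  also have "\<dots> = xpow i (a - 1) \<otimes> p i \<oplus> (of_int a \<odot> xpow i (a - 1 - 1) \<oplus> (-1) \<odot> xpow i (a - 1 - 1))"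
    unfolding step2.IH using i by (simp add: r_distr y_xpow a_assoc minus_eq smult_minus_left flip: m_assoc)
  also have "of_int a \<odot> xpow i (a - 1 - 1) \<oplus> (-1) \<odot> xpow i (a - 1 - 1) = of_int (a - 1) \<odot> xpow i (a - 1 - 1)"
    using i smult_l_distr[of "xpow i (a - 1 - 1)" "of_int a" "-1"] by simp
  finally show ?case .
qed

text \<open>Normally ordered monomials, with integer exponents on the \<open>x\<close> and natural
  ones on the \<open>p\<close>; in the concrete algebra they form the standard basis.\<close>

definition wmon :: "int vec \<times> nat vec \<Rightarrow> 'a" where
  "wmon = (\<lambda>(a, m). lprod (\<lambda>i. xpow i (a $ i)) [0..<n] \<otimes> lprod (\<lambda>i. p i [^] (m $ i)) [0..<n])"

lemma xs_closed [simp]: "lprod (\<lambda>i. xpow i (a $ i)) [0..<n] \<in> carrier W"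
  and ps_closed [simp]: "lprod (\<lambda>i. p i [^] (m $ i :: nat)) [0..<n] \<in> carrier W"
  by (auto intro!: lprod_closed)

lemma wmon_closed [simp]: "wmon am \<in> carrier W"
  by (simp add: wmon_def split_beta)

lemma wmon_0: "wmon (0\<^sub>v n, 0\<^sub>v n) = \<one>"
proof -
  have "lprod (\<lambda>i. xpow i (0\<^sub>v n $ i)) [0..<n] = lprod (\<lambda>i. \<one>) [0..<n]"
    "lprod (\<lambda>i. p i [^] (0\<^sub>v n $ i :: nat)) [0..<n] = lprod (\<lambda>i. \<one>) [0..<n]"
    by (rule lprod_cong; simp)+
  moreover have "lprod (\<lambda>i. \<one>) l = \<one>" for l :: "nat list" by (induction l) auto
  ultimately show ?thesis by (simp add: wmon_def)
qed

lemma xs_shift: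
  assumes "i < n" "a \<in> carrier_vec n" "b \<in> carrier_vec n" "\<And>j. j < n \<Longrightarrow> b $ j = (if j = i then a $ i + d else a $ j)"
  shows "lprod ((\<lambda>i. xpow i (a $ i))(i := xpow i (a $ i + d))) [0..<n] = lprod (\<lambda>i. xpow i (b $ i)) [0..<n]"
  using assms by (intro lprod_cong) auto

lemma x_wmon:
  assumes "i < n" "a \<in> carrier_vec n"
  shows "x i \<otimes> wmon (a, m) = wmon (a + unit_vec n i, m)"
proof -
  have "x i \<otimes> lprod (\<lambda>i. xpow i (a $ i)) [0..<n] = lprod ((\<lambda>i. xpow i (a $ i))(i := xpow i (a $ i + 1))) [0..<n]"
    using assms lprod_update[of "x i" "[0..<n]" "\<lambda>i. xpow i (a $ i)" i]
    unfolding x_xpow[OF assms(1)] by (simp add: commute_xpow x_comm)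
  also have "\<dots> = lprod (\<lambda>j. xpow j ((a + unit_vec n i) $ j)) [0..<n]"
    using assms by (intro xs_shift) auto
  finally show ?thesis using assms(1) by (simp add: wmon_def flip: m_assoc)
qed

lemma y_wmon:
  assumes "i < n" "a \<in> carrier_vec n"
  shows "y i \<otimes> wmon (a, m) = wmon (a - unit_vec n i, m)"
proof -
  have "y i \<otimes> lprod (\<lambda>i. xpow i (a $ i)) [0..<n] = lprod ((\<lambda>i. xpow i (a $ i))(i := xpow i (a $ i - 1))) [0..<n]"
    using assms lprod_update[of "y i" "[0..<n]" "\<lambda>i. xpow i (a $ i)" i]
    unfolding y_xpow[OF assms(1)] by (simp add: commute_xpow y_comm_x)
  also have "\<dots> = lprod (\<lambda>j. xpow j ((a - unit_vec n i) $ j)) [0..<n]"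
    using xs_shift[of i a "a - unit_vec n i" "-1"] assms by simp
  finally show ?thesis using assms(1) by (simp add: wmon_def flip: m_assoc)
qed

text \<open>As in \<open>x_wmon\<close> and \<open>y_wmon\<close>, the result is a combination of
  normal monomials with coefficients that do not depend on the representation. This makes two
  representations comparable.\<close>

lemma p_wmon:
  assumes i: "i < n" and a: "a \<in> carrier_vec n" and m: "m \<in> carrier_vec n"
  shows "p i \<otimes> wmon (a, m) = wmon (a, m + unit_vec n i) \<oplus> of_int (a $ i) \<odot> wmon (a - unit_vec n i, m)"
proof -
  let ?X = "\<lambda>a. lprod (\<lambda>i. xpow i (a $ i)) [0..<n]" and ?P = "\<lambda>m. lprod (\<lambda>i. p i [^] (m $ i)) [0..<n]"
  have "p i \<otimes> ?X a = ?X a \<otimes> p i \<oplus> lprod ((\<lambda>i. xpow i (a $ i))(i := of_int (a $ i) \<odot> xpow i (a $ i - 1))) [0..<n]"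
    using i p_x by (intro lprod_derivation) (auto simp: commute_xpow p_xpow)
  also have "lprod ((\<lambda>i. xpow i (a $ i))(i := of_int (a $ i) \<odot> xpow i (a $ i - 1))) [0..<n]
      = of_int (a $ i) \<odot> lprod ((\<lambda>i. xpow i (a $ i))(i := xpow i (a $ i + (-1)))) [0..<n]"
    using i lprod_smult[of "[0..<n]" "\<lambda>i. xpow i (a $ i)" i "xpow i (a $ i + (-1))" "of_int (a $ i)"] by simp
  also have "lprod ((\<lambda>i. xpow i (a $ i))(i := xpow i (a $ i + (-1)))) [0..<n] = ?X (a - unit_vec n i)"
    using i a by (intro xs_shift) auto
  finally have X: "p i \<otimes> ?X a = ?X a \<otimes> p i \<oplus> of_int (a $ i) \<odot> ?X (a - unit_vec n i)" .
  have "p i \<otimes> ?P m = lprod ((\<lambda>i. p i [^] (m $ i))(i := p i \<otimes> p i [^] (m $ i))) [0..<n]"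
    using i by (intro lprod_update) (auto simp: commute_pow p_comm)
  also have "\<dots> = ?P (m + unit_vec n i)"
    using i m commute_pow[of "p i" "p i" "m $ i"] by (intro lprod_cong) auto
  finally have P: "p i \<otimes> ?P m = ?P (m + unit_vec n i)" .
  have "p i \<otimes> wmon (a, m) = (p i \<otimes> ?X a) \<otimes> ?P m"
    using i by (simp add: wmon_def m_assoc)
  also have "\<dots> = ?X a \<otimes> (p i \<otimes> ?P m) \<oplus> of_int (a $ i) \<odot> (?X (a - unit_vec n i) \<otimes> ?P m)"
    unfolding X using i by (simp add: l_distr m_assoc)
  finally show ?thesis unfolding P by (simp add: wmon_def)
qed

abbreviation "widx \<equiv> carrier_vec n \<times> carrier_vec n :: (int vec \<times> nat vec) set"

lemma wmon_Pi: "wmon \<in> widx \<rightarrow> carrier W" by simp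

end

section \<open>Comparing two representations of the Weyl relations\<close>

lemma (in calg) subalgebra_carrier: "subalgebra (carrier A)"
  by (rule subalgebraI) auto

text \<open>\<open>E\<close> is a model in which the normal monomials are independent,
  \<open>W\<close> is arbitrary. The aim is a homomorphism from the subalgebra generated in
  \<open>E\<close> to \<open>W\<close>, so that the Weyl relations turn out to present this
  subalgebra.\<close>

locale weyl_pair = D: weyl_rep E n X Y P + T: weyl_rep W n x y p
  for E :: "(complex, 'a, 'm) module_scheme" and W :: "(complex, 'b, 'k) module_scheme" and n X Y P x y p +
  assumes indep: "\<lbrakk>Poly_Mapping.keys c \<subseteq> carrier_vec n \<times> carrier_vec n; lin E D.wmon c = \<zero>\<^bsub>E\<^esub>\<rbrakk> \<Longrightarrow> c = 0"
begin

text \<open>The graph of the desired map on combinations of normal monomials. Linearity is closure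
  of the graph, and well-definedness is deferred to \<open>rel_unique\<close>, where independence
  enters.\<close>

definition rel :: "('a \<times> 'b) set" where
  "rel = {(lin E D.wmon c, lin W T.wmon c) | c. Poly_Mapping.keys c \<subseteq> D.widx}"

lemma relI: "Poly_Mapping.keys c \<subseteq> D.widx \<Longrightarrow> (lin E D.wmon c, lin W T.wmon c) \<in> rel"
  unfolding rel_def by blast

lemma relE:
  assumes "(d, t) \<in> rel"
  obtains c where "Poly_Mapping.keys c \<subseteq> D.widx" "d = lin E D.wmon c" "t = lin W T.wmon c"
  using assms unfolding rel_def by blast

lemma rel_closed: "(d, t) \<in> rel \<Longrightarrow> d \<in> carrier E" "(d, t) \<in> rel \<Longrightarrow> t \<in> carrier W"
  by (auto elim!: relE intro!: D.lin_closed[OF D.wmon_Pi] T.lin_closed[OF T.wmon_Pi])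

lemma rel_add:
  assumes "(d, t) \<in> rel" "(d', t') \<in> rel"
  shows "(d \<oplus>\<^bsub>E\<^esub> d', t \<oplus>\<^bsub>W\<^esub> t') \<in> rel"
proof -
  obtain c c' where c: "Poly_Mapping.keys c \<subseteq> D.widx" "d = lin E D.wmon c" "t = lin W T.wmon c"
    and c': "Poly_Mapping.keys c' \<subseteq> D.widx" "d' = lin E D.wmon c'" "t' = lin W T.wmon c'"
    using assms by (elim relE)
  show ?thesis
    using relI[OF keys_add_subset[OF c(1) c'(1)]] D.lin_add[OF D.wmon_Pi c(1) c'(1)] T.lin_add[OF T.wmon_Pi c(1) c'(1)]
    by (simp add: c c')
qed

lemma rel_smult:
  assumes "(d, t) \<in> rel"
  shows "(k \<odot>\<^bsub>E\<^esub> d, k \<odot>\<^bsub>W\<^esub> t) \<in> rel"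
proof -
  obtain c where c: "Poly_Mapping.keys c \<subseteq> D.widx" "d = lin E D.wmon c" "t = lin W T.wmon c"
    using assms by (elim relE)
  show ?thesis
    using relI[OF subset_trans[OF keys_map_times c(1)], of k] D.lin_smult[OF D.wmon_Pi c(1)] T.lin_smult[OF T.wmon_Pi c(1)]
    by (simp add: c)
qed

lemma rel_wmon: "am \<in> D.widx \<Longrightarrow> (D.wmon am, T.wmon am) \<in> rel"
  using relI[of "Poly_Mapping.single am 1"] D.lin_single[OF D.wmon_Pi, of am 1] T.lin_single[OF T.wmon_Pi, of am 1]
  by auto

lemma rel_one: "(\<one>\<^bsub>E\<^esub>, \<one>\<^bsub>W\<^esub>) \<in> rel"
  using rel_wmon[of "(0\<^sub>v n, 0\<^sub>v n)"] by (simp add: D.wmon_0 T.wmon_0)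

lemma rel_mult:
  assumes g: "g \<in> carrier E" "h \<in> carrier W"
    and step: "\<And>a m. \<lbrakk>a \<in> carrier_vec n; m \<in> carrier_vec n\<rbrakk> \<Longrightarrow> (g \<otimes>\<^bsub>E\<^esub> D.wmon (a, m), h \<otimes>\<^bsub>W\<^esub> T.wmon (a, m)) \<in> rel"
    and dt: "(d, t) \<in> rel"
  shows "(g \<otimes>\<^bsub>E\<^esub> d, h \<otimes>\<^bsub>W\<^esub> t) \<in> rel"
proof -
  obtain c where c: "Poly_Mapping.keys c \<subseteq> D.widx" "d = lin E D.wmon c" "t = lin W T.wmon c"
    using dt by (elim relE)
  note D = D.lin_single[OF D.wmon_Pi] D.lin_add[OF D.wmon_Pi] D.lin_closed[OF D.wmon_Pi]
  note T = T.lin_single[OF T.wmon_Pi] T.lin_add[OF T.wmon_Pi] T.lin_closed[OF T.wmon_Pi]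
  have "(g \<otimes>\<^bsub>E\<^esub> lin E D.wmon c, h \<otimes>\<^bsub>W\<^esub> lin W T.wmon c) \<in> rel"
    using c(1)
  proof (induction c rule: finsupp_induct)
    case zero
    show ?case using g rel_smult[OF rel_one, of 0] by simp
  next
    case (single am k)
    then obtain a m where "am = (a, m)" "a \<in> carrier_vec n" "m \<in> carrier_vec n" by auto
    with rel_smult[OF step[of a m], of k] show ?case
      using g by (simp add: D(1) T(1))
  next
    case (add p q)
    with rel_add[OF add(3,4)] show ?case
      using g by (simp add: D T D.r_distr T.r_distr)
  qed
  with c show ?thesis by simp
qed

lemma rel_gen:
  assumes "i < n" "(d, t) \<in> rel"
  shows "(X i \<otimes>\<^bsub>E\<^esub> d, x i \<otimes>\<^bsub>W\<^esub> t) \<in> rel" "(Y i \<otimes>\<^bsub>E\<^esub> d, y i \<otimes>\<^bsub>W\<^esub> t) \<in> rel" "(P i \<otimes>\<^bsub>E\<^esub> d, p i \<otimes>\<^bsub>W\<^esub> t) \<in> rel"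
proof -
  show "(X i \<otimes>\<^bsub>E\<^esub> d, x i \<otimes>\<^bsub>W\<^esub> t) \<in> rel"
    by (rule rel_mult[OF _ _ _ assms(2)]) (use assms(1) in \<open>simp_all add: D.x_wmon T.x_wmon rel_wmon\<close>)
  show "(Y i \<otimes>\<^bsub>E\<^esub> d, y i \<otimes>\<^bsub>W\<^esub> t) \<in> rel"
    by (rule rel_mult[OF _ _ _ assms(2)]) (use assms(1) in \<open>simp_all add: D.y_wmon T.y_wmon rel_wmon\<close>)
  show "(P i \<otimes>\<^bsub>E\<^esub> d, p i \<otimes>\<^bsub>W\<^esub> t) \<in> rel"
    by (rule rel_mult[OF _ _ _ assms(2)])
      (use assms(1) in \<open>simp_all add: D.p_wmon T.p_wmon rel_wmon rel_add rel_smult\<close>)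
qed

lemma rel_zero: "(\<zero>\<^bsub>E\<^esub>, t) \<in> rel \<Longrightarrow> t = \<zero>\<^bsub>W\<^esub>"
  by (elim relE) (use indep in force)

lemma rel_unique:
  assumes "(d, t) \<in> rel" "(d, t') \<in> rel"
  shows "t = t'"
proof -
  have "(d \<oplus>\<^bsub>E\<^esub> (-1) \<odot>\<^bsub>E\<^esub> d, t \<oplus>\<^bsub>W\<^esub> (-1) \<odot>\<^bsub>W\<^esub> t') \<in> rel"
    using assms by (intro rel_add rel_smult)
  then have "(\<zero>\<^bsub>E\<^esub>, t \<ominus>\<^bsub>W\<^esub> t') \<in> rel"
    using rel_closed[OF assms(1)] rel_closed[OF assms(2)]
    by (simp add: D.smult_minus_left T.smult_minus_left D.r_neg T.minus_eq)
  from rel_zero[OF this] show ?thesis using rel_closed[OF assms(1)] rel_closed[OF assms(2)] by simp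
qed

abbreviation "gens \<equiv> \<Union>i<n. {X i, Y i, P i}"
abbreviation "E' \<equiv> E\<lparr>carrier := generated_subalg_carrier E gens\<rparr>"

text \<open>Products of two normal monomials are never expanded; left multiplication by a generator
  is the only product compared. The elements \<open>d\<close> with a partner \<open>t\<close> such
  that multiplication by \<open>(d, t)\<close> preserves the graph form a subalgebra containing the
  generators.\<close>

lemma gen_rel:
  assumes "d \<in> generated_subalg_carrier E gens"
  shows "\<exists>t\<in>carrier W. \<forall>d' t'. (d', t') \<in> rel \<longrightarrow> (d \<otimes>\<^bsub>E\<^esub> d', t \<otimes>\<^bsub>W\<^esub> t') \<in> rel"
proof -
  let ?Q = "{d \<in> carrier E. \<exists>t\<in>carrier W. \<forall>d' t'. (d', t') \<in> rel \<longrightarrow> (d \<otimes>\<^bsub>E\<^esub> d', t \<otimes>\<^bsub>W\<^esub> t') \<in> rel}"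
  have "D.subalgebra ?Q"
  proof (rule D.subalgebraI)
    show "\<one>\<^bsub>E\<^esub> \<in> ?Q" using rel_closed by (auto intro!: bexI[of _ "\<one>\<^bsub>W\<^esub>"])
  next
    fix d e assume "d \<in> ?Q" "e \<in> ?Q"
    then obtain t u where t: "d \<in> carrier E" "t \<in> carrier W" "\<And>d' t'. (d', t') \<in> rel \<Longrightarrow> (d \<otimes>\<^bsub>E\<^esub> d', t \<otimes>\<^bsub>W\<^esub> t') \<in> rel"
      and u: "e \<in> carrier E" "u \<in> carrier W" "\<And>d' t'. (d', t') \<in> rel \<Longrightarrow> (e \<otimes>\<^bsub>E\<^esub> d', u \<otimes>\<^bsub>W\<^esub> t') \<in> rel" by blast
    have "(d \<otimes>\<^bsub>E\<^esub> e \<otimes>\<^bsub>E\<^esub> d', t \<otimes>\<^bsub>W\<^esub> u \<otimes>\<^bsub>W\<^esub> t') \<in> rel" if "(d', t') \<in> rel" for d' t'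
      using t(3)[OF u(3)[OF that]] rel_closed[OF that] t u by (simp add: D.m_assoc T.m_assoc)
    with t u show "d \<otimes>\<^bsub>E\<^esub> e \<in> ?Q" by (auto intro!: bexI[of _ "t \<otimes>\<^bsub>W\<^esub> u"])
    have "((d \<oplus>\<^bsub>E\<^esub> e) \<otimes>\<^bsub>E\<^esub> d', (t \<oplus>\<^bsub>W\<^esub> u) \<otimes>\<^bsub>W\<^esub> t') \<in> rel" if "(d', t') \<in> rel" for d' t'
      using rel_add[OF t(3)[OF that] u(3)[OF that]] rel_closed[OF that] t u by (simp add: D.l_distr T.l_distr)
    with t u show "d \<oplus>\<^bsub>E\<^esub> e \<in> ?Q" by (auto intro!: bexI[of _ "t \<oplus>\<^bsub>W\<^esub> u"])
  next
    fix k d assume "d \<in> ?Q"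
    then obtain t where t: "d \<in> carrier E" "t \<in> carrier W" "\<And>d' t'. (d', t') \<in> rel \<Longrightarrow> (d \<otimes>\<^bsub>E\<^esub> d', t \<otimes>\<^bsub>W\<^esub> t') \<in> rel" by blast
    have "(k \<odot>\<^bsub>E\<^esub> d \<otimes>\<^bsub>E\<^esub> d', k \<odot>\<^bsub>W\<^esub> t \<otimes>\<^bsub>W\<^esub> t') \<in> rel" if "(d', t') \<in> rel" for d' t'
      using rel_smult[OF t(3)[OF that], of k] rel_closed[OF that] t by simp
    with t show "k \<odot>\<^bsub>E\<^esub> d \<in> ?Q" by (auto intro!: bexI[of _ "k \<odot>\<^bsub>W\<^esub> t"])
  qed auto
  moreover have "gens \<subseteq> ?Q"
  proof
    fix g assume "g \<in> gens"
    then obtain i where i: "i < n" and "g = X i \<or> g = Y i \<or> g = P i" by auto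
    then consider "g = X i" | "g = Y i" | "g = P i" by blast
    then show "g \<in> ?Q"
      by cases (use i rel_gen[OF i] in \<open>auto intro: bexI[of _ "x i"] bexI[of _ "y i"] bexI[of _ "p i"]\<close>)
  qed
  ultimately show ?thesis using D.generated_least assms by blast
qed

lemma gen_in_rel: "d \<in> generated_subalg_carrier E gens \<Longrightarrow> \<exists>t. (d, t) \<in> rel"
proof -
  assume d: "d \<in> generated_subalg_carrier E gens"
  have "gens \<subseteq> carrier E" by auto
  then have "d \<in> carrier E" using d D.generated_least[OF D.subalgebra_carrier] by blast
  with gen_rel[OF d] rel_one show ?thesis by force
qed

lemma weyl_pair_hom: "\<exists>\<rho>\<in>alg_hom E' W. \<forall>i<n. \<rho> (X i) = x i \<and> \<rho> (Y i) = y i \<and> \<rho> (P i) = p i"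
proof -
  define \<rho> where "\<rho> d = (THE t. (d, t) \<in> rel)" for d
  have \<rho>_eq: "\<rho> d = t" if "(d, t) \<in> rel" for d t
    unfolding \<rho>_def using that rel_unique by blast
  have \<rho>_rel: "(d, \<rho> d) \<in> rel" if "d \<in> generated_subalg_carrier E gens" for d
    using gen_in_rel[OF that] \<rho>_eq by auto
  have g: "gens \<subseteq> carrier E" by auto
  have sub: "d \<in> carrier E" if "d \<in> generated_subalg_carrier E gens" for d
    using rel_closed(1)[OF \<rho>_rel[OF that]] .
  have "\<rho> \<in> alg_hom E' W"
  proof (rule alg_homI; simp)
    fix d e assume de: "d \<in> generated_subalg_carrier E gens" "e \<in> generated_subalg_carrier E gens"
    obtain t where t: "t \<in> carrier W" "\<And>d' t'. (d', t') \<in> rel \<Longrightarrow> (d \<otimes>\<^bsub>E\<^esub> d', t \<otimes>\<^bsub>W\<^esub> t') \<in> rel"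
      using gen_rel[OF de(1)] by auto
    \<comment> \<open>Multiplying \<open>(1, 1)\<close> by \<open>(d, t)\<close> puts
      \<open>(d, t)\<close> itself into the graph. So the partner is the value of
      \<open>\<rho>\<close>, and preservation of the graph becomes multiplicativity.\<close>
    have "\<rho> d = t" using \<rho>_eq t(2)[OF rel_one] t(1) sub[OF de(1)] by simp
    then show "\<rho> (d \<otimes>\<^bsub>E\<^esub> e) = \<rho> d \<otimes>\<^bsub>W\<^esub> \<rho> e" using \<rho>_eq[OF t(2)[OF \<rho>_rel[OF de(2)]]] by simp
    show "\<rho> (d \<oplus>\<^bsub>E\<^esub> e) = \<rho> d \<oplus>\<^bsub>W\<^esub> \<rho> e" using rel_add[OF \<rho>_rel[OF de(1)] \<rho>_rel[OF de(2)]] by (rule \<rho>_eq)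
  next
    fix c d assume d: "d \<in> generated_subalg_carrier E gens"
    show "\<rho> d \<in> carrier W" using rel_closed(2)[OF \<rho>_rel[OF d]] .
    show "\<rho> (c \<odot>\<^bsub>E\<^esub> d) = c \<odot>\<^bsub>W\<^esub> \<rho> d" using rel_smult[OF \<rho>_rel[OF d]] by (rule \<rho>_eq)
  qed (rule \<rho>_eq[OF rel_one])
  moreover have "\<rho> (X i) = x i \<and> \<rho> (Y i) = y i \<and> \<rho> (P i) = p i" if "i < n" for i
    using rel_gen[OF that rel_one] that by (auto intro!: \<rho>_eq)
  ultimately show ?thesis by blast
qed

end

section \<open>Laurent polynomials\<close>

context
  fixes n :: nat
begin

abbreviation "LA \<equiv> laurent_alg n"
abbreviation "EL \<equiv> End_alg (laurent_alg n)"

lemma monoid_vec_simps [simp]: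
  "carrier (monoid_vec TYPE(int) n) = carrier_vec n" "a \<otimes>\<^bsub>monoid_vec TYPE(int) n\<^esub> b = a + b"
  "\<one>\<^bsub>monoid_vec TYPE(int) n\<^esub> = 0\<^sub>v n"
  by (simp_all add: monoid_vec_def)

lemma monoid_monoid_vec: "Group.monoid (monoid_vec TYPE(int) n)"
  by (rule monoidI) auto

lemma calg_laurent: "calg LA"
  unfolding laurent_alg_def by (rule calg_monoid_alg[OF monoid_monoid_vec])

interpretation L: calg LA by (rule calg_laurent)
interpretation EL: calg EL by (rule L.calg_End)

lemma laurent_simps [simp]:
  "carrier LA = {p. Poly_Mapping.keys p \<subseteq> carrier_vec n}" "p \<oplus>\<^bsub>LA\<^esub> q = p + q" "\<zero>\<^bsub>LA\<^esub> = 0"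
  "c \<odot>\<^bsub>LA\<^esub> p = Poly_Mapping.map ((*) c) p"
  "Poly_Mapping.single a c \<otimes>\<^bsub>LA\<^esub> Poly_Mapping.single b d = Poly_Mapping.single (a + b) (c * d)"
  by (simp_all add: laurent_alg_def)

lemma laurent_mult_closed: "a \<in> carrier_vec n \<Longrightarrow> laurent_mult n a \<in> carrier EL"
  unfolding laurent_mult_def
  by (rule L.EndI) (use L.m_closed L.r_distr L.smult_mult_right in \<open>simp_all add: keys_add_subset keys_map_times[THEN subset_trans]\<close>)

lemma laurent_mult_single [simp]:
  "v \<in> carrier_vec n \<Longrightarrow> laurent_mult n a (Poly_Mapping.single v c) = Poly_Mapping.single (a + v) c"
  by (simp add: laurent_mult_def)

lemma laurent_deriv_single [simp]:
  "v \<in> carrier_vec n \<Longrightarrow> laurent_deriv n i (Poly_Mapping.single v c) = Poly_Mapping.single (v - unit_vec n i) (of_int (v $ i) * c)"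
  by (simp add: laurent_deriv_def)

lemma laurent_deriv_closed: "laurent_deriv n i \<in> carrier EL"
proof (rule L.EndI)
  let ?d = "\<lambda>p. \<Sum>a\<in>Poly_Mapping.keys p. Poly_Mapping.single (a - unit_vec n i) (of_int (a $ i) * Poly_Mapping.lookup p a) :: int vec \<Rightarrow>\<^sub>0 complex"
  have d: "laurent_deriv n i p = ?d p" if "p \<in> carrier LA" for p using that by (simp add: laurent_deriv_def)
  have add: "?d (p + q) = ?d p + ?d q" for p q
    by (rule setsum_keys_plus_distrib) (simp_all add: distrib_left single_add)
  show "laurent_deriv n i \<in> extensional (carrier LA)" by (simp add: laurent_deriv_def)
  show "laurent_deriv n i (p \<oplus>\<^bsub>LA\<^esub> q) = laurent_deriv n i p \<oplus>\<^bsub>LA\<^esub> laurent_deriv n i q"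
    if "p \<in> carrier LA" "q \<in> carrier LA" for p q
    using that L.a_closed[OF that] by (simp add: d add)
  show "laurent_deriv n i p \<in> carrier LA" if "p \<in> carrier LA" for p
  proof -
    have "Poly_Mapping.keys p \<subseteq> carrier_vec n" using that by simp
    then have "Poly_Mapping.keys (?d p) \<subseteq> carrier_vec n"
    proof (induction p rule: finsupp_induct)
      case (add p q)
      then show ?case unfolding \<open>\<And>p q. ?d (p + q) = ?d p + ?d q\<close> by (intro keys_add_subset)
    qed auto
    with d[OF that] show ?thesis by simp
  qed
  show "laurent_deriv n i (c \<odot>\<^bsub>LA\<^esub> p) = c \<odot>\<^bsub>LA\<^esub> laurent_deriv n i p" if "p \<in> carrier LA" for c p
  proof -
    have "Poly_Mapping.keys p \<subseteq> carrier_vec n" using that by simp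
    then have "?d (Poly_Mapping.map ((*) c) p) = Poly_Mapping.map ((*) c) (?d p)"
    proof (induction p rule: finsupp_induct)
      case (add p q)
      then show ?case unfolding \<open>\<And>p q. ?d (p + q) = ?d p + ?d q\<close> map_times_add by simp
    qed (simp_all add: mult.left_commute)
    with d[OF that] d[OF L.smult_closed[OF that, of c]] show ?thesis by simp
  qed
qed

text \<open>Operators are determined on monomials, so every operator identity reduces to arithmetic
  of exponent vectors and coefficients.\<close>

lemma EL_eqI:
  assumes "f \<in> carrier EL" "g \<in> carrier EL"
    and "\<And>v. v \<in> carrier_vec n \<Longrightarrow> f (Poly_Mapping.single v 1) = g (Poly_Mapping.single v 1)"
  shows "f = g"
proof (rule L.End_eqI[OF assms(1,2)])
  fix p assume "p \<in> carrier LA"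
  then have "Poly_Mapping.keys p \<subseteq> carrier_vec n" by simp
  then show "f p = g p"
  proof (induction p rule: finsupp_induct)
    case zero
    show ?case using L.EndD(4)[OF assms(1), of 0 0] L.EndD(4)[OF assms(2), of 0 0]
      L.EndD(2)[OF assms(1), of 0] L.EndD(2)[OF assms(2), of 0] L.smult_zero_left[of "f 0"] L.smult_zero_left[of "g 0"] by simp
  next
    case (single v c)
    then have "Poly_Mapping.single v 1 \<in> carrier LA" by simp
    from L.EndD(4)[OF assms(1) this, of c] L.EndD(4)[OF assms(2) this, of c] assms(3)[OF single]
    show ?case by simp
  next
    case (add p q)
    then show ?case using L.EndD(3)[OF assms(1), of p q] L.EndD(3)[OF assms(2), of p q] by simp
  qed
qed

lemma weyl_rep_End:
  "weyl_rep EL n (\<lambda>i. laurent_mult n (unit_vec n i)) (\<lambda>i. laurent_mult n (- unit_vec n i)) (laurent_deriv n)"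
proof -
  note [simp] = laurent_mult_closed laurent_deriv_closed L.End_closed compose_eq
  have k: "Poly_Mapping.keys (Poly_Mapping.single v c) \<subseteq> carrier_vec n" if "v \<in> carrier_vec n" for v :: "int vec" and c :: complex
    using that by auto
  show ?thesis
  proof (intro weyl_rep.intro weyl_rep_axioms.intro EL.calg_axioms)
    fix i j assume ij: "i < n" "j < n"
    note closed = EL.m_closed EL.a_closed EL.one_closed EL.zero_closed laurent_mult_closed laurent_deriv_closed
      unit_vec_carrier uminus_carrier_vec[THEN iffD2]
    show "laurent_mult n (unit_vec n i) \<otimes>\<^bsub>EL\<^esub> laurent_mult n (unit_vec n j) = laurent_mult n (unit_vec n j) \<otimes>\<^bsub>EL\<^esub> laurent_mult n (unit_vec n i)"
      by (rule EL_eqI; (intro closed)?) (auto simp: k intro!: arg_cong2[where f = Poly_Mapping.single] eq_vecI)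
    show "laurent_deriv n i \<otimes>\<^bsub>EL\<^esub> laurent_deriv n j = laurent_deriv n j \<otimes>\<^bsub>EL\<^esub> laurent_deriv n i"
      by (rule EL_eqI; (intro closed)?) (use ij in \<open>auto simp: k intro!: arg_cong2[where f = Poly_Mapping.single] eq_vecI\<close>)
    show "laurent_deriv n i \<otimes>\<^bsub>EL\<^esub> laurent_mult n (unit_vec n j) =
      laurent_mult n (unit_vec n j) \<otimes>\<^bsub>EL\<^esub> laurent_deriv n i \<oplus>\<^bsub>EL\<^esub> (if i = j then \<one>\<^bsub>EL\<^esub> else \<zero>\<^bsub>EL\<^esub>)"
    proof (rule EL_eqI)
      fix v :: "int vec" assume v: "v \<in> carrier_vec n"
      have e: "unit_vec n j + v - unit_vec n i = unit_vec n j + (v - unit_vec n i)"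
        "unit_vec n i + (v - unit_vec n i) = v" "unit_vec n j + (v - unit_vec n j) = v"
        using v by (auto intro!: eq_vecI)
      show "(laurent_deriv n i \<otimes>\<^bsub>EL\<^esub> laurent_mult n (unit_vec n j)) (Poly_Mapping.single v 1) =
        (laurent_mult n (unit_vec n j) \<otimes>\<^bsub>EL\<^esub> laurent_deriv n i \<oplus>\<^bsub>EL\<^esub> (if i = j then \<one>\<^bsub>EL\<^esub> else \<zero>\<^bsub>EL\<^esub>)) (Poly_Mapping.single v 1)"
        using v ij k[OF v, of 1] by (simp add: e add.commute flip: single_add)
    next
      have "(if i = j then \<one>\<^bsub>EL\<^esub> else \<zero>\<^bsub>EL\<^esub>) \<in> carrier EL"
        using EL.one_closed EL.zero_closed by presburger
      then show "laurent_mult n (unit_vec n j) \<otimes>\<^bsub>EL\<^esub> laurent_deriv n i \<oplus>\<^bsub>EL\<^esub> (if i = j then \<one>\<^bsub>EL\<^esub> else \<zero>\<^bsub>EL\<^esub>) \<in> carrier EL"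
        by (intro closed)
    qed (intro closed)
  next
    fix i assume i: "i < n"
    note closed = EL.m_closed EL.one_closed laurent_mult_closed laurent_deriv_closed
      unit_vec_carrier uminus_carrier_vec[THEN iffD2]
    show "laurent_mult n (unit_vec n i) \<otimes>\<^bsub>EL\<^esub> laurent_mult n (- unit_vec n i) = \<one>\<^bsub>EL\<^esub>"
      by (rule EL_eqI; (intro closed)?) (auto simp: k intro!: arg_cong2[where f = Poly_Mapping.single] eq_vecI)
    show "laurent_mult n (- unit_vec n i) \<otimes>\<^bsub>EL\<^esub> laurent_mult n (unit_vec n i) = \<one>\<^bsub>EL\<^esub>"
      by (rule EL_eqI; (intro closed)?) (auto simp: k intro!: arg_cong2[where f = Poly_Mapping.single] eq_vecI)
  qed auto
qed

interpretation E: weyl_rep EL n "\<lambda>i. laurent_mult n (unit_vec n i)" "\<lambda>i. laurent_mult n (- unit_vec n i)" "laurent_deriv n"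
  by (rule weyl_rep_End)

lemma xpow_apply:
  assumes "i < n" "v \<in> carrier_vec n"
  shows "E.xpow i a (Poly_Mapping.single v c) = Poly_Mapping.single (vec n (\<lambda>j. v $ j + (if j = i then a else 0))) c"
proof (induction a rule: int_induct[where k = 0])
  case base
  have "vec n (\<lambda>j. v $ j + (if j = i then 0 else 0)) = v" using assms by (auto intro!: eq_vecI)
  then show ?case using assms(2) E.xpow_0 by simp
next
  case (step1 a)
  have "E.xpow i (a + 1) (Poly_Mapping.single v c) = laurent_mult n (unit_vec n i) (E.xpow i a (Poly_Mapping.single v c))"
    using assms by (subst E.x_xpow[symmetric]) (auto simp: compose_eq)
  also have "\<dots> = Poly_Mapping.single (vec n (\<lambda>j. v $ j + (if j = i then a + 1 else 0))) c"
    unfolding step1.IH using assms by (auto intro!: arg_cong2[where f = Poly_Mapping.single] eq_vecI)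
  finally show ?case .
next
  case (step2 a)
  have "E.xpow i (a - 1) (Poly_Mapping.single v c) = laurent_mult n (- unit_vec n i) (E.xpow i a (Poly_Mapping.single v c))"
    using assms by (subst E.y_xpow[symmetric]) (auto simp: compose_eq)
  also have "\<dots> = Poly_Mapping.single (vec n (\<lambda>j. v $ j + (if j = i then a - 1 else 0))) c"
    unfolding step2.IH using assms by (auto intro!: arg_cong2[where f = Poly_Mapping.single] eq_vecI)
  finally show ?case .
qed

text \<open>The falling factorial z (z - 1) ... (z - r + 1), by which the \<open>r\<close>-th
  derivative acts on the \<open>z\<close>-th power. For integral \<open>z\<close> it vanishes
  exactly when 0 \<le> z < r.\<close>

definition ffact :: "int \<Rightarrow> nat \<Rightarrow> complex" where
  "ffact z r = (\<Prod>j<r. of_int (z - int j))"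

lemma deriv_pow_apply:
  assumes "i < n" "v \<in> carrier_vec n"
  shows "(laurent_deriv n i [^]\<^bsub>EL\<^esub> r) (Poly_Mapping.single v c) =
    Poly_Mapping.single (vec n (\<lambda>j. v $ j - (if j = i then int r else 0))) (ffact (v $ i) r * c)"
proof (induction r)
  case 0
  have "vec n (\<lambda>j. v $ j - (if j = i then int 0 else 0)) = v" using assms by (auto intro!: eq_vecI)
  then show ?case using assms(2) by (simp add: ffact_def)
next
  case (Suc r)
  have "(laurent_deriv n i [^]\<^bsub>EL\<^esub> Suc r) (Poly_Mapping.single v c) =
      laurent_deriv n i ((laurent_deriv n i [^]\<^bsub>EL\<^esub> r) (Poly_Mapping.single v c))"
    using assms(2) EL.nat_pow_Suc2[OF laurent_deriv_closed, of i r] by (simp add: compose_eq del: EL.nat_pow_Suc)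
  also have "\<dots> = Poly_Mapping.single (vec n (\<lambda>j. v $ j - (if j = i then int (Suc r) else 0))) (ffact (v $ i) (Suc r) * c)"
    unfolding Suc.IH using assms
    by (auto simp: ffact_def intro!: arg_cong2[where f = Poly_Mapping.single] eq_vecI)
  finally show ?case .
qed

lemma xs_apply:
  assumes "v \<in> carrier_vec n" "distinct l" "set l \<subseteq> {..<n}"
  shows "EL.lprod (\<lambda>i. E.xpow i (a $ i)) l (Poly_Mapping.single v c) =
    Poly_Mapping.single (vec n (\<lambda>j. v $ j + (if j \<in> set l then a $ j else 0))) c"
  using assms(2,3)
proof (induction l)
  case Nil
  have "vec n (\<lambda>j. v $ j + 0) = v" using assms by (auto intro!: eq_vecI)
  then show ?case using assms(1) by simp
next
  case (Cons i l)
  have "EL.lprod (\<lambda>i. E.xpow i (a $ i)) (i # l) (Poly_Mapping.single v c) =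
      E.xpow i (a $ i) (EL.lprod (\<lambda>i. E.xpow i (a $ i)) l (Poly_Mapping.single v c))"
    using assms(1) by (simp add: compose_eq)
  also have "\<dots> = Poly_Mapping.single (vec n (\<lambda>j. v $ j + (if j \<in> set (i # l) then a $ j else 0))) c"
    using Cons by (auto simp: xpow_apply intro!: arg_cong2[where f = Poly_Mapping.single] eq_vecI)
  finally show ?case .
qed

lemma ps_apply:
  assumes "v \<in> carrier_vec n" "distinct l" "set l \<subseteq> {..<n}"
  shows "EL.lprod (\<lambda>i. laurent_deriv n i [^]\<^bsub>EL\<^esub> (m $ i :: nat)) l (Poly_Mapping.single v c) =
    Poly_Mapping.single (vec n (\<lambda>j. v $ j - (if j \<in> set l then int (m $ j) else 0))) ((\<Prod>j\<in>set l. ffact (v $ j) (m $ j)) * c)"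
  using assms(2,3)
proof (induction l)
  case Nil
  have "vec n (\<lambda>j. v $ j - 0) = v" using assms by (auto intro!: eq_vecI)
  then show ?case using assms(1) by simp
next
  case (Cons i l)
  have "EL.lprod (\<lambda>i. laurent_deriv n i [^]\<^bsub>EL\<^esub> (m $ i)) (i # l) (Poly_Mapping.single v c) =
      (laurent_deriv n i [^]\<^bsub>EL\<^esub> (m $ i)) (EL.lprod (\<lambda>i. laurent_deriv n i [^]\<^bsub>EL\<^esub> (m $ i)) l (Poly_Mapping.single v c))"
    using assms(1) by (simp add: compose_eq)
  also have "\<dots> = Poly_Mapping.single (vec n (\<lambda>j. v $ j - (if j \<in> set (i # l) then int (m $ j) else 0)))
      ((\<Prod>j\<in>set (i # l). ffact (v $ j) (m $ j)) * c)"
    using Cons by (auto simp: deriv_pow_apply mult.assoc intro!: arg_cong2[where f = Poly_Mapping.single] eq_vecI)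
  finally show ?case .
qed

lemma wmon_apply:
  assumes "v \<in> carrier_vec n"
  shows "E.wmon (a, m) (Poly_Mapping.single v c) =
    Poly_Mapping.single (vec n (\<lambda>j. v $ j - int (m $ j) + a $ j)) ((\<Prod>j<n. ffact (v $ j) (m $ j)) * c)"
proof -
  have "E.wmon (a, m) (Poly_Mapping.single v c) = EL.lprod (\<lambda>i. E.xpow i (a $ i)) [0..<n]
      (EL.lprod (\<lambda>i. laurent_deriv n i [^]\<^bsub>EL\<^esub> (m $ i)) [0..<n] (Poly_Mapping.single v c))"
    using assms by (simp add: E.wmon_def compose_eq)
  also have "\<dots> = Poly_Mapping.single (vec n (\<lambda>j. v $ j - int (m $ j) + a $ j)) ((\<Prod>j<n. ffact (v $ j) (m $ j)) * c)"
    using ps_apply[OF assms, of "[0..<n]" m c] xs_apply[of "vec n (\<lambda>j. v $ j - (if j < n then int (m $ j) else 0))" "[0..<n]" a]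
    by (auto simp: atLeast0LessThan intro!: arg_cong2[where f = Poly_Mapping.single] eq_vecI)
  finally show ?thesis .
qed

lemma lookup_lin_laurent:
  assumes g: "g \<in> S \<rightarrow> carrier LA" and "Poly_Mapping.keys c \<subseteq> S"
  shows "Poly_Mapping.lookup (lin LA g c) v = (\<Sum>k\<in>Poly_Mapping.keys c. Poly_Mapping.lookup c k * Poly_Mapping.lookup (g k) v)"
  using assms(2)
proof (induction c rule: finsupp_induct)
  case (add p q)
  then show ?case
    using setsum_keys_plus_distrib[of "\<lambda>k z. z * Poly_Mapping.lookup (g k) v" p q]
    by (simp add: L.lin_add[OF g] lookup_add distrib_right)
qed (simp_all add: L.lin_single[OF g])

text \<open>A vanishing combination is applied to the monomial with exponent \<open>m\<close>, where
  \<open>(a, m)\<close> is a term of least total order of differentiation, and the coefficient at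
  \<open>a\<close> is read off. Derivatives of another multi-order kill this monomial; those of
  order \<open>m\<close> turn it into a nonzero multiple of the monomial with exponent
  \<open>b\<close>, and \<open>b\<close> differs from \<open>a\<close> for the other terms.\<close>

lemma wmon_indep:
  assumes c: "Poly_Mapping.keys c \<subseteq> E.widx" and zero: "lin EL E.wmon c = \<zero>\<^bsub>EL\<^esub>"
  shows "c = 0"
proof (rule ccontr)
  assume "c \<noteq> 0"
  then have ne: "Poly_Mapping.keys c \<noteq> {}" by simp
  define deg where "deg = (\<lambda>(a :: int vec, m :: nat vec). \<Sum>j<n. m $ j)"
  obtain am where am: "am \<in> Poly_Mapping.keys c" "\<And>k. k \<in> Poly_Mapping.keys c \<Longrightarrow> deg am \<le> deg k"
    using ex_min_if_finite[of "deg ` Poly_Mapping.keys c"] ne by (metis (no_types, lifting) arg_min_if_finite(1) arg_min_least finite_keys)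
  obtain a m where am_eq: "am = (a, m)" by (cases am)
  have a: "a \<in> carrier_vec n" "m \<in> carrier_vec n" using am(1) c by (auto simp: am_eq)
  define v where "v = vec n (\<lambda>j. int (m $ j))"
  have v: "v \<in> carrier_vec n" by (simp add: v_def)
  have vL: "Poly_Mapping.single v 1 \<in> carrier LA" using v by simp
  let ?g = "\<lambda>k. E.wmon k (Poly_Mapping.single v 1)"
  have g: "?g \<in> E.widx \<rightarrow> carrier LA"
    using L.EndD(2)[OF E.wmon_closed vL] by blast
  have "lin LA ?g c = lin EL E.wmon c (Poly_Mapping.single v 1)"
    using L.lin_apply[OF E.wmon_Pi c vL] by simp
  also have "\<dots> = 0" unfolding zero using vL by simp
  finally have "(\<Sum>k\<in>Poly_Mapping.keys c. Poly_Mapping.lookup c k * Poly_Mapping.lookup (?g k) a) = 0"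
    using lookup_lin_laurent[OF g c, of a] by simp
  moreover have "Poly_Mapping.lookup (?g k) a = 0" if k: "k \<in> Poly_Mapping.keys c" "k \<noteq> am" for k
  proof -
    obtain b r where k_eq: "k = (b, r)" by (cases k)
    have b: "b \<in> carrier_vec n" "r \<in> carrier_vec n" using k c by (auto simp: k_eq)
    show ?thesis
    proof (cases "r = m")
      case True
      have "vec n (\<lambda>j. v $ j - int (r $ j) + b $ j) = b"
        using b True by (auto simp: v_def intro!: eq_vecI)
      then show ?thesis
        using k True v by (simp add: k_eq am_eq wmon_apply lookup_single_not_eq)
    next
      case False
      \<comment> \<open>Otherwise \<open>r\<close> lies below \<open>m\<close> in each coordinate
        without being equal to it, against the minimality of the total order of
        \<open>m\<close>.\<close>
      have "\<exists>j<n. m $ j < r $ j"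
      proof (rule ccontr)
        assume "\<not> (\<exists>j<n. m $ j < r $ j)"
        then have le: "r $ j \<le> m $ j" if "j < n" for j using that by (meson not_less)
        obtain j where j: "j < n" "r $ j \<noteq> m $ j" using False a(2) b(2) by (metis carrier_vecD eq_vecI)
        have "(\<Sum>j<n. r $ j) < (\<Sum>j<n. m $ j)"
          using le j(1) le_neq_implies_less[OF le[OF j(1)] j(2)]
          by (intro sum_strict_mono_ex1) (auto intro!: bexI[of _ j])
        with am(2)[OF k(1)] show False by (simp add: deg_def k_eq am_eq)
      qed
      then obtain j where j: "j < n" "m $ j < r $ j" by blast
      \<comment> \<open>The factor with index \<open>m $ j\<close> is \<open>m $ j - m $ j\<close>;
        it occurs because \<open>m $ j < r $ j\<close>.\<close>
      have "ffact (v $ j) (r $ j) = 0"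
        using j unfolding ffact_def by (auto simp: v_def intro!: bexI[of _ "m $ j"])
      then have "(\<Prod>j<n. ffact (v $ j) (r $ j)) = 0" using j(1) by auto
      then show ?thesis using v by (simp add: k_eq wmon_apply del: prod_zero_iff)
    qed
  qed
  ultimately have "Poly_Mapping.lookup c am * Poly_Mapping.lookup (?g am) a = 0"
    using am(1) by (subst (asm) sum.remove[of _ am]) auto
  moreover have "Poly_Mapping.lookup c am \<noteq> 0" using am(1) by (simp add: in_keys_iff)
  moreover have "Poly_Mapping.lookup (?g am) a \<noteq> 0"
  proof -
    have "vec n (\<lambda>j. v $ j - int (m $ j) + a $ j) = a"
      using a by (auto simp: v_def intro!: eq_vecI)
    then show ?thesis using v by (simp add: am_eq wmon_apply ffact_def v_def)
  qed
  ultimately show False by simp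
qed

lemma weyl_alg_eq: "weyl_alg n = EL\<lparr>carrier := generated_subalg_carrier EL
    (\<Union>i<n. {laurent_mult n (unit_vec n i), laurent_mult n (- unit_vec n i), laurent_deriv n i})\<rparr>"
  by (simp add: weyl_alg_def)

lemma weyl_gens_closed: "(\<Union>i<n. {laurent_mult n (unit_vec n i), laurent_mult n (- unit_vec n i), laurent_deriv n i}) \<subseteq> carrier EL"
  by (auto simp del: laurent_simps intro!: laurent_mult_closed laurent_deriv_closed)

lemma calg_weyl: "calg (weyl_alg n)"
  unfolding weyl_alg_eq by (intro EL.calg_subalgebra EL.generated_subalgebra weyl_gens_closed)

text \<open>The universal property of the operator algebra: its generators satisfy no relations
  beyond the consequences of those of \<open>weyl_rep\<close>.\<close>

lemma weyl_lift:
  assumes "weyl_rep W n x y p"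
  shows "\<exists>\<rho>\<in>alg_hom (weyl_alg n) W. \<forall>i<n. \<rho> (laurent_mult n (unit_vec n i)) = x i \<and>
    \<rho> (laurent_mult n (- unit_vec n i)) = y i \<and> \<rho> (laurent_deriv n i) = p i"
proof -
  interpret T: weyl_rep W n x y p by fact
  interpret weyl_pair EL W n "\<lambda>i. laurent_mult n (unit_vec n i)" "\<lambda>i. laurent_mult n (- unit_vec n i)" "laurent_deriv n" x y p
    by unfold_locales (rule wmon_indep)
  show ?thesis unfolding weyl_alg_eq by (rule weyl_pair_hom)
qed

lemma weyl_rep_weyl:
  "weyl_rep (weyl_alg n) n (\<lambda>i. laurent_mult n (unit_vec n i)) (\<lambda>i. laurent_mult n (- unit_vec n i)) (laurent_deriv n)"
proof -
  interpret W: calg "weyl_alg n" by (rule calg_weyl)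
  have g: "laurent_mult n (unit_vec n i) \<in> carrier (weyl_alg n)" "laurent_mult n (- unit_vec n i) \<in> carrier (weyl_alg n)"
    "laurent_deriv n i \<in> carrier (weyl_alg n)" if "i < n" for i
    using EL.generated_subalgebra(2)[OF weyl_gens_closed] that unfolding weyl_alg_eq by auto
  have ops: "mult (weyl_alg n) = mult EL" "add (weyl_alg n) = add EL" "one (weyl_alg n) = one EL" "zero (weyl_alg n) = zero EL"
    by (simp_all add: weyl_alg_def)
  show ?thesis
    by (intro weyl_rep.intro weyl_rep_axioms.intro W.calg_axioms g; (assumption)?; simp only: ops E.x_comm E.p_comm E.x_y E.y_x E.p_x)
qed

lemma weyl_induct:
  assumes "d \<in> carrier (weyl_alg n)" and "calg.subalgebra (weyl_alg n) S"
    and "\<And>i. i < n \<Longrightarrow> laurent_mult n (unit_vec n i) \<in> S" "\<And>i. i < n \<Longrightarrow> laurent_mult n (- unit_vec n i) \<in> S"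
      "\<And>i. i < n \<Longrightarrow> laurent_deriv n i \<in> S"
  shows "d \<in> S"
proof -
  interpret W: calg "weyl_alg n" by (rule calg_weyl)
  have S: "subring S (weyl_alg n)" "\<And>c x. x \<in> S \<Longrightarrow> c \<odot>\<^bsub>weyl_alg n\<^esub> x \<in> S"
    using assms(2) by (auto simp: W.subalgebra_def)
  have D: "carrier (weyl_alg n) \<subseteq> carrier EL"
    unfolding weyl_alg_eq using EL.generated_least[OF EL.subalgebra_carrier weyl_gens_closed] by simp
  have ops: "mult (weyl_alg n) = mult EL" "add (weyl_alg n) = add EL" "one (weyl_alg n) = one EL"
    "smult (weyl_alg n) = smult EL"
    by (simp_all add: weyl_alg_def)
  have "EL.subalgebra S"
    using subringE[OF S(1)] S(2) D unfolding ops by (intro EL.subalgebraI) auto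
  from EL.generated_least[OF this, of "\<Union>i<n. {laurent_mult n (unit_vec n i), laurent_mult n (- unit_vec n i), laurent_deriv n i}"]
  show ?thesis using assms(1,3-5) unfolding weyl_alg_eq by auto
qed

end

section \<open>The Lie algebra \<open>\<s>\<^sub>n\<close>\<close>

lemma s_lie_simps [simp]:
  "carrier (s_lie n) = carrier_mat n n \<times> carrier_vec n"
  "(A, v) \<oplus>\<^bsub>s_lie n\<^esub> (B, w) = (A + B, v + w)"
  "c \<odot>\<^bsub>s_lie n\<^esub> (A, v) = (c \<cdot>\<^sub>m A, c \<cdot>\<^sub>v v)"
  "lie_bracket (s_lie n) (A, v) (B, w) = (A * B - B * A, A *\<^sub>v w - B *\<^sub>v v)"
  by (simp_all add: s_lie_def)

lemma lie_ops_s_lie: "lie_ops (s_lie n)"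
  by unfold_locales (auto intro!: minus_carrier_mat mult_carrier_mat minus_carrier_vec mult_mat_vec_carrier)

lemma s_mat_carrier [simp]: "s_mat n i j \<in> carrier (s_lie n)" and s_vec_carrier [simp]: "s_vec n i \<in> carrier (s_lie n)"
  by (simp_all add: s_mat_def s_vec_def)

lemma s_lie_bracket_linear:
  assumes "x \<in> carrier (s_lie n)" "x' \<in> carrier (s_lie n)" "y \<in> carrier (s_lie n)"
  shows "lie_bracket (s_lie n) (x \<oplus>\<^bsub>s_lie n\<^esub> x') y = lie_bracket (s_lie n) x y \<oplus>\<^bsub>s_lie n\<^esub> lie_bracket (s_lie n) x' y"
    and "lie_bracket (s_lie n) (c \<odot>\<^bsub>s_lie n\<^esub> x) y = c \<odot>\<^bsub>s_lie n\<^esub> lie_bracket (s_lie n) x y"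
    and "lie_bracket (s_lie n) y x = (-1) \<odot>\<^bsub>s_lie n\<^esub> lie_bracket (s_lie n) x y"
proof -
  obtain A v A' v' B w where [simp]: "x = (A, v)" "x' = (A', v')" "y = (B, w)"
    by (cases x, cases x', cases y)
  have c: "A \<in> carrier_mat n n" "A' \<in> carrier_mat n n" "B \<in> carrier_mat n n" "v \<in> carrier_vec n" "v' \<in> carrier_vec n" "w \<in> carrier_vec n"
    using assms by auto
  show "lie_bracket (s_lie n) (x \<oplus>\<^bsub>s_lie n\<^esub> x') y = lie_bracket (s_lie n) x y \<oplus>\<^bsub>s_lie n\<^esub> lie_bracket (s_lie n) x' y"
    using c by (auto simp: add_mult_distrib_mat[of _ n n] mult_add_distrib_mat[of _ n n] add_mult_distrib_mat_vec[of _ n n]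
      mult_add_distrib_mat_vec[of _ n n] intro!: eq_matI eq_vecI)
  show "lie_bracket (s_lie n) (c \<odot>\<^bsub>s_lie n\<^esub> x) y = c \<odot>\<^bsub>s_lie n\<^esub> lie_bracket (s_lie n) x y"
    using c by (auto simp: scalar_prod_def sum_distrib_left right_diff_distrib mult_ac intro!: eq_matI eq_vecI)
  show "lie_bracket (s_lie n) y x = (-1) \<odot>\<^bsub>s_lie n\<^esub> lie_bracket (s_lie n) x y"
    using c by (auto intro!: eq_matI eq_vecI)
qed

text \<open>Closure under linear combinations, the empty one included. \<open>Q\<close> is meant as
  the set of elements with a linear property, to be verified on a spanning family.\<close>

definition lie_closed :: "nat \<Rightarrow> (complex mat \<times> complex vec) set \<Rightarrow> bool" where
  "lie_closed n Q \<longleftrightarrow> (\<forall>x\<in>Q. \<forall>y\<in>Q. x \<oplus>\<^bsub>s_lie n\<^esub> y \<in> Q) \<and> (\<forall>c. \<forall>x\<in>Q. c \<odot>\<^bsub>s_lie n\<^esub> x \<in> Q) \<and> (0\<^sub>m n n, 0\<^sub>v n) \<in> Q"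

lemma lie_closedI:
  assumes "\<And>x y. \<lbrakk>x \<in> Q; y \<in> Q\<rbrakk> \<Longrightarrow> x \<oplus>\<^bsub>s_lie n\<^esub> y \<in> Q" "\<And>c x. x \<in> Q \<Longrightarrow> c \<odot>\<^bsub>s_lie n\<^esub> x \<in> Q" "(0\<^sub>m n n, 0\<^sub>v n) \<in> Q"
  shows "lie_closed n Q"
  using assms by (simp add: lie_closed_def)

lemma lie_closed_mats:
  assumes Q: "lie_closed n Q" and m: "\<And>i j. \<lbrakk>i < n; j < n\<rbrakk> \<Longrightarrow> s_mat n i j \<in> Q" and A: "A \<in> carrier_mat n n"
  shows "(A, 0\<^sub>v n) \<in> Q"
proof -
  have *: "(mat n n (\<lambda>ij. if ij \<in> K then A $$ ij else 0), 0\<^sub>v n) \<in> Q" if "finite K" "K \<subseteq> {..<n} \<times> {..<n}" for K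
    using that
  proof (induction K rule: finite_induct)
    case empty
    have "mat n n (\<lambda>ij. 0 :: complex) = 0\<^sub>m n n" by (auto intro!: eq_matI)
    then show ?case using Q by (simp add: lie_closed_def)
  next
    case (insert ij K)
    obtain i j where [simp]: "ij = (i, j)" by (cases ij)
    have "(A $$ (i, j)) \<odot>\<^bsub>s_lie n\<^esub> s_mat n i j \<oplus>\<^bsub>s_lie n\<^esub> (mat n n (\<lambda>ij. if ij \<in> K then A $$ ij else 0), 0\<^sub>v n) \<in> Q"
      using Q insert m unfolding lie_closed_def by auto
    also have "(A $$ (i, j)) \<odot>\<^bsub>s_lie n\<^esub> s_mat n i j \<oplus>\<^bsub>s_lie n\<^esub> (mat n n (\<lambda>ij. if ij \<in> K then A $$ ij else 0), 0\<^sub>v n)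
      = (mat n n (\<lambda>ij. if ij \<in> insert (i, j) K then A $$ ij else 0), 0\<^sub>v n)"
      using insert by (auto simp: s_mat_def intro!: eq_matI eq_vecI)
    finally show ?case by simp
  qed
  have "mat n n (\<lambda>ij. if ij \<in> {..<n} \<times> {..<n} then A $$ ij else 0) = A"
    using A by (auto intro!: eq_matI)
  with *[of "{..<n} \<times> {..<n}"] show ?thesis by simp
qed

lemma lie_closed_all:
  assumes Q: "lie_closed n Q" and m: "\<And>i j. \<lbrakk>i < n; j < n\<rbrakk> \<Longrightarrow> s_mat n i j \<in> Q"
    and v: "\<And>i. i < n \<Longrightarrow> s_vec n i \<in> Q" and x: "x \<in> carrier (s_lie n)"
  shows "x \<in> Q"
proof -
  obtain A w where [simp]: "x = (A, w)" by (cases x)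
  have A: "A \<in> carrier_mat n n" "w \<in> carrier_vec n" using x by auto
  have *: "(0\<^sub>m n n, vec n (\<lambda>i. if i \<in> K then w $ i else 0)) \<in> Q" if "finite K" "K \<subseteq> {..<n}" for K
    using that
  proof (induction K rule: finite_induct)
    case empty
    have "vec n (\<lambda>i. 0 :: complex) = 0\<^sub>v n" by (auto intro!: eq_vecI)
    then show ?case using Q by (simp add: lie_closed_def)
  next
    case (insert i K)
    have "(w $ i) \<odot>\<^bsub>s_lie n\<^esub> s_vec n i \<oplus>\<^bsub>s_lie n\<^esub> (0\<^sub>m n n, vec n (\<lambda>i. if i \<in> K then w $ i else 0)) \<in> Q"
      using Q insert v unfolding lie_closed_def by auto
    also have "(w $ i) \<odot>\<^bsub>s_lie n\<^esub> s_vec n i \<oplus>\<^bsub>s_lie n\<^esub> (0\<^sub>m n n, vec n (\<lambda>i. if i \<in> K then w $ i else 0))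
      = (0\<^sub>m n n, vec n (\<lambda>j. if j \<in> insert i K then w $ j else 0))"
      using insert by (auto simp: s_vec_def intro!: eq_matI eq_vecI)
    finally show ?case .
  qed
  have "vec n (\<lambda>i. if i \<in> {..<n} then w $ i else 0) = w"
    using A by (auto intro!: eq_vecI)
  with *[of "{..<n}"] have "(0\<^sub>m n n, w) \<in> Q" by simp
  with lie_closed_mats[OF Q m A(1)] have "(A, 0\<^sub>v n) \<oplus>\<^bsub>s_lie n\<^esub> (0\<^sub>m n n, w) \<in> Q"
    using Q unfolding lie_closed_def by blast
  with A show ?thesis by simp
qed

text \<open>For fixed \<open>y\<close> the condition is linear in \<open>x\<close>, and antisymmetry
  of the bracket makes it symmetric in \<open>x\<close> and \<open>y\<close>. So it extends from
  \<open>B\<close> in one argument and then in the other.\<close>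

lemma bracket_from_spanning:
  assumes W: "calg W" and \<phi>: "\<And>x. x \<in> carrier (s_lie n) \<Longrightarrow> \<phi> x \<in> carrier W"
    and add: "\<And>x y. \<lbrakk>x \<in> carrier (s_lie n); y \<in> carrier (s_lie n)\<rbrakk> \<Longrightarrow> \<phi> (x \<oplus>\<^bsub>s_lie n\<^esub> y) = \<phi> x \<oplus>\<^bsub>W\<^esub> \<phi> y"
    and smult: "\<And>c x. x \<in> carrier (s_lie n) \<Longrightarrow> \<phi> (c \<odot>\<^bsub>s_lie n\<^esub> x) = c \<odot>\<^bsub>W\<^esub> \<phi> x"
    and B: "B \<subseteq> carrier (s_lie n)" and span: "\<And>Q. \<lbrakk>lie_closed n Q; B \<subseteq> Q\<rbrakk> \<Longrightarrow> carrier (s_lie n) \<subseteq> Q"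
    and bracket: "\<And>x y. \<lbrakk>x \<in> B; y \<in> B\<rbrakk> \<Longrightarrow> \<phi> x \<otimes>\<^bsub>W\<^esub> \<phi> y = \<phi> y \<otimes>\<^bsub>W\<^esub> \<phi> x \<oplus>\<^bsub>W\<^esub> \<phi> (lie_bracket (s_lie n) x y)"
    and xy: "x \<in> carrier (s_lie n)" "y \<in> carrier (s_lie n)"
  shows "\<phi> x \<otimes>\<^bsub>W\<^esub> \<phi> y = \<phi> y \<otimes>\<^bsub>W\<^esub> \<phi> x \<oplus>\<^bsub>W\<^esub> \<phi> (lie_bracket (s_lie n) x y)"
proof -
  interpret W: calg W by fact
  interpret L: lie_ops "s_lie n" by (rule lie_ops_s_lie)
  let ?R = "\<lambda>x y. \<phi> x \<otimes>\<^bsub>W\<^esub> \<phi> y = \<phi> y \<otimes>\<^bsub>W\<^esub> \<phi> x \<oplus>\<^bsub>W\<^esub> \<phi> (lie_bracket (s_lie n) x y)"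
  have zero: "(0\<^sub>m n n, 0\<^sub>v n) \<in> carrier (s_lie n)" by simp
  have sym: "?R y x" if "?R x y" "x \<in> carrier (s_lie n)" "y \<in> carrier (s_lie n)" for x y
  proof -
    have "\<phi> y \<otimes>\<^bsub>W\<^esub> \<phi> x = \<phi> x \<otimes>\<^bsub>W\<^esub> \<phi> y \<ominus>\<^bsub>W\<^esub> \<phi> (lie_bracket (s_lie n) x y)"
      using that \<phi> L.bracket_closed by (simp add: W.minus_eq W.a_assoc W.r_neg)
    then show ?thesis
      using that \<phi> L.bracket_closed smult s_lie_bracket_linear(3)[of x n x y]
      by (simp add: W.minus_eq W.smult_minus_left)
  qed
  have closed: "lie_closed n {x \<in> carrier (s_lie n). ?R x y}" if y: "y \<in> carrier (s_lie n)" for y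
  proof (rule lie_closedI)
    fix x x' assume "x \<in> {x \<in> carrier (s_lie n). ?R x y}" "x' \<in> {x \<in> carrier (s_lie n). ?R x y}"
    then have x: "x \<in> carrier (s_lie n)" "?R x y" "x' \<in> carrier (s_lie n)" "?R x' y" by blast+
    have c: "lie_bracket (s_lie n) x y \<in> carrier (s_lie n)" "lie_bracket (s_lie n) x' y \<in> carrier (s_lie n)"
      using L.bracket_closed x y by blast+
    have "?R (x \<oplus>\<^bsub>s_lie n\<^esub> x') y"
      unfolding s_lie_bracket_linear(1)[OF x(1,3) y] add[OF x(1,3)] add[OF c]
      using \<phi> x y c by (simp add: W.l_distr W.r_distr W.a_ac)
    then show "x \<oplus>\<^bsub>s_lie n\<^esub> x' \<in> {x \<in> carrier (s_lie n). ?R x y}"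
      using L.add_closed x by blast
  next
    fix c x assume "x \<in> {x \<in> carrier (s_lie n). ?R x y}"
    then have x: "x \<in> carrier (s_lie n)" "?R x y" by blast+
    have b: "lie_bracket (s_lie n) x y \<in> carrier (s_lie n)" using L.bracket_closed x y by blast
    have "?R (c \<odot>\<^bsub>s_lie n\<^esub> x) y"
      unfolding s_lie_bracket_linear(2)[OF x(1) x(1) y] smult[OF x(1)] smult[OF b]
      using \<phi> x y b by (simp add: W.smult_r_distr)
    then show "c \<odot>\<^bsub>s_lie n\<^esub> x \<in> {x \<in> carrier (s_lie n). ?R x y}"
      using L.smult_closed x by blast
  next
    have "?R (0 \<odot>\<^bsub>s_lie n\<^esub> (0\<^sub>m n n, 0\<^sub>v n)) y"
      unfolding s_lie_bracket_linear(2)[OF zero zero y] smult[OF zero] smult[OF L.bracket_closed[OF zero y]]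
      using \<phi>[OF zero] \<phi>[OF y] \<phi>[OF L.bracket_closed[OF zero y]] by simp
    moreover have "0 \<odot>\<^bsub>s_lie n\<^esub> (0\<^sub>m n n, 0\<^sub>v n) = (0\<^sub>m n n, 0\<^sub>v n :: complex vec)" by (auto intro!: eq_matI eq_vecI)
    ultimately show "(0\<^sub>m n n, 0\<^sub>v n) \<in> {x \<in> carrier (s_lie n). ?R x y}" using zero by simp
  qed
  have "?R y b" if "b \<in> B" "y \<in> carrier (s_lie n)" for b y
    using span[OF closed[of b]] bracket B that by blast
  then have "?R b y" if "b \<in> B" "y \<in> carrier (s_lie n)" for b y
    using sym that B by blast
  then show ?thesis
    using span[OF closed[OF xy(2)]] xy B by blast
qed

subsection \<open>Rank one elements\<close>

text \<open>A pair \<open>(P, v)\<close> in s_z is read as a linear map from C^z + C to C^z. These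
  are the maps of rank at most one: \<open>u\<close> spans the image, and \<open>r\<close> with
  \<open>s\<close> is the linear form.\<close>

definition rank1 :: "nat \<Rightarrow> (nat \<Rightarrow> complex) \<Rightarrow> (nat \<Rightarrow> complex) \<Rightarrow> complex \<Rightarrow> complex mat \<times> complex vec" where
  "rank1 z u r s = (mat z z (\<lambda>(a, b). u a * r b), vec z (\<lambda>a. u a * s))"

lemma rank1_carrier [simp]: "rank1 z u r s \<in> carrier (s_lie z)"
  by (simp add: rank1_def)

text \<open>The composite of two rank one maps is again of rank one, scaled by the pairing of a form
  with a vector. The part \<open>s\<close> is not paired because images lie in C^z.\<close>

lemma rank1_bracket:
  "lie_bracket (s_lie z) (rank1 z u r s) (rank1 z u' r' s') =
    (\<Sum>b<z. r b * u' b) \<odot>\<^bsub>s_lie z\<^esub> rank1 z u r' s' \<oplus>\<^bsub>s_lie z\<^esub> (- (\<Sum>b<z. r' b * u b)) \<odot>\<^bsub>s_lie z\<^esub> rank1 z u' r s"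
  by (auto simp: rank1_def scalar_prod_def sum_distrib_left sum_distrib_right mult_ac sum_negf atLeast0LessThan
      intro!: eq_matI eq_vecI)

abbreviation \<delta> :: "nat \<Rightarrow> nat \<Rightarrow> complex" where
  "\<delta> i j \<equiv> (if i = j then 1 else 0)"

text \<open>
  The matrices with all column sums zero form a Lie subalgebra of \<open>\<gg>\<ll>\<^sub>n\<close>, \<open>n = z + 1\<close>, isomorphic
  to \<open>\<s>\<^sub>z\<close>; \<open>w i j\<close> corresponds to the difference \<open>e\<^sub>i\<^sub>j - e\<^sub>z\<^sub>j\<close> of matrix units. In particular \<open>w z j = 0\<close>.
\<close>

definition w_elem :: "nat \<Rightarrow> nat \<Rightarrow> nat \<Rightarrow> complex mat \<times> complex vec" where
  "w_elem z i j = rank1 z (\<delta> i) (\<lambda>b. \<delta> b j - \<delta> j z) (\<delta> j z)"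

text \<open>This corresponds to \<open>e_ij - e_jj\<close>, which sends \<open>e_j\<close> to
  \<open>e_i - e_j\<close>. The hyperplane of vectors with coordinate sum zero has the basis
  \<open>e_a - e_z\<close> with a < z, and \<open>e_z\<close> is the vector outside it; the form
  takes the \<open>e_j\<close>-coordinate, which is \<open>\<delta> b j - \<delta> j z\<close> on
  \<open>e_b - e_z\<close> and \<open>\<delta> j z\<close> on \<open>e_z\<close>.\<close>

definition zeta :: "nat \<Rightarrow> nat \<Rightarrow> nat \<Rightarrow> complex mat \<times> complex vec" where
  "zeta z i j = rank1 z (\<lambda>a. \<delta> i a - \<delta> j a) (\<lambda>b. \<delta> b j - \<delta> j z) (\<delta> j z)"

lemma w_carrier [simp]: "w_elem z i j \<in> carrier (s_lie z)" and zeta_carrier [simp]: "zeta z i j \<in> carrier (s_lie z)"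
  by (simp_all only: w_elem_def zeta_def rank1_carrier)

text \<open>For \<open>k = z\<close> all summands vanish, and so does the right-hand side; thus the
  distinguished index requires no case of its own.\<close>

lemma pairing:
  assumes "j \<le> z" "k \<le> z"
  shows "(\<Sum>b<z. (\<delta> b j - \<delta> j z) * \<delta> k b) = \<delta> j k - \<delta> j z"
proof -
  have "(\<Sum>b<z. (\<delta> b j - \<delta> j z) * \<delta> k b) = (\<Sum>b<z. if b = k then \<delta> k j - \<delta> j z else 0)"
    by (intro sum.cong) auto
  then show ?thesis using assms by (auto simp: sum.delta)
qed

lemma w_bracket:
  assumes "i \<le> z" "j \<le> z" "k \<le> z" "l \<le> z"
  shows "lie_bracket (s_lie z) (w_elem z i j) (w_elem z k l) =
    (\<delta> j k - \<delta> j z) \<odot>\<^bsub>s_lie z\<^esub> w_elem z i l \<oplus>\<^bsub>s_lie z\<^esub> (\<delta> l z - \<delta> i l) \<odot>\<^bsub>s_lie z\<^esub> w_elem z k j"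
  unfolding w_elem_def rank1_bracket pairing[OF assms(2,3)] pairing[OF assms(4,1)] by simp

text \<open>The structure constants are those of \<open>\<beta>\<close> below. Hence adding these
  elements to Euler operators produces solutions of the relations of the N_ij.\<close>

lemma zeta_bracket:
  assumes "i \<le> z" "j \<le> z" "k \<le> z" "l \<le> z"
  shows "lie_bracket (s_lie z) (zeta z i j) (zeta z k l) =
    \<delta> j k \<odot>\<^bsub>s_lie z\<^esub> (zeta z i l \<oplus>\<^bsub>s_lie z\<^esub> (-1) \<odot>\<^bsub>s_lie z\<^esub> zeta z k l) \<oplus>\<^bsub>s_lie z\<^esub>
    (\<delta> i l \<odot>\<^bsub>s_lie z\<^esub> (zeta z i j \<oplus>\<^bsub>s_lie z\<^esub> (-1) \<odot>\<^bsub>s_lie z\<^esub> zeta z k j) \<oplus>\<^bsub>s_lie z\<^esub>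
     \<delta> j l \<odot>\<^bsub>s_lie z\<^esub> (zeta z k l \<oplus>\<^bsub>s_lie z\<^esub> (-1) \<odot>\<^bsub>s_lie z\<^esub> zeta z i j))"
proof -
  have p: "(\<Sum>b<z. (\<delta> b j - \<delta> j z) * (\<delta> k b - \<delta> l b)) = \<delta> j k - \<delta> j l" if "j \<le> z" "k \<le> z" "l \<le> z" for j k l
    using pairing[OF that(1,2)] pairing[OF that(1,3)] by (simp add: right_diff_distrib sum_subtractf)
  \<comment> \<open>The identity holds for arbitrary \<open>u\<close>, \<open>r\<close>,
    \<open>s\<close>: only coincidences between the indices matter.\<close>
  have comb: "(\<delta> j k - \<delta> j l) \<odot>\<^bsub>s_lie z\<^esub> rank1 z (\<lambda>a. u i a - u j a) (r l) (s l) \<oplus>\<^bsub>s_lie z\<^esub>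
      (- (\<delta> l i - \<delta> l j)) \<odot>\<^bsub>s_lie z\<^esub> rank1 z (\<lambda>a. u k a - u l a) (r j) (s j) =
    \<delta> j k \<odot>\<^bsub>s_lie z\<^esub> (rank1 z (\<lambda>a. u i a - u l a) (r l) (s l) \<oplus>\<^bsub>s_lie z\<^esub>
      (-1) \<odot>\<^bsub>s_lie z\<^esub> rank1 z (\<lambda>a. u k a - u l a) (r l) (s l)) \<oplus>\<^bsub>s_lie z\<^esub>
    (\<delta> i l \<odot>\<^bsub>s_lie z\<^esub> (rank1 z (\<lambda>a. u i a - u j a) (r j) (s j) \<oplus>\<^bsub>s_lie z\<^esub>
      (-1) \<odot>\<^bsub>s_lie z\<^esub> rank1 z (\<lambda>a. u k a - u j a) (r j) (s j)) \<oplus>\<^bsub>s_lie z\<^esub>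
     \<delta> j l \<odot>\<^bsub>s_lie z\<^esub> (rank1 z (\<lambda>a. u k a - u l a) (r l) (s l) \<oplus>\<^bsub>s_lie z\<^esub>
      (-1) \<odot>\<^bsub>s_lie z\<^esub> rank1 z (\<lambda>a. u i a - u j a) (r j) (s j)))"
    for u r :: "nat \<Rightarrow> nat \<Rightarrow> complex" and s
    by (cases "j = k"; cases "i = l"; cases "j = l") (auto simp: rank1_def algebra_simps intro!: eq_matI eq_vecI)
  show ?thesis
    unfolding zeta_def rank1_bracket p[OF assms(2,3,4)] p[OF assms(4,1,2)]
    by (rule comb[of \<delta> "\<lambda>j b. \<delta> b j - \<delta> j z" "\<lambda>j. \<delta> j z"])
qed

lemma w_span:
  assumes Q: "lie_closed z Q" and w: "\<And>i j. \<lbrakk>i \<le> z; j \<le> z\<rbrakk> \<Longrightarrow> w_elem z i j \<in> Q"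
  shows "carrier (s_lie z) \<subseteq> Q"
proof -
  have m: "s_mat z i j \<in> Q" if "i < z" "j < z" for i j
  proof -
    have "w_elem z i j = s_mat z i j"
      using that by (auto simp: w_elem_def rank1_def s_mat_def intro!: eq_matI eq_vecI)
    then show ?thesis using w[of i j] that by simp
  qed
  have v: "s_vec z i \<in> Q" if "i < z" for i
  proof -
    \<comment> \<open>\<open>w_elem z i z\<close> has the right vector part, but its matrix part is
      -1 all along row \<open>i\<close>; \<open>?A\<close> compensates for this row.\<close>
    let ?A = "mat z z (\<lambda>(a, b). \<delta> i a)"
    have "(?A, 0\<^sub>v z) \<in> Q" by (rule lie_closed_mats[OF Q m]) auto
    then have "w_elem z i z \<oplus>\<^bsub>s_lie z\<^esub> (?A, 0\<^sub>v z) \<in> Q"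
      using Q w[of i z] that unfolding lie_closed_def by simp
    also have "w_elem z i z \<oplus>\<^bsub>s_lie z\<^esub> (?A, 0\<^sub>v z) = s_vec z i"
      using that by (auto simp: w_elem_def rank1_def s_vec_def intro!: eq_matI eq_vecI)
    finally show ?thesis .
  qed
  show ?thesis using lie_closed_all[OF Q m v] by blast
qed

text \<open>In matrix units: \<open>e_ij - e_zj = (e_ij - e_jj) - (e_zj - e_jj)\<close>.\<close>

lemma w_eq_zeta:
  assumes "i \<le> z" "j \<le> z"
  shows "w_elem z i j = zeta z i j \<oplus>\<^bsub>s_lie z\<^esub> (-1) \<odot>\<^bsub>s_lie z\<^esub> zeta z z j"
proof -
  \<comment> \<open>Row indices stay below \<open>z\<close>, so the summand
    \<open>\<delta> z a\<close> is zero.\<close>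
  have zz: "zeta z z j = rank1 z (\<lambda>a. - \<delta> j a) (\<lambda>b. \<delta> b j - \<delta> j z) (\<delta> j z)"
    unfolding zeta_def rank1_def
    by (intro arg_cong2[where f = Pair] eq_matI eq_vecI) simp_all
  have eq: "rank1 z u r s = rank1 z (\<lambda>a. u a - u' a) r s \<oplus>\<^bsub>s_lie z\<^esub> (-1) \<odot>\<^bsub>s_lie z\<^esub> rank1 z (\<lambda>a. - u' a) r s"
    for u u' r s
    by (auto simp: rank1_def algebra_simps intro!: eq_matI eq_vecI)
  show ?thesis
    unfolding zz unfolding w_elem_def zeta_def by (rule eq[of "\<delta> i" "\<lambda>b. \<delta> b j - \<delta> j z" "\<delta> j z" "\<delta> j"])
qed

subsection \<open>Coordinates\<close>

text \<open>\<open>Inl (i, j)\<close> indexes the matrix units and \<open>Inr i\<close> the vectors.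
  Composed with \<open>lin\<close>, the coordinates define a linear map on the Lie algebra by its
  values on the basis.\<close>

definition s_coord :: "nat \<Rightarrow> complex mat \<times> complex vec \<Rightarrow> (nat \<times> nat + nat) \<Rightarrow>\<^sub>0 complex" where
  "s_coord n = (\<lambda>(A, v). (\<Sum>i<n. \<Sum>j<n. Poly_Mapping.single (Inl (i, j)) (A $$ (i, j))) + (\<Sum>i<n. Poly_Mapping.single (Inr i) (v $ i)))"

lemma s_coord_linear:
  assumes "x \<in> carrier (s_lie n)" "y \<in> carrier (s_lie n)"
  shows "s_coord n (x \<oplus>\<^bsub>s_lie n\<^esub> y) = s_coord n x + s_coord n y"
    and "s_coord n (c \<odot>\<^bsub>s_lie n\<^esub> x) = Poly_Mapping.map ((*) c) (s_coord n x)"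
proof -
  obtain A v B w where [simp]: "x = (A, v)" "y = (B, w)" by (cases x, cases y)
  have c: "A \<in> carrier_mat n n" "v \<in> carrier_vec n" "B \<in> carrier_mat n n" "w \<in> carrier_vec n" using assms by auto
  have "(\<Sum>i<n. \<Sum>j<n. Poly_Mapping.single (Inl (i, j) :: nat \<times> nat + nat) ((A + B) $$ (i, j))) =
      (\<Sum>i<n. \<Sum>j<n. Poly_Mapping.single (Inl (i, j) :: nat \<times> nat + nat) (A $$ (i, j))) + (\<Sum>i<n. \<Sum>j<n. Poly_Mapping.single (Inl (i, j) :: nat \<times> nat + nat) (B $$ (i, j)))"
    unfolding sum.distrib[symmetric] using c by (intro sum.cong refl) (simp add: single_add)
  moreover have "(\<Sum>i<n. Poly_Mapping.single (Inr i :: nat \<times> nat + nat) ((v + w) $ i)) = (\<Sum>i<n. Poly_Mapping.single (Inr i :: nat \<times> nat + nat) (v $ i)) + (\<Sum>i<n. Poly_Mapping.single (Inr i :: nat \<times> nat + nat) (w $ i))"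
    unfolding sum.distrib[symmetric] using c by (intro sum.cong refl) (simp add: single_add)
  ultimately show "s_coord n (x \<oplus>\<^bsub>s_lie n\<^esub> y) = s_coord n x + s_coord n y"
    by (simp add: s_coord_def)
  have "(\<Sum>i<n. \<Sum>j<n. Poly_Mapping.single (Inl (i, j) :: nat \<times> nat + nat) ((c \<cdot>\<^sub>m A) $$ (i, j))) =
      Poly_Mapping.map ((*) c) (\<Sum>i<n. \<Sum>j<n. Poly_Mapping.single (Inl (i, j) :: nat \<times> nat + nat) (A $$ (i, j)))"
    unfolding map_times_sum using c by (intro sum.cong refl) simp
  moreover have "(\<Sum>i<n. Poly_Mapping.single (Inr i :: nat \<times> nat + nat) ((c \<cdot>\<^sub>v v) $ i)) = Poly_Mapping.map ((*) c) (\<Sum>i<n. Poly_Mapping.single (Inr i :: nat \<times> nat + nat) (v $ i))"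
    unfolding map_times_sum using c by (intro sum.cong refl) simp
  ultimately show "s_coord n (c \<odot>\<^bsub>s_lie n\<^esub> x) = Poly_Mapping.map ((*) c) (s_coord n x)"
    by (simp add: s_coord_def map_times_add)
qed

lemma sum_single_delta:
  "finite K \<Longrightarrow> k \<in> K \<Longrightarrow> (\<Sum>i\<in>K. Poly_Mapping.single (f i) (if i = k then c else 0)) = Poly_Mapping.single (f k) (c :: complex)"
  by (subst sum.remove[of K k]) (auto intro!: sum.neutral)

lemma s_coord_basis:
  "\<lbrakk>i < n; j < n\<rbrakk> \<Longrightarrow> s_coord n (s_mat n i j) = Poly_Mapping.single (Inl (i, j)) 1"
  "i < n \<Longrightarrow> s_coord n (s_vec n i) = Poly_Mapping.single (Inr i) 1"
proof -
  assume ij: "i < n" "j < n"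
  have "(\<Sum>a<n. \<Sum>b<n. Poly_Mapping.single (Inl (a, b)) (if a = i \<and> b = j then 1 else 0)) =
    (\<Sum>a<n. if a = i then Poly_Mapping.single (Inl (i, j)) (1 :: complex) else 0)"
    using ij sum_single_delta[of "{..<n}" j "\<lambda>b. Inl (i, b)" 1] by (intro sum.cong) auto
  with ij show "s_coord n (s_mat n i j) = Poly_Mapping.single (Inl (i, j)) 1"
    by (simp add: s_coord_def s_mat_def sum.delta)
next
  assume i: "i < n"
  have "(\<Sum>a<n. Poly_Mapping.single (Inr a) (unit_vec n i $ a)) = (\<Sum>a<n. Poly_Mapping.single (Inr a) (if a = i then 1 else (0 :: complex)))"
    by (intro sum.cong) (auto simp: i)
  with i show "s_coord n (s_vec n i) = Poly_Mapping.single (Inr i) 1"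
    using sum_single_delta[of "{..<n}" i Inr 1] by (simp add: s_coord_def s_vec_def)
qed

section \<open>Matrices with vanishing column sums as formal combinations of matrix units\<close>

abbreviation S1 :: "nat \<Rightarrow> nat \<Rightarrow> (nat \<times> nat) \<Rightarrow>\<^sub>0 complex" where
  "S1 i j \<equiv> Poly_Mapping.single (i, j) 1"

text \<open>The inverse of the identification behind \<open>w_elem\<close>: \<open>(P, v)\<close>
  becomes a combination of the differences \<open>e_ab - e_zb\<close>. The coefficient is the
  coordinate along \<open>e_a - e_z\<close> of the image of \<open>e_b\<close>. For b < z it is
  \<open>P $$ (a, b) + v $ a\<close>, as \<open>e_b = (e_b - e_z) + e_z\<close>; for
  \<open>b = z\<close> only \<open>v $ a\<close> remains.\<close>

definition col0 :: "nat \<Rightarrow> complex mat \<times> complex vec \<Rightarrow> (nat \<times> nat) \<Rightarrow>\<^sub>0 complex" where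
  "col0 z = (\<lambda>(P, v). \<Sum>a<z. \<Sum>b<Suc z. Poly_Mapping.map ((*) (if b < z then P $$ (a, b) + v $ a else v $ a)) (S1 a b - S1 z b))"

lemma map_times_distrib: "Poly_Mapping.map ((*) (c + d)) p = Poly_Mapping.map ((*) c) p + Poly_Mapping.map ((*) (d :: complex)) p"
  by (rule poly_mapping_eqI) (simp add: lookup_add distrib_right)

lemma map_times_assoc: "Poly_Mapping.map ((*) c) (Poly_Mapping.map ((*) d) p) = Poly_Mapping.map ((*) (c * d :: complex)) p"
  by (rule poly_mapping_eqI) simp

lemma map_times_one: "Poly_Mapping.map ((*) (1 :: complex)) p = p" and map_times_0: "Poly_Mapping.map ((*) (0 :: complex)) p = 0"
  by (rule poly_mapping_eqI; simp)+

lemma map_times_minus_one: "Poly_Mapping.map ((*) (- 1 :: complex)) p = - p"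
  by (rule poly_mapping_eqI) simp

lemma col0_linear:
  assumes "x \<in> carrier (s_lie z)" "y \<in> carrier (s_lie z)"
  shows "col0 z (x \<oplus>\<^bsub>s_lie z\<^esub> y) = col0 z x + col0 z y"
    and "col0 z (c \<odot>\<^bsub>s_lie z\<^esub> x) = Poly_Mapping.map ((*) c) (col0 z x)"
proof -
  obtain P v R w where [simp]: "x = (P, v)" "y = (R, w)" by (cases x, cases y)
  have c: "P \<in> carrier_mat z z" "v \<in> carrier_vec z" "R \<in> carrier_mat z z" "w \<in> carrier_vec z" using assms by auto
  show "col0 z (x \<oplus>\<^bsub>s_lie z\<^esub> y) = col0 z x + col0 z y"
    using c by (auto simp: col0_def simp flip: sum.distrib map_times_distrib intro!: sum.cong arg_cong2[where f = Poly_Mapping.map] simp del: sum.lessThan_Suc)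
  show "col0 z (c \<odot>\<^bsub>s_lie z\<^esub> x) = Poly_Mapping.map ((*) c) (col0 z x)"
    using c by (auto simp: col0_def map_times_sum map_times_assoc distrib_left intro!: sum.cong arg_cong2[where f = Poly_Mapping.map] simp del: sum.lessThan_Suc)
qed

lemma col0_w:
  assumes "i \<le> z" "j \<le> z"
  shows "col0 z (w_elem z i j) = S1 i j - S1 z j"
proof -
  have "col0 z (w_elem z i j) = (\<Sum>a<z. \<Sum>b<Suc z. if b = j then (if a = i then S1 i j - S1 z j else 0) else 0)"
    unfolding col0_def w_elem_def rank1_def prod.case
  proof (intro sum.cong refl)
    fix a b assume ab: "a \<in> {..<z}" "b \<in> {..<Suc z}"
    have "(if b < z then mat z z (\<lambda>(a, b). \<delta> i a * (\<delta> b j - \<delta> j z)) $$ (a, b) + vec z (\<lambda>a. \<delta> i a * \<delta> j z) $ a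
        else vec z (\<lambda>a. \<delta> i a * \<delta> j z) $ a) = (if b = j then \<delta> i a else 0)"
      using ab assms by auto
    then show "Poly_Mapping.map ((*) (if b < z then mat z z (\<lambda>(a, b). \<delta> i a * (\<delta> b j - \<delta> j z)) $$ (a, b) + vec z (\<lambda>a. \<delta> i a * \<delta> j z) $ a
        else vec z (\<lambda>a. \<delta> i a * \<delta> j z) $ a)) (S1 a b - S1 z b) = (if b = j then (if a = i then S1 i j - S1 z j else 0) else 0)"
      by (simp add: map_times_one map_times_0)
  qed
  also have "\<dots> = (\<Sum>a<z. if a = i then S1 i j - S1 z j else 0)"
    using assms by (simp add: sum.delta del: sum.lessThan_Suc)
  also have "\<dots> = S1 i j - S1 z j" using assms by (auto simp: sum.delta)
  finally show ?thesis .
qed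

section \<open>Two sets of relations\<close>

text \<open>The commutator of N_ij with N_kl, as a formal combination. Each summand is a difference
  of two entries with the same second index, so terms that depend on the column alone cancel in
  it.\<close>

definition \<beta> :: "nat \<Rightarrow> nat \<Rightarrow> nat \<Rightarrow> nat \<Rightarrow> (nat \<times> nat) \<Rightarrow>\<^sub>0 complex" where
  "\<beta> i j k l = (if j = k then S1 i l - S1 k l else 0) + (if i = l then S1 i j - S1 k j else 0)
    + (if j = l then S1 k l - S1 i j else 0)"

text \<open>The commutator of the matrix units e_ij and e_kl.\<close>

definition \<gamma> :: "nat \<Rightarrow> nat \<Rightarrow> nat \<Rightarrow> nat \<Rightarrow> (nat \<times> nat) \<Rightarrow>\<^sub>0 complex" where
  "\<gamma> i j k l = (if j = k then S1 i l else 0) - (if i = l then S1 k j else 0)"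

text \<open>The correction from moving N_ij past \<open>x k\<close> and the inverse of
  \<open>x l\<close>, on which it has weights +1 and -1 when \<open>j\<close> matches, multiplied by
  N_kl.\<close>

definition shift :: "nat \<Rightarrow> nat \<Rightarrow> nat \<Rightarrow> nat \<Rightarrow> (nat \<times> nat) \<Rightarrow>\<^sub>0 complex" where
  "shift i j k l = (if j = k then S1 k l else 0) - (if j = l then S1 k l else 0)"

text \<open>The origin of \<open>\<beta>\<close>: with the units moved to the left in
  \<open>e_ij e_kl\<close> and in \<open>e_kl e_ij\<close>, this is the comparison of what
  remains.\<close>

lemma \<beta>_\<gamma>: "\<beta> i j k l + shift i j k l = shift k l i j + \<gamma> i j k l"
  by (cases "j = k"; cases "i = l"; cases "j = l") (auto simp: \<beta>_def \<gamma>_def shift_def)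

text \<open>The common interface of both sides: N_ij scales \<open>x k\<close> by weight 1 for k = j
  and 0 otherwise, whatever \<open>i\<close> is. Closure is required at all indices, also beyond
  \<open>n\<close>, so that \<open>Nlin\<close> is free of side conditions.\<close>

locale gl_rep = calg W for W :: "(complex, 'a, 'm) module_scheme" (structure) +
  fixes n :: nat and x y :: "nat \<Rightarrow> 'a" and N :: "nat \<Rightarrow> nat \<Rightarrow> 'a"
  assumes x_closed [simp]: "x i \<in> carrier W" and y_closed [simp]: "y i \<in> carrier W"
    and N_closed [simp]: "N i j \<in> carrier W"
    and x_comm: "\<lbrakk>i < n; j < n\<rbrakk> \<Longrightarrow> x i \<otimes> x j = x j \<otimes> x i"
    and x_y: "i < n \<Longrightarrow> x i \<otimes> y i = \<one>" and y_x: "i < n \<Longrightarrow> y i \<otimes> x i = \<one>"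
    and N_x: "\<lbrakk>i < n; j < n; k < n\<rbrakk> \<Longrightarrow> N i j \<otimes> x k = x k \<otimes> N i j \<oplus> (if j = k then x k else \<zero>)"
begin

abbreviation Nlin :: "((nat \<times> nat) \<Rightarrow>\<^sub>0 complex) \<Rightarrow> 'a" where
  "Nlin \<equiv> lin W (\<lambda>(i, j). N i j)"

lemma N_Pi: "(\<lambda>(i, j). N i j) \<in> UNIV \<rightarrow> carrier W" by auto

lemma Nlin_simps [simp]:
  "Nlin p \<in> carrier W" "Nlin (p + q) = Nlin p \<oplus> Nlin q" "Nlin (p - q) = Nlin p \<ominus> Nlin q"
  "Nlin (Poly_Mapping.map ((*) c) p) = c \<odot> Nlin p" "Nlin (Poly_Mapping.single (i, j) c) = c \<odot> N i j"
  using lin_closed[OF N_Pi] lin_add[OF N_Pi] lin_diff[OF N_Pi] lin_smult[OF N_Pi] lin_single[OF N_Pi] by auto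

lemma xy_commute:
  assumes "k < n" "h \<in> carrier W" "h \<otimes> x k = x k \<otimes> h"
  shows "h \<otimes> y k = y k \<otimes> h"
proof -
  have "h \<otimes> y k = y k \<otimes> (x k \<otimes> h) \<otimes> y k"
    using assms(1,2) by (simp add: y_x flip: m_assoc)
  also have "\<dots> = y k \<otimes> h"
    using assms(1,2) by (simp add: x_y m_assoc flip: assms(3))
  finally show ?thesis .
qed

lemma y_comm_x: "\<lbrakk>i < n; j < n\<rbrakk> \<Longrightarrow> y i \<otimes> x j = x j \<otimes> y i"
  using xy_commute[of i "x j"] x_comm by simp

lemma y_comm: "\<lbrakk>i < n; j < n\<rbrakk> \<Longrightarrow> y i \<otimes> y j = y j \<otimes> y i"
  using xy_commute[of j "y i"] y_comm_x by simp

lemma N_y: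
  assumes "i < n" "j < n" "k < n"
  shows "N i j \<otimes> y k = y k \<otimes> N i j \<ominus> (if j = k then y k else \<zero>)"
proof -
  let ?d = "if j = k then \<one> else \<zero>"
  have Nx: "N i j \<otimes> x k = x k \<otimes> N i j \<oplus> x k \<otimes> ?d" using N_x[OF assms] by simp
  have "y k \<otimes> N i j = y k \<otimes> (N i j \<otimes> x k) \<otimes> y k" using assms by (simp add: m_assoc x_y)
  also have "\<dots> = (y k \<otimes> x k) \<otimes> N i j \<otimes> y k \<oplus> (y k \<otimes> x k) \<otimes> ?d \<otimes> y k"
    unfolding Nx by (cases "j = k") (simp_all add: r_distr l_distr m_assoc)
  also have "\<dots> = N i j \<otimes> y k \<oplus> (if j = k then y k else \<zero>)" using assms by (simp add: y_x)
  finally show ?thesis by (simp add: minus_eq a_assoc r_neg)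
qed

definition e :: "nat \<Rightarrow> nat \<Rightarrow> 'a" where "e i j = x i \<otimes> y j \<otimes> N i j"

lemma e_closed [simp]: "e i j \<in> carrier W"
  by (simp add: e_def)

lemma e_x:
  assumes "i < n" "j < n" "k < n"
  shows "e i j \<otimes> x k = x k \<otimes> e i j \<oplus> (if j = k then x i else \<zero>)"
proof -
  have "e i j \<otimes> x k = x i \<otimes> y j \<otimes> (N i j \<otimes> x k)" by (simp add: e_def m_assoc)
  also have "\<dots> = (x i \<otimes> (y j \<otimes> x k)) \<otimes> N i j \<oplus> (if j = k then x i \<otimes> (y j \<otimes> x k) else \<zero>)"
    unfolding N_x[OF assms] by (simp add: r_distr m_assoc)
  also have "x i \<otimes> (y j \<otimes> x k) = x k \<otimes> (x i \<otimes> y j)"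
    using assms by (simp add: y_comm_x x_comm flip: m_assoc)
  also have "x k \<otimes> (x i \<otimes> y j) \<otimes> N i j = x k \<otimes> e i j" by (simp add: e_def m_assoc)
  also have "(if j = k then x k \<otimes> (x i \<otimes> y j) else \<zero>) = (if j = k then x i else \<zero>)"
  proof (cases "j = k")
    case True
    have "x k \<otimes> (x i \<otimes> y k) = x i \<otimes> (x k \<otimes> y k)" using assms by (simp add: x_comm[of k i] flip: m_assoc)
    with True assms show ?thesis by (simp add: x_y)
  qed simp
  finally show ?thesis .
qed

text \<open>All units are collected on the left: N_ij commutes with the monomial
  \<open>x k \<otimes> y l\<close> up to its weight, which \<open>shift\<close> records.\<close>

lemma e_mult:
  assumes "i < n" "j < n" "k < n" "l < n"
  shows "e i j \<otimes> e k l = (x i \<otimes> y j \<otimes> (x k \<otimes> y l)) \<otimes> (N i j \<otimes> N k l \<oplus> Nlin (shift i j k l))"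
proof -
  let ?u = "x k \<otimes> y l"
  have 1: "N i j \<otimes> ?u = ?u \<otimes> N i j \<oplus> ((if j = k then ?u else \<zero>) \<ominus> (if j = l then ?u else \<zero>))"
  proof -
    have "N i j \<otimes> ?u = (x k \<otimes> N i j \<oplus> (if j = k then x k else \<zero>)) \<otimes> y l"
      using assms by (simp add: N_x flip: m_assoc)
    also have "\<dots> = x k \<otimes> (N i j \<otimes> y l) \<oplus> (if j = k then ?u else \<zero>)"
      by (simp add: l_distr m_assoc)
    also have "\<dots> = ?u \<otimes> N i j \<ominus> (if j = l then ?u else \<zero>) \<oplus> (if j = k then ?u else \<zero>)"
      unfolding N_y[OF assms(1,2,4)] by (simp add: minus_eq r_distr r_minus m_assoc)
    finally show ?thesis by (simp add: minus_eq a_ac)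
  qed
  have 2: "Nlin (shift i j k l) = (if j = k then N k l else \<zero>) \<ominus> (if j = l then N k l else \<zero>)"
    by (simp add: shift_def)
  have "e i j \<otimes> e k l = x i \<otimes> y j \<otimes> ((N i j \<otimes> ?u) \<otimes> N k l)" by (simp add: e_def m_assoc)
  also have "(N i j \<otimes> ?u) \<otimes> N k l = ?u \<otimes> (N i j \<otimes> N k l \<oplus> Nlin (shift i j k l))"
    unfolding 1 2 by (simp add: minus_eq l_distr r_distr l_minus r_minus m_assoc)
  finally show ?thesis by (simp add: m_assoc)
qed

lemma unit_swap:
  assumes "i < n" "j < n" "k < n" "l < n"
  shows "x k \<otimes> y l \<otimes> (x i \<otimes> y j) = x i \<otimes> y j \<otimes> (x k \<otimes> y l)"
proof -
  have c: "h \<otimes> (x i \<otimes> y j) = x i \<otimes> y j \<otimes> h"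
    if "h \<in> carrier W" "h \<otimes> x i = x i \<otimes> h" "h \<otimes> y j = y j \<otimes> h" for h
    using that m_assoc[of h "x i" "y j"] m_assoc[of "x i" h "y j"] by (simp add: m_assoc)
  have 1: "x k \<otimes> (x i \<otimes> y j) = x i \<otimes> y j \<otimes> x k" by (rule c) (use assms in \<open>simp_all add: x_comm y_comm_x\<close>)
  have 2: "y l \<otimes> (x i \<otimes> y j) = x i \<otimes> y j \<otimes> y l" by (rule c) (use assms in \<open>simp_all add: y_comm y_comm_x\<close>)
  have "x k \<otimes> y l \<otimes> (x i \<otimes> y j) = x k \<otimes> (x i \<otimes> y j \<otimes> y l)" by (simp add: m_assoc flip: 2)
  also have "\<dots> = (x k \<otimes> (x i \<otimes> y j)) \<otimes> y l" by (simp add: m_assoc)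
  finally show ?thesis unfolding 1 by (simp add: m_assoc)
qed

text \<open>Where two indices meet, the units telescope, as in
  \<open>x_i y_j x_j y_l = x_i y_l\<close>, and turn N_il back into e_il.\<close>

lemma unit_gamma:
  assumes "i < n" "j < n" "k < n" "l < n"
  shows "(x i \<otimes> y j \<otimes> (x k \<otimes> y l)) \<otimes> Nlin (\<gamma> i j k l) = (if j = k then e i l else \<zero>) \<ominus> (if i = l then e k j else \<zero>)"
proof -
  have 1: "(x i \<otimes> y j \<otimes> (x j \<otimes> y l)) \<otimes> N i l = e i l" if "i < n" "j < n" "l < n" for i j l
  proof -
    have "x i \<otimes> y j \<otimes> (x j \<otimes> y l) = x i \<otimes> ((y j \<otimes> x j) \<otimes> y l)" by (simp add: m_assoc)
    with that show ?thesis by (simp add: y_x e_def)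
  qed
  let ?U = "x i \<otimes> y j \<otimes> (x k \<otimes> y l)"
  have 2: "?U \<otimes> (if j = k then N i l else \<zero>) = (if j = k then e i l else \<zero>)"
    using 1[of i j l] assms by (cases "j = k") auto
  have 3: "?U \<otimes> (if i = l then N k j else \<zero>) = (if i = l then e k j else \<zero>)"
    using 1[of k l j] assms unit_swap[OF assms] by (cases "i = l") auto
  have g: "Nlin (\<gamma> i j k l) = (if j = k then N i l else \<zero>) \<ominus> (if i = l then N k j else \<zero>)"
    by (simp add: \<gamma>_def)
  have "?U \<otimes> Nlin (\<gamma> i j k l) = ?U \<otimes> (if j = k then N i l else \<zero>) \<ominus> ?U \<otimes> (if i = l then N k j else \<zero>)"
    unfolding g minus_eq by (cases "j = k"; cases "i = l") (simp_all add: r_distr r_minus)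
  then show ?thesis unfolding 2 3 .
qed

definition N_rel :: bool where
  "N_rel \<longleftrightarrow> (\<forall>i<n. \<forall>j<n. \<forall>k<n. \<forall>l<n. N i j \<otimes> N k l = N k l \<otimes> N i j \<oplus> Nlin (\<beta> i j k l))"

definition e_rel :: bool where
  "e_rel \<longleftrightarrow> (\<forall>i<n. \<forall>j<n. \<forall>k<n. \<forall>l<n.
    e i j \<otimes> e k l = e k l \<otimes> e i j \<oplus> ((if j = k then e i l else \<zero>) \<ominus> (if i = l then e k j else \<zero>)))"

text \<open>The inverse of the monomial is written down explicitly, its factors being inverted in
  reverse order.\<close>

lemma unit_cancel:
  assumes "i < n" "j < n" "k < n" "l < n" "a \<in> carrier W" "b \<in> carrier W"
    and "(x i \<otimes> y j \<otimes> (x k \<otimes> y l)) \<otimes> a = (x i \<otimes> y j \<otimes> (x k \<otimes> y l)) \<otimes> b"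
  shows "a = b"
proof -
  have "x l \<otimes> y k \<otimes> (x j \<otimes> y i) \<otimes> (x i \<otimes> y j \<otimes> (x k \<otimes> y l)) =
      x l \<otimes> (y k \<otimes> (x j \<otimes> (y i \<otimes> x i) \<otimes> y j) \<otimes> x k) \<otimes> y l"
    by (simp add: m_assoc)
  also have "\<dots> = \<one>" using assms(1-4) by (simp add: y_x x_y)
  finally have inv: "x l \<otimes> y k \<otimes> (x j \<otimes> y i) \<otimes> (x i \<otimes> y j \<otimes> (x k \<otimes> y l)) = \<one>" .
  have "a = x l \<otimes> y k \<otimes> (x j \<otimes> y i) \<otimes> ((x i \<otimes> y j \<otimes> (x k \<otimes> y l)) \<otimes> a)"
    using inv assms(5) m_assoc[of "x l \<otimes> y k \<otimes> (x j \<otimes> y i)" "x i \<otimes> y j \<otimes> (x k \<otimes> y l)" a] by simp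
  also have "\<dots> = b"
    unfolding assms(7) using inv assms(6) m_assoc[of "x l \<otimes> y k \<otimes> (x j \<otimes> y i)" "x i \<otimes> y j \<otimes> (x k \<otimes> y l)" b] by simp
  finally show ?thesis .
qed

text \<open>By \<open>\<beta>_\<gamma>\<close> the two commutator relations are one equation, up to
  an invertible monomial in front and the common summand \<open>shift i j k l\<close>. One direction
  gives the homomorphism out of U(s_n), the other the lift out of the tensor product.\<close>

lemma N_rel_iff_e_rel: "N_rel \<longleftrightarrow> e_rel"
proof -
  have "N i j \<otimes> N k l = N k l \<otimes> N i j \<oplus> Nlin (\<beta> i j k l) \<longleftrightarrow>
    e i j \<otimes> e k l = e k l \<otimes> e i j \<oplus> ((if j = k then e i l else \<zero>) \<ominus> (if i = l then e k j else \<zero>))"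
    if ijkl: "i < n" "j < n" "k < n" "l < n" for i j k l
  proof -
    let ?U = "x i \<otimes> y j \<otimes> (x k \<otimes> y l)"
    have r: "e k l \<otimes> e i j \<oplus> ((if j = k then e i l else \<zero>) \<ominus> (if i = l then e k j else \<zero>)) =
      ?U \<otimes> (N k l \<otimes> N i j \<oplus> Nlin (shift k l i j) \<oplus> Nlin (\<gamma> i j k l))"
      unfolding e_mult[OF ijkl(3,4,1,2)] unit_swap[OF ijkl] using unit_gamma[OF ijkl] by (simp add: r_distr)
    have s: "N k l \<otimes> N i j \<oplus> Nlin (shift k l i j) \<oplus> Nlin (\<gamma> i j k l) = (N k l \<otimes> N i j \<oplus> Nlin (\<beta> i j k l)) \<oplus> Nlin (shift i j k l)"
      using arg_cong[OF \<beta>_\<gamma>[of i j k l], of Nlin] by (simp add: a_assoc)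
    let ?a = "N i j \<otimes> N k l" and ?b = "N k l \<otimes> N i j \<oplus> Nlin (\<beta> i j k l)" and ?s = "Nlin (shift i j k l)"
    show ?thesis
      unfolding r s e_mult[OF ijkl]
    proof
      assume "?U \<otimes> (?a \<oplus> ?s) = ?U \<otimes> (?b \<oplus> ?s)"
      then have "?a \<oplus> ?s = ?b \<oplus> ?s" by (rule unit_cancel[OF ijkl, rotated 2]) simp_all
      then show "?a = ?b" by (subst (asm) add.right_cancel) simp_all
    qed simp
  qed
  then show ?thesis unfolding N_rel_def e_rel_def by simp
qed

end

context calg
begin

lemma centralizer_subalgebra: "h \<in> carrier A \<Longrightarrow> subalgebra {a \<in> carrier A. a \<otimes> h = h \<otimes> a}"
proof (rule subalgebraI)
  fix a b assume h: "h \<in> carrier A" and "a \<in> {a \<in> carrier A. a \<otimes> h = h \<otimes> a}" "b \<in> {a \<in> carrier A. a \<otimes> h = h \<otimes> a}"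
  then have ab: "a \<in> carrier A" "b \<in> carrier A" "a \<otimes> h = h \<otimes> a" "b \<otimes> h = h \<otimes> b" by auto
  have "a \<otimes> b \<otimes> h = a \<otimes> h \<otimes> b" using ab(1,2) h by (simp add: m_assoc ab(4))
  then show "a \<otimes> b \<in> {a \<in> carrier A. a \<otimes> h = h \<otimes> a}" using ab(1,2) h by (simp add: m_assoc ab(3))
  show "a \<oplus> b \<in> {a \<in> carrier A. a \<otimes> h = h \<otimes> a}" using ab h by (simp add: l_distr r_distr)
qed auto

end

text \<open>Reduces a statement about all values of \<open>h\<close> to generators of
  \<open>A\<close>; with a centralizer for \<open>S\<close> it spreads commutation.\<close>

lemma alg_hom_preimage:
  assumes h: "h \<in> alg_hom A B" and "calg A" "calg B" and S: "calg.subalgebra B S"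
  shows "calg.subalgebra A {a \<in> carrier A. h a \<in> S}"
proof -
  interpret A: calg A by fact
  interpret B: calg B by fact
  have S: "subring S B" "\<And>c x. x \<in> S \<Longrightarrow> c \<odot>\<^bsub>B\<^esub> x \<in> S" using S by (auto simp: B.subalgebra_def)
  show ?thesis
    by (rule A.subalgebraI) (use S(2) subringE(3,6,7)[OF S(1)] in \<open>auto simp: alg_homD[OF h]\<close>)
qed

context gl_rep
begin

lemma N_relD:
  "\<lbrakk>N_rel; i < n; j < n; k < n; l < n\<rbrakk> \<Longrightarrow> N i j \<otimes> N k l = N k l \<otimes> N i j \<oplus> Nlin (\<beta> i j k l)"
  unfolding N_rel_def by blast

text \<open>The gl_n relations come from \<open>N_rel\<close> through
  \<open>N_rel_iff_e_rel\<close>, those involving vectors from \<open>e_x\<close> and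
  \<open>x_comm\<close>; \<open>bracket_from_spanning\<close> handles the rest.\<close>

lemma envelope_hom:
  assumes N_rel
  shows "\<exists>\<Phi>\<in>alg_hom (enveloping_alg (s_lie n)) W.
    (\<forall>i<n. \<forall>j<n. \<Phi> (enveloping_incl (s_lie n) (s_mat n i j)) = e i j) \<and>
    (\<forall>i<n. \<Phi> (enveloping_incl (s_lie n) (s_vec n i)) = x i)"
proof -
  interpret L: lie_ops "s_lie n" by (rule lie_ops_s_lie)
  define f where "f = case_sum (\<lambda>(i, j). e i j) x"
  have f: "f \<in> UNIV \<rightarrow> carrier W" by (auto simp: f_def split: sum.splits)
  define \<phi> where "\<phi> v = lin W f (s_coord n v)" for v
  have closed: "\<phi> v \<in> carrier W" for v unfolding \<phi>_def by (rule lin_closed[OF f]) simp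
  have add: "\<phi> (u \<oplus>\<^bsub>s_lie n\<^esub> v) = \<phi> u \<oplus> \<phi> v" if "u \<in> carrier (s_lie n)" "v \<in> carrier (s_lie n)" for u v
    using lin_add[OF f] by (simp only: \<phi>_def s_coord_linear[OF that] subset_UNIV)
  have smult: "\<phi> (c \<odot>\<^bsub>s_lie n\<^esub> v) = c \<odot> \<phi> v" if "v \<in> carrier (s_lie n)" for c v
    using lin_smult[OF f] by (simp only: \<phi>_def s_coord_linear(2)[OF that that] subset_UNIV)
  have \<phi>_mat: "\<phi> (s_mat n i j) = e i j" if "i < n" "j < n" for i j
    using that lin_single[OF f, of "Inl (i, j)" 1] by (simp add: \<phi>_def s_coord_basis f_def)
  have \<phi>_vec: "\<phi> (s_vec n i) = x i" if "i < n" for i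
    using that lin_single[OF f, of "Inr i" 1] by (simp add: \<phi>_def s_coord_basis f_def)
  have e_rel using assms N_rel_iff_e_rel by simp
  then have ee: "e i j \<otimes> e k l = e k l \<otimes> e i j \<oplus> ((if j = k then e i l else \<zero>) \<ominus> (if i = l then e k j else \<zero>))"
    if "i < n" "j < n" "k < n" "l < n" for i j k l
    using that unfolding e_rel_def by blast
  let ?R = "\<lambda>x y. \<phi> x \<otimes> \<phi> y = \<phi> y \<otimes> \<phi> x \<oplus> \<phi> (lie_bracket (s_lie n) x y)"
  let ?mats = "{s_mat n i j | i j. i < n \<and> j < n}" and ?vecs = "{s_vec n i | i. i < n}"
  have mm: "?R (s_mat n i j) (s_mat n k l)" if "i < n" "j < n" "k < n" "l < n" for i j k l
  proof -
    have "\<phi> (lie_bracket (s_lie n) (s_mat n i j) (s_mat n k l)) =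
      (if j = k then 1 else 0) \<odot> e i l \<oplus> (if l = i then - 1 else 0) \<odot> e k j"
      using that unfolding s_lie_brackets(1)[OF that]
      by (simp only: add L.smult_closed s_mat_carrier smult \<phi>_mat)
    also have "\<dots> = (if j = k then e i l else \<zero>) \<ominus> (if i = l then e k j else \<zero>)"
      by (simp add: minus_eq smult_minus_left)
    finally show ?thesis using ee[OF that] that by (simp add: \<phi>_mat)
  qed
  have mv: "?R (s_mat n i j) (s_vec n k)" if "i < n" "j < n" "k < n" for i j k
  proof -
    have "\<phi> (lie_bracket (s_lie n) (s_mat n i j) (s_vec n k)) = (if j = k then 1 else 0) \<odot> x i"
      using that unfolding s_lie_brackets(2)[OF that that(3)] by (simp only: smult s_vec_carrier \<phi>_vec)
    also have "\<dots> = (if j = k then x i else \<zero>)" by simp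
    finally show ?thesis using e_x[OF that] that by (simp add: \<phi>_mat \<phi>_vec)
  qed
  have vm: "?R (s_vec n k) (s_mat n i j)" if "i < n" "j < n" "k < n" for i j k
  proof -
    have "\<phi> (lie_bracket (s_lie n) (s_vec n k) (s_mat n i j)) = \<ominus> \<phi> (lie_bracket (s_lie n) (s_mat n i j) (s_vec n k))"
    proof -
      have "lie_bracket (s_lie n) (s_vec n k) (s_mat n i j) = (-1) \<odot>\<^bsub>s_lie n\<^esub> lie_bracket (s_lie n) (s_mat n i j) (s_vec n k)"
        by (rule s_lie_bracket_linear(3)[OF s_mat_carrier s_mat_carrier s_vec_carrier])
      then show ?thesis
        using closed by (simp only: smult L.bracket_closed s_mat_carrier s_vec_carrier) (simp add: smult_minus_left)
    qed
    then show ?thesis using mv[OF that] closed by (simp add: a_assoc r_neg)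
  qed
  have vv: "?R (s_vec n i) (s_vec n j)" if "i < n" "j < n" for i j
  proof -
    \<comment> \<open>Zero is written as 0 times a basis vector, so that linearity of
      \<open>\<phi>\<close> evaluates it.\<close>
    have "lie_bracket (s_lie n) (s_vec n i) (s_vec n j) = 0 \<odot>\<^bsub>s_lie n\<^esub> s_vec n i"
      using that by (auto simp: s_vec_def intro!: eq_matI eq_vecI)
    then have "\<phi> (lie_bracket (s_lie n) (s_vec n i) (s_vec n j)) = \<zero>"
      using closed by (simp only: smult s_vec_carrier) simp
    then show ?thesis using that x_comm by (simp add: \<phi>_vec)
  qed
  have bracket: "?R u v" if "u \<in> carrier (s_lie n)" "v \<in> carrier (s_lie n)" for u v
  proof (rule bracket_from_spanning[where B = "?mats \<union> ?vecs"])
    show "?mats \<union> ?vecs \<subseteq> carrier (s_lie n)" using s_mat_carrier s_vec_carrier by blast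
    show "carrier (s_lie n) \<subseteq> Q" if "lie_closed n Q" "?mats \<union> ?vecs \<subseteq> Q" for Q
      using lie_closed_all[OF that(1)] that(2) by blast
    show "?R u v" if "u \<in> ?mats \<union> ?vecs" "v \<in> ?mats \<union> ?vecs" for u v
    proof -
      have "(\<exists>i j. u = s_mat n i j \<and> i < n \<and> j < n) \<or> (\<exists>i. u = s_vec n i \<and> i < n)"
        "(\<exists>i j. v = s_mat n i j \<and> i < n \<and> j < n) \<or> (\<exists>i. v = s_vec n i \<and> i < n)"
        using that by blast+
      then show ?thesis
        apply -
        apply (elim disjE exE conjE)
        apply hypsubst
        apply (rule mm; assumption)
        apply hypsubst
        apply (rule mv; assumption)
        apply hypsubst
        apply (rule vm; assumption)
        apply hypsubst
        apply (rule vv; assumption)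
        done
    qed
  qed (rule calg_axioms closed add smult that; assumption?)+
  have "\<exists>\<Phi>\<in>alg_hom (enveloping_alg (s_lie n)) W. \<forall>v\<in>carrier (s_lie n). \<Phi> (enveloping_incl (s_lie n) v) = \<phi> v"
    by (rule L.envelope_lift) (rule calg_axioms closed add smult bracket; assumption?)+
  then obtain \<Phi> where \<Phi>: "\<Phi> \<in> alg_hom (enveloping_alg (s_lie n)) W" "\<forall>v\<in>carrier (s_lie n). \<Phi> (enveloping_incl (s_lie n) v) = \<phi> v"
    by (elim bexE) (rule that)
  have "\<Phi> (enveloping_incl (s_lie n) (s_mat n i j)) = e i j" if "i < n" "j < n" for i j
    using bspec[OF \<Phi>(2) s_mat_carrier] \<phi>_mat[OF that] by (rule trans)
  moreover have "\<Phi> (enveloping_incl (s_lie n) (s_vec n i)) = x i" if "i < n" for i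
    using bspec[OF \<Phi>(2) s_vec_carrier] \<phi>_vec[OF that] by (rule trans)
  ultimately show ?thesis using \<Phi>(1) by (intro bexI[of _ \<Phi>] conjI allI impI)
qed

text \<open>\<open>N i i\<close> has weight one on \<open>x i\<close> like the Euler operator
  \<open>x d/dx\<close>, so \<open>y i \<otimes> N i i\<close> behaves like the derivative. For
  distinct \<open>i\<close> and \<open>j\<close> these commute, as \<open>\<beta> i i j j\<close> is
  zero.\<close>

lemma weyl_rep_N:
  assumes N_rel
  shows "weyl_rep W n x y (\<lambda>i. y i \<otimes> N i i)"
proof (intro weyl_rep.intro weyl_rep_axioms.intro calg_axioms)
  fix i j assume ij: "i < n" "j < n"
  show "y i \<otimes> N i i \<otimes> x j = x j \<otimes> (y i \<otimes> N i i) \<oplus> (if i = j then \<one> else \<zero>)"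
  proof -
    have "y i \<otimes> N i i \<otimes> x j = y i \<otimes> (N i i \<otimes> x j)" by (simp add: m_assoc)
    also have "\<dots> = (y i \<otimes> x j) \<otimes> N i i \<oplus> y i \<otimes> (if i = j then x j else \<zero>)"
      unfolding N_x[OF ij(1,1,2)] by (simp add: r_distr m_assoc)
    also have "y i \<otimes> x j = x j \<otimes> y i" using ij by (rule y_comm_x)
    also have "y i \<otimes> (if i = j then x j else \<zero>) = (if i = j then \<one> else \<zero>)" using ij by (simp add: y_x)
    finally show ?thesis by (simp add: m_assoc)
  qed
  show "y i \<otimes> N i i \<otimes> (y j \<otimes> N j j) = y j \<otimes> N j j \<otimes> (y i \<otimes> N i i)"
  proof (cases "i = j")
    case False
    have "N i i \<otimes> N j j = N j j \<otimes> N i i \<oplus> Nlin (\<beta> i i j j)"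
      using N_relD[OF assms ij(1,1) ij(2,2)] .
    also have "\<beta> i i j j = 0" using False by (simp add: \<beta>_def)
    finally have "N i i \<otimes> N j j = N j j \<otimes> N i i" by simp
    moreover have "N i i \<otimes> y j = y j \<otimes> N i i" "N j j \<otimes> y i = y i \<otimes> N j j"
      using N_y[of i i j] N_y[of j j i] ij False by (simp_all add: minus_eq)
    moreover have "y i \<otimes> N i i \<otimes> (y j \<otimes> N j j) = y i \<otimes> (N i i \<otimes> y j) \<otimes> N j j"
      "y j \<otimes> N j j \<otimes> (y i \<otimes> N i i) = y j \<otimes> (N j j \<otimes> y i) \<otimes> N i i" by (simp_all add: m_assoc)
    moreover have "y i \<otimes> (y j \<otimes> N i i) \<otimes> N j j = (y i \<otimes> y j) \<otimes> (N i i \<otimes> N j j)"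
      "y j \<otimes> (y i \<otimes> N j j) \<otimes> N i i = (y j \<otimes> y i) \<otimes> (N j j \<otimes> N i i)" by (simp_all add: m_assoc)
    ultimately show ?thesis using y_comm[OF ij] by simp
  qed simp
qed (simp_all add: x_comm x_y y_x)

text \<open>The error terms are kept as formal combinations, so that iterated differences end in an
  identity between finitely supported functions.\<close>

lemma commutator_diff:
  assumes "Nlin p \<otimes> Nlin q = Nlin q \<otimes> Nlin p \<oplus> Nlin r" "Nlin p' \<otimes> Nlin q = Nlin q \<otimes> Nlin p' \<oplus> Nlin r'"
  shows "Nlin (p - p') \<otimes> Nlin q = Nlin q \<otimes> Nlin (p - p') \<oplus> Nlin (r - r')"
  using assms(1)
  by (simp add: minus_eq l_distr r_distr l_minus r_minus assms minus_add a_ac)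

lemma commutator_sym:
  assumes "Nlin p \<otimes> Nlin q = Nlin q \<otimes> Nlin p \<oplus> Nlin r"
  shows "Nlin q \<otimes> Nlin p = Nlin p \<otimes> Nlin q \<oplus> Nlin (0 - r)"
  unfolding Nlin_simps(3) using assms by (simp add: minus_eq a_assoc r_neg)

lemma N_rel_Nlin:
  assumes N_rel "i < n" "j < n" "k < n" "l < n"
  shows "Nlin (S1 i j) \<otimes> Nlin (S1 k l) = Nlin (S1 k l) \<otimes> Nlin (S1 i j) \<oplus> Nlin (\<beta> i j k l)"
  using N_relD[OF assms] by simp

text \<open>The coefficients on the right are those of \<open>w_bracket\<close>: column differences
  of the N_ij obey the brackets of s_z.\<close>

lemma w_commutator:
  assumes N: N_rel and n: "n = Suc z" and ij: "i < n" "j < n" "k < n" "l < n"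
  shows "Nlin (S1 i j - S1 z j) \<otimes> Nlin (S1 k l - S1 z l) = Nlin (S1 k l - S1 z l) \<otimes> Nlin (S1 i j - S1 z j) \<oplus>
    Nlin (Poly_Mapping.map ((*) (\<delta> j k - \<delta> j z)) (S1 i l - S1 z l) + Poly_Mapping.map ((*) (\<delta> l z - \<delta> i l)) (S1 k j - S1 z j))"
proof -
  have z: "z < n" using n by simp
  \<comment> \<open>\<open>commutator_diff\<close> works in the left argument. The right one is
    reached by exchanging the arguments before and after, whence the nested
    \<open>0 - r\<close>.\<close>
  have right: "Nlin (S1 a j) \<otimes> Nlin (S1 k l - S1 z l) = Nlin (S1 k l - S1 z l) \<otimes> Nlin (S1 a j)
      \<oplus> Nlin (0 - ((0 - \<beta> a j k l) - (0 - \<beta> a j z l)))" if "a < n" for a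
    by (intro commutator_sym commutator_diff N_rel_Nlin N that ij z)
  have "Nlin (S1 i j - S1 z j) \<otimes> Nlin (S1 k l - S1 z l) = Nlin (S1 k l - S1 z l) \<otimes> Nlin (S1 i j - S1 z j)
      \<oplus> Nlin ((0 - ((0 - \<beta> i j k l) - (0 - \<beta> i j z l))) - (0 - ((0 - \<beta> z j k l) - (0 - \<beta> z j z l))))"
    by (rule commutator_diff[OF right[OF ij(1)] right[OF z]])
  also have "(0 - ((0 - \<beta> i j k l) - (0 - \<beta> i j z l))) - (0 - ((0 - \<beta> z j k l) - (0 - \<beta> z j z l))) =
     Poly_Mapping.map ((*) (\<delta> j k - \<delta> j z)) (S1 i l - S1 z l) + Poly_Mapping.map ((*) (\<delta> l z - \<delta> i l)) (S1 k j - S1 z j)"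
    by (cases "j = k"; cases "i = l"; cases "j = l"; cases "j = z"; cases "l = z")
      (simp_all add: \<beta>_def map_times_one map_times_0 map_times_minus_one)
  finally show ?thesis .
qed

text \<open>The linear map is defined on all of s_z by \<open>col0\<close>; its bracket relation is
  tested on the spanning family \<open>w_elem\<close>, where \<open>w_commutator\<close>
  applies.\<close>

lemma small_envelope_hom:
  assumes N: N_rel and n: "n = Suc z"
  shows "\<exists>\<sigma>\<in>alg_hom (enveloping_alg (s_lie z)) W.
    \<forall>i<n. \<forall>j<n. \<sigma> (enveloping_incl (s_lie z) (w_elem z i j)) = N i j \<ominus> N z j"
proof -
  interpret L: lie_ops "s_lie z" by (rule lie_ops_s_lie)
  define \<phi> where "\<phi> v = Nlin (col0 z v)" for v
  have closed: "\<phi> v \<in> carrier W" for v by (simp add: \<phi>_def)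
  have add: "\<phi> (u \<oplus>\<^bsub>s_lie z\<^esub> v) = \<phi> u \<oplus> \<phi> v" if "u \<in> carrier (s_lie z)" "v \<in> carrier (s_lie z)" for u v
    by (simp only: \<phi>_def col0_linear[OF that] Nlin_simps)
  have smult: "\<phi> (c \<odot>\<^bsub>s_lie z\<^esub> v) = c \<odot> \<phi> v" if "v \<in> carrier (s_lie z)" for c v
    by (simp only: \<phi>_def col0_linear(2)[OF that that] Nlin_simps)
  have \<phi>_w: "\<phi> (w_elem z i j) = Nlin (S1 i j - S1 z j)" if "i < n" "j < n" for i j
    using that n by (simp only: \<phi>_def col0_w less_Suc_eq_le)
  let ?R = "\<lambda>x y. \<phi> x \<otimes> \<phi> y = \<phi> y \<otimes> \<phi> x \<oplus> \<phi> (lie_bracket (s_lie z) x y)"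
  have ww: "?R (w_elem z i j) (w_elem z k l)" if "i < n" "j < n" "k < n" "l < n" for i j k l
  proof -
    have le: "i \<le> z" "j \<le> z" "k \<le> z" "l \<le> z" using that n by simp_all
    have "\<phi> (lie_bracket (s_lie z) (w_elem z i j) (w_elem z k l)) =
      Nlin (Poly_Mapping.map ((*) (\<delta> j k - \<delta> j z)) (S1 i l - S1 z l) + Poly_Mapping.map ((*) (\<delta> l z - \<delta> i l)) (S1 k j - S1 z j))"
      unfolding w_bracket[OF le] using that
      by (simp only: add smult L.smult_closed w_carrier \<phi>_w Nlin_simps)
    then show ?thesis using w_commutator[OF N n that] that by (simp only: \<phi>_w)
  qed
  have bracket: "?R u v" if "u \<in> carrier (s_lie z)" "v \<in> carrier (s_lie z)" for u v
  proof (rule bracket_from_spanning[where B = "{w_elem z i j | i j. i < n \<and> j < n}"])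
    show "{w_elem z i j | i j. i < n \<and> j < n} \<subseteq> carrier (s_lie z)" using w_carrier by blast
    show "carrier (s_lie z) \<subseteq> Q" if Q: "lie_closed z Q" "{w_elem z i j | i j. i < n \<and> j < n} \<subseteq> Q" for Q
    proof (rule w_span[OF Q(1)])
      show "w_elem z i j \<in> Q" if "i \<le> z" "j \<le> z" for i j using that Q(2) n le_imp_less_Suc by blast
    qed
    show "?R u v" if uv: "u \<in> {w_elem z i j | i j. i < n \<and> j < n}" "v \<in> {w_elem z i j | i j. i < n \<and> j < n}" for u v
    proof -
      obtain i j k l where "u = w_elem z i j" "v = w_elem z k l" and "i < n" "j < n" "k < n" "l < n"
        using uv by blast
      from ww[OF this(3-6)] show ?thesis by (simp only: \<open>u = w_elem z i j\<close> \<open>v = w_elem z k l\<close>)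
    qed
  qed (rule calg_axioms closed add smult that; assumption?)+
  have "\<exists>\<sigma>\<in>alg_hom (enveloping_alg (s_lie z)) W. \<forall>v\<in>carrier (s_lie z). \<sigma> (enveloping_incl (s_lie z) v) = \<phi> v"
    by (rule L.envelope_lift) (rule calg_axioms closed add smult bracket; assumption?)+
  then obtain \<sigma> where \<sigma>: "\<sigma> \<in> alg_hom (enveloping_alg (s_lie z)) W" "\<forall>v\<in>carrier (s_lie z). \<sigma> (enveloping_incl (s_lie z) v) = \<phi> v"
    by (elim bexE) (rule that)
  have "\<sigma> (enveloping_incl (s_lie z) (w_elem z i j)) = N i j \<ominus> N z j" if "i < n" "j < n" for i j
    using trans[OF bspec[OF \<sigma>(2) w_carrier] \<phi>_w[OF that]] by simp
  with \<sigma>(1) show ?thesis by (intro bexI[of _ \<sigma>] conjI allI impI)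
qed

text \<open>The weight of N_ij depends on the column \<open>j\<close> alone, so a difference within
  one column commutes with every \<open>x k\<close>. It commutes with \<open>N k k\<close> because
  \<open>\<beta> a j k k\<close> is zero for every \<open>a\<close>.\<close>

lemma w_commutes:
  assumes N: N_rel and n: "n = Suc z" and "i < n" "j < n" "k < n"
  shows "(N i j \<ominus> N z j) \<otimes> x k = x k \<otimes> (N i j \<ominus> N z j)"
    and "(N i j \<ominus> N z j) \<otimes> y k = y k \<otimes> (N i j \<ominus> N z j)"
    and "(N i j \<ominus> N z j) \<otimes> (y k \<otimes> N k k) = (y k \<otimes> N k k) \<otimes> (N i j \<ominus> N z j)"
proof -
  have z: "z < n" using n by simp
  let ?w = "N i j \<ominus> N z j"
  show x: "?w \<otimes> x k = x k \<otimes> ?w"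
    using N_x[OF assms(3-5)] N_x[OF z assms(4,5)]
    by (cases "j = k") (simp_all add: minus_eq l_distr r_distr l_minus r_minus minus_add a_ac r_neg r_neg1 r_neg2)
  then show y: "?w \<otimes> y k = y k \<otimes> ?w" using assms by (intro xy_commute) simp_all
  have "Nlin (S1 i j - S1 z j) \<otimes> Nlin (S1 k k) = Nlin (S1 k k) \<otimes> Nlin (S1 i j - S1 z j) \<oplus> Nlin (\<beta> i j k k - \<beta> z j k k)"
    by (intro commutator_diff N_rel_Nlin N z assms)
  moreover have "\<beta> a j k k = 0" for a by (simp add: \<beta>_def)
  ultimately have N: "?w \<otimes> N k k = N k k \<otimes> ?w" by simp
  have "?w \<otimes> (y k \<otimes> N k k) = (?w \<otimes> y k) \<otimes> N k k" by (simp add: m_assoc)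
  also have "\<dots> = y k \<otimes> (?w \<otimes> N k k)" unfolding y by (simp add: m_assoc)
  finally show "?w \<otimes> (y k \<otimes> N k k) = (y k \<otimes> N k k) \<otimes> ?w" unfolding N by (simp add: m_assoc)
qed

end

section \<open>Ore localization\<close>

text \<open>A commutative two-sided Ore set, with reversibility in the role of cancellation. The
  left Ore condition serves the localization, the right-hand conditions the module of right
  fractions, and \<open>left_rev\<close> turns right torsion into left torsion.\<close>

locale ore_set = calg A for A :: "(complex, 'a, 'm) module_scheme" (structure) +
  fixes S :: "'a set"
  assumes S_sub: "S \<subseteq> carrier A" and S_one: "\<one> \<in> S"
    and S_mult: "\<lbrakk>s \<in> S; t \<in> S\<rbrakk> \<Longrightarrow> s \<otimes> t \<in> S"
    and S_comm: "\<lbrakk>s \<in> S; t \<in> S\<rbrakk> \<Longrightarrow> s \<otimes> t = t \<otimes> s"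
    and left_ore: "\<lbrakk>s \<in> S; r \<in> carrier A\<rbrakk> \<Longrightarrow> \<exists>u\<in>S. \<exists>v\<in>carrier A. u \<otimes> r = v \<otimes> s"
    and left_rev: "\<lbrakk>s \<in> S; r \<in> carrier A; r \<otimes> s = \<zero>\<rbrakk> \<Longrightarrow> \<exists>u\<in>S. u \<otimes> r = \<zero>"
    and right_ore: "\<lbrakk>s \<in> S; r \<in> carrier A\<rbrakk> \<Longrightarrow> \<exists>u\<in>S. \<exists>v\<in>carrier A. r \<otimes> u = s \<otimes> v"
    and right_rev: "\<lbrakk>s \<in> S; r \<in> carrier A; s \<otimes> r = \<zero>\<rbrakk> \<Longrightarrow> \<exists>u\<in>S. r \<otimes> u = \<zero>"
begin

lemma S_closed [simp]: "s \<in> S \<Longrightarrow> s \<in> carrier A" using S_sub by blast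

text \<open>A fraction is sent to \<open>F s r\<close>, the solution \<open>b\<close> of
  \<open>\<Phi> s \<otimes> b = \<Phi> r\<close> in \<open>B\<close>. Fractions are equivalent
  exactly when their values under \<open>F\<close> agree, so the classes are the fibres of
  \<open>F\<close>, and the operations are those of \<open>B\<close> carried over to fibres.\<close>

lemma localization_iso:
  fixes B :: "(complex, 'b, 'n) module_scheme"
  assumes B: "calg B" and \<Phi>: "\<Phi> \<in> alg_hom A B"
    and unit: "\<And>s. s \<in> S \<Longrightarrow> \<exists>b\<in>carrier B. \<Phi> s \<otimes>\<^bsub>B\<^esub> b = \<one>\<^bsub>B\<^esub> \<and> b \<otimes>\<^bsub>B\<^esub> \<Phi> s = \<one>\<^bsub>B\<^esub>"
    and surj: "\<And>b. b \<in> carrier B \<Longrightarrow> \<exists>s\<in>S. \<exists>r\<in>carrier A. \<Phi> s \<otimes>\<^bsub>B\<^esub> b = \<Phi> r"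
    and ker: "\<And>r. \<lbrakk>r \<in> carrier A; \<Phi> r = \<zero>\<^bsub>B\<^esub>\<rbrakk> \<Longrightarrow> \<exists>u\<in>S. u \<otimes> r = \<zero>"
  shows "ore_localization A S \<cong>\<^sub>a\<^sub>l\<^sub>g B"
proof -
  interpret B: calg B by fact
  note hom [simp] = alg_homD[OF \<Phi>]
  have cancel: "b = b'" if "s \<in> S" "b \<in> carrier B" "b' \<in> carrier B" "\<Phi> s \<otimes>\<^bsub>B\<^esub> b = \<Phi> s \<otimes>\<^bsub>B\<^esub> b'" for s b b'
  proof -
    obtain i where i: "i \<in> carrier B" "i \<otimes>\<^bsub>B\<^esub> \<Phi> s = \<one>\<^bsub>B\<^esub>" using unit[OF \<open>s \<in> S\<close>] by blast
    have "b = (i \<otimes>\<^bsub>B\<^esub> \<Phi> s) \<otimes>\<^bsub>B\<^esub> b" using that(2) i by simp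
    also have "\<dots> = i \<otimes>\<^bsub>B\<^esub> (\<Phi> s \<otimes>\<^bsub>B\<^esub> b)" using that(1,2) i(1) by (simp add: B.m_assoc)
    also have "\<dots> = (i \<otimes>\<^bsub>B\<^esub> \<Phi> s) \<otimes>\<^bsub>B\<^esub> b'" unfolding that(4) using that(1,3) i(1) by (simp add: B.m_assoc)
    finally show ?thesis using that(3) i by simp
  qed
  define F where "F s r = (SOME b. b \<in> carrier B \<and> \<Phi> s \<otimes>\<^bsub>B\<^esub> b = \<Phi> r)" for s r
  have F: "F s r \<in> carrier B" "\<Phi> s \<otimes>\<^bsub>B\<^esub> F s r = \<Phi> r" if "s \<in> S" "r \<in> carrier A" for s r
  proof -
    obtain i where i: "i \<in> carrier B" "\<Phi> s \<otimes>\<^bsub>B\<^esub> i = \<one>\<^bsub>B\<^esub>" using unit[OF \<open>s \<in> S\<close>] by blast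
    have "i \<otimes>\<^bsub>B\<^esub> \<Phi> r \<in> carrier B \<and> \<Phi> s \<otimes>\<^bsub>B\<^esub> (i \<otimes>\<^bsub>B\<^esub> \<Phi> r) = \<Phi> r"
      using that i by (simp flip: B.m_assoc)
    then have "F s r \<in> carrier B \<and> \<Phi> s \<otimes>\<^bsub>B\<^esub> F s r = \<Phi> r" unfolding F_def by (rule someI)
    then show "F s r \<in> carrier B" "\<Phi> s \<otimes>\<^bsub>B\<^esub> F s r = \<Phi> r" by auto
  qed
  have F_eqI: "F s r = b" if "s \<in> S" "r \<in> carrier A" "b \<in> carrier B" "\<Phi> s \<otimes>\<^bsub>B\<^esub> b = \<Phi> r" for s r b
    using cancel[OF that(1) F(1)[OF that(1,2)] that(3)] F(2)[OF that(1,2)] that(4) by simp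
  have rel: "((s, r), (s', r')) \<in> frac_rel A S \<longleftrightarrow> s \<in> S \<and> r \<in> carrier A \<and> s' \<in> S \<and> r' \<in> carrier A \<and> F s r = F s' r'"
    for s r s' r'
  proof
    assume "((s, r), (s', r')) \<in> frac_rel A S"
    then obtain u u' where c: "s \<in> S" "r \<in> carrier A" "s' \<in> S" "r' \<in> carrier A" "u \<in> carrier A" "u' \<in> carrier A"
      and eq: "u \<otimes> s = u' \<otimes> s'" "u \<otimes> s \<in> S" "u \<otimes> r = u' \<otimes> r'"
      unfolding frac_rel_def by auto
    have "\<Phi> (u \<otimes> s) \<otimes>\<^bsub>B\<^esub> F s r = \<Phi> (u \<otimes> r)" using c F[OF c(1,2)] by (simp add: B.m_assoc)
    moreover have "\<Phi> (u' \<otimes> s') \<otimes>\<^bsub>B\<^esub> F s' r' = \<Phi> (u' \<otimes> r')" using c F[OF c(3,4)] by (simp add: B.m_assoc)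
    ultimately have "F s r = F s' r'"
      using cancel[OF eq(2) F(1)[OF c(1,2)] F(1)[OF c(3,4)]] eq by simp
    with c show "s \<in> S \<and> r \<in> carrier A \<and> s' \<in> S \<and> r' \<in> carrier A \<and> F s r = F s' r'" by blast
  next
    assume "s \<in> S \<and> r \<in> carrier A \<and> s' \<in> S \<and> r' \<in> carrier A \<and> F s r = F s' r'"
    then have c: "s \<in> S" "r \<in> carrier A" "s' \<in> S" "r' \<in> carrier A" and eq: "F s r = F s' r'" by auto
    \<comment> \<open>Both fractions are brought over the denominator \<open>s' \<otimes> s\<close>.
      The difference of the numerators lies in the kernel, so some \<open>w\<close> kills it, and
      \<open>w \<otimes> s'\<close> and \<open>w \<otimes> s\<close> are the multipliers that
      \<open>frac_rel\<close> asks for.\<close>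
    have "\<Phi> (s' \<otimes> r) = \<Phi> (s' \<otimes> s) \<otimes>\<^bsub>B\<^esub> F s r" using c F[OF c(1,2)] by (simp add: B.m_assoc)
    also have "\<dots> = \<Phi> (s \<otimes> s') \<otimes>\<^bsub>B\<^esub> F s' r'" unfolding eq S_comm[OF c(3,1)] ..
    also have "\<dots> = \<Phi> (s \<otimes> r')" using c F[OF c(3,4)] by (simp add: B.m_assoc)
    finally have "\<Phi> (s' \<otimes> r \<ominus> s \<otimes> r') = \<zero>\<^bsub>B\<^esub>"
      using c alg_hom_minus(3)[OF \<Phi> calg_axioms B, of "s' \<otimes> r" "s \<otimes> r'"] by simp
    then obtain w where w: "w \<in> S" "w \<otimes> (s' \<otimes> r \<ominus> s \<otimes> r') = \<zero>" using ker[of "s' \<otimes> r \<ominus> s \<otimes> r'"] c by auto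
    then have "w \<otimes> (s' \<otimes> r) \<ominus> w \<otimes> (s \<otimes> r') = \<zero>" using c by (simp add: minus_eq r_distr r_minus)
    then have "w \<otimes> s' \<otimes> r = w \<otimes> s \<otimes> r'" using c w(1) by (simp add: m_assoc)
    moreover have "w \<otimes> s' \<otimes> s = w \<otimes> s \<otimes> s'" using c w(1) S_comm[OF c(1,3)] by (simp add: m_assoc)
    moreover have "w \<otimes> s' \<otimes> s \<in> S" using c w(1) S_mult by blast
    moreover have "w \<otimes> s' \<in> carrier A" "w \<otimes> s \<in> carrier A" using c w(1) by simp_all
    ultimately have "\<exists>u\<in>carrier A. \<exists>u'\<in>carrier A. u \<otimes> s = u' \<otimes> s' \<and> u \<otimes> s \<in> S \<and> u \<otimes> r = u' \<otimes> r'" by blast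
    then show "((s, r), (s', r')) \<in> frac_rel A S" using c unfolding frac_rel_def by blast
  qed
  define fib where "fib b = {(s, r). s \<in> S \<and> r \<in> carrier A \<and> F s r = b}" for b
  have fibI: "(s, r) \<in> fib b" if "s \<in> S" "r \<in> carrier A" "F s r = b" for s r b using that by (simp add: fib_def)
  have fibE: "s \<in> S \<and> r \<in> carrier A \<and> F s r = b" if "(s, r) \<in> fib b" for s r b using that by (simp add: fib_def)
  have left_frac: "left_frac A S s r = fib (F s r)" if "s \<in> S" "r \<in> carrier A" for s r
    using that unfolding left_frac_def fib_def by (auto simp: rel)
  have ne: "\<exists>s r. (s, r) \<in> fib b" if b: "b \<in> carrier B" for b
  proof -
    obtain s r where "s \<in> S" "r \<in> carrier A" "\<Phi> s \<otimes>\<^bsub>B\<^esub> b = \<Phi> r" using surj[OF b] by blast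
    then show ?thesis using F_eqI[of s r b] b fibI by blast
  qed
  let ?L = "ore_localization A S"
  have carr: "carrier ?L = fib ` carrier B"
  proof -
    have "carrier ?L = {left_frac A S s r | s r. s \<in> S \<and> r \<in> carrier A}"
      unfolding ore_localization_def quotient_def left_frac_def by auto
    also have "\<dots> = {fib (F s r) | s r. s \<in> S \<and> r \<in> carrier A}"
      using left_frac by (metis (no_types, lifting))
    also have "\<dots> = fib ` carrier B"
      using F(1) ne fibE by (auto, metis (no_types, lifting))
    finally show ?thesis .
  qed
  \<comment> \<open>In each operation all choices lead to the same fibre; it then remains to exhibit
    one choice, which for products is the left Ore condition.\<close>
  have Union_const: "\<Union>Z = fib b" if "\<And>z. z \<in> Z \<Longrightarrow> z = fib b" "Z \<noteq> {}" for Z b using that by fastforce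
  have mult: "fib b \<otimes>\<^bsub>?L\<^esub> fib b' = fib (b \<otimes>\<^bsub>B\<^esub> b')" if b: "b \<in> carrier B" "b' \<in> carrier B" for b b'
  proof -
    let ?Z = "{left_frac A S (u \<otimes> s) (v \<otimes> r') | s r s' r' u v.
        (s, r) \<in> fib b \<and> (s', r') \<in> fib b' \<and> u \<in> S \<and> v \<in> carrier A \<and> u \<otimes> r = v \<otimes> s'}"
    have "\<Union>?Z = fib (b \<otimes>\<^bsub>B\<^esub> b')"
    proof (rule Union_const)
      fix Z assume "Z \<in> ?Z"
      then obtain s r s' r' u v where Z: "Z = left_frac A S (u \<otimes> s) (v \<otimes> r')"
        and m: "(s, r) \<in> fib b" "(s', r') \<in> fib b'" "u \<in> S" "v \<in> carrier A" "u \<otimes> r = v \<otimes> s'" by blast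
      note c = fibE[OF m(1)] fibE[OF m(2)]
      have e: "\<Phi> s \<otimes>\<^bsub>B\<^esub> b = \<Phi> r" "\<Phi> s' \<otimes>\<^bsub>B\<^esub> b' = \<Phi> r'" using c F(2) by auto
      have us: "u \<otimes> s \<in> S" using c m(3) S_mult by blast
      have "\<Phi> (u \<otimes> s) \<otimes>\<^bsub>B\<^esub> (b \<otimes>\<^bsub>B\<^esub> b') = \<Phi> u \<otimes>\<^bsub>B\<^esub> (\<Phi> s \<otimes>\<^bsub>B\<^esub> b) \<otimes>\<^bsub>B\<^esub> b'"
        using c m(3) b by (simp add: B.m_assoc)
      also have "\<dots> = (\<Phi> u \<otimes>\<^bsub>B\<^esub> \<Phi> r) \<otimes>\<^bsub>B\<^esub> b'" unfolding e ..
      also have "\<Phi> u \<otimes>\<^bsub>B\<^esub> \<Phi> r = \<Phi> v \<otimes>\<^bsub>B\<^esub> \<Phi> s'" using arg_cong[OF m(5), of \<Phi>] c m(3,4) by simp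
      also have "\<Phi> v \<otimes>\<^bsub>B\<^esub> \<Phi> s' \<otimes>\<^bsub>B\<^esub> b' = \<Phi> v \<otimes>\<^bsub>B\<^esub> (\<Phi> s' \<otimes>\<^bsub>B\<^esub> b')" using c m(4) b(2) by (simp add: B.m_assoc)
      also have "\<dots> = \<Phi> (v \<otimes> r')" unfolding e using c m by simp
      finally have "F (u \<otimes> s) (v \<otimes> r') = b \<otimes>\<^bsub>B\<^esub> b'" using us c m b by (intro F_eqI) auto
      then show "Z = fib (b \<otimes>\<^bsub>B\<^esub> b')" unfolding Z using left_frac us c m by simp
    next
      obtain s r s' r' where m: "(s, r) \<in> fib b" "(s', r') \<in> fib b'" using ne b by meson
      obtain u v where "u \<in> S" "v \<in> carrier A" "u \<otimes> r = v \<otimes> s'"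
        using left_ore fibE[OF m(1)] fibE[OF m(2)] by meson
      with m show "?Z \<noteq> {}" by blast
    qed
    then show ?thesis by (simp add: ore_localization_def)
  qed
  have add: "fib b \<oplus>\<^bsub>?L\<^esub> fib b' = fib (b \<oplus>\<^bsub>B\<^esub> b')" if b: "b \<in> carrier B" "b' \<in> carrier B" for b b'
  proof -
    let ?Z = "{left_frac A S (u \<otimes> s) (u \<otimes> r \<oplus> u' \<otimes> r') | s r s' r' u u'.
        (s, r) \<in> fib b \<and> (s', r') \<in> fib b' \<and> u \<in> carrier A \<and> u' \<in> carrier A \<and> u \<otimes> s = u' \<otimes> s' \<and> u \<otimes> s \<in> S}"
    have "\<Union>?Z = fib (b \<oplus>\<^bsub>B\<^esub> b')"
    proof (rule Union_const)
      fix Z assume "Z \<in> ?Z"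
      then obtain s r s' r' u u' where Z: "Z = left_frac A S (u \<otimes> s) (u \<otimes> r \<oplus> u' \<otimes> r')"
        and m: "(s, r) \<in> fib b" "(s', r') \<in> fib b'" "u \<in> carrier A" "u' \<in> carrier A" "u \<otimes> s = u' \<otimes> s'" "u \<otimes> s \<in> S" by blast
      note c = fibE[OF m(1)] fibE[OF m(2)]
      have e: "\<Phi> s \<otimes>\<^bsub>B\<^esub> b = \<Phi> r" "\<Phi> s' \<otimes>\<^bsub>B\<^esub> b' = \<Phi> r'" using c F(2) by auto
      have "\<Phi> (u \<otimes> s) \<otimes>\<^bsub>B\<^esub> b = \<Phi> (u \<otimes> r)" using c m(3) b e(1) by (simp add: B.m_assoc)
      moreover have "\<Phi> (u \<otimes> s) \<otimes>\<^bsub>B\<^esub> b' = \<Phi> (u' \<otimes> r')" unfolding m(5) using c m(4) b e(2) by (simp add: B.m_assoc)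
      ultimately have "\<Phi> (u \<otimes> s) \<otimes>\<^bsub>B\<^esub> (b \<oplus>\<^bsub>B\<^esub> b') = \<Phi> (u \<otimes> r \<oplus> u' \<otimes> r')"
        using c m b hom(1)[OF S_closed[OF m(6)]] by (simp only: B.r_distr hom(3) m_closed)
      then have "F (u \<otimes> s) (u \<otimes> r \<oplus> u' \<otimes> r') = b \<oplus>\<^bsub>B\<^esub> b'" using c m b by (intro F_eqI) auto
      then show "Z = fib (b \<oplus>\<^bsub>B\<^esub> b')" unfolding Z using left_frac c m by simp
    next
      obtain s r s' r' where m: "(s, r) \<in> fib b" "(s', r') \<in> fib b'" using ne b by meson
      have c: "s \<in> S" "s' \<in> S" using fibE[OF m(1)] fibE[OF m(2)] by auto
      then have "s' \<otimes> s = s \<otimes> s'" "s' \<otimes> s \<in> S" using S_comm S_mult by blast+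
      with m c S_closed show "?Z \<noteq> {}" by blast
    qed
    then show ?thesis by (simp add: ore_localization_def)
  qed
  have smult: "c \<odot>\<^bsub>?L\<^esub> fib b = fib (c \<odot>\<^bsub>B\<^esub> b)" if b: "b \<in> carrier B" for c b
  proof -
    let ?Z = "{left_frac A S s (c \<odot> r) | s r. (s, r) \<in> fib b}"
    have "\<Union>?Z = fib (c \<odot>\<^bsub>B\<^esub> b)"
    proof (rule Union_const)
      fix Z assume "Z \<in> ?Z"
      then obtain s r where Z: "Z = left_frac A S s (c \<odot> r)" and m: "(s, r) \<in> fib b" by blast
      note d = fibE[OF m]
      have "\<Phi> s \<otimes>\<^bsub>B\<^esub> (c \<odot>\<^bsub>B\<^esub> b) = \<Phi> (c \<odot> r)" using d b F(2)[of s r] by simp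
      then have "F s (c \<odot> r) = c \<odot>\<^bsub>B\<^esub> b" using d b by (intro F_eqI) auto
      then show "Z = fib (c \<odot>\<^bsub>B\<^esub> b)" unfolding Z using left_frac d by simp
    next
      show "?Z \<noteq> {}" using ne[OF b] by blast
    qed
    then show ?thesis by (simp add: ore_localization_def)
  qed
  have one: "\<one>\<^bsub>?L\<^esub> = fib \<one>\<^bsub>B\<^esub>"
  proof -
    have "F \<one> \<one> = \<one>\<^bsub>B\<^esub>" using S_one by (intro F_eqI) auto
    then show ?thesis using left_frac[OF S_one one_closed] by (simp add: ore_localization_def)
  qed
  define h where "h X = (let p = SOME p. p \<in> X in F (fst p) (snd p))" for X
  have h: "h (fib b) = b" if "b \<in> carrier B" for b
  proof -
    have "(SOME p. p \<in> fib b) \<in> fib b" using ne[OF that] by (auto intro: someI)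
    then show ?thesis using fibE[of "fst (SOME p. p \<in> fib b)" "snd (SOME p. p \<in> fib b)" b] by (simp add: h_def Let_def)
  qed
  have "h \<in> Ring.ring_hom ?L B"
    by (rule ring_hom_memI) (auto simp: carr h mult add one)
  moreover have "bij_betw h (carrier ?L) (carrier B)"
    unfolding carr by (rule bij_betwI[of _ _ _ fib]) (auto simp: h)
  moreover have "h \<in> module_hom class_ring ?L B"
    unfolding LinearCombinations.module_hom_def by (auto simp: carr h add smult class_ring_simps)
  ultimately have "h \<in> alg_iso ?L B" by (simp add: alg_iso_def ring_iso_def)
  then show ?thesis unfolding alg_isomorphic_def by blast
qed

subsection \<open>Right fractions as a module\<close>

lemma S_lcomm: "\<lbrakk>s \<in> S; t \<in> S; r \<in> carrier A\<rbrakk> \<Longrightarrow> s \<otimes> (t \<otimes> r) = t \<otimes> (s \<otimes> r)"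
  using S_comm[of s t] by (simp flip: m_assoc)

text \<open>The class of the right fraction \<open>r s^-1\<close> as the set of its representatives.
  Since \<open>S\<close> commutes, equality is cross multiplication up to a common factor
  \<open>w\<close>.\<close>

definition fr :: "'a \<Rightarrow> 'a \<Rightarrow> ('a \<times> 'a) set" where
  "fr r s = {(r', s'). r' \<in> carrier A \<and> s' \<in> S \<and> (\<exists>w\<in>S. r \<otimes> (s' \<otimes> w) = r' \<otimes> (s \<otimes> w))}"

lemma fr_eq:
  assumes "r \<in> carrier A" "s \<in> S" "r' \<in> carrier A" "s' \<in> S"
  shows "fr r s = fr r' s' \<longleftrightarrow> (\<exists>w\<in>S. r \<otimes> (s' \<otimes> w) = r' \<otimes> (s \<otimes> w))"
proof
  have "(r', s') \<in> fr r' s'" using assms S_one by (auto simp: fr_def)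
  moreover assume "fr r s = fr r' s'"
  ultimately have "(r', s') \<in> fr r s" by simp
  then show "\<exists>w\<in>S. r \<otimes> (s' \<otimes> w) = r' \<otimes> (s \<otimes> w)" by (simp add: fr_def)
next
  \<comment> \<open>Transitivity, with the product of the middle denominator and both given
    witnesses as the new witness.\<close>
  have trans: "\<exists>w\<in>S. a \<otimes> (u \<otimes> w) = c \<otimes> (s \<otimes> w)"
    if "w \<in> S" "a \<otimes> (t \<otimes> w) = b \<otimes> (s \<otimes> w)" "w' \<in> S" "b \<otimes> (u \<otimes> w') = c \<otimes> (t \<otimes> w')"
      "a \<in> carrier A" "b \<in> carrier A" "c \<in> carrier A" "s \<in> S" "t \<in> S" "u \<in> S" for a b c s t u w w'
  proof -
    have "a \<otimes> (u \<otimes> (t \<otimes> (w \<otimes> w'))) = a \<otimes> (t \<otimes> w) \<otimes> (u \<otimes> w')"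
      using that(1,3,5-10) by (simp add: m_assoc S_comm S_lcomm)
    also have "\<dots> = b \<otimes> (u \<otimes> w') \<otimes> (s \<otimes> w)"
      unfolding that(2) using that(1,3,5-10) by (simp add: m_assoc S_comm S_lcomm)
    also have "\<dots> = c \<otimes> (s \<otimes> (t \<otimes> (w \<otimes> w')))"
      unfolding that(4) using that(1,3,5-10) by (simp add: m_assoc S_comm S_lcomm)
    finally show ?thesis using that S_mult by blast
  qed
  assume "\<exists>w\<in>S. r \<otimes> (s' \<otimes> w) = r' \<otimes> (s \<otimes> w)"
  then obtain w where w: "w \<in> S" "r \<otimes> (s' \<otimes> w) = r' \<otimes> (s \<otimes> w)" by blast
  have "(\<exists>v\<in>S. r \<otimes> (u \<otimes> v) = c \<otimes> (s \<otimes> v)) \<longleftrightarrow> (\<exists>v\<in>S. r' \<otimes> (u \<otimes> v) = c \<otimes> (s' \<otimes> v))"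
    if "c \<in> carrier A" "u \<in> S" for c u
    using trans[of w r s' r' s _ u c] trans[of w r' s r s' _ u c] w w(2)[symmetric] assms that by blast
  then show "fr r s = fr r' s'" unfolding fr_def by auto
qed

lemma fr_expand:
  assumes "r \<in> carrier A" "s \<in> S" "t \<in> S"
  shows "fr (r \<otimes> t) (s \<otimes> t) = fr r s"
  using assms S_mult by (subst fr_eq) (auto intro!: bexI[OF _ S_one] simp: m_assoc S_comm S_lcomm)

lemma fr_same:
  assumes "r \<in> carrier A" "r' \<in> carrier A" "s \<in> S"
  shows "fr r s = fr r' s \<longleftrightarrow> (\<exists>w\<in>S. r \<otimes> w = r' \<otimes> w)"
proof -
  have "(\<exists>w\<in>S. r \<otimes> (s \<otimes> w) = r' \<otimes> (s \<otimes> w)) \<longleftrightarrow> (\<exists>w\<in>S. r \<otimes> w = r' \<otimes> w)"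
  proof
    assume "\<exists>w\<in>S. r \<otimes> (s \<otimes> w) = r' \<otimes> (s \<otimes> w)"
    then show "\<exists>w\<in>S. r \<otimes> w = r' \<otimes> w" using S_mult[OF assms(3)] by blast
  next
    assume "\<exists>w\<in>S. r \<otimes> w = r' \<otimes> w"
    then obtain w where w: "w \<in> S" "r \<otimes> w = r' \<otimes> w" by blast
    have "r \<otimes> (s \<otimes> w) = (r \<otimes> w) \<otimes> s" "r' \<otimes> (s \<otimes> w) = (r' \<otimes> w) \<otimes> s"
      using assms w(1) by (simp_all add: m_assoc S_comm)
    then have "r \<otimes> (s \<otimes> w) = r' \<otimes> (s \<otimes> w)" unfolding w(2) by simp
    with w(1) show "\<exists>w\<in>S. r \<otimes> (s \<otimes> w) = r' \<otimes> (s \<otimes> w)" by blast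
  qed
  then show ?thesis using fr_eq[OF assms(1,3,2,3)] by simp
qed

definition num :: "('a \<times> 'a) set \<Rightarrow> 'a" where "num X = fst (SOME p. p \<in> X)"
definition den :: "('a \<times> 'a) set \<Rightarrow> 'a" where "den X = snd (SOME p. p \<in> X)"

lemma num_den:
  assumes "r \<in> carrier A" "s \<in> S"
  shows "num (fr r s) \<in> carrier A" "den (fr r s) \<in> S" "fr (num (fr r s)) (den (fr r s)) = fr r s"
proof -
  have "(r, s) \<in> fr r s" using assms S_one by (auto simp: fr_def)
  then have "(SOME p. p \<in> fr r s) \<in> fr r s" by (rule someI)
  then have m: "(num (fr r s), den (fr r s)) \<in> fr r s" by (simp add: num_def den_def)
  then show c: "num (fr r s) \<in> carrier A" "den (fr r s) \<in> S" by (auto simp: fr_def)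
  from m have "\<exists>w\<in>S. r \<otimes> (den (fr r s) \<otimes> w) = num (fr r s) \<otimes> (s \<otimes> w)" by (simp add: fr_def)
  then show "fr (num (fr r s)) (den (fr r s)) = fr r s" using fr_eq[OF assms c] by simp
qed

text \<open>Only the vector space fields carry meaning. The operations use chosen representatives;
  \<open>fr_add\<close> and \<open>fr_smult\<close> show that the choice does not matter.\<close>

definition frac_mod :: "(complex, ('a \<times> 'a) set) module" where
  "frac_mod = \<lparr>carrier = {fr r s | r s. r \<in> carrier A \<and> s \<in> S}, mult = undefined, one = undefined,
     zero = fr \<zero> \<one>, add = (\<lambda>X Y. fr (num X \<otimes> den Y \<oplus> num Y \<otimes> den X) (den X \<otimes> den Y)),
     smult = (\<lambda>c X. fr (c \<odot> num X) (den X))\<rparr>"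

lemma frac_carrier: "carrier frac_mod = {fr r s | r s. r \<in> carrier A \<and> s \<in> S}"
  by (simp add: frac_mod_def)

lemma fr_closed [simp]: "\<lbrakk>r \<in> carrier A; s \<in> S\<rbrakk> \<Longrightarrow> fr r s \<in> carrier frac_mod"
  by (auto simp: frac_carrier)

lemma fr_zero:
  assumes "s \<in> S"
  shows "fr \<zero> s = \<zero>\<^bsub>frac_mod\<^esub>"
  using assms S_one by (simp add: frac_mod_def fr_eq) (auto intro!: bexI[OF _ S_one])

lemma fr_add:
  assumes "r \<in> carrier A" "r' \<in> carrier A" "s \<in> S"
  shows "fr r s \<oplus>\<^bsub>frac_mod\<^esub> fr r' s = fr (r \<oplus> r') s"
proof -
  define a t where "a = num (fr r s)" and "t = den (fr r s)"
  define b u where "b = num (fr r' s)" and "u = den (fr r' s)"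
  have c: "a \<in> carrier A" "t \<in> S" "fr a t = fr r s" "b \<in> carrier A" "u \<in> S" "fr b u = fr r' s"
    using num_den[OF assms(1,3)] num_den[OF assms(2,3)] by (simp_all add: a_def t_def b_def u_def)
  obtain w w' where w: "w \<in> S" "a \<otimes> (s \<otimes> w) = r \<otimes> (t \<otimes> w)" and w': "w' \<in> S" "b \<otimes> (s \<otimes> w') = r' \<otimes> (u \<otimes> w')"
    using c fr_eq[OF c(1,2) assms(1,3)] fr_eq[OF c(4,5) assms(2,3)] by auto
  have 1: "a \<otimes> (u \<otimes> (s \<otimes> (w \<otimes> w'))) = (a \<otimes> (s \<otimes> w)) \<otimes> (u \<otimes> w')"
    using c(1,2,4,5) w(1) w'(1) assms by (simp add: m_assoc S_comm S_lcomm)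
  have 2: "b \<otimes> (t \<otimes> (s \<otimes> (w \<otimes> w'))) = (b \<otimes> (s \<otimes> w')) \<otimes> (t \<otimes> w)"
    using c(1,2,4,5) w(1) w'(1) assms by (simp add: m_assoc S_comm S_lcomm)
  have "(a \<otimes> u \<oplus> b \<otimes> t) \<otimes> (s \<otimes> (w \<otimes> w')) = (r \<oplus> r') \<otimes> (t \<otimes> u \<otimes> (w \<otimes> w'))"
    using c w(1) w'(1) assms 1[unfolded w(2)] 2[unfolded w'(2)]
    by (simp add: l_distr m_assoc) (simp add: m_assoc S_comm S_lcomm)
  then have "fr (a \<otimes> u \<oplus> b \<otimes> t) (t \<otimes> u) = fr (r \<oplus> r') s"
    using c w w' assms S_mult by (subst fr_eq) auto
  then show ?thesis by (simp add: frac_mod_def a_def b_def t_def u_def)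
qed

lemma fr_smult:
  assumes "r \<in> carrier A" "s \<in> S"
  shows "c \<odot>\<^bsub>frac_mod\<^esub> fr r s = fr (c \<odot> r) s"
proof -
  define a t where "a = num (fr r s)" and "t = den (fr r s)"
  have at: "a \<in> carrier A" "t \<in> S" "fr a t = fr r s"
    using num_den[OF assms] by (simp_all add: a_def t_def)
  then obtain w where w: "w \<in> S" "a \<otimes> (s \<otimes> w) = r \<otimes> (t \<otimes> w)" using fr_eq[OF at(1,2) assms] by auto
  then have "(c \<odot> a) \<otimes> (s \<otimes> w) = (c \<odot> r) \<otimes> (t \<otimes> w)" using at assms by simp
  then have "\<exists>w\<in>S. (c \<odot> a) \<otimes> (s \<otimes> w) = (c \<odot> r) \<otimes> (t \<otimes> w)" using w(1) by blast
  then have "fr (c \<odot> a) t = fr (c \<odot> r) s"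
    by (rule iffD2[OF fr_eq, rotated -1]) (simp_all add: at assms)
  then show ?thesis by (simp add: frac_mod_def a_def t_def)
qed

lemma frac_common2:
  assumes "X \<in> carrier frac_mod" "Y \<in> carrier frac_mod"
  obtains r r' s where "r \<in> carrier A" "r' \<in> carrier A" "s \<in> S" "X = fr r s" "Y = fr r' s"
proof -
  obtain a s b t where c: "X = fr a s" "Y = fr b t" "a \<in> carrier A" "s \<in> S" "b \<in> carrier A" "t \<in> S"
    using assms unfolding frac_carrier by blast
  have "X = fr (a \<otimes> t) (s \<otimes> t)" "Y = fr (b \<otimes> s) (s \<otimes> t)"
    using c fr_expand[of a s t] fr_expand[of b t s] S_comm[of t s] by simp_all
  then show ?thesis using that[of "a \<otimes> t" "b \<otimes> s" "s \<otimes> t"] c S_mult by simp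
qed

lemma frac_common3:
  assumes "X \<in> carrier frac_mod" "Y \<in> carrier frac_mod" "Z \<in> carrier frac_mod"
  obtains r r' r'' s where "r \<in> carrier A" "r' \<in> carrier A" "r'' \<in> carrier A" "s \<in> S" "X = fr r s" "Y = fr r' s" "Z = fr r'' s"
proof -
  obtain a a' s where c: "X = fr a s" "Y = fr a' s" "a \<in> carrier A" "a' \<in> carrier A" "s \<in> S"
    using frac_common2[OF assms(1,2)] by metis
  obtain b t where d: "Z = fr b t" "b \<in> carrier A" "t \<in> S" using assms(3) unfolding frac_carrier by blast
  have "X = fr (a \<otimes> t) (s \<otimes> t)" "Y = fr (a' \<otimes> t) (s \<otimes> t)" "Z = fr (b \<otimes> s) (s \<otimes> t)"
    using c d fr_expand[of a s t] fr_expand[of a' s t] fr_expand[of b t s] S_comm[of t s] by simp_all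
  then show ?thesis using that[of "a \<otimes> t" "a' \<otimes> t" "b \<otimes> s" "s \<otimes> t"] c d S_mult by simp
qed

lemma frac_elem:
  assumes "X \<in> carrier frac_mod"
  obtains r s where "r \<in> carrier A" "s \<in> S" "X = fr r s"
  using assms unfolding frac_carrier by blast

lemma cvs_frac: "cvs frac_mod"
proof -
  have zero: "\<zero>\<^bsub>frac_mod\<^esub> \<in> carrier frac_mod" using fr_zero[OF S_one] fr_closed[OF zero_closed S_one] by simp
  have ab: "abelian_group frac_mod"
  proof (rule abelian_groupI)
    fix X Y assume "X \<in> carrier frac_mod" "Y \<in> carrier frac_mod"
    then obtain r r' s where "r \<in> carrier A" "r' \<in> carrier A" "s \<in> S" "X = fr r s" "Y = fr r' s" by (rule frac_common2)
    then show "X \<oplus>\<^bsub>frac_mod\<^esub> Y \<in> carrier frac_mod" "X \<oplus>\<^bsub>frac_mod\<^esub> Y = Y \<oplus>\<^bsub>frac_mod\<^esub> X"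
      by (simp_all add: fr_add a_comm)
  next
    fix X Y Z assume "X \<in> carrier frac_mod" "Y \<in> carrier frac_mod" "Z \<in> carrier frac_mod"
    then obtain r r' r'' s where "r \<in> carrier A" "r' \<in> carrier A" "r'' \<in> carrier A" "s \<in> S" "X = fr r s" "Y = fr r' s" "Z = fr r'' s"
      by (rule frac_common3)
    then show "X \<oplus>\<^bsub>frac_mod\<^esub> Y \<oplus>\<^bsub>frac_mod\<^esub> Z = X \<oplus>\<^bsub>frac_mod\<^esub> (Y \<oplus>\<^bsub>frac_mod\<^esub> Z)"
      by (simp add: fr_add a_assoc)
  next
    fix X assume "X \<in> carrier frac_mod"
    then obtain r s where r: "r \<in> carrier A" "s \<in> S" "X = fr r s" by (rule frac_elem)
    then show "\<zero>\<^bsub>frac_mod\<^esub> \<oplus>\<^bsub>frac_mod\<^esub> X = X" using fr_add[of \<zero> r s] by (simp add: fr_zero)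
    show "\<exists>Y\<in>carrier frac_mod. Y \<oplus>\<^bsub>frac_mod\<^esub> X = \<zero>\<^bsub>frac_mod\<^esub>"
      using r by (intro bexI[of _ "fr (\<ominus> r) s"]) (simp_all add: fr_add l_neg fr_zero)
  qed (rule zero)
  show ?thesis
  proof (intro cvs.intro cvs_axioms.intro ab)
    fix X Y c assume "X \<in> carrier frac_mod" "Y \<in> carrier frac_mod"
    then obtain r r' s where "r \<in> carrier A" "r' \<in> carrier A" "s \<in> S" "X = fr r s" "Y = fr r' s" by (rule frac_common2)
    then show "c \<odot>\<^bsub>frac_mod\<^esub> (X \<oplus>\<^bsub>frac_mod\<^esub> Y) = c \<odot>\<^bsub>frac_mod\<^esub> X \<oplus>\<^bsub>frac_mod\<^esub> c \<odot>\<^bsub>frac_mod\<^esub> Y"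
      by (simp add: fr_add fr_smult smult_r_distr)
  next
    fix X c d assume "X \<in> carrier frac_mod"
    then obtain r s where "r \<in> carrier A" "s \<in> S" "X = fr r s" by (rule frac_elem)
    then show "c \<odot>\<^bsub>frac_mod\<^esub> X \<in> carrier frac_mod" "1 \<odot>\<^bsub>frac_mod\<^esub> X = X"
      "(c + d) \<odot>\<^bsub>frac_mod\<^esub> X = c \<odot>\<^bsub>frac_mod\<^esub> X \<oplus>\<^bsub>frac_mod\<^esub> d \<odot>\<^bsub>frac_mod\<^esub> X"
      "c \<odot>\<^bsub>frac_mod\<^esub> (d \<odot>\<^bsub>frac_mod\<^esub> X) = (c * d) \<odot>\<^bsub>frac_mod\<^esub> X"
      by (simp_all add: fr_add fr_smult smult_l_distr)
  qed
qed

text \<open>Left multiplication changes numerators only, so it is compatible with right fractions at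
  once. The Ore condition is reserved for inverting it, in \<open>lmul_bij\<close>.\<close>

definition lmul :: "'a \<Rightarrow> ('a \<times> 'a) set \<Rightarrow> ('a \<times> 'a) set" where
  "lmul a = (\<lambda>X\<in>carrier frac_mod. fr (a \<otimes> num X) (den X))"

lemma lmul_fr:
  assumes "a \<in> carrier A" "r \<in> carrier A" "s \<in> S"
  shows "lmul a (fr r s) = fr (a \<otimes> r) s"
proof -
  define b t where "b = num (fr r s)" and "t = den (fr r s)"
  have bt: "b \<in> carrier A" "t \<in> S" "fr b t = fr r s"
    using num_den[OF assms(2,3)] by (simp_all add: b_def t_def)
  then obtain w where w: "w \<in> S" "b \<otimes> (s \<otimes> w) = r \<otimes> (t \<otimes> w)" using fr_eq[OF bt(1,2) assms(2,3)] by auto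
  then have "(a \<otimes> b) \<otimes> (s \<otimes> w) = (a \<otimes> r) \<otimes> (t \<otimes> w)" using bt assms by (simp add: m_assoc)
  then have "fr (a \<otimes> b) t = fr (a \<otimes> r) s" using bt assms w by (subst fr_eq) auto
  then show ?thesis using assms by (simp add: lmul_def b_def t_def)
qed

lemma lmul_closed: "a \<in> carrier A \<Longrightarrow> lmul a \<in> carrier (End_alg frac_mod)"
proof -
  assume a: "a \<in> carrier A"
  interpret V: cvs frac_mod by (rule cvs_frac)
  show ?thesis
  proof (rule V.EndI)
    fix X Y assume "X \<in> carrier frac_mod" "Y \<in> carrier frac_mod"
    then obtain r r' s where "r \<in> carrier A" "r' \<in> carrier A" "s \<in> S" "X = fr r s" "Y = fr r' s" by (rule frac_common2)
    then show "lmul a (X \<oplus>\<^bsub>frac_mod\<^esub> Y) = lmul a X \<oplus>\<^bsub>frac_mod\<^esub> lmul a Y"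
      using a by (simp add: fr_add lmul_fr r_distr)
  next
    fix X c assume "X \<in> carrier frac_mod"
    then obtain r s where "r \<in> carrier A" "s \<in> S" "X = fr r s" by (rule frac_elem)
    then show "lmul a X \<in> carrier frac_mod" "lmul a (c \<odot>\<^bsub>frac_mod\<^esub> X) = c \<odot>\<^bsub>frac_mod\<^esub> lmul a X"
      using a by (simp_all add: fr_smult lmul_fr)
  qed (simp add: lmul_def)
qed

lemma lmul_hom: "lmul \<in> alg_hom A (End_alg frac_mod)"
proof -
  interpret V: cvs frac_mod by (rule cvs_frac)
  interpret T: calg "End_alg frac_mod" by (rule V.calg_End)
  show ?thesis
  proof (rule alg_homI)
    fix a b assume ab: "a \<in> carrier A" "b \<in> carrier A"
    show "lmul (a \<otimes> b) = lmul a \<otimes>\<^bsub>End_alg frac_mod\<^esub> lmul b"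
    proof (rule V.End_eqI[OF lmul_closed T.m_closed[OF lmul_closed lmul_closed]])
      fix X assume X: "X \<in> carrier frac_mod"
      then obtain r s where "r \<in> carrier A" "s \<in> S" "X = fr r s" by (rule frac_elem)
      with X ab show "lmul (a \<otimes> b) X = (lmul a \<otimes>\<^bsub>End_alg frac_mod\<^esub> lmul b) X"
        by (simp add: lmul_fr compose_eq m_assoc)
    qed (use ab in auto)
    show "lmul (a \<oplus> b) = lmul a \<oplus>\<^bsub>End_alg frac_mod\<^esub> lmul b"
    proof (rule V.End_eqI[OF lmul_closed T.a_closed[OF lmul_closed lmul_closed]])
      fix X assume X: "X \<in> carrier frac_mod"
      then obtain r s where "r \<in> carrier A" "s \<in> S" "X = fr r s" by (rule frac_elem)
      with X ab show "lmul (a \<oplus> b) X = (lmul a \<oplus>\<^bsub>End_alg frac_mod\<^esub> lmul b) X"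
        by (simp add: lmul_fr fr_add l_distr)
    qed (use ab in auto)
  next
    fix a c assume a: "a \<in> carrier A"
    show "lmul (c \<odot> a) = c \<odot>\<^bsub>End_alg frac_mod\<^esub> lmul a"
    proof (rule V.End_eqI[OF lmul_closed T.smult_closed[OF lmul_closed]])
      fix X assume X: "X \<in> carrier frac_mod"
      then obtain r s where "r \<in> carrier A" "s \<in> S" "X = fr r s" by (rule frac_elem)
      with X a show "lmul (c \<odot> a) X = (c \<odot>\<^bsub>End_alg frac_mod\<^esub> lmul a) X"
        by (simp add: lmul_fr fr_smult)
    qed (use a in auto)
  next
    show "lmul \<one> = \<one>\<^bsub>End_alg frac_mod\<^esub>"
    proof (rule V.End_eqI[OF lmul_closed T.one_closed])
      fix X assume X: "X \<in> carrier frac_mod"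
      then obtain r s where "r \<in> carrier A" "s \<in> S" "X = fr r s" by (rule frac_elem)
      with X show "lmul \<one> X = \<one>\<^bsub>End_alg frac_mod\<^esub> X" by (simp add: lmul_fr)
    qed simp
  qed (rule lmul_closed)
qed

text \<open>Injectivity is \<open>right_rev\<close>: an element killed by \<open>e\<close> from the
  left is killed by some \<open>u\<close> from the right, which makes its fractions zero.
  Surjectivity is \<open>right_ore\<close>: from \<open>r u = e v\<close> follows
  \<open>r s^-1 = e v (s u)^-1\<close>.\<close>

lemma lmul_bij:
  assumes e: "e \<in> S"
  shows "bij_betw (lmul e) (carrier frac_mod) (carrier frac_mod)"
proof -
  interpret V: cvs frac_mod by (rule cvs_frac)
  have ec: "e \<in> carrier A" using e by simp
  have "inj_on (lmul e) (carrier frac_mod)"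
  proof (rule inj_onI)
    fix X Y assume XY: "X \<in> carrier frac_mod" "Y \<in> carrier frac_mod" "lmul e X = lmul e Y"
    obtain r r' s where c: "r \<in> carrier A" "r' \<in> carrier A" "s \<in> S" "X = fr r s" "Y = fr r' s"
      using XY(1,2) by (rule frac_common2)
    then have "\<exists>w\<in>S. e \<otimes> r \<otimes> w = e \<otimes> r' \<otimes> w" using XY(3) ec fr_same[of "e \<otimes> r" "e \<otimes> r'" s] by (simp add: lmul_fr)
    then obtain w where w: "w \<in> S" "e \<otimes> r \<otimes> w = e \<otimes> r' \<otimes> w" by blast
    then have "e \<otimes> (r \<otimes> w \<ominus> r' \<otimes> w) = \<zero>" using c ec by (simp add: minus_eq r_distr r_minus r_neg flip: m_assoc)
    then obtain u where u: "u \<in> S" "(r \<otimes> w \<ominus> r' \<otimes> w) \<otimes> u = \<zero>" using right_rev[OF e, of "r \<otimes> w \<ominus> r' \<otimes> w"] c w by auto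
    then have "r \<otimes> w \<otimes> u \<ominus> r' \<otimes> w \<otimes> u = \<zero>" using c w by (simp add: minus_eq l_distr l_minus)
    then have "r \<otimes> (w \<otimes> u) = r' \<otimes> (w \<otimes> u)" using c w u by (simp add: m_assoc)
    then show "X = Y" using fr_same[OF c(1,2,3)] c(4,5) S_mult[OF w(1) u(1)] by blast
  qed
  moreover have "lmul e ` carrier frac_mod = carrier frac_mod"
  proof
    show "lmul e ` carrier frac_mod \<subseteq> carrier frac_mod" using V.EndD(2)[OF lmul_closed[OF ec]] by blast
    show "carrier frac_mod \<subseteq> lmul e ` carrier frac_mod"
    proof
      fix X assume "X \<in> carrier frac_mod"
      then obtain r s where c: "r \<in> carrier A" "s \<in> S" "X = fr r s" by (rule frac_elem)
      obtain u v where u: "u \<in> S" "v \<in> carrier A" "r \<otimes> u = e \<otimes> v" using right_ore[OF e c(1)] by blast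
      have su: "s \<otimes> u \<in> S" using c u S_mult by blast
      have "X = fr (r \<otimes> u) (s \<otimes> u)" using fr_expand[OF c(1,2) u(1)] c(3) by simp
      also have "\<dots> = lmul e (fr v (s \<otimes> u))" unfolding u(3) using lmul_fr[OF ec u(2) su] by simp
      finally show "X \<in> lmul e ` carrier frac_mod" using fr_closed[OF u(2) su] by blast
    qed
  qed
  ultimately show ?thesis by (simp add: bij_betw_def)
qed

lemma lmul_unit:
  assumes e: "e \<in> S"
  shows "\<exists>y\<in>carrier (End_alg frac_mod). lmul e \<otimes>\<^bsub>End_alg frac_mod\<^esub> y = \<one>\<^bsub>End_alg frac_mod\<^esub> \<and>
    y \<otimes>\<^bsub>End_alg frac_mod\<^esub> lmul e = \<one>\<^bsub>End_alg frac_mod\<^esub>"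
proof -
  interpret V: cvs frac_mod by (rule cvs_frac)
  interpret T: calg "End_alg frac_mod" by (rule V.calg_End)
  have E: "lmul e \<in> carrier (End_alg frac_mod)" using e by (intro lmul_closed) simp
  note bij = lmul_bij[OF e]
  define y where "y = (\<lambda>X\<in>carrier frac_mod. inv_into (carrier frac_mod) (lmul e) X)"
  have y_in: "y X \<in> carrier frac_mod" and e_y: "lmul e (y X) = X" if "X \<in> carrier frac_mod" for X
    using that bij by (auto simp: y_def bij_betw_def inv_into_into f_inv_into_f)
  have y_e: "y (lmul e X) = X" if "X \<in> carrier frac_mod" for X
    using that bij V.EndD(2)[OF E that] by (auto simp: y_def bij_betw_def inv_into_f_f)
  have "y \<in> carrier (End_alg frac_mod)"
  proof (rule V.EndI)
    fix X Y assume XY: "X \<in> carrier frac_mod" "Y \<in> carrier frac_mod"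
    have "lmul e (y X \<oplus>\<^bsub>frac_mod\<^esub> y Y) = X \<oplus>\<^bsub>frac_mod\<^esub> Y" using XY y_in e_y V.EndD(3)[OF E] by simp
    then show "y (X \<oplus>\<^bsub>frac_mod\<^esub> Y) = y X \<oplus>\<^bsub>frac_mod\<^esub> y Y"
      using y_e[of "y X \<oplus>\<^bsub>frac_mod\<^esub> y Y"] XY y_in by simp
  next
    fix X c assume X: "X \<in> carrier frac_mod"
    have "lmul e (c \<odot>\<^bsub>frac_mod\<^esub> y X) = c \<odot>\<^bsub>frac_mod\<^esub> X" using X y_in e_y V.EndD(4)[OF E] by simp
    then show "y (c \<odot>\<^bsub>frac_mod\<^esub> X) = c \<odot>\<^bsub>frac_mod\<^esub> y X"
      using y_e[of "c \<odot>\<^bsub>frac_mod\<^esub> y X"] X y_in by simp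
  qed (simp_all add: y_in, simp add: y_def)
  moreover from this have "lmul e \<otimes>\<^bsub>End_alg frac_mod\<^esub> y = \<one>\<^bsub>End_alg frac_mod\<^esub>" "y \<otimes>\<^bsub>End_alg frac_mod\<^esub> lmul e = \<one>\<^bsub>End_alg frac_mod\<^esub>"
    using E T.m_closed T.one_closed by (auto intro!: V.End_eqI simp: compose_eq e_y y_e simp del: End_alg_simps(1,2))
      (auto simp: compose_eq e_y y_e)
  ultimately show ?thesis by blast
qed

text \<open>Evaluation at the fraction 1 shows that some \<open>w\<close> in \<open>S\<close> kills
  \<open>a\<close> from the right; \<open>left_rev\<close> moves the torsion to the left.\<close>

lemma lmul_zero:
  assumes "a \<in> carrier A" "lmul a = \<zero>\<^bsub>End_alg frac_mod\<^esub>"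
  shows "\<exists>u\<in>S. u \<otimes> a = \<zero>"
proof -
  have "lmul a (fr \<one> \<one>) = \<zero>\<^bsub>frac_mod\<^esub>" using assms(2) S_one by simp
  then have "fr a \<one> = fr \<zero> \<one>" using assms(1) S_one fr_zero[OF S_one] by (simp add: lmul_fr)
  then obtain w where "w \<in> S" "a \<otimes> w = \<zero>" using fr_same[of a \<zero> \<one>] assms(1) S_one by auto
  then show ?thesis using left_rev assms(1) by blast
qed

end

section \<open>Locally ad-nilpotent elements\<close>

context calg
begin

definition ad :: "'a \<Rightarrow> 'a \<Rightarrow> 'a" where "ad e a = e \<otimes> a \<ominus> a \<otimes> e"

definition nilp :: "'a \<Rightarrow> 'a \<Rightarrow> bool" where "nilp e a \<longleftrightarrow> (\<exists>k. (ad e ^^ k) a = \<zero>)"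

context
  fixes e assumes e [simp]: "e \<in> carrier A"
begin

lemma ad_closed [simp]: "a \<in> carrier A \<Longrightarrow> ad e a \<in> carrier A"
  by (simp add: ad_def)

lemma ad_zero [simp]: "ad e \<zero> = \<zero>"
  by (simp add: ad_def)

lemma ad_add: "\<lbrakk>a \<in> carrier A; b \<in> carrier A\<rbrakk> \<Longrightarrow> ad e (a \<oplus> b) = ad e a \<oplus> ad e b"
  by (simp add: ad_def minus_eq l_distr r_distr minus_add a_ac)

lemma ad_mult: "\<lbrakk>a \<in> carrier A; b \<in> carrier A\<rbrakk> \<Longrightarrow> ad e (a \<otimes> b) = ad e a \<otimes> b \<oplus> a \<otimes> ad e b"
  by (simp add: ad_def minus_eq l_distr r_distr l_minus r_minus m_assoc a_assoc r_neg1 r_neg2)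

lemma ad_pow_closed [simp]: "a \<in> carrier A \<Longrightarrow> (ad e ^^ k) a \<in> carrier A"
  by (induction k) auto

lemma ad_pow_zero [simp]: "(ad e ^^ k) \<zero> = \<zero>"
  by (induction k) auto

lemma ad_pow_add: "\<lbrakk>a \<in> carrier A; b \<in> carrier A\<rbrakk> \<Longrightarrow> (ad e ^^ k) (a \<oplus> b) = (ad e ^^ k) a \<oplus> (ad e ^^ k) b"
  by (induction k) (auto simp: ad_add)

lemma nilp_add:
  assumes "a \<in> carrier A" "b \<in> carrier A" "nilp e a" "nilp e b"
  shows "nilp e (a \<oplus> b)"
proof -
  obtain k m where "(ad e ^^ k) a = \<zero>" "(ad e ^^ m) b = \<zero>" using assms by (auto simp: nilp_def)
  then have "(ad e ^^ (m + k)) a = \<zero>" "(ad e ^^ (k + m)) b = \<zero>" by (simp_all add: funpow_add)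
  then show ?thesis using assms unfolding nilp_def
    by (intro exI[of _ "k + m"]) (simp add: ad_pow_add add.commute)
qed

lemma ad_smult: "a \<in> carrier A \<Longrightarrow> ad e (c \<odot> a) = c \<odot> ad e a"
  by (simp add: ad_def minus_eq smult_r_distr smult_minus_right)

lemma nilp_smult:
  assumes "a \<in> carrier A" "nilp e a"
  shows "nilp e (c \<odot> a)"
proof -
  have "(ad e ^^ k) (c \<odot> a) = c \<odot> (ad e ^^ k) a" for k
    using assms(1) by (induction k) (simp_all add: ad_smult)
  then show ?thesis using assms(2) unfolding nilp_def by (metis smult_zero_right)
qed

text \<open>In \<open>ad e (x a) = (ad e x) a + x (ad e a)\<close> the factor \<open>ad e x\<close>
  is a constant for \<open>ad e\<close>, so the first summand is nilpotent along with
  \<open>a\<close>; the second has smaller order and is covered by induction.\<close>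

lemma nilp_mult:
  assumes x: "x \<in> carrier A" "ad e (ad e x) = \<zero>" and a: "a \<in> carrier A" "nilp e a"
  shows "nilp e (x \<otimes> a)"
proof -
  have y: "(ad e ^^ k) (ad e x \<otimes> b) = ad e x \<otimes> (ad e ^^ k) b" if "b \<in> carrier A" for b k
    using that x by (induction k) (simp_all add: ad_mult)
  have "nilp e (x \<otimes> a)" if "(ad e ^^ k) a = \<zero>" "a \<in> carrier A" for k a
    using that
  proof (induction k arbitrary: a)
    case 0
    then show ?case using x by (auto simp: nilp_def intro: exI[of _ 0])
  next
    case (Suc k)
    then have "nilp e (x \<otimes> ad e a)" by (simp add: funpow_swap1)
    moreover have "nilp e (ad e x \<otimes> a)" using Suc.prems y[of a "Suc k"] x unfolding nilp_def by (intro exI[of _ "Suc k"]) simp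
    ultimately have "nilp e (ad e (x \<otimes> a))" using x Suc.prems by (simp add: ad_mult nilp_add)
    then obtain m where "(ad e ^^ m) (ad e (x \<otimes> a)) = \<zero>" by (auto simp: nilp_def)
    then show ?case unfolding nilp_def by (intro exI[of _ "Suc m"]) (simp add: funpow_swap1)
  qed
  with a show ?thesis by (auto simp: nilp_def)
qed

lemma mult_ad:
  assumes a: "a \<in> carrier A"
  shows "e \<otimes> a = a \<otimes> e \<oplus> ad e a" "a \<otimes> e = e \<otimes> a \<ominus> ad e a"
proof -
  have "x = y \<oplus> (x \<ominus> y)" "y = x \<ominus> (x \<ominus> y)" if "x \<in> carrier A" "y \<in> carrier A" for x y
    using that a_lcomm[of y x "\<ominus> y"] by (simp_all add: minus_eq minus_add r_neg r_neg2)
  then show "e \<otimes> a = a \<otimes> e \<oplus> ad e a" "a \<otimes> e = e \<otimes> a \<ominus> ad e a"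
    unfolding ad_def using a by auto
qed

text \<open>Moving \<open>e\<close> past \<open>a\<close> leaves \<open>ad e a\<close>, whose order
  of nilpotency is smaller by one. Each step therefore costs one further power of
  \<open>e\<close>.\<close>

lemma nilp_ore:
  assumes "nilp e a" "a \<in> carrier A"
  shows "\<exists>m v. v \<in> carrier A \<and> e [^] (m :: nat) \<otimes> a = v \<otimes> e" "\<exists>m v. v \<in> carrier A \<and> a \<otimes> e [^] (m :: nat) = e \<otimes> v"
proof -
  obtain k where k: "(ad e ^^ k) a = \<zero>" using assms by (auto simp: nilp_def)
  show "\<exists>m v. v \<in> carrier A \<and> e [^] (m :: nat) \<otimes> a = v \<otimes> e"
    using k assms(2)
  proof (induction k arbitrary: a)
    case 0
    then show ?case by (auto intro!: exI[of _ "0 :: nat"] exI[of _ \<zero>])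
  next
    case (Suc k)
    have "(ad e ^^ k) (ad e a) = \<zero>" using Suc.prems by (simp add: funpow_swap1)
    from Suc.IH[OF this ad_closed[OF Suc.prems(2)]]
    obtain m w where w: "w \<in> carrier A" "e [^] (m :: nat) \<otimes> ad e a = w \<otimes> e" by blast
    have "e [^] Suc m \<otimes> a = e [^] m \<otimes> (e \<otimes> a)" using Suc.prems by (simp add: m_assoc)
    also have "\<dots> = e [^] m \<otimes> a \<otimes> e \<oplus> e [^] m \<otimes> ad e a"
      unfolding mult_ad(1)[OF Suc.prems(2)] using Suc.prems by (simp add: r_distr m_assoc)
    also have "\<dots> = (e [^] m \<otimes> a \<oplus> w) \<otimes> e" unfolding w(2) using Suc.prems w(1) by (simp add: l_distr)
    finally show ?case using Suc.prems w(1) by (intro exI[of _ "Suc m"] exI[of _ "e [^] m \<otimes> a \<oplus> w"]) simp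
  qed
  show "\<exists>m v. v \<in> carrier A \<and> a \<otimes> e [^] (m :: nat) = e \<otimes> v"
    using k assms(2)
  proof (induction k arbitrary: a)
    case 0
    then show ?case by (auto intro!: exI[of _ "0 :: nat"] exI[of _ \<zero>])
  next
    case (Suc k)
    have "(ad e ^^ k) (ad e a) = \<zero>" using Suc.prems by (simp add: funpow_swap1)
    from Suc.IH[OF this ad_closed[OF Suc.prems(2)]]
    obtain m w where w: "w \<in> carrier A" "ad e a \<otimes> e [^] (m :: nat) = e \<otimes> w" by blast
    have "a \<otimes> e [^] Suc m = (a \<otimes> e) \<otimes> e [^] m"
      unfolding nat_pow_Suc2[OF e] using Suc.prems by (simp add: m_assoc)
    also have "\<dots> = e \<otimes> (a \<otimes> e [^] m) \<ominus> ad e a \<otimes> e [^] m"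
      unfolding mult_ad(2)[OF Suc.prems(2)] using Suc.prems by (simp add: minus_eq l_distr l_minus m_assoc)
    also have "\<dots> = e \<otimes> (a \<otimes> e [^] m \<ominus> w)" unfolding w(2) using Suc.prems w(1) by (simp add: minus_eq r_distr r_minus)
    finally show ?case using Suc.prems w(1) by (intro exI[of _ "Suc m"] exI[of _ "a \<otimes> e [^] m \<ominus> w"]) simp
  qed
qed

text \<open>If \<open>a e = 0\<close>, then \<open>ad e a = e a\<close> is again killed by
  \<open>e\<close> from the right and has smaller order. Induction yields a power of
  \<open>e\<close> killing \<open>a\<close> from the left; the other case is symmetric.\<close>

lemma nilp_rev:
  assumes "nilp e a" "a \<in> carrier A"
  shows "a \<otimes> e = \<zero> \<Longrightarrow> \<exists>m. e [^] (m :: nat) \<otimes> a = \<zero>" "e \<otimes> a = \<zero> \<Longrightarrow> \<exists>m. a \<otimes> e [^] (m :: nat) = \<zero>"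
proof -
  obtain k where k: "(ad e ^^ k) a = \<zero>" using assms by (auto simp: nilp_def)
  assume ae: "a \<otimes> e = \<zero>"
  show "\<exists>m. e [^] (m :: nat) \<otimes> a = \<zero>"
    using k assms(2) ae
  proof (induction k arbitrary: a)
    case 0
    then show ?case by (auto intro!: exI[of _ "0 :: nat"])
  next
    case (Suc k)
    have ad: "ad e a = e \<otimes> a" using Suc.prems by (simp add: ad_def minus_eq)
    have "ad e a \<otimes> e = \<zero>" unfolding ad using Suc.prems by (simp add: m_assoc)
    then obtain m where "e [^] (m :: nat) \<otimes> ad e a = \<zero>"
      using Suc.IH[of "ad e a"] Suc.prems by (auto simp: funpow_swap1)
    then have "e [^] Suc m \<otimes> a = \<zero>" unfolding ad using Suc.prems by (simp add: m_assoc)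
    then show ?case by blast
  qed
next
  obtain k where k: "(ad e ^^ k) a = \<zero>" using assms by (auto simp: nilp_def)
  assume ea: "e \<otimes> a = \<zero>"
  show "\<exists>m. a \<otimes> e [^] (m :: nat) = \<zero>"
    using k assms(2) ea
  proof (induction k arbitrary: a)
    case 0
    then show ?case by (auto intro!: exI[of _ "0 :: nat"])
  next
    case (Suc k)
    have ad: "ad e a = \<ominus> (a \<otimes> e)" using Suc.prems by (simp add: ad_def minus_eq)
    have "e \<otimes> ad e a = \<zero>" unfolding ad using Suc.prems by (simp add: r_minus flip: m_assoc)
    then obtain m where "ad e a \<otimes> e [^] (m :: nat) = \<zero>"
      using Suc.IH[of "ad e a"] Suc.prems by (auto simp: funpow_swap1)
    then have "a \<otimes> e \<otimes> e [^] m = \<zero>" unfolding ad using Suc.prems by (simp add: l_minus)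
    then have "a \<otimes> e [^] Suc m = \<zero>" unfolding nat_pow_Suc2[OF e] using Suc.prems by (simp add: m_assoc)
    then show ?case by blast
  qed
qed

end

end

section \<open>Ore sets generated by commuting, locally ad-nilpotent elements\<close>

locale comm_gens = calg A for A :: "(complex, 'a, 'm) module_scheme" (structure) +
  fixes n :: nat and e :: "nat \<Rightarrow> 'a"
  assumes e_closed [simp]: "i < n \<Longrightarrow> e i \<in> carrier A"
    and e_comm: "\<lbrakk>i < n; j < n\<rbrakk> \<Longrightarrow> e i \<otimes> e j = e j \<otimes> e i"
    and e_nilp: "\<lbrakk>i < n; a \<in> carrier A\<rbrakk> \<Longrightarrow> nilp (e i) a"
begin

definition mons :: "'a set" where
  "mons = {lprod (\<lambda>i. e i [^] (k i :: nat)) [0..<n] | k. True}"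

text \<open>Monomials are given by exponents, while Ore conditions propagate one generator at a
  time; this induction mediates between the two.\<close>

lemma mons_induct [consumes 1, case_names one step]:
  assumes "s \<in> mons" "P \<one>" "\<And>i t. \<lbrakk>i < n; t \<in> carrier A; P t\<rbrakk> \<Longrightarrow> P (e i \<otimes> t)"
  shows "P s"
proof -
  have pow: "P (e i [^] m \<otimes> t)" if "i < n" "t \<in> carrier A" "P t" for i t and m :: nat
  proof (induction m)
    case (Suc m)
    then have "P (e i \<otimes> (e i [^] m \<otimes> t))" using assms(3) that by simp
    then show ?case using that nat_pow_Suc2[of "e i" m] by (simp add: m_assoc del: nat_pow_Suc)
  qed (use that in simp)
  obtain k where k: "s = lprod (\<lambda>i. e i [^] (k i :: nat)) [0..<n]" using assms(1) by (auto simp: mons_def)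
  have "P (lprod (\<lambda>i. e i [^] k i) l) \<and> lprod (\<lambda>i. e i [^] k i) l \<in> carrier A" if "set l \<subseteq> {..<n}" for l
    using that by (induction l) (auto intro!: pow assms(2))
  then show ?thesis unfolding k by (simp add: atLeast0LessThan)
qed

lemma mons_closed: "s \<in> mons \<Longrightarrow> s \<in> carrier A"
  by (induction rule: mons_induct) auto

lemma mons_one: "\<one> \<in> mons"
proof -
  have "lprod (\<lambda>i. e i [^] (0 :: nat)) l = \<one>" for l by (induction l) auto
  then show ?thesis unfolding mons_def by (auto intro!: exI[of _ "\<lambda>_. 0"])
qed

lemma e_pow_comm: "\<lbrakk>i < n; j < n\<rbrakk> \<Longrightarrow> e i \<otimes> e j [^] (m :: nat) = e j [^] m \<otimes> e i"
  by (induction m) (simp_all add: m_assoc[symmetric], simp add: m_assoc e_comm)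

lemma e_mons:
  assumes "i < n" "s \<in> mons"
  shows "e i \<otimes> s \<in> mons"
proof -
  obtain k where k: "s = lprod (\<lambda>i. e i [^] (k i :: nat)) [0..<n]" using assms(2) by (auto simp: mons_def)
  have "e i \<otimes> s = lprod ((\<lambda>i. e i [^] k i)(i := e i \<otimes> e i [^] k i)) [0..<n]"
    unfolding k using assms(1) by (intro lprod_update) (auto simp: e_pow_comm)
  also have "\<dots> = lprod (\<lambda>j. e j [^] ((k(i := Suc (k i))) j)) [0..<n]"
    using assms(1) by (intro lprod_cong) (auto simp: e_pow_comm)
  finally show ?thesis by (auto simp: mons_def)
qed

lemma mons_mult: "\<lbrakk>s \<in> mons; t \<in> mons\<rbrakk> \<Longrightarrow> s \<otimes> t \<in> mons"
  by (induction rule: mons_induct) (auto simp: m_assoc mons_closed intro: e_mons)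

lemma e_mons_comm: "\<lbrakk>s \<in> mons; i < n\<rbrakk> \<Longrightarrow> e i \<otimes> s = s \<otimes> e i"
proof (induction rule: mons_induct)
  case (step j t)
  have "e i \<otimes> (e j \<otimes> t) = e j \<otimes> (e i \<otimes> t)" using step m_assoc[of "e i" "e j" t] m_assoc[of "e j" "e i" t] e_comm[of i j] by simp
  with step show ?case by (simp add: m_assoc)
qed simp

lemma mons_comm: "\<lbrakk>s \<in> mons; t \<in> mons\<rbrakk> \<Longrightarrow> s \<otimes> t = t \<otimes> s"
proof (induction rule: mons_induct)
  case (step i s)
  have t: "t \<in> carrier A" using step mons_closed by blast
  have "e i \<otimes> s \<otimes> t = (e i \<otimes> t) \<otimes> s" using step t by (simp add: m_assoc)
  with e_mons_comm[OF step(4,1)] show ?case using step t by (simp add: m_assoc)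
qed (simp add: mons_closed)

lemma e_pow_mons: "i < n \<Longrightarrow> e i [^] (m :: nat) \<in> mons"
proof (induction m)
  case (Suc m)
  then show ?case using e_mons[of i "e i [^] m"] nat_pow_Suc2[of "e i" m] by (simp del: nat_pow_Suc)
qed (simp add: mons_one)

lemma ore_set_mons: "ore_set A mons"
proof (intro ore_set.intro ore_set_axioms.intro calg_axioms)
  show "mons \<subseteq> carrier A" using mons_closed by blast
next
  fix s r assume "s \<in> mons" "r \<in> carrier A"
  then show "\<exists>u\<in>mons. \<exists>v\<in>carrier A. u \<otimes> r = v \<otimes> s"
  proof (induction arbitrary: r rule: mons_induct)
    case one
    then show ?case by (intro bexI[of _ \<one>] bexI[of _ r]) (auto simp: mons_one)
  next
    case (step i t)
    \<comment> \<open>The numerator first crosses \<open>t\<close> by induction, then what results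
      crosses the single generator \<open>e i\<close> by nilpotency. On the right-hand side the
      order is reversed.\<close>
    obtain u v where u: "u \<in> mons" "v \<in> carrier A" "u \<otimes> r = v \<otimes> t" using step by meson
    obtain m w where w: "w \<in> carrier A" "e i [^] (m :: nat) \<otimes> v = w \<otimes> e i"
      using nilp_ore(1)[OF e_closed e_nilp] step u(2) by meson
    have "e i [^] m \<otimes> u \<otimes> r = (e i [^] m \<otimes> v) \<otimes> t"
      using step u(1,2) mons_closed[OF u(1)] by (simp add: m_assoc u(3))
    also have "\<dots> = w \<otimes> (e i \<otimes> t)" unfolding w(2) using step w(1) by (simp add: m_assoc)
    finally show ?case using w(1) mons_mult[OF e_pow_mons[OF step(1)] u(1)] by blast
  qed
next
  fix s r assume "s \<in> mons" "r \<in> carrier A"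
  then show "\<exists>u\<in>mons. \<exists>v\<in>carrier A. r \<otimes> u = s \<otimes> v"
  proof (induction arbitrary: r rule: mons_induct)
    case one
    then show ?case by (intro bexI[of _ \<one>] bexI[of _ r]) (auto simp: mons_one)
  next
    case (step i t)
    obtain m w where w: "w \<in> carrier A" "r \<otimes> e i [^] (m :: nat) = e i \<otimes> w"
      using nilp_ore(2)[OF e_closed e_nilp] step by meson
    obtain u v where u: "u \<in> mons" "v \<in> carrier A" "w \<otimes> u = t \<otimes> v" using step w(1) by meson
    have "r \<otimes> (e i [^] m \<otimes> u) = (r \<otimes> e i [^] m) \<otimes> u"
      using step mons_closed[OF u(1)] by (simp add: m_assoc)
    also have "\<dots> = e i \<otimes> t \<otimes> v" unfolding w(2) using step w(1) u(2) mons_closed[OF u(1)] by (simp add: m_assoc u(3))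
    finally show ?case using u(2) mons_mult[OF e_pow_mons[OF step(1)] u(1)] by blast
  qed
next
  fix s r assume "s \<in> mons" "r \<in> carrier A" "r \<otimes> s = \<zero>"
  then show "\<exists>u\<in>mons. u \<otimes> r = \<zero>"
  proof (induction arbitrary: r rule: mons_induct)
    case one
    then show ?case by (intro bexI[of _ \<one>]) (auto simp: mons_one)
  next
    case (step i t)
    have "(r \<otimes> e i) \<otimes> t = \<zero>" using step by (simp add: m_assoc)
    then obtain u where u: "u \<in> mons" "u \<otimes> (r \<otimes> e i) = \<zero>" using step(3)[of "r \<otimes> e i"] step(1,4) by fastforce
    have "(u \<otimes> r) \<otimes> e i = \<zero>" using u step mons_closed[OF u(1)] by (simp add: m_assoc)
    then obtain m where "e i [^] (m :: nat) \<otimes> (u \<otimes> r) = \<zero>"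
      using nilp_rev(1)[OF e_closed e_nilp] step mons_closed[OF u(1)] by (meson m_closed)
    then have "(e i [^] m \<otimes> u) \<otimes> r = \<zero>" using step mons_closed[OF u(1)] by (simp add: m_assoc)
    then show ?case using mons_mult[OF e_pow_mons[OF step(1)] u(1)] by blast
  qed
next
  fix s r assume "s \<in> mons" "r \<in> carrier A" "s \<otimes> r = \<zero>"
  then show "\<exists>u\<in>mons. r \<otimes> u = \<zero>"
  proof (induction arbitrary: r rule: mons_induct)
    case one
    then show ?case by (intro bexI[of _ \<one>]) (auto simp: mons_one)
  next
    case (step i t)
    have "e i \<otimes> (t \<otimes> r) = \<zero>" using step by (simp add: m_assoc)
    then obtain m where "(t \<otimes> r) \<otimes> e i [^] (m :: nat) = \<zero>"
      using nilp_rev(2)[OF e_closed e_nilp] step by (meson m_closed)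
    then have "t \<otimes> (r \<otimes> e i [^] m) = \<zero>" using step by (simp add: m_assoc)
    then obtain u where u: "u \<in> mons" "(r \<otimes> e i [^] m) \<otimes> u = \<zero>" using step(3)[of "r \<otimes> e i [^] m"] step(1,4) by fastforce
    then have "r \<otimes> (e i [^] m \<otimes> u) = \<zero>" using step mons_closed[OF u(1)] by (simp add: m_assoc)
    then show ?case using mons_mult[OF e_pow_mons[OF step(1)] u(1)] by blast
  qed
qed (simp_all add: mons_one mons_mult mons_comm)

end

section \<open>The Ore set of \<open>U(\<s>\<^sub>n)\<close>\<close>

abbreviation "Us n \<equiv> enveloping_alg (s_lie n)"
abbreviation "inc n \<equiv> enveloping_incl (s_lie n)"

lemma inc_zero: "inc n (0\<^sub>m n n, 0\<^sub>v n) = \<zero>\<^bsub>Us n\<^esub>"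
proof -
  interpret L: lie_ops "s_lie n" by (rule lie_ops_s_lie)
  have z: "(0\<^sub>m n n, 0\<^sub>v n) \<in> carrier (s_lie n)" by simp
  have "(0\<^sub>m n n, 0\<^sub>v n) = 0 \<odot>\<^bsub>s_lie n\<^esub> (0\<^sub>m n n, 0\<^sub>v n :: complex vec)" by (auto intro!: eq_matI eq_vecI)
  then have "inc n (0\<^sub>m n n, 0\<^sub>v n) = 0 \<odot>\<^bsub>Us n\<^esub> inc n (0\<^sub>m n n, 0\<^sub>v n)"
    using L.incl_smult[OF z, of 0] by metis
  then show ?thesis using L.incl_closed[OF z] by simp
qed

text \<open>Bracketing with \<open>e_i\<close> sends \<open>(A, v)\<close> into C^n, where a second
  bracket gives zero. So \<open>ad e_i\<close> squares to zero on the Lie algebra, and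
  \<open>nilp_mult\<close> extends nilpotency to products.\<close>

lemma comm_gens_envelope: "comm_gens (Us n) n (\<lambda>i. inc n (s_vec n i))"
proof -
  interpret L: lie_ops "s_lie n" by (rule lie_ops_s_lie)
  have vv: "lie_bracket (s_lie n) (s_vec n i) (0\<^sub>m n n, v) = (0\<^sub>m n n, 0\<^sub>v n)" if "v \<in> carrier_vec n" for i v
    using that by (auto simp: s_vec_def intro!: eq_matI eq_vecI)
  have comm: "inc n (s_vec n i) \<otimes>\<^bsub>Us n\<^esub> inc n (0\<^sub>m n n, v) = inc n (0\<^sub>m n n, v) \<otimes>\<^bsub>Us n\<^esub> inc n (s_vec n i)"
    if v: "v \<in> carrier_vec n" for i v
  proof -
    have c: "(0\<^sub>m n n, v) \<in> carrier (s_lie n)" using v by simp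
    show ?thesis
      using L.incl_bracket[OF s_vec_carrier[of n i] c] L.incl_closed[OF s_vec_carrier[of n i]] L.incl_closed[OF c]
      unfolding vv[OF v] inc_zero by simp
  qed
  have ad: "L.U.ad (inc n (s_vec n i)) (inc n x) = inc n (lie_bracket (s_lie n) (s_vec n i) x)" if x: "x \<in> carrier (s_lie n)" for i x
    using L.incl_closed[OF x] L.incl_closed[OF s_vec_carrier] L.incl_closed[OF L.bracket_closed[OF s_vec_carrier x]]
    unfolding L.U.ad_def L.incl_bracket[OF s_vec_carrier x]
    by (simp add: L.U.minus_eq L.U.a_ac L.U.r_neg L.U.r_neg1 L.U.r_neg2)
  show ?thesis
  proof (intro comm_gens.intro comm_gens_axioms.intro L.U.calg_axioms)
    fix i j
    show "inc n (s_vec n i) \<otimes>\<^bsub>Us n\<^esub> inc n (s_vec n j) = inc n (s_vec n j) \<otimes>\<^bsub>Us n\<^esub> inc n (s_vec n i)"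
      using comm[of "unit_vec n j" i] by (simp add: s_vec_def)
  next
    fix i a assume "a \<in> carrier (Us n)"
    have ei: "inc n (s_vec n i) \<in> carrier (Us n)" by (rule L.incl_closed[OF s_vec_carrier])
    show "L.U.nilp (inc n (s_vec n i)) a"
      using \<open>a \<in> carrier (Us n)\<close>
    proof (induction a rule: L.envelope_induct[consumes 1, case_names one add smult mult])
      case one
      have "L.U.ad (inc n (s_vec n i)) \<one>\<^bsub>Us n\<^esub> = \<zero>\<^bsub>Us n\<^esub>" using ei by (simp add: L.U.ad_def L.U.minus_eq L.U.r_neg)
      then show ?case unfolding L.U.nilp_def by (intro exI[of _ 1]) simp
    next
      case (add X Y)
      then show ?case by (rule L.U.nilp_add[OF ei])
    next
      case (smult c X)
      then show ?case by (rule L.U.nilp_smult[OF ei])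
    next
      case (mult x X)
      obtain P v where Pv: "x = (P, v)" by (cases x)
      then have c: "P \<in> carrier_mat n n" "v \<in> carrier_vec n" using mult(1) by auto
      have "lie_bracket (s_lie n) (s_vec n i) x = (0\<^sub>m n n, 0\<^sub>m n n *\<^sub>v v - P *\<^sub>v unit_vec n i)"
        using c by (auto simp: Pv s_vec_def intro!: eq_matI)
      moreover have "0\<^sub>m n n *\<^sub>v v - P *\<^sub>v unit_vec n i \<in> carrier_vec n" using c by (intro carrier_vecI) simp
      ultimately have "lie_bracket (s_lie n) (s_vec n i) (lie_bracket (s_lie n) (s_vec n i) x) = (0\<^sub>m n n, 0\<^sub>v n)"
        using vv by simp
      then have "L.U.ad (inc n (s_vec n i)) (L.U.ad (inc n (s_vec n i)) (inc n x)) = \<zero>\<^bsub>Us n\<^esub>"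
        using ad[OF mult(1)] ad[OF L.bracket_closed[OF s_vec_carrier mult(1)]] inc_zero by simp
      then show ?case by (rule L.U.nilp_mult[OF ei L.incl_closed[OF mult(1)] _ mult(2,3)])
    qed
  qed (rule L.incl_closed[OF s_vec_carrier])
qed

lemma X_set_eq: "X_set n = comm_gens.mons (Us n) n (\<lambda>i. inc n (s_vec n i))"
proof -
  interpret comm_gens "Us n" n "\<lambda>i. inc n (s_vec n i)" by (rule comm_gens_envelope)
  show ?thesis unfolding X_set_def mons_def lprod_def ..
qed

lemma alg_hom_equalizer:
  assumes "f \<in> alg_hom A B" "g \<in> alg_hom A B" "calg A"
  shows "calg.subalgebra A {a \<in> carrier A. f a = g a}"
proof -
  interpret A: calg A by fact
  show ?thesis
    by (rule A.subalgebraI) (auto simp: alg_homD[OF assms(1)] alg_homD[OF assms(2)])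
qed

lemma (in lie_ops) envelope_generated:
  assumes S: "U.subalgebra S" and gen: "\<And>x. x \<in> carrier L \<Longrightarrow> \<iota> x \<in> S" and X: "X \<in> carrier U"
  shows "X \<in> S"
proof -
  have S': "subring S U" "\<And>c x. x \<in> S \<Longrightarrow> c \<odot>\<^bsub>U\<^esub> x \<in> S" using S by (auto simp: U.subalgebra_def)
  show ?thesis
    using X
  proof (induction X rule: envelope_induct[consumes 1, case_names one add smult mult])
    case one
    show ?case by (rule subringE(3)[OF S'(1)])
  next
    case (add X Y)
    then show ?case by (intro subringE(7)[OF S'(1)])
  next
    case (smult c X)
    then show ?case by (intro S'(2))
  next
    case (mult x X)
    then show ?case by (intro subringE(6)[OF S'(1)] gen)
  qed
qed

lemma lie_closed_preimage:
  assumes "calg.subalgebra (Us n) S"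
  shows "lie_closed n {v \<in> carrier (s_lie n). inc n v \<in> S}"
proof -
  interpret L: lie_ops "s_lie n" by (rule lie_ops_s_lie)
  have S: "subring S (Us n)" "\<And>c x. x \<in> S \<Longrightarrow> c \<odot>\<^bsub>Us n\<^esub> x \<in> S" using assms by (auto simp: L.U.subalgebra_def)
  show ?thesis
  proof (rule lie_closedI)
    fix u v assume "u \<in> {v \<in> carrier (s_lie n). inc n v \<in> S}" "v \<in> {v \<in> carrier (s_lie n). inc n v \<in> S}"
    then have uv: "u \<in> carrier (s_lie n)" "v \<in> carrier (s_lie n)" "inc n u \<in> S" "inc n v \<in> S" by blast+
    show "u \<oplus>\<^bsub>s_lie n\<^esub> v \<in> {v \<in> carrier (s_lie n). inc n v \<in> S}"
      using L.add_closed[OF uv(1,2)] subringE(7)[OF S(1) uv(3,4)] unfolding L.incl_add[OF uv(1,2), symmetric] by blast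
  next
    fix c v assume "v \<in> {v \<in> carrier (s_lie n). inc n v \<in> S}"
    then have v: "v \<in> carrier (s_lie n)" "inc n v \<in> S" by blast+
    show "c \<odot>\<^bsub>s_lie n\<^esub> v \<in> {v \<in> carrier (s_lie n). inc n v \<in> S}"
      using L.smult_closed[OF v(1)] S(2)[OF v(2)] unfolding L.incl_smult[OF v(1), symmetric] by blast
  next
    show "(0\<^sub>m n n, 0\<^sub>v n) \<in> {v \<in> carrier (s_lie n). inc n v \<in> S}"
      using subringE(2)[OF S(1)] by (simp add: inc_zero)
  qed
qed

lemma s_envelope_generated:
  assumes S: "calg.subalgebra (Us n) S" and "\<And>i j. \<lbrakk>i < n; j < n\<rbrakk> \<Longrightarrow> inc n (s_mat n i j) \<in> S"
    and "\<And>i. i < n \<Longrightarrow> inc n (s_vec n i) \<in> S" and X: "X \<in> carrier (Us n)"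
  shows "X \<in> S"
proof -
  interpret L: lie_ops "s_lie n" by (rule lie_ops_s_lie)
  show ?thesis
  proof (rule L.envelope_generated[OF S _ X])
    fix v assume "v \<in> carrier (s_lie n)"
    then have "v \<in> {v \<in> carrier (s_lie n). inc n v \<in> S}"
    proof (rule lie_closed_all[OF lie_closed_preimage[OF S], rotated 2])
      fix i j assume "i < n" "j < n"
      then show "s_mat n i j \<in> {v \<in> carrier (s_lie n). inc n v \<in> S}" using s_mat_carrier assms(2) by blast
    next
      fix i assume "i < n"
      then show "s_vec n i \<in> {v \<in> carrier (s_lie n). inc n v \<in> S}" using s_vec_carrier assms(3) by blast
    qed
    then show "inc n v \<in> S" by blast
  qed
qed

lemma w_envelope_generated:
  assumes S: "calg.subalgebra (Us z) S" and w: "\<And>i j. \<lbrakk>i \<le> z; j \<le> z\<rbrakk> \<Longrightarrow> inc z (w_elem z i j) \<in> S"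
    and X: "X \<in> carrier (Us z)"
  shows "X \<in> S"
proof -
  interpret L: lie_ops "s_lie z" by (rule lie_ops_s_lie)
  have "carrier (s_lie z) \<subseteq> {v \<in> carrier (s_lie z). inc z v \<in> S}"
    by (intro w_span lie_closed_preimage S CollectI conjI w_carrier w)
  then show ?thesis by (intro L.envelope_generated[OF S _ X]) blast
qed

lemma zeta_eq_w:
  "zeta z i j = w_elem z i j \<oplus>\<^bsub>s_lie z\<^esub> (-1) \<odot>\<^bsub>s_lie z\<^esub> w_elem z j j"
  by (auto simp: zeta_def w_elem_def rank1_def algebra_simps intro!: eq_matI eq_vecI)

text \<open>Consequently N_ii has no component from U(s_z) and is the Euler operator itself.\<close>

lemma zeta_diag: "zeta z i i = (0\<^sub>m z z, 0\<^sub>v z)"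
  by (auto simp: zeta_def rank1_def intro!: eq_matI eq_vecI)

section \<open>Constructing representations\<close>

lemma weyl_rep_image:
  assumes r: "weyl_rep W n x y p" and h: "h \<in> alg_hom W V" and V: "calg V"
  shows "weyl_rep V n (\<lambda>i. h (x i)) (\<lambda>i. h (y i)) (\<lambda>i. h (p i))"
proof -
  interpret weyl_rep W n x y p by fact
  interpret V: calg V by fact
  note hD = alg_homD[OF h]
  have hz: "h \<zero>\<^bsub>W\<^esub> = \<zero>\<^bsub>V\<^esub>" by (rule alg_hom_minus(1)[OF h calg_axioms V])
  show ?thesis
  proof (intro weyl_rep.intro weyl_rep_axioms.intro V)
    fix i j assume ij: "i < n" "j < n"
    show "h (x i) \<otimes>\<^bsub>V\<^esub> h (x j) = h (x j) \<otimes>\<^bsub>V\<^esub> h (x i)"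
      using ij x_comm[OF ij] by (simp flip: hD(2))
    show "h (p i) \<otimes>\<^bsub>V\<^esub> h (p j) = h (p j) \<otimes>\<^bsub>V\<^esub> h (p i)"
      using ij p_comm[OF ij] by (simp flip: hD(2))
    show "h (p i) \<otimes>\<^bsub>V\<^esub> h (x j) = h (x j) \<otimes>\<^bsub>V\<^esub> h (p i) \<oplus>\<^bsub>V\<^esub> (if i = j then \<one>\<^bsub>V\<^esub> else \<zero>\<^bsub>V\<^esub>)"
      using ij arg_cong[OF p_x[OF ij], of h] by (cases "i = j") (simp_all add: hD hz)
  next
    fix i assume i: "i < n"
    show "h (x i) \<otimes>\<^bsub>V\<^esub> h (y i) = \<one>\<^bsub>V\<^esub>" "h (y i) \<otimes>\<^bsub>V\<^esub> h (x i) = \<one>\<^bsub>V\<^esub>"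
      using i x_y[OF i] y_x[OF i] hD(4) by (simp_all flip: hD(2))
  qed (simp_all add: hD(1))
qed

section \<open>Euler operators plus a family commuting with the Weyl generators\<close>

context weyl_rep
begin

text \<open>Extension by zero beyond \<open>n\<close>, because \<open>gl_rep\<close> demands closure
  at every index.\<close>

definition total :: "(nat \<Rightarrow> 'a) \<Rightarrow> nat \<Rightarrow> 'a" where "total f i = (if i < n then f i else \<zero>)"

definition euler :: "nat \<Rightarrow> 'a" where "euler = total (\<lambda>i. x i \<otimes> p i)"

lemma total_simps: "total x i \<in> carrier W" "total y i \<in> carrier W" "i < n \<Longrightarrow> total f i = f i"
  by (simp_all add: total_def)

lemma euler_closed [simp]: "euler i \<in> carrier W"
  by (simp add: euler_def total_def)

lemma euler_x:
  assumes "i < n" "j < n"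
  shows "euler i \<otimes> x j = x j \<otimes> euler i \<oplus> (if i = j then x j else \<zero>)"
proof -
  have "euler i \<otimes> x j = x i \<otimes> (p i \<otimes> x j)" using assms by (simp add: euler_def total_def m_assoc)
  also have "\<dots> = (x i \<otimes> x j) \<otimes> p i \<oplus> x i \<otimes> (if i = j then \<one> else \<zero>)"
    unfolding p_x[OF assms] using assms by (simp add: r_distr m_assoc)
  also have "(x i \<otimes> x j) \<otimes> p i = x j \<otimes> euler i"
    unfolding x_comm[OF assms] using assms by (simp add: euler_def total_def m_assoc)
  also have "x i \<otimes> (if i = j then \<one> else \<zero>) = (if i = j then x j else \<zero>)" using assms by simp
  finally show ?thesis .
qed

lemma euler_comm:
  assumes "i < n" "j < n"
  shows "euler i \<otimes> euler j = euler j \<otimes> euler i"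
proof (cases "i = j")
  case False
  have px: "p i \<otimes> x j = x j \<otimes> p i" "p j \<otimes> x i = x i \<otimes> p j"
    using p_x[OF assms] p_x[OF assms(2,1)] assms False by simp_all
  have "euler i \<otimes> euler j = x i \<otimes> (p i \<otimes> x j) \<otimes> p j" using assms by (simp add: euler_def total_def m_assoc)
  also have "\<dots> = (x i \<otimes> x j) \<otimes> (p i \<otimes> p j)" unfolding px using assms by (simp add: m_assoc)
  also have "\<dots> = (x j \<otimes> x i) \<otimes> (p j \<otimes> p i)" unfolding x_comm[OF assms] p_comm[OF assms] ..
  also have "\<dots> = x j \<otimes> (p j \<otimes> x i) \<otimes> p i" unfolding px using assms by (simp add: m_assoc)
  also have "\<dots> = euler j \<otimes> euler i" using assms by (simp add: euler_def total_def m_assoc)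
  finally show ?thesis .
qed simp

context
  fixes q :: "nat \<Rightarrow> nat \<Rightarrow> 'a"
  assumes q_closed [simp]: "q i j \<in> carrier W"
    and q_x: "k < n \<Longrightarrow> q i j \<otimes> x k = x k \<otimes> q i j"
    and q_p: "k < n \<Longrightarrow> q i j \<otimes> p k = p k \<otimes> q i j"
begin

text \<open>\<open>q i j\<close> commutes with all \<open>x k\<close>, so the weight on
  \<open>x k\<close> comes from \<open>euler j\<close> and depends on the column only.\<close>

lemma gl_rep_euler: "gl_rep W n (total x) (total y) (\<lambda>i j. euler j \<oplus> q i j)"
proof (intro gl_rep.intro gl_rep_axioms.intro calg_axioms)
  fix i j k assume ijk: "i < n" "j < n" "k < n"
  have "(euler j \<oplus> q i j) \<otimes> x k = euler j \<otimes> x k \<oplus> x k \<otimes> q i j"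
    using ijk by (simp add: l_distr q_x)
  also have "\<dots> = x k \<otimes> (euler j \<oplus> q i j) \<oplus> (if j = k then x k else \<zero>)"
    unfolding euler_x[OF ijk(2,3)] using ijk by (simp add: r_distr a_ac)
  finally show "(euler j \<oplus> q i j) \<otimes> total x k = total x k \<otimes> (euler j \<oplus> q i j) \<oplus> (if j = k then total x k else \<zero>)"
    using ijk by (simp add: total_simps)
qed (simp_all add: total_simps x_comm x_y y_x)

lemma q_euler:
  assumes "k < n"
  shows "q i j \<otimes> euler k = euler k \<otimes> q i j"
proof -
  have "q i j \<otimes> euler k = (q i j \<otimes> x k) \<otimes> p k" using assms by (simp add: euler_def total_def m_assoc)
  also have "\<dots> = x k \<otimes> (q i j \<otimes> p k)" unfolding q_x[OF assms] using assms by (simp add: m_assoc)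
  also have "\<dots> = euler k \<otimes> q i j" unfolding q_p[OF assms] using assms by (simp add: euler_def total_def m_assoc)
  finally show ?thesis .
qed

lemma N_rel_euler:
  assumes qq: "\<And>i j k l. \<lbrakk>i < n; j < n; k < n; l < n\<rbrakk> \<Longrightarrow>
    q i j \<otimes> q k l = q k l \<otimes> q i j \<oplus> lin W (\<lambda>(i, j). q i j) (\<beta> i j k l)"
  shows "gl_rep.N_rel W n (\<lambda>i j. euler j \<oplus> q i j)"
proof -
  interpret G: gl_rep W n "total x" "total y" "\<lambda>i j. euler j \<oplus> q i j" by (rule gl_rep_euler)
  have Pi: "(\<lambda>(i, j). q i j) \<in> UNIV \<rightarrow> carrier W" by auto
  have cancel: "(a \<oplus> b) \<ominus> (a \<oplus> c) = b \<ominus> c" if "a \<in> carrier W" "b \<in> carrier W" "c \<in> carrier W" for a b c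
    using that a_lcomm[of b "\<ominus> a" "\<ominus> c"] by (simp add: minus_eq minus_add a_assoc r_neg2)
  \<comment> \<open>\<open>\<beta>\<close> is made of differences within a column, and
    \<open>euler j\<close> depends on nothing but the column, so the Euler parts cancel.\<close>
  have lin: "G.Nlin (\<beta> i j k l) = lin W (\<lambda>(i, j). q i j) (\<beta> i j k l)" for i j k l
    by (cases "j = k"; cases "i = l"; cases "j = l")
      (simp_all add: \<beta>_def lin_add[OF Pi] lin_diff[OF Pi] lin_single[OF Pi] lin_closed[OF Pi] cancel)
  show ?thesis
    unfolding G.N_rel_def
  proof (intro allI impI)
    fix i j k l assume ijkl: "i < n" "j < n" "k < n" "l < n"
    let ?L = "lin W (\<lambda>(i, j). q i j) (\<beta> i j k l)"
    have L: "?L \<in> carrier W" by (rule lin_closed[OF Pi]) simp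
    have "(euler j \<oplus> q i j) \<otimes> (euler l \<oplus> q k l) =
      (euler j \<otimes> euler l \<oplus> q i j \<otimes> euler l) \<oplus> (euler j \<otimes> q k l \<oplus> q i j \<otimes> q k l)"
      by (simp add: l_distr r_distr)
    also have "\<dots> = (euler l \<otimes> euler j \<oplus> euler l \<otimes> q i j) \<oplus> (q k l \<otimes> euler j \<oplus> (q k l \<otimes> q i j \<oplus> ?L))"
      unfolding euler_comm[OF ijkl(2,4)] q_euler[OF ijkl(4)] q_euler[OF ijkl(2)] qq[OF ijkl] ..
    also have "\<dots> = (euler l \<oplus> q k l) \<otimes> (euler j \<oplus> q i j) \<oplus> ?L"
      using L by (simp add: l_distr r_distr a_ac)
    finally show "(euler j \<oplus> q i j) \<otimes> (euler l \<oplus> q k l) = (euler l \<oplus> q k l) \<otimes> (euler j \<oplus> q i j) \<oplus> G.Nlin (\<beta> i j k l)"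
      unfolding lin .
  qed
qed

end

end

section \<open>From matrix units back to the N_ij\<close>

context calg
begin

context
  fixes n :: nat and x y :: "nat \<Rightarrow> 'a" and E :: "nat \<Rightarrow> nat \<Rightarrow> 'a"
  assumes closed [simp]: "x i \<in> carrier A" "y i \<in> carrier A" "E i j \<in> carrier A"
    and xx: "\<lbrakk>i < n; j < n\<rbrakk> \<Longrightarrow> x i \<otimes> x j = x j \<otimes> x i"
    and xy: "i < n \<Longrightarrow> x i \<otimes> y i = \<one>" "i < n \<Longrightarrow> y i \<otimes> x i = \<one>"
    and Ex: "\<lbrakk>i < n; j < n; k < n\<rbrakk> \<Longrightarrow> E i j \<otimes> x k = x k \<otimes> E i j \<oplus> (if j = k then x i else \<zero>)"
begin

text \<open>The commutator with \<open>E i j\<close> replaces a factor \<open>x j\<close> by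
  \<open>x i\<close>; the prefactor \<open>y i \<otimes> x j\<close> reverses this, which leaves a
  scaling.\<close>

lemma gl_rep_from_e: "gl_rep A n x y (\<lambda>i j. y i \<otimes> x j \<otimes> E i j)"
proof (intro gl_rep.intro gl_rep_axioms.intro calg_axioms)
  fix i j k assume ijk: "i < n" "j < n" "k < n"
  have yx: "y i \<otimes> x k = x k \<otimes> y i"
  proof -
    have "y i \<otimes> x k = y i \<otimes> (x k \<otimes> x i) \<otimes> y i" using ijk by (simp add: m_assoc xy)
    also have "\<dots> = (y i \<otimes> x i) \<otimes> (x k \<otimes> y i)" unfolding xx[OF ijk(3,1)] by (simp add: m_assoc)
    finally show ?thesis using ijk by (simp add: xy)
  qed
  have "y i \<otimes> x j \<otimes> E i j \<otimes> x k = y i \<otimes> x j \<otimes> (E i j \<otimes> x k)" by (simp add: m_assoc)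
  also have "\<dots> = y i \<otimes> (x j \<otimes> x k) \<otimes> E i j \<oplus> (if j = k then y i \<otimes> (x j \<otimes> x i) else \<zero>)"
    unfolding Ex[OF ijk] by (simp add: r_distr m_assoc)
  also have "y i \<otimes> (x j \<otimes> x k) \<otimes> E i j = (y i \<otimes> x k) \<otimes> (x j \<otimes> E i j)"
    unfolding xx[OF ijk(2,3)] by (simp add: m_assoc)
  also have "y i \<otimes> (x j \<otimes> x i) = (y i \<otimes> x i) \<otimes> x j"
    unfolding xx[OF ijk(2,1)] by (simp add: m_assoc)
  finally show "y i \<otimes> x j \<otimes> E i j \<otimes> x k = x k \<otimes> (y i \<otimes> x j \<otimes> E i j) \<oplus> (if j = k then x k else \<zero>)"
    unfolding yx using ijk by (auto simp: xy m_assoc)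
qed (simp_all add: xx xy)

lemma from_e:
  assumes "i < n" "j < n"
  shows "gl_rep.e A x y (\<lambda>i j. y i \<otimes> x j \<otimes> E i j) i j = E i j"
proof -
  interpret G: gl_rep A n x y "\<lambda>i j. y i \<otimes> x j \<otimes> E i j" by (rule gl_rep_from_e)
  have "G.e i j = x i \<otimes> (y j \<otimes> y i) \<otimes> x j \<otimes> E i j" unfolding G.e_def by (simp add: m_assoc)
  also have "\<dots> = (x i \<otimes> y i) \<otimes> (y j \<otimes> x j) \<otimes> E i j"
    unfolding G.y_comm[OF assms(2,1)] by (simp add: m_assoc)
  finally show ?thesis using assms by (simp add: xy)
qed

lemma N_rel_from_e:
  assumes EE: "\<And>i j k l. \<lbrakk>i < n; j < n; k < n; l < n\<rbrakk> \<Longrightarrow>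
    E i j \<otimes> E k l = E k l \<otimes> E i j \<oplus> ((if j = k then E i l else \<zero>) \<ominus> (if i = l then E k j else \<zero>))"
  shows "gl_rep.N_rel A n (\<lambda>i j. y i \<otimes> x j \<otimes> E i j)"
proof -
  interpret G: gl_rep A n x y "\<lambda>i j. y i \<otimes> x j \<otimes> E i j" by (rule gl_rep_from_e)
  show ?thesis
    unfolding G.N_rel_iff_e_rel G.e_rel_def
  proof (intro allI impI)
    fix i j k l assume ijkl: "i < n" "j < n" "k < n" "l < n"
    show "G.e i j \<otimes> G.e k l = G.e k l \<otimes> G.e i j \<oplus> ((if j = k then G.e i l else \<zero>) \<ominus> (if i = l then G.e k j else \<zero>))"
      unfolding from_e[OF ijkl(1,2)] from_e[OF ijkl(3,4)] from_e[OF ijkl(1,4)] from_e[OF ijkl(3,2)] by (rule EE[OF ijkl])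
  qed
qed

end

end

text \<open>Products of two left fractions are not compared directly. The elements \<open>g\<close>
  for which right multiplication preserves left fractions form a subalgebra, which contains the
  image of \<open>\<Phi>\<close> and the inverses of \<open>\<Phi> s\<close>; applying them to the
  fraction 1 reaches all of \<open>B\<close>.\<close>

lemma (in ore_set) localization_surj:
  fixes B :: "(complex, 'b, 'n) module_scheme"
  assumes B: "calg B" and \<Phi>: "\<Phi> \<in> alg_hom A B"
    and gen: "\<And>Q b. \<lbrakk>calg.subalgebra B Q; \<Phi> ` carrier A \<subseteq> Q;
      \<And>s y. \<lbrakk>s \<in> S; y \<in> carrier B; \<Phi> s \<otimes>\<^bsub>B\<^esub> y = \<one>\<^bsub>B\<^esub>\<rbrakk> \<Longrightarrow> y \<in> Q; b \<in> carrier B\<rbrakk> \<Longrightarrow> b \<in> Q"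
    and b: "b \<in> carrier B"
  shows "\<exists>s\<in>S. \<exists>r\<in>carrier A. \<Phi> s \<otimes>\<^bsub>B\<^esub> b = \<Phi> r"
proof -
  interpret B: calg B by fact
  note hD [simp] = alg_homD[OF \<Phi>]
  define good where "good b \<longleftrightarrow> (\<exists>s\<in>S. \<exists>r\<in>carrier A. \<Phi> s \<otimes>\<^bsub>B\<^esub> b = \<Phi> r)" for b
  have goodI: "good b" if "s \<in> S" "r \<in> carrier A" "\<Phi> s \<otimes>\<^bsub>B\<^esub> b = \<Phi> r" for s r b
    using that unfolding good_def by blast
  let ?Q = "{g \<in> carrier B. \<forall>b\<in>carrier B. good b \<longrightarrow> good (b \<otimes>\<^bsub>B\<^esub> g)}"
  have good_add: "good (b \<oplus>\<^bsub>B\<^esub> c)" if "b \<in> carrier B" "c \<in> carrier B" "good b" "good c" for b c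
  proof -
    obtain s r s' r' where s: "s \<in> S" "r \<in> carrier A" "\<Phi> s \<otimes>\<^bsub>B\<^esub> b = \<Phi> r"
      and s': "s' \<in> S" "r' \<in> carrier A" "\<Phi> s' \<otimes>\<^bsub>B\<^esub> c = \<Phi> r'"
      using \<open>good b\<close> \<open>good c\<close> unfolding good_def by blast
    have "\<Phi> (s' \<otimes> s) \<otimes>\<^bsub>B\<^esub> b = \<Phi> s' \<otimes>\<^bsub>B\<^esub> \<Phi> r"
      using s s' \<open>b \<in> carrier B\<close> by (simp add: B.m_assoc)
    moreover have "\<Phi> (s' \<otimes> s) \<otimes>\<^bsub>B\<^esub> c = \<Phi> s \<otimes>\<^bsub>B\<^esub> \<Phi> r'"
      unfolding S_comm[OF s'(1) s(1)] using s s' \<open>c \<in> carrier B\<close> by (simp add: B.m_assoc)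
    ultimately have "\<Phi> (s' \<otimes> s) \<otimes>\<^bsub>B\<^esub> (b \<oplus>\<^bsub>B\<^esub> c) = \<Phi> (s' \<otimes> r \<oplus> s \<otimes> r')"
      using s s' \<open>b \<in> carrier B\<close> \<open>c \<in> carrier B\<close> by (simp add: B.r_distr)
    then show ?thesis by (rule goodI[OF S_mult[OF s'(1) s(1)], rotated]) (use s s' in simp)
  qed
  have good_smult: "good (k \<odot>\<^bsub>B\<^esub> b)" if "b \<in> carrier B" "good b" for k b
  proof -
    obtain s r where s: "s \<in> S" "r \<in> carrier A" "\<Phi> s \<otimes>\<^bsub>B\<^esub> b = \<Phi> r"
      using \<open>good b\<close> unfolding good_def by blast
    then have "\<Phi> s \<otimes>\<^bsub>B\<^esub> (k \<odot>\<^bsub>B\<^esub> b) = \<Phi> (k \<odot> r)" using \<open>b \<in> carrier B\<close> by simp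
    then show ?thesis by (rule goodI[OF s(1), rotated]) (use s in simp)
  qed
  have Q: "B.subalgebra ?Q"
  proof (rule B.subalgebraI)
    fix g h assume gh: "g \<in> ?Q" "h \<in> ?Q"
    have "good (b \<otimes>\<^bsub>B\<^esub> (g \<otimes>\<^bsub>B\<^esub> h))" if "b \<in> carrier B" "good b" for b
    proof -
      have "good (b \<otimes>\<^bsub>B\<^esub> g \<otimes>\<^bsub>B\<^esub> h)" using gh that B.m_closed by blast
      then show ?thesis using gh that by (simp add: B.m_assoc)
    qed
    then show "g \<otimes>\<^bsub>B\<^esub> h \<in> ?Q" using gh by simp
    show "g \<oplus>\<^bsub>B\<^esub> h \<in> ?Q" using gh good_add by (simp add: B.r_distr)
  next
    fix k g assume "g \<in> ?Q"
    then show "k \<odot>\<^bsub>B\<^esub> g \<in> ?Q" using good_smult by simp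
  qed auto
  have \<Phi>Q: "\<Phi> a \<in> ?Q" if a: "a \<in> carrier A" for a
  proof (intro CollectI conjI ballI impI)
    fix b assume b: "b \<in> carrier B" "good b"
    then obtain s r where s: "s \<in> S" "r \<in> carrier A" "\<Phi> s \<otimes>\<^bsub>B\<^esub> b = \<Phi> r" unfolding good_def by blast
    have "\<Phi> s \<otimes>\<^bsub>B\<^esub> (b \<otimes>\<^bsub>B\<^esub> \<Phi> a) = (\<Phi> s \<otimes>\<^bsub>B\<^esub> b) \<otimes>\<^bsub>B\<^esub> \<Phi> a" using s(1) b(1) a by (simp add: B.m_assoc)
    also have "\<dots> = \<Phi> (r \<otimes> a)" unfolding s(3) using s a by simp
    finally show "good (b \<otimes>\<^bsub>B\<^esub> \<Phi> a)" by (rule goodI[OF s(1) m_closed[OF s(2) a]])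
  qed (use a in simp)
  have inv: "y \<in> ?Q" if y: "t \<in> S" "y \<in> carrier B" "\<Phi> t \<otimes>\<^bsub>B\<^esub> y = \<one>\<^bsub>B\<^esub>" for t y
  proof (intro CollectI conjI ballI impI y(2))
    fix b assume b: "b \<in> carrier B" "good b"
    then obtain s r where s: "s \<in> S" "r \<in> carrier A" "\<Phi> s \<otimes>\<^bsub>B\<^esub> b = \<Phi> r" unfolding good_def by blast
    \<comment> \<open>The Ore condition rewrites \<open>r t^-1\<close> as
      \<open>u^-1 v\<close>.\<close>
    obtain u v where u: "u \<in> S" "v \<in> carrier A" "u \<otimes> r = v \<otimes> t"
      using left_ore[OF y(1) s(2)] by (elim bexE) (rule that)
    have "\<Phi> (u \<otimes> s) \<otimes>\<^bsub>B\<^esub> (b \<otimes>\<^bsub>B\<^esub> y) = \<Phi> u \<otimes>\<^bsub>B\<^esub> (\<Phi> s \<otimes>\<^bsub>B\<^esub> b) \<otimes>\<^bsub>B\<^esub> y"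
      using s(1) b(1) y(2) u(1) by (simp add: B.m_assoc)
    also have "\<dots> = \<Phi> (u \<otimes> r) \<otimes>\<^bsub>B\<^esub> y" unfolding s(3) using u(1) s(2) by simp
    also have "\<dots> = \<Phi> v" unfolding u(3) using u(2) y by (simp add: B.m_assoc)
    finally show "good (b \<otimes>\<^bsub>B\<^esub> y)" by (rule goodI[OF S_mult[OF u(1) s(1)] u(2)])
  qed
  have "good \<one>\<^bsub>B\<^esub>" by (rule goodI[OF S_one one_closed]) simp
  moreover have "b \<in> ?Q" by (rule gen[OF Q _ inv b]) (use \<Phi>Q in blast)+
  ultimately have "good (\<one>\<^bsub>B\<^esub> \<otimes>\<^bsub>B\<^esub> b)" by blast
  then show ?thesis using b unfolding good_def by simp
qed

lemma (in gl_rep) N_from_e: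
  assumes "i < n" "j < n"
  shows "y i \<otimes> x j \<otimes> e i j = N i j"
proof -
  have "y i \<otimes> x j \<otimes> e i j = y i \<otimes> (x j \<otimes> x i) \<otimes> (y j \<otimes> N i j)" by (simp add: e_def m_assoc)
  also have "\<dots> = (y i \<otimes> x i) \<otimes> (x j \<otimes> y j) \<otimes> N i j"
    unfolding x_comm[OF assms(2,1)] by (simp add: m_assoc)
  finally show ?thesis using assms by (simp add: x_y y_x)
qed

section \<open>Images of the Lie relations under a homomorphism from U(s_n)\<close>

context
  fixes W :: "(complex, 'a, 'm) module_scheme" (structure) and h n
  assumes W: "calg W" and h: "h \<in> alg_hom (Us n) W"
begin

interpretation W: calg W by (rule W)
interpretation L: lie_ops "s_lie n" by (rule lie_ops_s_lie)

lemma image_linear: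
  "v \<in> carrier (s_lie n) \<Longrightarrow> h (inc n v) \<in> carrier W"
  "\<lbrakk>u \<in> carrier (s_lie n); v \<in> carrier (s_lie n)\<rbrakk> \<Longrightarrow> h (inc n (u \<oplus>\<^bsub>s_lie n\<^esub> v)) = h (inc n u) \<oplus> h (inc n v)"
  "v \<in> carrier (s_lie n) \<Longrightarrow> h (inc n (c \<odot>\<^bsub>s_lie n\<^esub> v)) = c \<odot> h (inc n v)"
  by (simp_all only: L.incl_add L.incl_smult L.incl_closed alg_homD[OF h])

lemma image_bracket:
  assumes "u \<in> carrier (s_lie n)" "v \<in> carrier (s_lie n)"
  shows "h (inc n u) \<otimes> h (inc n v) = h (inc n v) \<otimes> h (inc n u) \<oplus> h (inc n (lie_bracket (s_lie n) u v))"
proof -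
  note c = L.incl_closed[OF assms(1)] L.incl_closed[OF assms(2)] L.incl_closed[OF L.bracket_closed[OF assms]]
  have "h (inc n u \<otimes>\<^bsub>Us n\<^esub> inc n v) = h (inc n v \<otimes>\<^bsub>Us n\<^esub> inc n u \<oplus>\<^bsub>Us n\<^esub> inc n (lie_bracket (s_lie n) u v))"
    by (rule arg_cong[OF L.incl_bracket[OF assms]])
  then show ?thesis using c by (simp only: alg_homD[OF h] L.U.m_closed)
qed

text \<open>\<open>zeta_bracket\<close> in the form of \<open>\<beta>\<close>. The bounds include
  \<open>n\<close> itself because here \<open>s_lie n\<close> is the smaller algebra, whose
  \<open>zeta\<close> carries the indices of a matrix algebra of size n + 1.\<close>

lemma image_zeta_bracket:
  assumes "i \<le> n" "j \<le> n" "k \<le> n" "l \<le> n"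
  shows "h (inc n (zeta n i j)) \<otimes> h (inc n (zeta n k l)) = h (inc n (zeta n k l)) \<otimes> h (inc n (zeta n i j))
    \<oplus> lin W (\<lambda>(i, j). h (inc n (zeta n i j))) (\<beta> i j k l)"
proof -
  define q where "q i j = h (inc n (zeta n i j))" for i j
  have q: "q i j \<in> carrier W" for i j unfolding q_def by (rule image_linear(1)[OF zeta_carrier])
  then have Pi: "(\<lambda>(i, j). q i j) \<in> UNIV \<rightarrow> carrier W" by auto
  have "h (inc n (lie_bracket (s_lie n) (zeta n i j) (zeta n k l))) =
    \<delta> j k \<odot> (q i l \<oplus> (-1) \<odot> q k l) \<oplus> (\<delta> i l \<odot> (q i j \<oplus> (-1) \<odot> q k j) \<oplus> \<delta> j l \<odot> (q k l \<oplus> (-1) \<odot> q i j))"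
    unfolding zeta_bracket[OF assms] q_def
    by (simp only: image_linear zeta_carrier L.add_closed L.smult_closed)
  also have "\<dots> = lin W (\<lambda>(i, j). q i j) (\<beta> i j k l)"
    by (cases "j = k"; cases "i = l"; cases "j = l")
      (simp_all add: q \<beta>_def W.lin_add[OF Pi] W.lin_diff[OF Pi] W.lin_single[OF Pi] W.lin_closed[OF Pi]
        W.minus_eq W.minus_eq_smult[symmetric] W.a_assoc W.r_neg W.r_neg1 W.r_neg2)
  finally show ?thesis
    using image_bracket[OF zeta_carrier zeta_carrier, of i j k l] unfolding q_def by simp
qed

lemma image_vec_comm:
  assumes "i < n" "j < n"
  shows "h (inc n (s_vec n i)) \<otimes> h (inc n (s_vec n j)) = h (inc n (s_vec n j)) \<otimes> h (inc n (s_vec n i))"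
proof -
  have "inc n \<zero>\<^bsub>s_lie n\<^esub> = \<zero>\<^bsub>Us n\<^esub>" using inc_zero by (simp add: s_lie_def)
  then have "h (inc n \<zero>\<^bsub>s_lie n\<^esub>) = \<zero>" using alg_hom_minus(1)[OF h L.U.calg_axioms W] by simp
  then show ?thesis
    using image_bracket[OF s_vec_carrier s_vec_carrier, of i j] image_linear(1)[OF s_vec_carrier]
    unfolding s_lie_brackets(3)[OF assms(1) assms(2) assms] by simp
qed

lemma image_mat_vec:
  assumes "i < n" "j < n" "k < n"
  shows "h (inc n (s_mat n i j)) \<otimes> h (inc n (s_vec n k)) = h (inc n (s_vec n k)) \<otimes> h (inc n (s_mat n i j))
    \<oplus> (if j = k then h (inc n (s_vec n i)) else \<zero>)"
  using image_bracket[OF s_mat_carrier s_vec_carrier, of i j k] image_linear(1)[OF s_vec_carrier]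
  unfolding s_lie_brackets(2)[OF assms assms(3)] image_linear(3)[OF s_vec_carrier] by simp

lemma image_mat_mat:
  assumes "i < n" "j < n" "k < n" "l < n"
  shows "h (inc n (s_mat n i j)) \<otimes> h (inc n (s_mat n k l)) = h (inc n (s_mat n k l)) \<otimes> h (inc n (s_mat n i j))
    \<oplus> ((if j = k then h (inc n (s_mat n i l)) else \<zero>) \<ominus> (if i = l then h (inc n (s_mat n k j)) else \<zero>))"
proof -
  have "h (inc n (lie_bracket (s_lie n) (s_mat n i j) (s_mat n k l))) =
    (if j = k then 1 else 0) \<odot> h (inc n (s_mat n i l)) \<oplus> (if l = i then - 1 else 0) \<odot> h (inc n (s_mat n k j))"
    unfolding s_lie_brackets(1)[OF assms] by (simp only: image_linear L.smult_closed s_mat_carrier)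
  also have "\<dots> = (if j = k then h (inc n (s_mat n i l)) else \<zero>) \<ominus> (if i = l then h (inc n (s_mat n k j)) else \<zero>)"
    using image_linear(1)[OF s_mat_carrier] by (auto simp: W.minus_eq W.smult_minus_left)
  finally show ?thesis using image_bracket[OF s_mat_carrier s_mat_carrier, of i j k l] by simp
qed

context
  fixes y
  assumes y: "y i \<in> carrier W" "i < n \<Longrightarrow> h (inc n (s_vec n i)) \<otimes> y i = \<one>" "i < n \<Longrightarrow> y i \<otimes> h (inc n (s_vec n i)) = \<one>"
begin

text \<open>The converse of \<open>envelope_hom\<close>: as soon as the images of the vectors are
  invertible, a homomorphism from U(s_n) produces the N_ij with their relations.\<close>

lemma image_gl_rep:
  defines "x \<equiv> \<lambda>i. h (inc n (s_vec n i))" and "N \<equiv> \<lambda>i j. y i \<otimes> h (inc n (s_vec n j)) \<otimes> h (inc n (s_mat n i j))"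
  shows "gl_rep W n x y N" "gl_rep.N_rel W n N"
    and "\<lbrakk>i < n; j < n\<rbrakk> \<Longrightarrow> gl_rep.e W x y N i j = h (inc n (s_mat n i j))"
proof -
  note c = image_linear(1)[OF s_vec_carrier] y(1) image_linear(1)[OF s_mat_carrier]
  show "gl_rep W n x y N" unfolding x_def N_def
    by (rule W.gl_rep_from_e) (rule c image_vec_comm y image_mat_vec; assumption?)+
  show "gl_rep.N_rel W n N" unfolding N_def
    by (rule W.N_rel_from_e[where x = "\<lambda>i. h (inc n (s_vec n i))"])
      (rule c image_vec_comm y image_mat_vec image_mat_mat; assumption?)+
  show "gl_rep.e W x y N i j = h (inc n (s_mat n i j))" if "i < n" "j < n" unfolding x_def N_def
    by (rule W.from_e[where n = n]) (rule c image_vec_comm y image_mat_vec that; assumption?)+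
qed

end

end

section \<open>The tensor product \<open>\<D>\<^sub>n \<otimes> U(\<s>\<^sub>z)\<close>\<close>

text \<open>
  \<open>X\<close>, \<open>Y\<close>, \<open>NN\<close> below satisfy the same relations in \<open>\<D>\<^sub>n \<otimes> U(\<s>\<^sub>z)\<close> as the generators
  \<open>e\<^sub>i\<close>, \<open>e\<^sub>i\<^sup>-\<^sup>1\<close>, \<open>e\<^sub>i\<^sup>-\<^sup>1 e\<^sub>j e\<^sub>i\<^sub>j\<close> of the localization.
\<close>

locale weyl_tensor = tensor "weyl_alg n" "Us z" for n z :: nat +
  assumes n: "n = Suc z"

lemma weyl_tensorI: "n = Suc z \<Longrightarrow> weyl_tensor n z"
proof -
  interpret L: lie_ops "s_lie z" by (rule lie_ops_s_lie)
  show "n = Suc z \<Longrightarrow> weyl_tensor n z" by (intro weyl_tensor.intro tensor.intro weyl_tensor_axioms.intro calg_weyl L.U.calg_axioms)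
qed

context weyl_tensor
begin

abbreviation tns (infixr \<open>\<otimes>\<^sub>t\<close> 72) where "a \<otimes>\<^sub>t b \<equiv> tens a b"

definition X where "X i = laurent_mult n (unit_vec n i) \<otimes>\<^sub>t \<one>\<^bsub>Us z\<^esub>"
definition Y where "Y i = laurent_mult n (- unit_vec n i) \<otimes>\<^sub>t \<one>\<^bsub>Us z\<^esub>"
definition P where "P i = laurent_deriv n i \<otimes>\<^sub>t \<one>\<^bsub>Us z\<^esub>"
definition Q where "Q i j = \<one>\<^bsub>weyl_alg n\<^esub> \<otimes>\<^sub>t inc z (zeta z i j)"

lemma inc_carrier: "v \<in> carrier (s_lie z) \<Longrightarrow> inc z v \<in> carrier (Us z)"
  by (rule lie_ops.incl_closed[OF lie_ops_s_lie])

lemma Q_closed: "Q i j \<in> carrier T"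
  unfolding Q_def by (intro tens_closed A.one_closed inc_carrier zeta_carrier)

lemma weyl_rep_T: "weyl_rep T n X Y P"
  using weyl_rep_image[OF weyl_rep_weyl tens_left_hom T.calg_axioms]
  unfolding X_def[abs_def] Y_def[abs_def] P_def[abs_def] .

sublocale D: weyl_rep T n X Y P by (rule weyl_rep_T)

lemma tens_comm:
  assumes "a \<in> carrier (weyl_alg n)" "b \<in> carrier (Us z)"
  shows "(\<one>\<^bsub>weyl_alg n\<^esub> \<otimes>\<^sub>t b) \<otimes>\<^bsub>T\<^esub> (a \<otimes>\<^sub>t \<one>\<^bsub>Us z\<^esub>) = a \<otimes>\<^sub>t b"
    "(a \<otimes>\<^sub>t \<one>\<^bsub>Us z\<^esub>) \<otimes>\<^bsub>T\<^esub> (\<one>\<^bsub>weyl_alg n\<^esub> \<otimes>\<^sub>t b) = a \<otimes>\<^sub>t b"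
  using assms by (simp_all add: tens_mult)

lemma Q_X: "k < n \<Longrightarrow> Q i j \<otimes>\<^bsub>T\<^esub> X k = X k \<otimes>\<^bsub>T\<^esub> Q i j"
  and Q_P: "k < n \<Longrightarrow> Q i j \<otimes>\<^bsub>T\<^esub> P k = P k \<otimes>\<^bsub>T\<^esub> Q i j"
  unfolding Q_def X_def P_def
  by (simp_all only: tens_comm inc_carrier zeta_carrier weyl_rep.x_closed[OF weyl_rep_weyl] weyl_rep.p_closed[OF weyl_rep_weyl])

abbreviation "NN i j \<equiv> D.euler j \<oplus>\<^bsub>T\<^esub> Q i j"

sublocale G: gl_rep T n "D.total X" "D.total Y" NN
  by (rule D.gl_rep_euler) (rule Q_closed Q_X Q_P; assumption?)+

lemma NN_rel: "G.N_rel"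
proof (rule D.N_rel_euler)
  fix i j k l assume "i < n" "j < n" "k < n" "l < n"
  then show "Q i j \<otimes>\<^bsub>T\<^esub> Q k l = Q k l \<otimes>\<^bsub>T\<^esub> Q i j \<oplus>\<^bsub>T\<^esub> lin T (\<lambda>(i, j). Q i j) (\<beta> i j k l)"
    unfolding Q_def using n by (intro image_zeta_bracket[OF T.calg_axioms tens_right_hom]) simp_all
qed (rule Q_closed Q_X Q_P; assumption?)+

lemma Q_diag: "Q i i = \<zero>\<^bsub>T\<^esub>"
proof -
  show ?thesis unfolding Q_def zeta_diag inc_zero by (rule alg_hom_minus(1)[OF tens_right_hom B.calg_axioms T.calg_axioms])
qed

text \<open>The two Euler operators belong to the same column and cancel in the difference.\<close>

lemma w_Q:
  assumes "i \<le> z" "j \<le> z"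
  shows "\<one>\<^bsub>weyl_alg n\<^esub> \<otimes>\<^sub>t inc z (w_elem z i j) = NN i j \<ominus>\<^bsub>T\<^esub> NN z j"
proof -
  interpret L: lie_ops "s_lie z" by (rule lie_ops_s_lie)
  note lin = image_linear[OF T.calg_axioms tens_right_hom]
  have "\<one>\<^bsub>weyl_alg n\<^esub> \<otimes>\<^sub>t inc z (w_elem z i j) = Q i j \<oplus>\<^bsub>T\<^esub> (-1) \<odot>\<^bsub>T\<^esub> Q z j"
    unfolding w_eq_zeta[OF assms] Q_def by (simp only: lin zeta_carrier L.smult_closed)
  also have "\<dots> = NN i j \<ominus>\<^bsub>T\<^esub> NN z j"
    using Q_closed[of i j] Q_closed[of z j] T.a_lcomm[of "Q i j" "\<ominus>\<^bsub>T\<^esub> D.euler j" "\<ominus>\<^bsub>T\<^esub> Q z j"]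
    by (simp add: T.minus_eq T.minus_add T.minus_eq_smult[symmetric] T.a_assoc T.r_neg2)
  finally show ?thesis .
qed

lemma Q_w: "Q i j = \<one>\<^bsub>weyl_alg n\<^esub> \<otimes>\<^sub>t inc z (w_elem z i j) \<ominus>\<^bsub>T\<^esub> \<one>\<^bsub>weyl_alg n\<^esub> \<otimes>\<^sub>t inc z (w_elem z j j)"
proof -
  interpret L: lie_ops "s_lie z" by (rule lie_ops_s_lie)
  note lin = image_linear[OF T.calg_axioms tens_right_hom]
  show ?thesis
    unfolding zeta_eq_w Q_def lin(2)[OF w_carrier L.smult_closed[OF w_carrier]] lin(3)[OF w_carrier]
    using lin(1)[OF w_carrier] by (simp add: T.minus_eq T.minus_eq_smult)
qed

text \<open>Since \<open>Q i i\<close> is zero, the derivative \<open>P i\<close> equals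
  \<open>Y i \<otimes> NN i i\<close>; the second tensor factor is generated by the differences
  \<open>NN i j - NN z j\<close>, by \<open>w_Q\<close>.\<close>

lemma weyl_tensor_generated:
  assumes S: "T.subalgebra S" and X: "\<And>i. i < n \<Longrightarrow> X i \<in> S" and Y: "\<And>i. i < n \<Longrightarrow> Y i \<in> S"
    and N: "\<And>i j. \<lbrakk>i < n; j < n\<rbrakk> \<Longrightarrow> NN i j \<in> S" and b: "b \<in> carrier T"
  shows "b \<in> S"
proof -
  have S': "subring S T" using S by (simp add: T.subalgebra_def)
  have P: "P i \<in> S" if i: "i < n" for i
  proof -
    have "Y i \<otimes>\<^bsub>T\<^esub> NN i i = (Y i \<otimes>\<^bsub>T\<^esub> X i) \<otimes>\<^bsub>T\<^esub> P i"
      using i by (simp add: Q_diag D.euler_def D.total_def T.m_assoc)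
    then have "P i = Y i \<otimes>\<^bsub>T\<^esub> NN i i" using i by (simp add: D.y_x)
    then show ?thesis using subringE(6)[OF S' Y N] i by simp
  qed
  have left: "a \<otimes>\<^sub>t \<one>\<^bsub>Us z\<^esub> \<in> S" if "a \<in> carrier (weyl_alg n)" for a
  proof -
    note w = weyl_rep.x_closed[OF weyl_rep_weyl] weyl_rep.y_closed[OF weyl_rep_weyl] weyl_rep.p_closed[OF weyl_rep_weyl]
    have "a \<in> {a \<in> carrier (weyl_alg n). a \<otimes>\<^sub>t \<one>\<^bsub>Us z\<^esub> \<in> S}"
      by (rule weyl_induct[OF that alg_hom_preimage[OF tens_left_hom A.calg_axioms T.calg_axioms S]])
        (use w X Y P in \<open>simp_all add: X_def Y_def P_def\<close>)
    then show ?thesis by blast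
  qed
  have right: "\<one>\<^bsub>weyl_alg n\<^esub> \<otimes>\<^sub>t b \<in> S" if b: "b \<in> carrier (Us z)" for b
  proof -
    have w: "\<one>\<^bsub>weyl_alg n\<^esub> \<otimes>\<^sub>t inc z (w_elem z i j) \<in> S" if "i \<le> z" "j \<le> z" for i j
      unfolding w_Q[OF that] T.minus_eq using n that by (intro subringE(5,7)[OF S'] N) simp_all
    have "b \<in> {b \<in> carrier (Us z). \<one>\<^bsub>weyl_alg n\<^esub> \<otimes>\<^sub>t b \<in> S}"
      by (rule w_envelope_generated[OF alg_hom_preimage[OF tens_right_hom B.calg_axioms T.calg_axioms S] _ b])
        (use w inc_carrier[OF w_carrier] in simp)
    then show ?thesis by blast
  qed
  show ?thesis
    using b
  proof (induction b rule: tensor_induct[consumes 1, case_names tens add])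
    case (tens a b)
    show ?case using subringE(6)[OF S' left[OF tens(1)] right[OF tens(2)]] unfolding tens_comm(2)[OF tens] .
  qed (rule subringE(7)[OF S'])
qed

text \<open>The tensor product is universal for \<open>gl_rep\<close> with \<open>N_rel\<close>: the
  diagonal N_ii determine the map on the Weyl algebra, the column differences the map on U(s_z), and
  \<open>w_commutes\<close> lets the two images commute.\<close>

lemma weyl_tensor_lift:
  fixes W :: "(complex, 'a, 'm) module_scheme" (structure)
  assumes "gl_rep W n x y N" and N_rel: "gl_rep.N_rel W n N"
  shows "\<exists>\<psi>\<in>alg_hom T W. \<forall>i<n. \<psi> (X i) = x i \<and> \<psi> (Y i) = y i \<and> (\<forall>j<n. \<psi> (NN i j) = N i j)"
proof -
  interpret R: gl_rep W n x y N by fact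
  obtain \<rho> where \<rho>: "\<rho> \<in> alg_hom (weyl_alg n) W" and \<rho>': "\<forall>i<n. \<rho> (laurent_mult n (unit_vec n i)) = x i \<and>
    \<rho> (laurent_mult n (- unit_vec n i)) = y i \<and> \<rho> (laurent_deriv n i) = y i \<otimes> N i i"
    using weyl_lift[OF R.weyl_rep_N[OF N_rel]] by blast
  obtain \<sigma> where \<sigma>: "\<sigma> \<in> alg_hom (Us z) W" and "\<forall>i<n. \<forall>j<n. \<sigma> (inc z (w_elem z i j)) = N i j \<ominus> N z j"
    using R.small_envelope_hom[OF N_rel n] by blast
  then have \<sigma>': "\<sigma> (inc z (w_elem z i j)) = N i j \<ominus> N z j" if "i < n" "j < n" for i j using that by blast
  note w = weyl_rep.x_closed[OF weyl_rep_weyl] weyl_rep.y_closed[OF weyl_rep_weyl] weyl_rep.p_closed[OF weyl_rep_weyl]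
  \<comment> \<open>Commutation is spread in two stages: over the Weyl algebra with one column
    difference fixed, then over U(s_z).\<close>
  have comm_w: "\<rho> a \<otimes> (N i j \<ominus> N z j) = (N i j \<ominus> N z j) \<otimes> \<rho> a"
    if a: "a \<in> carrier (weyl_alg n)" and ij: "i < n" "j < n" for a i j
  proof -
    have h: "N i j \<ominus> N z j \<in> carrier W" by simp
    note c = R.w_commutes[OF N_rel n ij]
    have "a \<in> {a \<in> carrier (weyl_alg n). \<rho> a \<in> {c \<in> carrier W. c \<otimes> (N i j \<ominus> N z j) = (N i j \<ominus> N z j) \<otimes> c}}"
      by (rule weyl_induct[OF a alg_hom_preimage[OF \<rho> A.calg_axioms R.calg_axioms R.centralizer_subalgebra[OF h]]])
        (use w \<rho>' c in simp_all)
    then show ?thesis by blast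
  qed
  have comm: "\<sigma> b \<otimes> \<rho> a = \<rho> a \<otimes> \<sigma> b" if a: "a \<in> carrier (weyl_alg n)" and b: "b \<in> carrier (Us z)" for a b
  proof -
    note a' = alg_homD(1)[OF \<rho> a]
    have "b \<in> {b \<in> carrier (Us z). \<sigma> b \<in> {c \<in> carrier W. c \<otimes> \<rho> a = \<rho> a \<otimes> c}}"
    proof (rule w_envelope_generated[OF alg_hom_preimage[OF \<sigma> B.calg_axioms R.calg_axioms R.centralizer_subalgebra[OF a']] _ b])
      fix i j assume "i \<le> z" "j \<le> z"
      then have "i < n" "j < n" using n by simp_all
      then show "inc z (w_elem z i j) \<in> {b \<in> carrier (Us z). \<sigma> b \<in> {c \<in> carrier W. c \<otimes> \<rho> a = \<rho> a \<otimes> c}}"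
        using comm_w[OF a] inc_carrier[OF w_carrier] by (simp add: \<sigma>')
    qed
    then show ?thesis by blast
  qed
  obtain \<psi> where \<psi>: "\<psi> \<in> alg_hom T W" and "\<forall>a\<in>carrier (weyl_alg n). \<forall>b\<in>carrier (Us z). \<psi> (a \<otimes>\<^sub>t b) = \<rho> a \<otimes> \<sigma> b"
    using tensor_lift[OF R.calg_axioms \<rho> \<sigma> comm] by blast
  then have tens: "\<psi> (a \<otimes>\<^sub>t b) = \<rho> a \<otimes> \<sigma> b" if "a \<in> carrier (weyl_alg n)" "b \<in> carrier (Us z)" for a b
    using that by blast
  have left: "\<psi> (a \<otimes>\<^sub>t \<one>\<^bsub>Us z\<^esub>) = \<rho> a" if "a \<in> carrier (weyl_alg n)" for a
    using tens[OF that B.one_closed] alg_homD(1)[OF \<rho> that] by (simp add: alg_homD(4)[OF \<sigma>])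
  have right: "\<psi> (\<one>\<^bsub>weyl_alg n\<^esub> \<otimes>\<^sub>t b) = \<sigma> b" if "b \<in> carrier (Us z)" for b
    using tens[OF A.one_closed that] alg_homD(1)[OF \<sigma> that] by (simp add: alg_homD(4)[OF \<rho>])
  have gens: "\<psi> (X i) = x i" "\<psi> (Y i) = y i" "\<psi> (P i) = y i \<otimes> N i i" if "i < n" for i
    using that \<rho>' w by (simp_all add: X_def Y_def P_def left)
  have euler: "\<psi> (D.euler j) = N j j" if "j < n" for j
  proof -
    have "\<psi> (D.euler j) = (x j \<otimes> y j) \<otimes> N j j"
      using that by (simp add: D.euler_def D.total_def alg_homD(2)[OF \<psi>] gens R.m_assoc)
    then show ?thesis using that by (simp add: R.x_y)
  qed
  have "\<psi> (NN i j) = N i j" if ij: "i < n" "j < n" for i j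
  proof -
    note c = inc_carrier[OF w_carrier] tens_closed[OF A.one_closed inc_carrier[OF w_carrier]]
    have "\<psi> (Q i j) = (N i j \<ominus> N z j) \<ominus> (N j j \<ominus> N z j)"
      unfolding Q_w alg_hom_minus(3)[OF \<psi> T.calg_axioms R.calg_axioms c(2) c(2)] right[OF c(1)] \<sigma>'[OF ij] \<sigma>'[OF ij(2,2)] ..
    also have "\<dots> = N i j \<ominus> N j j"
      using R.a_lcomm[of "\<ominus> N z j" "\<ominus> N j j" "N z j"] by (simp add: R.minus_eq R.minus_add R.a_assoc R.l_neg)
    finally have Q: "\<psi> (Q i j) = N i j \<ominus> N j j" .
    have "\<psi> (NN i j) = N j j \<oplus> (N i j \<ominus> N j j)"
      unfolding alg_homD(3)[OF \<psi> D.euler_closed Q_closed] Q euler[OF ij(2)] ..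
    also have "\<dots> = N i j"
      using R.a_lcomm[of "N j j" "N i j" "\<ominus> N j j"] by (simp add: R.minus_eq R.r_neg)
    finally show ?thesis .
  qed
  with gens \<psi> show ?thesis by blast
qed

end

theorem theorem3:
  fixes n :: nat
  assumes "n \<ge> 2"
  shows "ore_localization (enveloping_alg (s_lie n)) (X_set n)
    \<cong>\<^sub>a\<^sub>l\<^sub>g weyl_alg n \<otimes>\<^sub>a\<^sub>l\<^sub>g enveloping_alg (s_lie (n - 1))"
proof -
  define z where "z = n - 1"
  interpret weyl_tensor n z using assms by (intro weyl_tensorI) (simp add: z_def)
  interpret L: lie_ops "s_lie n" by (rule lie_ops_s_lie)
  interpret M: comm_gens "Us n" n "\<lambda>i. inc n (s_vec n i)" by (rule comm_gens_envelope)
  interpret O: ore_set "Us n" "X_set n" unfolding X_set_eq by (rule M.ore_set_mons)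
  obtain \<Phi> where \<Phi>: "\<Phi> \<in> alg_hom (Us n) T"
    and "\<forall>i<n. \<forall>j<n. \<Phi> (inc n (s_mat n i j)) = G.e i j" "\<forall>i<n. \<Phi> (inc n (s_vec n i)) = D.total X i"
    using G.envelope_hom[OF NN_rel] by blast
  then have \<Phi>_mat: "\<Phi> (inc n (s_mat n i j)) = G.e i j" if "i < n" "j < n" for i j using that by blast
  have \<Phi>_vec: "\<Phi> (inc n (s_vec n i)) = X i" if "i < n" for i
    using that \<open>\<forall>i<n. \<Phi> (inc n (s_vec n i)) = D.total X i\<close> by (simp add: D.total_simps)
  note mat = L.incl_closed[OF s_mat_carrier] and vec = L.incl_closed[OF s_vec_carrier]
  have vec_X: "inc n (s_vec n i) \<in> X_set n" if "i < n" for i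
    using M.e_pow_mons[OF that, of 1] vec[of i] unfolding X_set_eq by simp
  have "ore_localization (Us n) (X_set n) \<cong>\<^sub>a\<^sub>l\<^sub>g T"
  proof (rule O.localization_iso[OF T.calg_axioms \<Phi>])
    show "\<exists>b\<in>carrier T. \<Phi> s \<otimes>\<^bsub>T\<^esub> b = \<one>\<^bsub>T\<^esub> \<and> b \<otimes>\<^bsub>T\<^esub> \<Phi> s = \<one>\<^bsub>T\<^esub>" if "s \<in> X_set n" for s
      using that unfolding X_set_eq
    proof (induction s rule: M.mons_induct)
      case one
      show ?case by (intro bexI[of _ "\<one>\<^bsub>T\<^esub>"]) (simp_all add: alg_homD(4)[OF \<Phi>])
    next
      case (step i t)
      then obtain b where b: "b \<in> carrier T" "\<Phi> t \<otimes>\<^bsub>T\<^esub> b = \<one>\<^bsub>T\<^esub>" "b \<otimes>\<^bsub>T\<^esub> \<Phi> t = \<one>\<^bsub>T\<^esub>" by blast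
      note t = alg_homD(1)[OF \<Phi> step(2)]
      have eq: "\<Phi> (inc n (s_vec n i) \<otimes>\<^bsub>Us n\<^esub> t) = X i \<otimes>\<^bsub>T\<^esub> \<Phi> t"
        unfolding alg_homD(2)[OF \<Phi> vec step(2)] \<Phi>_vec[OF step(1)] ..
      have "X i \<otimes>\<^bsub>T\<^esub> \<Phi> t \<otimes>\<^bsub>T\<^esub> (b \<otimes>\<^bsub>T\<^esub> Y i) = X i \<otimes>\<^bsub>T\<^esub> (\<Phi> t \<otimes>\<^bsub>T\<^esub> b) \<otimes>\<^bsub>T\<^esub> Y i"
        using b(1) t step(1) by (simp add: T.m_assoc)
      moreover have "b \<otimes>\<^bsub>T\<^esub> Y i \<otimes>\<^bsub>T\<^esub> (X i \<otimes>\<^bsub>T\<^esub> \<Phi> t) = b \<otimes>\<^bsub>T\<^esub> (Y i \<otimes>\<^bsub>T\<^esub> X i) \<otimes>\<^bsub>T\<^esub> \<Phi> t"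
        using b(1) t step(1) by (simp add: T.m_assoc)
      ultimately show ?case
        unfolding eq using b t step(1) by (intro bexI[of _ "b \<otimes>\<^bsub>T\<^esub> Y i"]) (simp_all add: D.x_y D.y_x)
    qed
    show "\<exists>s\<in>X_set n. \<exists>r\<in>carrier (Us n). \<Phi> s \<otimes>\<^bsub>T\<^esub> b = \<Phi> r" if "b \<in> carrier T" for b
    proof (rule O.localization_surj[OF T.calg_axioms \<Phi> _ that])
      fix Q' b assume Q': "T.subalgebra Q'" and \<Phi>Q: "\<Phi> ` carrier (Us n) \<subseteq> Q'"
        and inv: "\<And>s y. \<lbrakk>s \<in> X_set n; y \<in> carrier T; \<Phi> s \<otimes>\<^bsub>T\<^esub> y = \<one>\<^bsub>T\<^esub>\<rbrakk> \<Longrightarrow> y \<in> Q'"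
        and b: "b \<in> carrier T"
      have Q'': "subring Q' T" using Q' by (simp add: T.subalgebra_def)
      have X: "X i \<in> Q'" if "i < n" for i using \<Phi>Q vec[of i] \<Phi>_vec[OF that] by force
      have Y: "Y i \<in> Q'" if "i < n" for i
        by (rule inv[OF vec_X[OF that]]) (use that in \<open>simp_all add: \<Phi>_vec D.x_y\<close>)
      have e: "G.e i j \<in> Q'" if "i < n" "j < n" for i j using \<Phi>Q mat[of i j] \<Phi>_mat[OF that] by force
      \<comment> \<open>\<open>N_from_e\<close> expresses \<open>NN i j\<close> by the inverse of a
        vector, a vector and a matrix unit, which are all in \<open>Q'\<close>.\<close>
      have N: "NN i j \<in> Q'" if "i < n" "j < n" for i j
        using G.N_from_e[OF that] subringE(6)[OF Q'' subringE(6)[OF Q'' Y[OF that(1)] X[OF that(2)]] e[OF that]] that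
        by (simp add: D.total_simps)
      show "b \<in> Q'" by (rule weyl_tensor_generated[OF Q' X Y N b])
    qed
    show "\<exists>u\<in>X_set n. u \<otimes>\<^bsub>Us n\<^esub> r = \<zero>\<^bsub>Us n\<^esub>" if r: "r \<in> carrier (Us n)" "\<Phi> r = \<zero>\<^bsub>T\<^esub>" for r
    proof -
      let ?W = "End_alg O.frac_mod"
      interpret W: calg ?W by (rule cvs.calg_End[OF O.cvs_frac])
      \<comment> \<open>For \<open>i\<close> from \<open>n\<close> on any operator serves, here
        zero: \<open>gl_rep\<close> expects a value in the carrier at every index.\<close>
      have "\<forall>i. \<exists>y\<in>carrier ?W. i < n \<longrightarrow> O.lmul (inc n (s_vec n i)) \<otimes>\<^bsub>?W\<^esub> y = \<one>\<^bsub>?W\<^esub> \<and> y \<otimes>\<^bsub>?W\<^esub> O.lmul (inc n (s_vec n i)) = \<one>\<^bsub>?W\<^esub>"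
        using O.lmul_unit[OF vec_X] W.zero_closed by blast
      then obtain y where y: "y i \<in> carrier ?W"
        "i < n \<Longrightarrow> O.lmul (inc n (s_vec n i)) \<otimes>\<^bsub>?W\<^esub> y i = \<one>\<^bsub>?W\<^esub>"
        "i < n \<Longrightarrow> y i \<otimes>\<^bsub>?W\<^esub> O.lmul (inc n (s_vec n i)) = \<one>\<^bsub>?W\<^esub>" for i
        by metis
      define N where "N i j = y i \<otimes>\<^bsub>?W\<^esub> O.lmul (inc n (s_vec n j)) \<otimes>\<^bsub>?W\<^esub> O.lmul (inc n (s_mat n i j))" for i j
      note rep = image_gl_rep[OF W.calg_axioms O.lmul_hom y, folded N_def]
      interpret R: gl_rep ?W n "\<lambda>i. O.lmul (inc n (s_vec n i))" y N by (rule rep(1))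
      obtain \<psi> where \<psi>: "\<psi> \<in> alg_hom T ?W" and "\<forall>i<n. \<psi> (X i) = O.lmul (inc n (s_vec n i)) \<and> \<psi> (Y i) = y i \<and> (\<forall>j<n. \<psi> (NN i j) = N i j)"
        using weyl_tensor_lift[OF rep(1,2)] by blast
      then have \<psi>': "\<psi> (X i) = O.lmul (inc n (s_vec n i))" "\<psi> (Y i) = y i" "j < n \<Longrightarrow> \<psi> (NN i j) = N i j" if "i < n" for i j
        using that by blast+
      have \<psi>_e: "\<psi> (G.e i j) = R.e i j" if ij: "i < n" "j < n" for i j
        unfolding G.e_def R.e_def using ij by (simp add: D.total_simps alg_homD(2)[OF \<psi>] \<psi>' del: alg_homD(3)) 
      \<comment> \<open>Both sides are homomorphisms on U(s_n), so agreement on matrix units and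
        vectors suffices.\<close>
      have "r \<in> {a \<in> carrier (Us n). \<psi> (\<Phi> a) = O.lmul a}"
        by (rule s_envelope_generated[OF alg_hom_equalizer[OF alg_hom_comp[OF \<psi> \<Phi>] O.lmul_hom L.U.calg_axioms] _ _ r(1)])
          (use mat vec rep(3) in \<open>simp_all add: \<Phi>_mat \<Phi>_vec \<psi>' \<psi>_e\<close>)
      then have "O.lmul r = \<zero>\<^bsub>?W\<^esub>" using r(2) alg_hom_minus(1)[OF \<psi> T.calg_axioms W.calg_axioms] by simp
      then show ?thesis by (rule O.lmul_zero[OF r(1)])
    qed
  qed
  then show ?thesis by (simp add: z_def)
qed

end
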